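(* Let $T:\Lambda\to\Lambda$ be an expanding map topologically conjugate, via $p:\Sigma_A^+\to\Lambda$, to a mixing one-sided subshift of finite type, with sequences $x^j,y^j,z^j$ chosen as in the context. Suppose that $\phi:\Lambda\to\mathbb{R}$ is a Hölder continuous function and that $-\phi$ is normalized. Then, for any $f\in C(\Lambda,\mathbb{C})$: (i) $\pi(f)|D_\phi|^{-1}\in\mathcal{L}^{1,\infty}(H)$; (ii) $\pi(f)|D_\phi|^{-1}$ is measurable and, for every Dixmier trace $\tau_\omega$, $$\tau_\omega\left(\pi(f)|D_\phi|^{-1}\right)=c_\phi\int f\,d\mu,$$ where $\mu$ is the Gibbs measure for $-\phi$ and $$c_\phi=\frac{2}{\int\phi\,d\mu}\sum_{j=1}^k\ \sum_{Tx=x^j}e^{-\phi(x)}\chi_j(x),$$ with $\chi_j$ the indicator function of the set $p([j])$; here, in the sum over $x\in\Lambda$ with $Tx=x^j$, the sequence $x^j$ is identified with the point $p(x^j)\in\Lambda$.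
   Context: Subshift. Let $A$ be a $k\times k$ matrix with entries in $\{0,1\}$ that is aperiodic (there is $n\ge 1$ with $A^n(i,j)>0$ for all $i,j$). Put $\Sigma_A^+=\{(x_n)_{n\ge1}\in\{1,\dots,k\}^{\mathbb{N}}: A(x_n,x_{n+1})=1\ \forall n\ge1\}$ with the topology induced from the product topology, compatible metric $d(x,y)=\sum_{n\ge1}2^{-n}(1-\delta_{x_ny_n})$ ($\delta_{ij}$ being the Kronecker symbol), and $\sigma:\Sigma_A^+\to\Sigma_A^+$, $(\sigma x)_n=x_{n+1}$ (a mixing one-sided subshift of finite type). Expanding map. $M$ is a compact connected smooth Riemannian manifold, $\Lambda\subset U\subset M$ with $\Lambda$ compact and $U$ open, and $T:U\to M$ is a $C^1$ map such that: (i) there is $\lambda>1$ with $\|DT_x(v)\|\ge\lambda\|v\|$ for all $x\in U$ and all tangent vectors $v$ at $x$; (ii) $\Lambda=\bigcap_{n\ge0}T^{-n}U$; (iii) $T:\Lambda\to\Lambda$ is topologically mixing; (iv) there is a Hölder continuous homeomorphism $p:\Sigma_A^+\to\Lambda$ with $p\circ\sigma=T\circ p$. In particular $\Lambda$ is a Cantor set. Hölder continuity on $\Lambda$ is with respect to the Riemannian distance of $M$. For a function $f$ on $\Lambda$ and $x\in\Sigma_A^+$ we write $f(x)$ for $f(p(x))$. Words. $W_n$ is the set of allowed words $w=(w_1,\dots,w_n)\in\{1,\dots,k\}^n$, i.e. $A(w_m,w_{m+1})=1$ for $1\le m\le n-1$; $W^*=\bigcup_{n\ge1}W_n$; $\mathfrak{t}(w)=w_n$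 for $w\in W_n$; $[w]=\{x\in\Sigma_A^+:x_m=w_m,\ 1\le m\le n\}$, in particular $[j]=\{x\in\Sigma_A^+:x_1=j\}$. For $w\in W_n$ and $x\in\Sigma_A^+$, $wx$ is the concatenated sequence. For each $j\in\{1,\dots,k\}$ fix a sequence $x^j\in\Sigma_A^+$ and distinct sequences $y^j\neq z^j$ in $\Sigma_A^+$ such that $jx^j,jy^j,jz^j\in\Sigma_A^+$. Operators. $H=\ell^2(W^* )\oplus\ell^2(W^* )$, with elements written $\xi=\bigoplus_{w\in W^*}\begin{pmatrix}\xi_1(w)\\ \xi_2(w)\end{pmatrix}$. For $f\in C(\Lambda,\mathbb{C})$, $\pi(f)\xi=\bigoplus_{w\in W^*}\begin{pmatrix}f(wy^{\mathfrak{t}(w)})\,\xi_1(w)\\ f(wz^{\mathfrak{t}(w)})\,\xi_2(w)\end{pmatrix}$. With $\phi^n=\phi+\phi\circ T+\cdots+\phi\circ T^{n-1}$, $D_\phi\xi=\bigoplus_{n\ge1}\bigoplus_{w\in W_n}e^{\phi^n(wx^{\mathfrak{t}(w)})}\begin{pmatrix}\xi_2(w)\\ \xi_1(w)\end{pmatrix}$. Thus $$\pi(f)|D_\phi|^{-1}\xi=\bigoplus_{n\ge1}\bigoplus_{w\in W_n}e^{-\phi^n(wx^{\mathfrak{t}(w)})}\begin{pmatrix}f(wy^{\mathfrak{t}(w)})\,\xi_1(w)\\ f(wz^{\mathfrak{t}(w)})\,\xi_2(w)\end{pmatrix}.$$ Normalization and Gibbs measure. $-\phi$ is normalized if $\sum_{Ty=x}e^{-\phi(y)}=1$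 for all $x\in\Lambda$. Let $\mathcal{M}_T$ be the set of $T$-invariant Borel probability measures on $\Lambda$ and $h_T(m)$ the entropy of $T$ with respect to $m$. For Hölder continuous $\psi:\Lambda\to\mathbb{R}$, the Gibbs measure for $\psi$ is the unique $\mu\in\mathcal{M}_T$ with $h_T(\mu)+\int\psi\,d\mu=\sup_{m\in\mathcal{M}_T}\left(h_T(m)+\int\psi\,dm\right)$. Dixmier traces. For a compact operator $B$ on $H$ let $b_1\ge b_2\ge\cdots$ be the eigenvalues of $|B|=\sqrt{B^*B}$ in decreasing order, counted with multiplicity. $\mathcal{L}^{1,\infty}(H)$ is the set of compact $B$ with $\limsup_{n\to\infty}\frac{1}{\log n}\sum_{m=1}^nb_m<+\infty$. A Dixmier trace $\tau_\omega$ is defined on positive $B\in\mathcal{L}^{1,\infty}(H)$ by $\tau_\omega(B)=\omega\text{-}\lim\frac{1}{\log n}\sum_{m=1}^nb_m$, where $\omega$-$\lim$ is a generalized limit given by a state $\omega$ on $\ell^\infty$ (agreeing with the usual limit on convergent sequences, and of the kind used by Dixmier, so that $\tau_\omega$ is additive on positive operators), and is extended to $\mathcal{L}^{1,\infty}(H)$ by linearity. $B$ is measurable if $\lim_{n\to\infty}\frac{1}{\log n}\sum_{m=1}^nb_m$ exists. *)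

theory Defs
  imports
    "HOL-Probability.Probability"
    "HOL-Library.Function_Algebras"
    "HOL-Library.Omega_Words_Fun"
begin

section \<open>Riemannian manifolds\<close>

primrec C_k_on :: "nat \<Rightarrow> 'a::euclidean_space set \<Rightarrow> ('a \<Rightarrow> 'b::real_normed_vector) \<Rightarrow> bool" where
  "C_k_on 0 S f \<longleftrightarrow> continuous_on S f"
| "C_k_on (Suc k) S f \<longleftrightarrow> f differentiable_on S
     \<and> (\<forall>v. C_k_on k S (\<lambda>x. frechet_derivative f (at x) v))"

text \<open>A chart is a pair of its domain and its coordinate map. Tangent vectors at \<open>x\<close> are handled
  through their coordinates: a chart \<open>c\<close> around \<open>x\<close> identifies the tangent space at \<open>x\<close> with \<open>'e\<close>,
  and a change of charts from \<open>c\<close> to \<open>d\<close> acts by \<open>dmap c d id x\<close>.\<close>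

type_synonym ('m, 'e) chart = "'m set \<times> ('m \<Rightarrow> 'e)"

definition local_rep :: "('m, 'e) chart \<Rightarrow> ('m, 'e) chart \<Rightarrow> ('m \<Rightarrow> 'm) \<Rightarrow> 'e \<Rightarrow> 'e" where
  "local_rep c d F = snd d \<circ> F \<circ> inv_into (fst c) (snd c)"

definition dmap :: "('m, 'e::euclidean_space) chart \<Rightarrow> ('m, 'e) chart \<Rightarrow> ('m \<Rightarrow> 'm) \<Rightarrow> 'm \<Rightarrow> 'e \<Rightarrow> 'e" where
  "dmap c d F x = frechet_derivative (local_rep c d F) (at (snd c x))"

definition smooth_atlas :: "'m::t2_space set \<Rightarrow> ('m, 'e::euclidean_space) chart set \<Rightarrow> bool" where
  "smooth_atlas M \<A> \<longleftrightarrow>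
     (\<Union>c\<in>\<A>. fst c) = M
   \<and> (\<forall>c\<in>\<A>. openin (top_of_set M) (fst c) \<and> open (snd c ` fst c)
          \<and> homeomorphism (fst c) (snd c ` fst c) (snd c) (inv_into (fst c) (snd c)))
   \<and> (\<forall>c\<in>\<A>. \<forall>d\<in>\<A>. \<forall>k. C_k_on k (snd c ` (fst c \<inter> fst d)) (local_rep c d id))"

text \<open>\<open>g c x v w\<close> is the inner product of the tangent vectors at \<open>x\<close> with \<open>c\<close>-coordinates \<open>v\<close>, \<open>w\<close>.\<close>

type_synonym ('m, 'e) metric_tensor = "('m, 'e) chart \<Rightarrow> 'm \<Rightarrow> 'e \<Rightarrow> 'e \<Rightarrow> real"

definition riemannian_manifold ::
    "'m::t2_space set \<Rightarrow> ('m, 'e::euclidean_space) chart set \<Rightarrow> ('m, 'e) metric_tensor \<Rightarrow> bool" where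
  "riemannian_manifold M \<A> g \<longleftrightarrow>
     smooth_atlas M \<A>
   \<and> (\<forall>c\<in>\<A>. \<forall>x\<in>fst c. bilinear (g c x) \<and> (\<forall>v w. g c x v w = g c x w v)
          \<and> (\<forall>v. v \<noteq> 0 \<longrightarrow> g c x v v > 0))
   \<and> (\<forall>c\<in>\<A>. \<forall>v w k. C_k_on k (snd c ` fst c) (\<lambda>u. g c (inv_into (fst c) (snd c) u) v w))
   \<and> (\<forall>c\<in>\<A>. \<forall>d\<in>\<A>. \<forall>x\<in>fst c \<inter> fst d. \<forall>v w.
          g d x (dmap c d id x v) (dmap c d id x w) = g c x v w)"

definition C1_curve_on ::
    "'m::t2_space set \<Rightarrow> ('m, 'e::euclidean_space) chart set \<Rightarrow> real set \<Rightarrow> (real \<Rightarrow> 'm) \<Rightarrow> bool" where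
  "C1_curve_on M \<A> J \<gamma> \<longleftrightarrow> continuous_on J \<gamma> \<and> \<gamma> ` J \<subseteq> M
   \<and> (\<forall>c\<in>\<A>. \<exists>v. continuous_on (J \<inter> \<gamma> -` fst c) v
          \<and> (\<forall>t\<in>J \<inter> \<gamma> -` fst c. ((snd c \<circ> \<gamma>) has_vector_derivative v t) (at t within J)))"

definition piecewise_C1_curve ::
    "'m::t2_space set \<Rightarrow> ('m, 'e::euclidean_space) chart set \<Rightarrow> (real \<Rightarrow> 'm) \<Rightarrow> bool" where
  "piecewise_C1_curve M \<A> \<gamma> \<longleftrightarrow>
     (\<exists>n (t::nat \<Rightarrow> real). t 0 = 0 \<and> t n = 1
        \<and> (\<forall>i<n. t i < t (Suc i) \<and> C1_curve_on M \<A> {t i..t (Suc i)} \<gamma>))"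

text \<open>By the transformation rule of the metric the speed does not depend on the chosen chart. At the
  finitely many break points of a piecewise \<open>C\<^sup>1\<close> curve its value is irrelevant for the length.\<close>

definition speed ::
    "('m, 'e::euclidean_space) chart set \<Rightarrow> ('m, 'e) metric_tensor \<Rightarrow> (real \<Rightarrow> 'm) \<Rightarrow> real \<Rightarrow> real" where
  "speed \<A> g \<gamma> t =
     (let c = (SOME c. c \<in> \<A> \<and> \<gamma> t \<in> fst c);
          v = vector_derivative (snd c \<circ> \<gamma>) (at t within {0..1})
      in sqrt (g c (\<gamma> t) v v))"

definition curve_length ::
    "('m, 'e::euclidean_space) chart set \<Rightarrow> ('m, 'e) metric_tensor \<Rightarrow> (real \<Rightarrow> 'm) \<Rightarrow> real" where
  "curve_length \<A> g \<gamma> = integral {0..1} (speed \<A> g \<gamma>)"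

definition riemannian_dist ::
    "'m::t2_space set \<Rightarrow> ('m, 'e::euclidean_space) chart set \<Rightarrow> ('m, 'e) metric_tensor
      \<Rightarrow> 'm \<Rightarrow> 'm \<Rightarrow> real" where
  "riemannian_dist M \<A> g x y =
     Inf {curve_length \<A> g \<gamma> |\<gamma>. piecewise_C1_curve M \<A> \<gamma> \<and> \<gamma> 0 = x \<and> \<gamma> 1 = y}"

definition C1_map_on :: "('m::t2_space, 'e::euclidean_space) chart set \<Rightarrow> 'm set \<Rightarrow> ('m \<Rightarrow> 'm) \<Rightarrow> bool" where
  "C1_map_on \<A> U T \<longleftrightarrow> continuous_on U T
   \<and> (\<forall>c\<in>\<A>. \<forall>d\<in>\<A>. C_k_on 1 (snd c ` (fst c \<inter> U \<inter> T -` fst d)) (local_rep c d T))"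

definition expands_by ::
    "real \<Rightarrow> ('m::t2_space, 'e::euclidean_space) chart set \<Rightarrow> ('m, 'e) metric_tensor
      \<Rightarrow> 'm set \<Rightarrow> ('m \<Rightarrow> 'm) \<Rightarrow> bool" where
  "expands_by \<kappa> \<A> g U T \<longleftrightarrow>
     (\<forall>x\<in>U. \<forall>c\<in>\<A>. \<forall>d\<in>\<A>. x \<in> fst c \<longrightarrow> T x \<in> fst d \<longrightarrow>
        (\<forall>v. sqrt (g d (T x) (dmap c d T x v) (dmap c d T x v)) \<ge> \<kappa> * sqrt (g c x v v)))"

definition holder_on ::
    "'a set \<Rightarrow> ('a \<Rightarrow> 'a \<Rightarrow> real) \<Rightarrow> ('b \<Rightarrow> 'b \<Rightarrow> real) \<Rightarrow> ('a \<Rightarrow> 'b) \<Rightarrow> bool" where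
  "holder_on S d e f \<longleftrightarrow>
     (\<exists>C \<alpha>. 0 < \<alpha> \<and> \<alpha> \<le> 1 \<and> (\<forall>x\<in>S. \<forall>y\<in>S. e (f x) (f y) \<le> C * d x y powr \<alpha>))"

definition topologically_mixing_on :: "'m::topological_space set \<Rightarrow> ('m \<Rightarrow> 'm) \<Rightarrow> bool" where
  "topologically_mixing_on L T \<longleftrightarrow>
     (\<forall>V W. openin (top_of_set L) V \<longrightarrow> openin (top_of_set L) W \<longrightarrow> V \<noteq> {} \<longrightarrow> W \<noteq> {} \<longrightarrow>
        (\<exists>N. \<forall>n\<ge>N. (T ^^ n) ` V \<inter> W \<noteq> {}))"


section \<open>Subshifts of finite type\<close>

text \<open>The alphabet is a finite type \<open>'k\<close>; sequences are indexed from \<open>0\<close>.\<close>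

definition aperiodic :: "nat^'k^'k \<Rightarrow> bool" where
  "aperiodic A \<longleftrightarrow> (\<exists>n\<ge>1. \<forall>i j. (((**) A ^^ n) (mat 1)) $ i $ j > 0)"

definition subshift :: "nat^'k^'k \<Rightarrow> (nat \<Rightarrow> 'k) set" where
  "subshift A = {x. \<forall>n. A $ x n $ x (Suc n) = 1}"

definition subshift_top :: "nat^'k^'k \<Rightarrow> (nat \<Rightarrow> 'k) topology" where
  "subshift_top A = subtopology (product_topology (\<lambda>_. discrete_topology UNIV) UNIV) (subshift A)"

definition seq_dist :: "(nat \<Rightarrow> 'k) \<Rightarrow> (nat \<Rightarrow> 'k) \<Rightarrow> real" where
  "seq_dist x y = (\<Sum>n. (1/2) ^ Suc n * (1 - of_bool (x n = y n)))"

definition seq_shift :: "(nat \<Rightarrow> 'k) \<Rightarrow> nat \<Rightarrow> 'k" where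
  "seq_shift x n = x (Suc n)"

definition words :: "nat^'k^'k \<Rightarrow> nat \<Rightarrow> 'k list set" where
  "words A n = {w. length w = n \<and> (\<forall>m. Suc m < n \<longrightarrow> A $ (w ! m) $ (w ! Suc m) = 1)}"

definition all_words :: "nat^'k^'k \<Rightarrow> 'k list set" where
  "all_words A = (\<Union>n\<in>{1..}. words A n)"

definition cylinder1 :: "nat^'k^'k \<Rightarrow> 'k \<Rightarrow> (nat \<Rightarrow> 'k) set" where
  "cylinder1 A j = {x \<in> subshift A. x 0 = j}"


section \<open>Entropy and Gibbs measures\<close>

definition invariant_measures :: "'m::topological_space set \<Rightarrow> ('m \<Rightarrow> 'm) \<Rightarrow> 'm measure set" where
  "invariant_measures L T =
     {m. prob_space m \<and> sets m = sets (restrict_space borel L)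
       \<and> T \<in> m \<rightarrow>\<^sub>M m \<and> distr m m T = m}"

definition partition_entropy :: "'m measure \<Rightarrow> 'm set set \<Rightarrow> real" where
  "partition_entropy m P = - (\<Sum>B\<in>P. measure m B * ln (measure m B))"

text \<open>The join of the partitions \<open>T\<^sup>-\<^sup>i P\<close>, \<open>i < n\<close>, possibly together with the empty set, which does
  not contribute to the entropy.\<close>

definition join_partition :: "'m measure \<Rightarrow> ('m \<Rightarrow> 'm) \<Rightarrow> 'm set set \<Rightarrow> nat \<Rightarrow> 'm set set" where
  "join_partition m T P n =
     {{x \<in> space m. \<forall>i<n. (T ^^ i) x \<in> a i} |a. \<forall>i<n. a i \<in> P}"

definition ks_entropy :: "('m \<Rightarrow> 'm) \<Rightarrow> 'm measure \<Rightarrow> ereal" where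
  "ks_entropy T m =
     (SUP P \<in> {P. finite P \<and> P \<subseteq> sets m \<and> partition_on (space m) P}.
        ereal (lim (\<lambda>n. partition_entropy m (join_partition m T P n) / real n)))"

definition pressure_functional :: "('m \<Rightarrow> 'm) \<Rightarrow> ('m \<Rightarrow> real) \<Rightarrow> 'm measure \<Rightarrow> ereal" where
  "pressure_functional T \<psi> m = ks_entropy T m + ereal (\<integral>x. \<psi> x \<partial>m)"

text \<open>\<open>\<mu>\<close> is the unique invariant measure attaining the supremum.\<close>

definition is_gibbs_measure ::
    "'m::topological_space set \<Rightarrow> ('m \<Rightarrow> 'm) \<Rightarrow> ('m \<Rightarrow> real) \<Rightarrow> 'm measure \<Rightarrow> bool" where
  "is_gibbs_measure L T \<psi> \<mu> \<longleftrightarrow>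
     {m \<in> invariant_measures L T.
        pressure_functional T \<psi> m = (SUP m' \<in> invariant_measures L T. pressure_functional T \<psi> m')}
     = {\<mu>}"

definition normalized_on :: "'m set \<Rightarrow> ('m \<Rightarrow> 'm) \<Rightarrow> ('m \<Rightarrow> real) \<Rightarrow> bool" where
  "normalized_on L T \<psi> \<longleftrightarrow> (\<forall>x\<in>L. (\<Sum>y | y \<in> L \<and> T y = x. exp (\<psi> y)) = 1)"

definition birkhoff_sum :: "('m \<Rightarrow> 'm) \<Rightarrow> ('m \<Rightarrow> real) \<Rightarrow> nat \<Rightarrow> 'm \<Rightarrow> real" where
  "birkhoff_sum T \<phi> n x = (\<Sum>i<n. \<phi> ((T ^^ i) x))"


section \<open>Operators on \<open>\<ell>\<^sup>2\<close> spaces\<close>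

text \<open>Elements of \<open>\<ell>\<^sup>2(I)\<close> are functions on the whole index type vanishing outside \<open>I\<close>.\<close>

definition ell2 :: "'i set \<Rightarrow> ('i \<Rightarrow> complex) set" where
  "ell2 I = {\<xi>. (\<forall>i. i \<notin> I \<longrightarrow> \<xi> i = 0) \<and> (\<lambda>i. (cmod (\<xi> i))\<^sup>2) summable_on I}"

definition ell2_inner :: "('i \<Rightarrow> complex) \<Rightarrow> ('i \<Rightarrow> complex) \<Rightarrow> complex" where
  "ell2_inner \<xi> \<eta> = (\<Sum>\<^sub>\<infinity>i. cnj (\<xi> i) * \<eta> i)"

definition ell2_norm :: "('i \<Rightarrow> complex) \<Rightarrow> real" where
  "ell2_norm \<xi> = sqrt (\<Sum>\<^sub>\<infinity>i. (cmod (\<xi> i))\<^sup>2)"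

definition cscale :: "complex \<Rightarrow> ('i \<Rightarrow> complex) \<Rightarrow> 'i \<Rightarrow> complex" where
  "cscale c \<xi> = (\<lambda>i. c * \<xi> i)"

text \<open>Bounded and unbounded operators on \<open>H = \<ell>\<^sup>2(I)\<close> are represented by their graphs, so that the
  inverse is the converse relation and the composition ``first \<open>R\<close>, then \<open>S\<close>'' is \<open>R O S\<close>.\<close>

type_synonym 'i oper = "(('i \<Rightarrow> complex) \<times> ('i \<Rightarrow> complex)) set"

text \<open>The operator given by the formula \<open>F\<close> on its maximal domain.\<close>

definition max_oper :: "('i \<Rightarrow> complex) set \<Rightarrow> (('i \<Rightarrow> complex) \<Rightarrow> 'i \<Rightarrow> complex) \<Rightarrow> 'i oper" where
  "max_oper H F = {(\<xi>, F \<xi>) |\<xi>. \<xi> \<in> H \<and> F \<xi> \<in> H}"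

definition linear_oper :: "('i \<Rightarrow> complex) set \<Rightarrow> 'i oper \<Rightarrow> bool" where
  "linear_oper H B \<longleftrightarrow> B \<subseteq> H \<times> H \<and> single_valued B \<and> (0, 0) \<in> B
   \<and> (\<forall>(\<xi>, \<eta>)\<in>B. \<forall>(\<xi>', \<eta>')\<in>B. (\<xi> + \<xi>', \<eta> + \<eta>') \<in> B)
   \<and> (\<forall>c. \<forall>(\<xi>, \<eta>)\<in>B. (cscale c \<xi>, cscale c \<eta>) \<in> B)"

definition compact_oper :: "('i \<Rightarrow> complex) set \<Rightarrow> 'i oper \<Rightarrow> bool" where
  "compact_oper H B \<longleftrightarrow> linear_oper H B \<and> Domain B = H
   \<and> (\<forall>X Y C. (\<forall>n::nat. (X n, Y n) \<in> B \<and> ell2_norm (X n) \<le> C) \<longrightarrow>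
        (\<exists>\<eta>\<in>H. \<exists>r. strict_mono r \<and> (\<lambda>n. ell2_norm (Y (r n) - \<eta>)) \<longlonglongrightarrow> 0))"

definition adjoint_oper :: "('i \<Rightarrow> complex) set \<Rightarrow> 'i oper \<Rightarrow> 'i oper" where
  "adjoint_oper H B =
     {(\<eta>, \<zeta>). \<eta> \<in> H \<and> \<zeta> \<in> H \<and> (\<forall>(\<xi>, \<theta>)\<in>B. ell2_inner \<theta> \<eta> = ell2_inner \<xi> \<zeta>)}"

definition positive_oper :: "'i oper \<Rightarrow> bool" where
  "positive_oper B \<longleftrightarrow> (\<forall>(\<xi>, \<eta>)\<in>B. ell2_inner \<xi> \<eta> \<in> \<real>\<^sub>\<ge>\<^sub>0)"

text \<open>\<open>|B|\<close> is the positive self-adjoint square root of \<open>B\<^sup>* B\<close>. Single-valuedness is required because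
  there are self-adjoint linear relations which are not operators; a single-valued self-adjoint
  relation is linear and densely defined.\<close>

definition abs_oper :: "('i \<Rightarrow> complex) set \<Rightarrow> 'i oper \<Rightarrow> 'i oper" where
  "abs_oper H B =
     (THE S. S \<subseteq> H \<times> H \<and> single_valued S \<and> adjoint_oper H S = S \<and> positive_oper S
           \<and> S O S = B O adjoint_oper H B)"

definition eigenspace :: "'i oper \<Rightarrow> complex \<Rightarrow> ('i \<Rightarrow> complex) set" where
  "eigenspace S t = {\<xi>. (\<xi>, cscale t \<xi>) \<in> S}"

text \<open>\<open>b\<close> lists, in decreasing order and with multiplicity, the positive eigenvalues of \<open>|B|\<close>; it is
  continued by \<open>0\<close> if there are only finitely many.\<close>

definition is_singular_values :: "('i \<Rightarrow> complex) set \<Rightarrow> 'i oper \<Rightarrow> (nat \<Rightarrow> real) \<Rightarrow> bool" where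
  "is_singular_values H B b \<longleftrightarrow> decseq b \<and> (\<forall>n. b n \<ge> 0)
   \<and> (\<forall>t>0. finite {n. b n = t}
          \<and> card {n. b n = t} = vector_space.dim cscale (eigenspace (abs_oper H B) (of_real t)))"

definition singular_values :: "('i \<Rightarrow> complex) set \<Rightarrow> 'i oper \<Rightarrow> nat \<Rightarrow> real" where
  "singular_values H B = (THE b. is_singular_values H B b)"

text \<open>The values at \<open>n = 0, 1\<close> are \<open>0\<close> by the conventions for \<open>ln 0\<close> and division by \<open>0\<close>.\<close>

definition log_mean :: "('i \<Rightarrow> complex) set \<Rightarrow> 'i oper \<Rightarrow> nat \<Rightarrow> real" where
  "log_mean H B n = 1 / ln (real n) * (\<Sum>m<n. singular_values H B m)"

definition L1_inf :: "('i \<Rightarrow> complex) set \<Rightarrow> 'i oper set" where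
  "L1_inf H = {B. compact_oper H B \<and> limsup (\<lambda>n. ereal (log_mean H B n)) < \<infinity>}"

definition measurable_oper :: "('i \<Rightarrow> complex) set \<Rightarrow> 'i oper \<Rightarrow> bool" where
  "measurable_oper H B \<longleftrightarrow> convergent (log_mean H B)"

definition lincomb_oper :: "complex \<Rightarrow> 'i oper \<Rightarrow> complex \<Rightarrow> 'i oper \<Rightarrow> 'i oper" where
  "lincomb_oper a A b B = {(\<xi>, cscale a \<eta> + cscale b \<zeta>) |\<xi> \<eta> \<zeta>. (\<xi>, \<eta>) \<in> A \<and> (\<xi>, \<zeta>) \<in> B}"

text \<open>States on \<open>\<ell>\<^sup>\<infinity>\<close> extending the usual limit; only the values on bounded sequences matter.\<close>

definition generalized_limit :: "((nat \<Rightarrow> complex) \<Rightarrow> complex) \<Rightarrow> bool" where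
  "generalized_limit \<omega> \<longleftrightarrow>
     (\<forall>X Y a b. Bseq X \<longrightarrow> Bseq Y \<longrightarrow> \<omega> (\<lambda>n. a * X n + b * Y n) = a * \<omega> X + b * \<omega> Y)
   \<and> (\<forall>X. Bseq X \<longrightarrow> (\<forall>n. X n \<in> \<real>\<^sub>\<ge>\<^sub>0) \<longrightarrow> \<omega> X \<in> \<real>\<^sub>\<ge>\<^sub>0)
   \<and> (\<forall>X L. X \<longlonglongrightarrow> L \<longrightarrow> \<omega> X = L)"

text \<open>\<open>\<tau>\<close> is the Dixmier trace \<open>\<tau>\<^sub>\<omega>\<close>: the linear functional extending the formula for positive
  operators. Such a \<open>\<tau>\<close> exists precisely for those \<open>\<omega>\<close> for which this formula is additive on positive
  operators; in particular it exists for the dilation invariant \<open>\<omega>\<close> used by Dixmier.\<close>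

definition is_dixmier_trace ::
    "('i \<Rightarrow> complex) set \<Rightarrow> ((nat \<Rightarrow> complex) \<Rightarrow> complex) \<Rightarrow> ('i oper \<Rightarrow> complex) \<Rightarrow> bool" where
  "is_dixmier_trace H \<omega> \<tau> \<longleftrightarrow> generalized_limit \<omega>
   \<and> (\<forall>B\<in>L1_inf H. positive_oper B \<longrightarrow> \<tau> B = \<omega> (\<lambda>n. complex_of_real (log_mean H B n)))
   \<and> (\<forall>A\<in>L1_inf H. \<forall>B\<in>L1_inf H. \<forall>a b. \<tau> (lincomb_oper a A b B) = a * \<tau> A + b * \<tau> B)"


section \<open>The representation and the Dirac operator\<close>

text \<open>\<open>\<ell>\<^sup>2(W\<^sup>*) \<oplus> \<ell>\<^sup>2(W\<^sup>*)\<close> is \<open>\<ell>\<^sup>2\<close> of the disjoint union: \<open>\<xi> (Inl w)\<close> and \<open>\<xi> (Inr w)\<close> are the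
  first and the second component of \<open>\<xi>\<close> at the word \<open>w\<close>.\<close>

definition hilb :: "nat^'k^'k \<Rightarrow> ('k list + 'k list \<Rightarrow> complex) set" where
  "hilb A = ell2 (all_words A <+> all_words A)"

definition pi_oper ::
    "nat^'k^'k \<Rightarrow> ((nat \<Rightarrow> 'k) \<Rightarrow> 'm) \<Rightarrow> ('k \<Rightarrow> nat \<Rightarrow> 'k) \<Rightarrow> ('k \<Rightarrow> nat \<Rightarrow> 'k)
      \<Rightarrow> ('m \<Rightarrow> complex) \<Rightarrow> ('k list + 'k list) oper" where
  "pi_oper A p y z f = max_oper (hilb A) (\<lambda>\<xi>.
     case_sum (\<lambda>w. f (p (w \<frown> y (last w))) * \<xi> (Inl w))
              (\<lambda>w. f (p (w \<frown> z (last w))) * \<xi> (Inr w)))"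

definition D_oper ::
    "nat^'k^'k \<Rightarrow> ((nat \<Rightarrow> 'k) \<Rightarrow> 'm) \<Rightarrow> ('m \<Rightarrow> 'm) \<Rightarrow> ('k \<Rightarrow> nat \<Rightarrow> 'k)
      \<Rightarrow> ('m \<Rightarrow> real) \<Rightarrow> ('k list + 'k list) oper" where
  "D_oper A p T x \<phi> = max_oper (hilb A) (\<lambda>\<xi>.
     let e = (\<lambda>w. complex_of_real (exp (birkhoff_sum T \<phi> (length w) (p (w \<frown> x (last w))))))
     in case_sum (\<lambda>w. e w * \<xi> (Inr w)) (\<lambda>w. e w * \<xi> (Inl w)))"

text \<open>\<open>\<pi>(f) |D\<^sub>\<phi>|\<^sup>-\<^sup>1\<close>\<close>

definition pi_absD_inv ::
    "nat^'k^'k \<Rightarrow> ((nat \<Rightarrow> 'k) \<Rightarrow> 'm) \<Rightarrow> ('m \<Rightarrow> 'm)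
      \<Rightarrow> ('k \<Rightarrow> nat \<Rightarrow> 'k) \<Rightarrow> ('k \<Rightarrow> nat \<Rightarrow> 'k) \<Rightarrow> ('k \<Rightarrow> nat \<Rightarrow> 'k)
      \<Rightarrow> ('m \<Rightarrow> real) \<Rightarrow> ('m \<Rightarrow> complex) \<Rightarrow> ('k list + 'k list) oper" where
  "pi_absD_inv A p T x y z \<phi> f = (abs_oper (hilb A) (D_oper A p T x \<phi>))\<inverse> O pi_oper A p y z f"

definition c_const ::
    "(nat^'k::finite^'k) \<Rightarrow> ((nat \<Rightarrow> 'k) \<Rightarrow> 'm) \<Rightarrow> 'm set \<Rightarrow> ('m \<Rightarrow> 'm) \<Rightarrow> ('k \<Rightarrow> nat \<Rightarrow> 'k)
      \<Rightarrow> ('m \<Rightarrow> real) \<Rightarrow> 'm measure \<Rightarrow> real" where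
  "c_const A p L T x \<phi> \<mu> =
     2 / (\<integral>u. \<phi> u \<partial>\<mu>) *
       (\<Sum>j\<in>UNIV. \<Sum>u | u \<in> L \<and> T u = p (x j). exp (- \<phi> u) * indicator (p ` cylinder1 A j) u)"

end

theory Submission
  imports Defs
begin

text \<open>\<open>\<pi>(f) |D|\<^sup>-\<^sup>1\<close> is diagonal, with entries of modulus \<open>\<lambda> |f|\<close>, where \<open>\<lambda>(w) = exp (- \<phi>\<^sup>n(w x))\<close>
  for a word \<open>w\<close> of length \<open>n\<close>, so its singular values are the decreasing rearrangement of these
  numbers. The sum of the largest \<open>N\<close> of them differs from the sum over the words with \<open>\<lambda> \<ge> 1/N\<close> by
  \<open>o(log N)\<close>. Summing \<open>\<lambda> |f|\<close> over all words of length \<open>n\<close> amounts to applying the \<open>n\<close>-th power of the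
  transfer operator, which converges to the integral against its invariant measure; and by the weak law
  of large numbers (correlations decay) the words of length \<open>n\<close> with \<open>\<lambda> \<ge> 1/N\<close> carry almost all of the
  mass if \<open>n < log N / \<integral>\<phi>\<close> and almost none of it if \<open>n > log N / \<integral>\<phi>\<close>. Hence the partial sums grow like
  \<open>log N / \<integral>\<phi>\<close> times the limit of the masses, without any Tauberian theorem.

  The invariant measure of the transfer operator is the Gibbs measure: Gibbs' inequality bounds
  \<open>h(m)\<close> by \<open>\<integral>\<phi> dm\<close> for every invariant \<open>m\<close>, and equality holds for it by bounded distortion.\<close>

section \<open>Operators on \<open>\<ell>\<^sup>2\<close> spaces\<close>

text \<open>Both \<open>abs_oper\<close> and \<open>singular_values\<close> are definite
  descriptions, so the operator side is mainly a matter of uniqueness: a positive self-adjoint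
  square root of a diagonal operator is pinned down on each basis vector without any spectral
  theorem, and a decreasing list is pinned down by the sizes of its level sets. The Dirac operator
  swaps the two summands, yet its absolute value is diagonal with the same entries on both; this is
  the factor 2 of c_\<phi>. The obstacle to a direct use of the transfer operator is that the tail
  x^j varies with the last letter j of the word. Splitting off that letter leaves an iterate at the
  fixed point j x^j times exp (- \<phi> (j x^j)); the iterates tend to the same limit at every
  point, and the factors add up to the sum over j in c_\<phi>. Singular values see only |f|, so the
  limit of the logarithmic means carries the integral of |f|. The integral of f itself is reached by
  linearity from nonnegative functions, for which the means converge and leave no freedom to the
  generalized limit.\<close>

lemma mult_le_sum_squares: "x * y \<le> x\<^sup>2 + (y::real)\<^sup>2"
  using sum_squares_bound[of x y] zero_le_power2[of x] zero_le_power2[of y] by linarith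

section \<open>Square-summable families and their inner product\<close>

definition unit_vec :: "'i \<Rightarrow> 'i \<Rightarrow> complex" where
  "unit_vec i = (\<lambda>j. of_bool (j = i))"

text \<open>Inner products and norms sum over the whole index type; since the families vanish
  outside \<open>I\<close>, summability over \<open>I\<close> and over \<open>UNIV\<close> coincide,
  and the second form is the convenient one.\<close>

lemma ell2_iff:
  "\<xi> \<in> ell2 I \<longleftrightarrow> (\<forall>i. i \<notin> I \<longrightarrow> \<xi> i = 0) \<and> (\<lambda>i. (cmod (\<xi> i))\<^sup>2) summable_on UNIV"
proof -
  have "(\<lambda>i. (cmod (\<xi> i))\<^sup>2) summable_on UNIV \<longleftrightarrow> (\<lambda>i. (cmod (\<xi> i))\<^sup>2) summable_on I"
    if "\<forall>i. i \<notin> I \<longrightarrow> \<xi> i = 0"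
    by (rule summable_on_cong_neutral) (use that in auto)
  then show ?thesis unfolding ell2_def by auto
qed

lemma ell2_outside: "\<xi> \<in> ell2 I \<Longrightarrow> i \<notin> I \<Longrightarrow> \<xi> i = 0"
  by (simp add: ell2_iff)

lemma ell2_summable: "\<xi> \<in> ell2 I \<Longrightarrow> (\<lambda>i. (cmod (\<xi> i))\<^sup>2) summable_on UNIV"
  by (simp add: ell2_iff)

lemma ell2_comparison:
  assumes "\<And>i. i \<notin> I \<Longrightarrow> \<eta> i = 0" and "g summable_on UNIV" and "\<And>i. (cmod (\<eta> i))\<^sup>2 \<le> g i"
  shows "\<eta> \<in> ell2 I"
  unfolding ell2_iff using assms(1) summable_on_comparison_test[OF assms(2)] assms(3) by auto

lemma zero_in_ell2: "0 \<in> ell2 I"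
  by (simp add: ell2_iff)

lemma ell2_add: "\<xi> \<in> ell2 I \<Longrightarrow> \<eta> \<in> ell2 I \<Longrightarrow> \<xi> + \<eta> \<in> ell2 I"
proof (rule ell2_comparison[where g = "\<lambda>i. 2 * (cmod (\<xi> i))\<^sup>2 + 2 * (cmod (\<eta> i))\<^sup>2"])
  fix i
  have "(cmod (\<xi> i + \<eta> i))\<^sup>2 \<le> (cmod (\<xi> i) + cmod (\<eta> i))\<^sup>2"
    by (intro power_mono norm_triangle_ineq) auto
  also have "\<dots> \<le> 2 * (cmod (\<xi> i))\<^sup>2 + 2 * (cmod (\<eta> i))\<^sup>2"
    using sum_squares_bound[of "cmod (\<xi> i)" "cmod (\<eta> i)"] by (simp add: power2_sum)
  finally show "(cmod ((\<xi> + \<eta>) i))\<^sup>2 \<le> 2 * (cmod (\<xi> i))\<^sup>2 + 2 * (cmod (\<eta> i))\<^sup>2" by simp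
qed (auto intro!: summable_on_add summable_on_cmult_right simp: ell2_iff)

lemma ell2_cscale: "\<xi> \<in> ell2 I \<Longrightarrow> cscale c \<xi> \<in> ell2 I"
  by (auto simp: ell2_iff cscale_def norm_mult power_mult_distrib intro!: summable_on_cmult_right)

lemma minus_conv_cscale: "\<xi> - \<eta> = \<xi> + cscale (-1) \<eta>"
  by (auto simp: cscale_def)

lemma ell2_diff: "\<xi> \<in> ell2 I \<Longrightarrow> \<eta> \<in> ell2 I \<Longrightarrow> \<xi> - \<eta> \<in> ell2 I"
  unfolding minus_conv_cscale by (intro ell2_add ell2_cscale)

lemma unit_vec_in_ell2: "i \<in> I \<Longrightarrow> unit_vec i \<in> ell2 I"
proof -
  assume "i \<in> I"
  have "(\<lambda>j. (cmod (unit_vec i j))\<^sup>2) summable_on UNIV \<longleftrightarrow> (\<lambda>j. (cmod (unit_vec i j))\<^sup>2) summable_on {i}"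
    by (rule summable_on_cong_neutral) (auto simp: unit_vec_def)
  then show ?thesis using \<open>i \<in> I\<close> by (auto simp: ell2_iff unit_vec_def)
qed

lemma ell2_bounded_mult:
  assumes "\<xi> \<in> ell2 I" and "\<And>i. i \<in> I \<Longrightarrow> cmod (a i) \<le> C"
  shows "(\<lambda>i. a i * \<xi> i) \<in> ell2 I"
proof (rule ell2_comparison[where g = "\<lambda>i. C\<^sup>2 * (cmod (\<xi> i))\<^sup>2"])
  show "(cmod (a i * \<xi> i))\<^sup>2 \<le> C\<^sup>2 * (cmod (\<xi> i))\<^sup>2" for i
  proof (cases "i \<in> I")
    case True
    then have "(cmod (a i))\<^sup>2 \<le> C\<^sup>2" using assms(2) by (intro power_mono) auto
    then show ?thesis by (simp add: norm_mult power_mult_distrib mult_right_mono)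
  qed (use assms in \<open>simp add: ell2_outside\<close>)
qed (use assms in \<open>auto simp: ell2_iff intro!: summable_on_cmult_right\<close>)

lemma ell2_inner_summable:
  assumes "\<xi> \<in> ell2 I" "\<eta> \<in> ell2 J"
  shows "(\<lambda>i. cnj (\<xi> i) * \<eta> i) summable_on UNIV"
proof (rule abs_summable_summable)
  have "(\<lambda>i. (cmod (\<xi> i))\<^sup>2 + (cmod (\<eta> i))\<^sup>2) summable_on UNIV"
    using assms by (intro summable_on_add) (auto simp: ell2_iff)
  then show "(\<lambda>i. norm (cnj (\<xi> i) * \<eta> i)) summable_on UNIV"
  proof (rule summable_on_comparison_test)
    show "norm (cnj (\<xi> i) * \<eta> i) \<le> (cmod (\<xi> i))\<^sup>2 + (cmod (\<eta> i))\<^sup>2" for i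
      using mult_le_sum_squares[of "cmod (\<xi> i)" "cmod (\<eta> i)"] by (simp add: norm_mult)
  qed auto
qed

lemma ell2_inner_add_right:
  assumes "\<xi> \<in> ell2 I" "\<eta> \<in> ell2 I" "\<zeta> \<in> ell2 I"
  shows "ell2_inner \<xi> (\<eta> + \<zeta>) = ell2_inner \<xi> \<eta> + ell2_inner \<xi> \<zeta>"
  unfolding ell2_inner_def
  using infsum_add[OF ell2_inner_summable[OF assms(1,2)] ell2_inner_summable[OF assms(1,3)]]
  by (simp add: ring_distribs)

lemma ell2_inner_cscale_right: "ell2_inner \<xi> (cscale c \<eta>) = c * ell2_inner \<xi> \<eta>"
proof -
  have "(\<lambda>i. cnj (\<xi> i) * cscale c \<eta> i) = (\<lambda>i. c * (cnj (\<xi> i) * \<eta> i))"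
    by (auto simp: cscale_def)
  then show ?thesis unfolding ell2_inner_def by (simp add: infsum_cmult_right')
qed

lemma ell2_inner_cnj: "cnj (ell2_inner \<xi> \<eta>) = ell2_inner \<eta> \<xi>"
  unfolding ell2_inner_def infsum_cnj[symmetric] by (simp add: mult.commute)

lemma ell2_inner_cscale_left: "ell2_inner (cscale c \<xi>) \<eta> = cnj c * ell2_inner \<xi> \<eta>"
  by (metis complex_cnj_mult ell2_inner_cnj ell2_inner_cscale_right)

lemma ell2_inner_unit_vec: "ell2_inner (unit_vec i) \<xi> = \<xi> i"
proof -
  have "infsum (\<lambda>j. cnj (unit_vec i j) * \<xi> j) UNIV = infsum (\<lambda>j. cnj (unit_vec i j) * \<xi> j) {i}"
    by (rule infsum_cong_neutral) (auto simp: unit_vec_def)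
  then show ?thesis by (simp add: ell2_inner_def unit_vec_def)
qed

lemma ell2_inner_of_real:
  assumes "\<xi> \<in> ell2 I" "\<eta> \<in> ell2 I" and "\<And>i. cnj (\<xi> i) * \<eta> i = of_real (g i)"
  shows "ell2_inner \<xi> \<eta> = of_real (\<Sum>\<^sub>\<infinity>i. g i)"
proof -
  have "(\<lambda>i. complex_of_real (g i)) summable_on UNIV"
    using ell2_inner_summable[OF assms(1,2)] by (simp add: assms(3))
  then have "g summable_on UNIV"
    using summable_on_bounded_linear[OF bounded_linear_Re] by fastforce
  then show ?thesis unfolding ell2_inner_def assms(3)
    by (intro infsumI has_sum_of_real has_sum_infsum)
qed

lemma ell2_inner_self: "\<xi> \<in> ell2 I \<Longrightarrow> ell2_inner \<xi> \<xi> = of_real (\<Sum>\<^sub>\<infinity>i. (cmod (\<xi> i))\<^sup>2)"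
  by (rule ell2_inner_of_real) (simp_all add: complex_norm_square mult.commute del: of_real_power)

lemma ell2_sq_le_infsum:
  assumes "\<xi> \<in> ell2 I"
  shows "(cmod (\<xi> i))\<^sup>2 \<le> (\<Sum>\<^sub>\<infinity>i. (cmod (\<xi> i))\<^sup>2)"
  using finite_sum_le_infsum[OF ell2_summable[OF assms], of "{i}"] by simp

lemma ell2_inner_self_eq_0:
  assumes "\<xi> \<in> ell2 I" "ell2_inner \<xi> \<xi> = 0"
  shows "\<xi> = 0"
proof
  fix i
  have "(\<Sum>\<^sub>\<infinity>i. (cmod (\<xi> i))\<^sup>2) = 0" using assms(2) by (simp only: ell2_inner_self[OF assms(1)] of_real_eq_0_iff)
  with ell2_sq_le_infsum[OF assms(1), of i] have "(cmod (\<xi> i))\<^sup>2 \<le> 0" by simp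
  then show "\<xi> i = 0 i" by simp
qed

text \<open>Both the Dirac operator, which swaps the two summands of \<open>\<ell>\<^sup>2(I) \<oplus> \<ell>\<^sup>2(I)\<close>, and multiplication
  operators are of the following form.\<close>

definition weighted_perm :: "'i set \<Rightarrow> ('i \<Rightarrow> complex) \<Rightarrow> ('i \<Rightarrow> 'i) \<Rightarrow> 'i oper" where
  "weighted_perm I a \<pi> = max_oper (ell2 I) (\<lambda>\<xi> i. a i * \<xi> (\<pi> i))"

abbreviation diag_oper :: "'i set \<Rightarrow> ('i \<Rightarrow> complex) \<Rightarrow> 'i oper" where
  "diag_oper I a \<equiv> weighted_perm I a (\<lambda>i. i)"

section \<open>Adjoints, squares and absolute values\<close>

lemma weighted_perm_iff:
  "(\<xi>, \<eta>) \<in> weighted_perm I a \<pi> \<longleftrightarrow> \<xi> \<in> ell2 I \<and> \<eta> \<in> ell2 I \<and> \<eta> = (\<lambda>i. a i * \<xi> (\<pi> i))"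
  by (auto simp: weighted_perm_def max_oper_def)

text \<open>One inclusion is a change of variables along the involution \<open>\<pi>\<close>. For
  the other, the adjoint identity is tested on \<open>unit_vec i\<close>, which lies in the domain
  however large the weights are and is mapped to a multiple of
  \<open>unit_vec (\<pi> i)\<close>.\<close>

lemma adjoint_weighted_perm:
  assumes inv: "\<And>i. \<pi> (\<pi> i) = i" and I: "\<And>i. \<pi> i \<in> I \<longleftrightarrow> i \<in> I"
  shows "adjoint_oper (ell2 I) (weighted_perm I a \<pi>) = weighted_perm I (\<lambda>i. cnj (a (\<pi> i))) \<pi>"
proof (intro set_eqI, safe)
  have bij: "bij_betw \<pi> UNIV UNIV"
    by (metis bij_betwI' inv UNIV_I)
  fix \<eta> \<zeta> :: "'a \<Rightarrow> complex"
  {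
    assume "(\<eta>, \<zeta>) \<in> weighted_perm I (\<lambda>i. cnj (a (\<pi> i))) \<pi>"
    then have \<eta>: "\<eta> \<in> ell2 I" "\<zeta> \<in> ell2 I" "\<zeta> = (\<lambda>i. cnj (a (\<pi> i)) * \<eta> (\<pi> i))"
      by (auto simp: weighted_perm_iff)
    have "ell2_inner \<theta> \<eta> = ell2_inner \<xi> \<zeta>" if "(\<xi>, \<theta>) \<in> weighted_perm I a \<pi>" for \<xi> \<theta>
    proof -
      have \<theta>: "\<theta> = (\<lambda>i. a i * \<xi> (\<pi> i))" using that by (auto simp: weighted_perm_iff)
      show ?thesis unfolding ell2_inner_def
        using infsum_reindex_bij_betw[OF bij, of "\<lambda>i. cnj (\<theta> i) * \<eta> i"]
        by (simp add: \<theta> \<eta>(3) inv mult_ac)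
    qed
    then show "(\<eta>, \<zeta>) \<in> adjoint_oper (ell2 I) (weighted_perm I a \<pi>)"
      using \<eta> by (auto simp: adjoint_oper_def)
  next
    assume "(\<eta>, \<zeta>) \<in> adjoint_oper (ell2 I) (weighted_perm I a \<pi>)"
    then have \<eta>: "\<eta> \<in> ell2 I" "\<zeta> \<in> ell2 I"
      and adj: "\<And>\<xi> \<theta>. (\<xi>, \<theta>) \<in> weighted_perm I a \<pi> \<Longrightarrow> ell2_inner \<theta> \<eta> = ell2_inner \<xi> \<zeta>"
      by (auto simp: adjoint_oper_def)
    have "\<zeta> i = cnj (a (\<pi> i)) * \<eta> (\<pi> i)" for i
    proof (cases "i \<in> I")
      case True
      have "\<pi> j = i \<longleftrightarrow> j = \<pi> i" for j by (metis inv)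
      then have "(\<lambda>j. a j * unit_vec i (\<pi> j)) = cscale (a (\<pi> i)) (unit_vec (\<pi> i))"
        by (simp add: cscale_def unit_vec_def fun_eq_iff)
      moreover have "unit_vec (\<pi> i) \<in> ell2 I" using I[of i] True by (simp add: unit_vec_in_ell2)
      ultimately have "(unit_vec i, cscale (a (\<pi> i)) (unit_vec (\<pi> i))) \<in> weighted_perm I a \<pi>"
        using unit_vec_in_ell2[OF True] by (simp add: weighted_perm_iff ell2_cscale)
      from adj[OF this] show ?thesis
        by (simp add: ell2_inner_cscale_left ell2_inner_unit_vec)
    next
      case False
      then show ?thesis using I[of i] \<eta> by (simp add: ell2_outside)
    qed
    then show "(\<eta>, \<zeta>) \<in> weighted_perm I (\<lambda>i. cnj (a (\<pi> i))) \<pi>"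
      using \<eta> by (auto simp: weighted_perm_iff)
  }
qed

text \<open>With unbounded weights the issue is the domain: when the two ends \<xi> and \<eta> are
  square summable, the intermediate vector must be shown to be so as well. Because the two weights
  met along the way have equal modulus, the squared moduli of its entries are products of moduli of
  entries of \<xi> and \<eta>.\<close>

lemma weighted_perm_comp:
  assumes inv: "\<And>i. \<pi> (\<pi> i) = i" and I: "\<And>i. \<pi> i \<in> I \<longleftrightarrow> i \<in> I"
    and ab: "\<And>i. cmod (b i) = cmod (a (\<pi> i))"
  shows "weighted_perm I a \<pi> O weighted_perm I b \<pi> = diag_oper I (\<lambda>i. b i * a (\<pi> i))"
proof (intro set_eqI, safe)
  fix \<xi> \<eta> assume *: "(\<xi>, \<eta>) \<in> diag_oper I (\<lambda>i. b i * a (\<pi> i))"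
  have bij: "bij_betw \<pi> UNIV UNIV"
    by (metis bij_betwI' inv UNIV_I)
  have "(\<lambda>i. (cmod (\<eta> (\<pi> i)))\<^sup>2 + (cmod (\<xi> (\<pi> i)))\<^sup>2) summable_on UNIV"
    using * summable_on_reindex_bij_betw[OF bij, of "\<lambda>i. (cmod (\<eta> i))\<^sup>2"]
      summable_on_reindex_bij_betw[OF bij, of "\<lambda>i. (cmod (\<xi> i))\<^sup>2"]
    by (intro summable_on_add) (auto simp: weighted_perm_iff ell2_summable)
  then have "(\<lambda>i. a i * \<xi> (\<pi> i)) \<in> ell2 I"
  proof (rule ell2_comparison[rotated])
    fix i
    have \<eta>: "\<eta> (\<pi> i) = b (\<pi> i) * a i * \<xi> (\<pi> i)" using * by (simp add: weighted_perm_iff inv)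
    have "(cmod (a i * \<xi> (\<pi> i)))\<^sup>2 = cmod (\<eta> (\<pi> i)) * cmod (\<xi> (\<pi> i))"
      unfolding \<eta> using ab[of "\<pi> i"] by (simp add: norm_mult power2_eq_square inv)
    also have "\<dots> \<le> (cmod (\<eta> (\<pi> i)))\<^sup>2 + (cmod (\<xi> (\<pi> i)))\<^sup>2"
      by (rule mult_le_sum_squares)
    finally show "(cmod (a i * \<xi> (\<pi> i)))\<^sup>2 \<le> (cmod (\<eta> (\<pi> i)))\<^sup>2 + (cmod (\<xi> (\<pi> i)))\<^sup>2" .
    show "a i * \<xi> (\<pi> i) = 0" if "i \<notin> I"
      using * that I[of i] ell2_outside[of \<xi> I "\<pi> i"] by (simp add: weighted_perm_iff)
  qed
  then show "(\<xi>, \<eta>) \<in> weighted_perm I a \<pi> O weighted_perm I b \<pi>"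
    using * by (intro relcompI[of _ "\<lambda>i. a i * \<xi> (\<pi> i)"]) (auto simp: weighted_perm_iff inv mult.assoc)
qed (auto simp: weighted_perm_iff inv mult.assoc)

text \<open>The description of |B| asks for self-adjointness rather than linearity; every adjoint
  relation is closed under linear combinations, so linearity and symmetry follow from S being its
  own adjoint.\<close>

lemma self_adjoint_oper_linear:
  assumes S: "S \<subseteq> ell2 I \<times> ell2 I" "adjoint_oper (ell2 I) S = S"
  shows "(\<xi>, \<eta>) \<in> S \<Longrightarrow> (\<xi>', \<eta>') \<in> S \<Longrightarrow> (\<xi> + \<xi>', \<eta> + \<eta>') \<in> S"
    and "(\<xi>, \<eta>) \<in> S \<Longrightarrow> (cscale c \<xi>, cscale c \<eta>) \<in> S"
    and "(\<xi>, \<eta>) \<in> S \<Longrightarrow> (\<xi>', \<eta>') \<in> S \<Longrightarrow> ell2_inner \<eta> \<xi>' = ell2_inner \<xi> \<eta>'"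
proof -
  have iff: "(\<xi>, \<eta>) \<in> S \<longleftrightarrow> \<xi> \<in> ell2 I \<and> \<eta> \<in> ell2 I
      \<and> (\<forall>(\<xi>', \<eta>')\<in>S. ell2_inner \<eta>' \<xi> = ell2_inner \<xi>' \<eta>)" for \<xi> \<eta>
    by (subst S(2)[symmetric]) (auto simp: adjoint_oper_def)
  have H: "\<xi> \<in> ell2 I" "\<eta> \<in> ell2 I" if "(\<xi>, \<eta>) \<in> S" for \<xi> \<eta>
    using S(1) that by auto
  show "(\<xi> + \<xi>', \<eta> + \<eta>') \<in> S" if "(\<xi>, \<eta>) \<in> S" "(\<xi>', \<eta>') \<in> S"
  proof (subst iff, intro conjI ballI, goal_cases)
    case (3 q)
    obtain \<alpha> \<beta> where q: "q = (\<alpha>, \<beta>)" by (cases q)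
    have "(\<alpha>, \<beta>) \<in> S" using 3 q by simp
    then have "ell2_inner \<beta> \<xi> = ell2_inner \<alpha> \<eta>" "ell2_inner \<beta> \<xi>' = ell2_inner \<alpha> \<eta>'"
      using that iff by blast+
    then show ?case
      using H[OF that(1)] H[OF that(2)] H[OF \<open>(\<alpha>, \<beta>) \<in> S\<close>] unfolding q
      by (simp add: ell2_inner_add_right[where I = I])
  qed (use H[OF that(1)] H[OF that(2)] in \<open>auto intro: ell2_add\<close>)
  show "(cscale c \<xi>, cscale c \<eta>) \<in> S" if "(\<xi>, \<eta>) \<in> S"
    using that unfolding iff[of \<xi> \<eta>] iff[of "cscale c \<xi>"]
    by (auto simp: ell2_cscale ell2_inner_cscale_right)
  show "ell2_inner \<eta> \<xi>' = ell2_inner \<xi> \<eta>'" if "(\<xi>, \<eta>) \<in> S" "(\<xi>', \<eta>') \<in> S"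
    using that(1) that(2)[unfolded iff[of \<xi>' \<eta>']] by blast
qed

lemma positive_diag_oper:
  assumes "\<And>i. i \<in> I \<Longrightarrow> 0 \<le> E i"
  shows "positive_oper (diag_oper I (\<lambda>i. of_real (E i)))"
  unfolding positive_oper_def
proof safe
  fix \<xi> \<eta> assume *: "(\<xi>, \<eta>) \<in> diag_oper I (\<lambda>i. complex_of_real (E i))"
  have "ell2_inner \<xi> \<eta> = of_real (\<Sum>\<^sub>\<infinity>i. E i * (cmod (\<xi> i))\<^sup>2)"
    using * by (intro ell2_inner_of_real[where I = I]) (auto simp: weighted_perm_iff complex_norm_square mult_ac simp del: of_real_power)
  moreover have "(\<Sum>\<^sub>\<infinity>i. E i * (cmod (\<xi> i))\<^sup>2) \<ge> 0"
  proof (rule infsum_nonneg)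
    show "0 \<le> E i * (cmod (\<xi> i))\<^sup>2" for i
      using * assms[of i] by (cases "i \<in> I") (auto simp: weighted_perm_iff ell2_outside)
  qed
  ultimately show "ell2_inner \<xi> \<eta> \<in> \<real>\<^sub>\<ge>\<^sub>0" by (simp add: nonneg_Reals_def)
qed

text \<open>A competing root S satisfies S S e = E^2 e on each basis vector e; positivity excludes
  the eigenvalue -E, so S e = E e. Symmetry then determines every coordinate of S \<xi>, which puts
  S inside the diagonal operator, and passing to adjoints gives the reverse inclusion.\<close>

lemma abs_oper_eqI:
  assumes B: "B O adjoint_oper (ell2 I) B = diag_oper I (\<lambda>i. of_real ((E i)\<^sup>2))"
    and E: "\<And>i. 0 \<le> E i"
  shows "abs_oper (ell2 I) B = diag_oper I (\<lambda>i. of_real (E i))" (is "_ = ?D")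
  unfolding abs_oper_def B
proof (rule the_equality, intro conjI)
  show D_adj: "adjoint_oper (ell2 I) ?D = ?D"
    by (subst adjoint_weighted_perm) auto
  show "?D \<subseteq> ell2 I \<times> ell2 I" by (auto simp: weighted_perm_iff)
  show "single_valued ?D" by (auto simp: single_valued_def weighted_perm_iff)
  show "positive_oper ?D" using E by (rule positive_diag_oper)
  show "?D O ?D = diag_oper I (\<lambda>i. of_real ((E i)\<^sup>2))"
    by (subst weighted_perm_comp) (auto simp: power2_eq_square)
  fix S assume "S \<subseteq> ell2 I \<times> ell2 I \<and> single_valued S \<and> adjoint_oper (ell2 I) S = S
      \<and> positive_oper S \<and> S O S = diag_oper I (\<lambda>i. of_real ((E i)\<^sup>2))"
  then have S: "S \<subseteq> ell2 I \<times> ell2 I" "adjoint_oper (ell2 I) S = S" and pos: "positive_oper S"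
    and sq: "S O S = diag_oper I (\<lambda>i. of_real ((E i)\<^sup>2))" by auto
  note lin = self_adjoint_oper_linear[OF S]
  have unit: "(unit_vec i, cscale (of_real (E i)) (unit_vec i)) \<in> S" if i: "i \<in> I" for i
  proof -
    let ?c = "complex_of_real (E i)" and ?e = "unit_vec i"
    have "(?e, cscale (?c\<^sup>2) ?e) \<in> S O S"
      using i by (auto simp: sq weighted_perm_iff unit_vec_in_ell2 ell2_cscale)
        (auto simp: cscale_def unit_vec_def)
    then obtain \<eta> where \<eta>: "(?e, \<eta>) \<in> S" "(\<eta>, cscale (?c\<^sup>2) ?e) \<in> S" by auto
    \<comment> \<open>\<open>\<zeta>\<close> satisfies \<open>S \<zeta> = - E \<zeta>\<close>, which contradicts positivity unless \<open>E \<zeta> = 0\<close>.\<close>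
    define \<zeta> where "\<zeta> = \<eta> + cscale (- ?c) ?e"
    have "(\<zeta>, cscale (?c\<^sup>2) ?e + cscale (- ?c) \<eta>) \<in> S"
      unfolding \<zeta>_def by (intro lin(1) lin(2) \<eta>)
    also have "cscale (?c\<^sup>2) ?e + cscale (- ?c) \<eta> = cscale (- ?c) \<zeta>"
      by (auto simp: \<zeta>_def cscale_def algebra_simps power2_eq_square)
    finally have \<zeta>: "(\<zeta>, cscale (- ?c) \<zeta>) \<in> S" .
    then have \<zeta>_H: "\<zeta> \<in> ell2 I" using S(1) by auto
    have "ell2_inner \<zeta> \<zeta> = 0"
    proof (cases "E i = 0")
      case True
      \<comment> \<open>For E i = 0 positivity yields nothing. Instead \<zeta> is the image of the
        basis vector e_i and S \<zeta> = 0, so symmetry gives <\<zeta>, \<zeta>> = <e_i, S \<zeta>>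
        = 0.\<close>
      then have "\<zeta> = \<eta>" "cscale (- ?c) \<zeta> = cscale 0 \<zeta>" by (auto simp: \<zeta>_def cscale_def)
      then show ?thesis using lin(3)[OF \<eta>(1) \<zeta>] by (simp add: ell2_inner_cscale_right)
    next
      case False
      have "- ?c * ell2_inner \<zeta> \<zeta> \<in> \<real>\<^sub>\<ge>\<^sub>0"
        using pos \<zeta> unfolding positive_oper_def by (auto simp: ell2_inner_cscale_right)
      then have "- E i * (\<Sum>\<^sub>\<infinity>j. (cmod (\<zeta> j))\<^sup>2) \<ge> 0"
        unfolding ell2_inner_self[OF \<zeta>_H] by (metis nonneg_Reals_of_real_iff of_real_minus of_real_mult)
      moreover have "(\<Sum>\<^sub>\<infinity>j. (cmod (\<zeta> j))\<^sup>2) \<ge> 0" by (intro infsum_nonneg) auto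
      ultimately have "(\<Sum>\<^sub>\<infinity>j. (cmod (\<zeta> j))\<^sup>2) = 0"
        using E[of i] False by (smt (verit) mult_minus_left mult_pos_pos)
      then show ?thesis by (simp add: ell2_inner_self[OF \<zeta>_H])
    qed
    then have "\<zeta> = 0" by (rule ell2_inner_self_eq_0[OF \<zeta>_H])
    then have "\<eta> = cscale ?c ?e"
      by (auto simp: \<zeta>_def cscale_def fun_eq_iff add_eq_0_iff)
    then show ?thesis using \<eta>(1) by simp
  qed
  have "S \<subseteq> ?D"
  proof safe
    fix \<xi> \<eta> assume *: "(\<xi>, \<eta>) \<in> S"
    then have H: "\<xi> \<in> ell2 I" "\<eta> \<in> ell2 I" using S(1) by auto
    have "\<eta> i = of_real (E i) * \<xi> i" for i
    proof (cases "i \<in> I")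
      case True
      show ?thesis using lin(3)[OF unit[OF True] *]
        by (simp add: ell2_inner_cscale_left ell2_inner_unit_vec)
    qed (use H in \<open>simp add: ell2_outside\<close>)
    then show "(\<xi>, \<eta>) \<in> ?D" using H by (auto simp: weighted_perm_iff)
  qed
  moreover have "?D \<subseteq> S"
  proof -
    have "?D \<subseteq> adjoint_oper (ell2 I) S"
    proof (subst D_adj[symmetric], safe)
      fix \<xi> \<eta> assume "(\<xi>, \<eta>) \<in> adjoint_oper (ell2 I) ?D"
      then show "(\<xi>, \<eta>) \<in> adjoint_oper (ell2 I) S" using \<open>S \<subseteq> ?D\<close>
        by (auto simp: adjoint_oper_def)
    qed
    then show ?thesis using S(2) by simp
  qed
  ultimately show "S = ?D" by auto
qed

lemma abs_weighted_perm:
  assumes inv: "\<And>i. \<pi> (\<pi> i) = i" and I: "\<And>i. \<pi> i \<in> I \<longleftrightarrow> i \<in> I"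
  shows "abs_oper (ell2 I) (weighted_perm I a \<pi>) = diag_oper I (\<lambda>i. of_real (cmod (a (\<pi> i))))"
proof (rule abs_oper_eqI)
  show "weighted_perm I a \<pi> O adjoint_oper (ell2 I) (weighted_perm I a \<pi>)
      = diag_oper I (\<lambda>i. of_real ((cmod (a (\<pi> i)))\<^sup>2))"
    unfolding adjoint_weighted_perm[OF inv I]
    by (subst weighted_perm_comp[OF inv I]) (auto simp: complex_norm_square mult.commute simp del: of_real_power)
qed auto

section \<open>Singular values of multiplication operators\<close>

lemma linear_diag_oper: "linear_oper (ell2 I) (diag_oper I a)"
proof -
  have add: "(\<xi> + \<xi>', \<eta> + \<eta>') \<in> diag_oper I a"
    if "(\<xi>, \<eta>) \<in> diag_oper I a" "(\<xi>', \<eta>') \<in> diag_oper I a" for \<xi> \<xi>' \<eta> \<eta>'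
    using that unfolding weighted_perm_iff by (auto intro!: ell2_add simp: ring_distribs fun_eq_iff)
  have scale: "(cscale c \<xi>, cscale c \<eta>) \<in> diag_oper I a"
    if "(\<xi>, \<eta>) \<in> diag_oper I a" for c \<xi> \<eta>
    using that unfolding weighted_perm_iff by (auto intro!: ell2_cscale) (auto simp: cscale_def)
  have "diag_oper I a \<subseteq> ell2 I \<times> ell2 I" "single_valued (diag_oper I a)" "(0, 0) \<in> diag_oper I a"
    by (auto simp: weighted_perm_iff zero_in_ell2 fun_eq_iff single_valued_def)
  then show ?thesis unfolding linear_oper_def using add scale by blast
qed

lemma Domain_diag_oper:
  assumes "\<And>i. i \<in> I \<Longrightarrow> cmod (a i) \<le> C"
  shows "Domain (diag_oper I a) = ell2 I"
proof safe
  fix \<xi> assume "\<xi> \<in> ell2 I"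
  then have "(\<xi>, \<lambda>i. a i * \<xi> i) \<in> diag_oper I a"
    using ell2_bounded_mult[of \<xi> I a C] assms by (simp add: weighted_perm_iff)
  then show "\<xi> \<in> Domain (diag_oper I a)" by blast
qed (simp add: weighted_perm_iff)

lemma ell2_norm_pow2: "(ell2_norm \<xi>)\<^sup>2 = (\<Sum>\<^sub>\<infinity>i. (cmod (\<xi> i))\<^sup>2)"
  unfolding ell2_norm_def by (rule real_sqrt_pow2) (intro infsum_nonneg, simp)

lemma ell2_norm_nonneg: "ell2_norm \<xi> \<ge> 0"
  unfolding ell2_norm_def by (intro real_sqrt_ge_zero infsum_nonneg) simp

lemma vanishing_imp_bounded:
  fixes a :: "'i \<Rightarrow> complex"
  assumes "\<And>\<epsilon>. \<epsilon> > 0 \<Longrightarrow> finite {i \<in> I. cmod (a i) \<ge> \<epsilon>}"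
  obtains C where "\<And>i. i \<in> I \<Longrightarrow> cmod (a i) \<le> C"
proof
  fix i assume "i \<in> I"
  let ?F = "{i \<in> I. cmod (a i) \<ge> 1}"
  have "cmod (a i) \<le> (\<Sum>i\<in>?F. cmod (a i))" if "i \<in> ?F"
    by (rule member_le_sum[OF that]) (use assms[of 1] in auto)
  moreover have "0 \<le> (\<Sum>i\<in>?F. cmod (a i))" by (rule sum_nonneg) auto
  ultimately show "cmod (a i) \<le> 1 + (\<Sum>i\<in>?F. cmod (a i))"
    using \<open>i \<in> I\<close> by (cases "i \<in> ?F") auto
qed

text \<open>Tychonoff's theorem, standing in for a diagonal argument over the coordinates.\<close>

lemma compact_fun_cball: "compact {x :: 'i \<Rightarrow> complex. \<forall>i. cmod (x i) \<le> C}"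
proof -
  have "compactin (product_topology (\<lambda>i::'i. euclidean :: complex topology) UNIV) (PiE UNIV (\<lambda>_. cball 0 C))"
    by (subst compactin_PiE) auto
  then show ?thesis
    by (simp add: euclidean_product_topology PiE_def Pi_def)
qed

text \<open>A bounded sequence has a subsequence converging in every coordinate, the index type
  being countable; finite partial sums show that the limit is again square summable. In the image,
  the finitely many coordinates with large weight converge one by one, and the remaining ones
  contribute at most e^2 times the bounded squared norm of the difference, uniformly along the
  subsequence.\<close>

lemma compact_diag_oper:
  fixes a :: "'i::countable \<Rightarrow> complex"
  assumes fin: "\<And>\<epsilon>. \<epsilon> > 0 \<Longrightarrow> finite {i \<in> I. cmod (a i) \<ge> \<epsilon>}"
  shows "compact_oper (ell2 I) (diag_oper I a)"
  unfolding compact_oper_def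
proof (intro conjI allI impI)
  obtain Ca where Ca: "\<And>i. i \<in> I \<Longrightarrow> cmod (a i) \<le> Ca"
    using vanishing_imp_bounded[of I a] fin by auto
  show "linear_oper (ell2 I) (diag_oper I a)" by (rule linear_diag_oper)
  show "Domain (diag_oper I a) = ell2 I" by (rule Domain_diag_oper[OF Ca])
  fix X Y :: "nat \<Rightarrow> 'i \<Rightarrow> complex" and C
  assume "\<forall>n. (X n, Y n) \<in> diag_oper I a \<and> ell2_norm (X n) \<le> C"
  then have X: "X n \<in> ell2 I" and Y: "Y n = (\<lambda>i. a i * X n i)" and C: "ell2_norm (X n) \<le> C" for n
    by (auto simp: weighted_perm_iff)
  have C0: "C \<ge> 0" using C[of 0] ell2_norm_nonneg[of "X 0"] by linarith
  have sumX: "(\<Sum>\<^sub>\<infinity>i. (cmod (X n i))\<^sup>2) \<le> C\<^sup>2" for n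
    unfolding ell2_norm_pow2[symmetric] by (intro power_mono C ell2_norm_nonneg)
  have "(cmod (X n i))\<^sup>2 \<le> C\<^sup>2" for n i
    using ell2_sq_le_infsum[OF X, of n i] sumX[of n] by linarith
  then have "cmod (X n i) \<le> C" for n i
    using C0 by (meson norm_ge_zero power2_le_imp_le)
  then have "\<forall>n. X n \<in> {x. \<forall>i. cmod (x i) \<le> C}" by auto
  then obtain l r where r: "strict_mono (r :: nat \<Rightarrow> nat)" "(X \<circ> r) \<longlonglongrightarrow> l"
    using compact_imp_seq_compact[OF compact_fun_cball[of C]] unfolding seq_compact_def by blast
  have lim: "(\<lambda>n. X (r n) i) \<longlonglongrightarrow> l i" for i
    using continuous_on_tendsto_compose[OF continuous_on_product_coordinates[of i] r(2)] by simp
  have l0: "l i = 0" if "i \<notin> I" for i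
    using lim[of i] by (simp add: ell2_outside[OF X that] LIMSEQ_const_iff)
  have suml: "(\<Sum>i\<in>F. (cmod (l i))\<^sup>2) \<le> C\<^sup>2" if "finite F" for F
  proof (rule LIMSEQ_le_const2)
    show "(\<lambda>n. \<Sum>i\<in>F. (cmod (X (r n) i))\<^sup>2) \<longlonglongrightarrow> (\<Sum>i\<in>F. (cmod (l i))\<^sup>2)"
      by (intro tendsto_intros lim)
    have "(\<Sum>i\<in>F. (cmod (X (r n) i))\<^sup>2) \<le> C\<^sup>2" for n
      using finite_sum_le_infsum[OF ell2_summable[OF X[of "r n"]] that] sumX[of "r n"]
      by (simp add: order.trans)
    then show "\<exists>N. \<forall>n\<ge>N. (\<Sum>i\<in>F. (cmod (X (r n) i))\<^sup>2) \<le> C\<^sup>2" by blast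
  qed
  have l_summable: "(\<lambda>i. (cmod (l i))\<^sup>2) summable_on UNIV"
    by (rule nonneg_bdd_above_summable_on) (use suml in \<open>auto intro!: bdd_aboveI2\<close>)
  then have l: "l \<in> ell2 I" using l0 by (auto simp: ell2_iff)
  have l_le: "(\<Sum>\<^sub>\<infinity>i. (cmod (l i))\<^sup>2) \<le> C\<^sup>2"
    by (rule infsum_le_finite_sums[OF l_summable]) (use suml in auto)
  define \<eta> where "\<eta> = (\<lambda>i. a i * l i)"
  define d where "d n = X (r n) - l" for n
  have d: "d n \<in> ell2 I" for n unfolding d_def by (intro ell2_diff X l)
  have d_le: "(\<Sum>\<^sub>\<infinity>i. (cmod (d n i))\<^sup>2) \<le> 4 * C\<^sup>2" for n
  proof -
    have "(\<Sum>\<^sub>\<infinity>i. (cmod (d n i))\<^sup>2) \<le> (\<Sum>\<^sub>\<infinity>i. 2 * (cmod (X (r n) i))\<^sup>2 + 2 * (cmod (l i))\<^sup>2)"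
    proof (rule infsum_mono)
      show "(cmod (d n i))\<^sup>2 \<le> 2 * (cmod (X (r n) i))\<^sup>2 + 2 * (cmod (l i))\<^sup>2" for i
      proof -
        have "(cmod (d n i))\<^sup>2 \<le> (cmod (X (r n) i) + cmod (l i))\<^sup>2"
          unfolding d_def by (intro power_mono) (auto intro: norm_triangle_ineq4)
        also have "\<dots> \<le> 2 * (cmod (X (r n) i))\<^sup>2 + 2 * (cmod (l i))\<^sup>2"
          using sum_squares_bound[of "cmod (X (r n) i)" "cmod (l i)"] by (simp add: power2_sum)
        finally show ?thesis .
      qed
    qed (intro summable_on_add summable_on_cmult_right ell2_summable[OF d] ell2_summable[OF X]
          ell2_summable[OF l])+
    also have "\<dots> = 2 * (\<Sum>\<^sub>\<infinity>i. (cmod (X (r n) i))\<^sup>2) + 2 * (\<Sum>\<^sub>\<infinity>i. (cmod (l i))\<^sup>2)"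
      by (subst infsum_add) (auto simp: infsum_cmult_right'
          intro!: summable_on_cmult_right ell2_summable[OF X] ell2_summable[OF l])
    also have "\<dots> \<le> 4 * C\<^sup>2" using sumX[of "r n"] l_le by simp
    finally show ?thesis .
  qed
  have lim_d: "(\<lambda>n. d n i) \<longlonglongrightarrow> 0" for i
    using tendsto_diff[OF lim[of i] tendsto_const[of "l i"]] by (simp add: d_def)
  have ad: "(\<lambda>i. a i * d n i) \<in> ell2 I" for n
    by (rule ell2_bounded_mult[OF d Ca])
  have bound: "(\<Sum>\<^sub>\<infinity>i. (cmod (a i * d n i))\<^sup>2)
      \<le> (\<Sum>i\<in>{i\<in>I. cmod (a i) \<ge> e}. (cmod (a i * d n i))\<^sup>2) + e\<^sup>2 * (4 * C\<^sup>2)" if "e > 0" for e n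
  proof -
    let ?F = "{i\<in>I. cmod (a i) \<ge> e}"
    have F: "finite ?F" using fin that by auto
    let ?g = "\<lambda>i. of_bool (i \<in> ?F) * (cmod (a i * d n i))\<^sup>2"
    have gs: "?g summable_on UNIV" and gi: "infsum ?g UNIV = (\<Sum>i\<in>?F. (cmod (a i * d n i))\<^sup>2)"
    proof -
      have "?g summable_on UNIV \<longleftrightarrow> ?g summable_on ?F" by (rule summable_on_cong_neutral) auto
      then show "?g summable_on UNIV" using F by simp
      have "infsum ?g UNIV = infsum ?g ?F" by (rule infsum_cong_neutral) auto
      also have "\<dots> = (\<Sum>i\<in>?F. (cmod (a i * d n i))\<^sup>2)" unfolding infsum_finite[OF F] by (rule sum.cong) auto
      finally show "infsum ?g UNIV = (\<Sum>i\<in>?F. (cmod (a i * d n i))\<^sup>2)" .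
    qed
    have ds: "(\<lambda>i. e\<^sup>2 * (cmod (d n i))\<^sup>2) summable_on UNIV"
      by (intro summable_on_cmult_right ell2_summable[OF d])
    have "(\<Sum>\<^sub>\<infinity>i. (cmod (a i * d n i))\<^sup>2) \<le> (\<Sum>\<^sub>\<infinity>i. ?g i + e\<^sup>2 * (cmod (d n i))\<^sup>2)"
    proof (rule infsum_mono)
      show "(cmod (a i * d n i))\<^sup>2 \<le> ?g i + e\<^sup>2 * (cmod (d n i))\<^sup>2" for i
      proof (cases "i \<in> ?F")
        case False
        show ?thesis
        proof (cases "i \<in> I")
          case True
          then have "(cmod (a i))\<^sup>2 \<le> e\<^sup>2" using False by (intro power_mono) auto
          then show ?thesis using False by (simp add: norm_mult power_mult_distrib mult_right_mono)
        qed (use d[of n] in \<open>simp add: ell2_outside\<close>)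
      qed auto
    qed (intro summable_on_add gs ds ell2_summable[OF ad])+
    also have "\<dots> = infsum ?g UNIV + (\<Sum>\<^sub>\<infinity>i. e\<^sup>2 * (cmod (d n i))\<^sup>2)"
      by (rule infsum_add[OF gs ds])
    also have "(\<Sum>\<^sub>\<infinity>i. e\<^sup>2 * (cmod (d n i))\<^sup>2) \<le> e\<^sup>2 * (4 * C\<^sup>2)"
      unfolding infsum_cmult_right' by (intro mult_left_mono d_le) simp
    finally show ?thesis unfolding gi by simp
  qed
  have "(\<lambda>n. \<Sum>\<^sub>\<infinity>i. (cmod (a i * d n i))\<^sup>2) \<longlonglongrightarrow> 0"
  proof (rule order_tendstoI)
    fix \<epsilon> :: real assume \<epsilon>: "0 < \<epsilon>"
    \<comment> \<open>Makes the contribution of the small weights at most \<epsilon> / 2; the added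
      1 keeps the denominator away from 0 when C = 0.\<close>
    define e where "e = sqrt (\<epsilon> / (2 * (1 + 4 * C\<^sup>2)))"
    have pos: "1 + 4 * C\<^sup>2 > 0" using zero_le_power2[of C] by linarith
    have e: "e > 0" "e\<^sup>2 = \<epsilon> / (2 * (1 + 4 * C\<^sup>2))" using \<epsilon> pos by (auto simp: e_def)
    have "e\<^sup>2 * (4 * C\<^sup>2) \<le> e\<^sup>2 * (1 + 4 * C\<^sup>2)" by (intro mult_left_mono) auto
    also have "\<dots> = \<epsilon> / 2" unfolding e(2) using pos by (simp add: field_simps)
    finally have e2: "e\<^sup>2 * (4 * C\<^sup>2) \<le> \<epsilon> / 2" .
    have "(\<lambda>n. \<Sum>i\<in>{i\<in>I. cmod (a i) \<ge> e}. (cmod (a i * d n i))\<^sup>2)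
        \<longlonglongrightarrow> (\<Sum>i\<in>{i\<in>I. cmod (a i) \<ge> e}. (cmod (a i * 0))\<^sup>2)"
      by (intro tendsto_intros lim_d)
    then have "\<forall>\<^sub>F n in sequentially. (\<Sum>i\<in>{i\<in>I. cmod (a i) \<ge> e}. (cmod (a i * d n i))\<^sup>2) < \<epsilon> / 2"
      using \<epsilon> by (intro order_tendstoD(2)) (auto)
    then show "\<forall>\<^sub>F n in sequentially. (\<Sum>\<^sub>\<infinity>i. (cmod (a i * d n i))\<^sup>2) < \<epsilon>"
    proof eventually_elim
      case (elim n)
      show ?case using bound[OF e(1), of n] e2 elim by linarith
    qed
  next
    fix \<epsilon> :: real assume "\<epsilon> < 0"
    then show "\<forall>\<^sub>F n in sequentially. \<epsilon> < (\<Sum>\<^sub>\<infinity>i. (cmod (a i * d n i))\<^sup>2)"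
      by (intro always_eventually allI) (smt (verit) infsum_nonneg zero_le_power2)
  qed
  then have "(\<lambda>n. sqrt (\<Sum>\<^sub>\<infinity>i. (cmod (a i * d n i))\<^sup>2)) \<longlonglongrightarrow> sqrt 0" by (rule tendsto_real_sqrt)
  then have "(\<lambda>n. ell2_norm (Y (r n) - \<eta>)) \<longlonglongrightarrow> 0"
    by (simp add: ell2_norm_def Y \<eta>_def d_def right_diff_distrib)
  moreover have "\<eta> \<in> ell2 I" unfolding \<eta>_def by (rule ell2_bounded_mult[OF l Ca])
  ultimately show "\<exists>\<eta>\<in>ell2 I. \<exists>r. strict_mono r \<and> (\<lambda>n. ell2_norm (Y (r n) - \<eta>)) \<longlonglongrightarrow> 0"
    using r(1) by blast
qed

section \<open>Multiplicities of eigenvalues and decreasing rearrangements\<close>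

lemma vector_space_cscale: "vector_space cscale"
  by unfold_locales (auto simp: cscale_def ring_distribs fun_eq_iff)

lemma sum_apply: "(\<Sum>i\<in>J. f i) x = (\<Sum>i\<in>J. f i x)"
  for f :: "'j \<Rightarrow> 'i \<Rightarrow> complex"
  by (induction J rule: infinite_finite_induct) auto

lemma dim_finite_support:
  assumes J: "finite J"
  shows "vector_space.dim cscale {\<xi>. \<forall>i. i \<notin> J \<longrightarrow> \<xi> i = 0} = card J"
proof -
  interpret vs: vector_space "cscale :: complex \<Rightarrow> ('a \<Rightarrow> complex) \<Rightarrow> _" by (rule vector_space_cscale)
  have span: "vs.span (unit_vec ` J) = {\<xi>. \<forall>i. i \<notin> J \<longrightarrow> \<xi> i = 0}" if J: "finite J" for J :: "'a set"
  proof
    show "vs.span (unit_vec ` J) \<subseteq> {\<xi>. \<forall>i. i \<notin> J \<longrightarrow> \<xi> i = 0}"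
    proof (rule vs.span_minimal)
      show "vs.subspace {\<xi>. \<forall>i. i \<notin> J \<longrightarrow> \<xi> i = 0}"
        unfolding vs.subspace_def by (auto simp: cscale_def)
    qed (auto simp: unit_vec_def)
    show "{\<xi>. \<forall>i. i \<notin> J \<longrightarrow> \<xi> i = 0} \<subseteq> vs.span (unit_vec ` J)"
    proof
      fix \<xi> :: "'a \<Rightarrow> complex" assume \<xi>: "\<xi> \<in> {\<xi>. \<forall>i. i \<notin> J \<longrightarrow> \<xi> i = 0}"
      have "\<xi> = (\<Sum>i\<in>J. cscale (\<xi> i) (unit_vec i))"
      proof
        fix x
        have "(\<Sum>i\<in>J. cscale (\<xi> i) (unit_vec i)) x = (\<Sum>i\<in>J. if x = i then \<xi> i else 0)"
          unfolding sum_apply by (intro sum.cong) (auto simp: cscale_def unit_vec_def)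
        then show "\<xi> x = (\<Sum>i\<in>J. cscale (\<xi> i) (unit_vec i)) x"
          using \<xi> J by auto
      qed
      also have "\<dots> \<in> vs.span (unit_vec ` J)"
        by (intro vs.span_sum vs.span_scale vs.span_base) auto
      finally show "\<xi> \<in> vs.span (unit_vec ` J)" .
    qed
  qed
  have inj: "inj_on unit_vec J" by (auto simp: inj_on_def unit_vec_def fun_eq_iff)
  have "vs.independent (unit_vec ` J)"
    unfolding vs.dependent_def
  proof safe
    fix i assume i: "i \<in> J" "unit_vec i \<in> vs.span (unit_vec ` J - {unit_vec i})"
    have "unit_vec ` J - {unit_vec i} \<subseteq> unit_vec ` (J - {i})" by auto
    then have "unit_vec i \<in> vs.span (unit_vec ` (J - {i}))" using i vs.span_mono by blast
    then show False using J by (subst (asm) span) (auto simp: unit_vec_def)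
  qed
  then have "vs.dim (vs.span (unit_vec ` J)) = card (unit_vec ` J)"
    by (rule vs.dim_eq_card[OF vs.span_span[symmetric]])
  then show ?thesis by (simp add: span[OF J] card_image[OF inj])
qed

lemma dim_eigenspace_diag:
  assumes t: "t > 0" and fin: "finite {i \<in> I. E i = t}"
  shows "vector_space.dim cscale (eigenspace (diag_oper I (\<lambda>i. of_real (E i))) (of_real t)) = card {i \<in> I. E i = t}"
proof -
  have "eigenspace (diag_oper I (\<lambda>i. of_real (E i))) (of_real t)
      = {\<xi>. \<forall>i. i \<notin> {i \<in> I. E i = t} \<longrightarrow> \<xi> i = 0}" (is "?L = ?R")
  proof
    show "?L \<subseteq> ?R"
    proof (intro subsetI CollectI allI impI)
      fix \<xi> i assume *: "\<xi> \<in> ?L" and i: "i \<notin> {i \<in> I. E i = t}"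
      then have "\<xi> \<in> ell2 I" "complex_of_real t * \<xi> i = of_real (E i) * \<xi> i"
        by (auto simp: eigenspace_def weighted_perm_iff cscale_def fun_eq_iff)
      then show "\<xi> i = 0" using i by (cases "i \<in> I") (auto simp: ell2_outside)
    qed
    show "?R \<subseteq> ?L"
    proof
      fix \<xi> assume *: "\<xi> \<in> ?R"
      have "(\<lambda>i. (cmod (\<xi> i))\<^sup>2) summable_on UNIV \<longleftrightarrow> (\<lambda>i. (cmod (\<xi> i))\<^sup>2) summable_on {i \<in> I. E i = t}"
        by (rule summable_on_cong_neutral) (use * in auto)
      then have "\<xi> \<in> ell2 I" using fin * by (auto simp: ell2_iff)
      moreover have "cscale (of_real t) \<xi> = (\<lambda>i. of_real (E i) * \<xi> i)"
        using * by (fastforce simp: cscale_def)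
      ultimately show "\<xi> \<in> ?L"
        using ell2_cscale[of \<xi> I "of_real t"] by (simp add: eigenspace_def weighted_perm_iff)
    qed
  qed
  then show ?thesis using dim_finite_support[OF fin] by simp
qed

text \<open>The conditions of \<open>is_singular_values\<close> with eigenspace dimensions replaced
  by sizes of level sets. The level 0 is left free: \<alpha> may vanish at infinitely many indices,
  and b may have to be padded with zeros.\<close>

definition decr_rearrangement :: "'i set \<Rightarrow> ('i \<Rightarrow> real) \<Rightarrow> (nat \<Rightarrow> real) \<Rightarrow> bool" where
  "decr_rearrangement I \<alpha> b \<longleftrightarrow> decseq b \<and> (\<forall>n. b n \<ge> 0)
     \<and> (\<forall>t>0. finite {n. b n = t} \<and> card {n. b n = t} = card {i \<in> I. \<alpha> i = t})"

lemma is_singular_values_diag: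
  assumes fin: "\<And>\<epsilon>. \<epsilon> > 0 \<Longrightarrow> finite {i \<in> I. cmod (a i) \<ge> \<epsilon>}"
  shows "is_singular_values (ell2 I) (diag_oper I a) b \<longleftrightarrow> decr_rearrangement I (\<lambda>i. cmod (a i)) b"
proof -
  have "finite {i \<in> I. cmod (a i) = t}" if "t > 0" for t
    by (rule finite_subset[OF _ fin[OF that]]) auto
  then show ?thesis unfolding is_singular_values_def decr_rearrangement_def
    by (subst abs_weighted_perm) (auto simp: dim_eigenspace_diag)
qed

lemma finite_downclosed_nat:
  fixes D :: "nat set"
  assumes "finite D" "\<And>m n. n \<in> D \<Longrightarrow> m \<le> n \<Longrightarrow> m \<in> D"
  shows "D = {..<card D}"
proof (cases "D = {}")
  case False
  have "D = {..Max D}"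
    using assms False by (auto intro: Max_in)
  then show ?thesis by (metis card_atMost lessThan_Suc_atMost)
qed auto

text \<open>The list is recovered from its distribution function: \<open>{n. t \<le> b n}\<close> is
  an initial segment because b decreases, and its size is the sum of the sizes of the finitely many
  nonempty level sets at height at least t.\<close>

lemma decr_rearrangement_ge_iff:
  assumes b: "decr_rearrangement I \<alpha> b" and fin: "\<And>\<epsilon>. \<epsilon> > 0 \<Longrightarrow> finite {i \<in> I. \<alpha> i \<ge> \<epsilon>}" and t: "t > 0"
  shows "t \<le> b n \<longleftrightarrow> n < card {i \<in> I. t \<le> \<alpha> i}"
proof -
  have fin': "finite {n. b n = s}" and card': "card {n. b n = s} = card {i \<in> I. \<alpha> i = s}" if "s > 0" for s
    using b that by (auto simp: decr_rearrangement_def)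
  define V where "V = \<alpha> ` {i \<in> I. t \<le> \<alpha> i}"
  have V: "finite V" "\<And>s. s \<in> V \<Longrightarrow> s > 0" using fin[OF t] t by (auto simp: V_def)
  have 1: "{n. t \<le> b n} = (\<Union>s\<in>V. {n. b n = s})"
  proof safe
    fix n assume n: "t \<le> b n"
    then have "card {m. b m = b n} \<noteq> 0" using fin'[of "b n"] t by auto
    then have "card {i \<in> I. \<alpha> i = b n} \<noteq> 0" using card'[of "b n"] n t by simp
    then have "{i \<in> I. \<alpha> i = b n} \<noteq> {}" by (metis card.empty)
    then have "b n \<in> V" using n unfolding V_def by force
    then show "n \<in> (\<Union>s\<in>V. {n. b n = s})" by auto
  qed (auto simp: V_def)
  have 2: "{i \<in> I. t \<le> \<alpha> i} = (\<Union>s\<in>V. {i \<in> I. \<alpha> i = s})" by (auto simp: V_def)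
  have "card {n. t \<le> b n} = (\<Sum>s\<in>V. card {n. b n = s})"
    unfolding 1 by (rule card_UN_disjoint) (use V fin' in auto)
  also have "\<dots> = (\<Sum>s\<in>V. card {i \<in> I. \<alpha> i = s})" using card' V by (intro sum.cong) auto
  also have "\<dots> = card {i \<in> I. t \<le> \<alpha> i}"
    unfolding 2 by (rule card_UN_disjoint[symmetric])
      (use V in \<open>auto intro!: finite_subset[OF _ fin]\<close>)
  finally have card: "card {n. t \<le> b n} = card {i \<in> I. t \<le> \<alpha> i}" .
  have "finite {n. t \<le> b n}" unfolding 1 using V fin' by auto
  then have "{n. t \<le> b n} = {..<card {n. t \<le> b n}}"
  proof (rule finite_downclosed_nat)
    show "m \<in> {n. t \<le> b n}" if "n \<in> {n. t \<le> b n}" "m \<le> n" for m n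
      using that b decseqD[of b m n] by (auto simp: decr_rearrangement_def)
  qed
  then show ?thesis unfolding card by blast
qed

lemma decr_rearrangement_unique:
  assumes "decr_rearrangement I \<alpha> b" "decr_rearrangement I \<alpha> b'"
    and fin: "\<And>\<epsilon>. \<epsilon> > 0 \<Longrightarrow> finite {i \<in> I. \<alpha> i \<ge> \<epsilon>}"
  shows "b = b'"
proof
  fix n
  have *: "t \<le> b n \<longleftrightarrow> t \<le> b' n" if "t > 0" for t
    using decr_rearrangement_ge_iff[OF assms(1) fin that] decr_rearrangement_ge_iff[OF assms(2) fin that] by simp
  have "b n \<ge> 0" "b' n \<ge> 0" using assms by (auto simp: decr_rearrangement_def)
  then show "b n = b' n" using *[of "b n"] *[of "b' n"] by fastforce
qed

text \<open>b n is the supremum of the heights reached by more than n indices, with 0 included so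
  that the set is never empty. As finitely many indices lie above any positive height, positive
  suprema are attained, and b has the same distribution function as \<alpha>.\<close>

lemma decr_rearrangement_exists:
  assumes fin: "\<And>\<epsilon>. \<epsilon> > 0 \<Longrightarrow> finite {i \<in> I. \<alpha> i \<ge> (\<epsilon>::real)}"
  shows "\<exists>b. decr_rearrangement I \<alpha> b"
proof -
  define N where "N t = card {i \<in> I. t \<le> \<alpha> i}" for t
  define Q where "Q n = insert 0 {t. t > 0 \<and> n < N t}" for n
  define b where "b n = Sup (Q n)" for n
  have N_mono: "N t \<le> N s" if "0 < s" "s \<le> t" for s t
    unfolding N_def using that by (intro card_mono fin) auto
  have fin_above: "\<exists>u>t. \<forall>i\<in>I. t < \<alpha> i \<longrightarrow> u \<le> \<alpha> i" if "t > 0" for t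
  proof -
    have "finite (insert (t + 1) (\<alpha> ` {i \<in> I. t < \<alpha> i}))" (is "finite ?X")
      by (intro finite.insertI finite_imageI finite_subset[OF _ fin[OF that]]) auto
    then have "Min ?X > t" "\<forall>i\<in>I. t < \<alpha> i \<longrightarrow> Min ?X \<le> \<alpha> i" by auto
    then show ?thesis by blast
  qed
  obtain u where u: "u > 0" "\<forall>i\<in>I. \<alpha> i \<le> u"
  proof -
    have "finite (insert 1 (\<alpha> ` {i \<in> I. 1 \<le> \<alpha> i}))" (is "finite ?X") using fin[of 1] by auto
    then have "Max ?X \<ge> 1" "\<And>x. x \<in> ?X \<Longrightarrow> x \<le> Max ?X" by auto
    then have "Max ?X > 0" "\<forall>i\<in>I. \<alpha> i \<le> Max ?X"
      by (linarith, metis (mono_tags, lifting) dual_order.trans image_eqI insertCI linear mem_Collect_eq)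
    then show ?thesis using that by blast
  qed
  have "t \<le> u" if "t \<in> Q n" for t n
  proof (cases "t = 0")
    case False
    then have "N t \<noteq> 0" using that by (auto simp: Q_def)
    then have "{i \<in> I. t \<le> \<alpha> i} \<noteq> {}" unfolding N_def by (metis card.empty)
    then show ?thesis using u by force
  qed (use u in simp)
  then have bdd: "bdd_above (Q n)" for n by (auto intro!: bdd_aboveI)
  have ge: "t \<le> b n \<longleftrightarrow> n < N t" if t: "t > 0" for t n
  proof
    assume "n < N t"
    then show "t \<le> b n" unfolding b_def using t by (intro cSup_upper bdd) (auto simp: Q_def)
  next
    assume tb: "t \<le> b n"
    show "n < N t"
    proof (rule ccontr)
      assume n: "\<not> n < N t"
      \<comment> \<open>No value of \<alpha> lies strictly between \<open>Max X\<close> and t, so a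
        height above \<open>Max X\<close> is reached by no more indices than t itself; hence every
        height in \<open>Q n\<close> is at most \<open>Max X\<close> < t.\<close>
      define X where "X = insert (t / 2) (\<alpha> ` {i \<in> I. t / 2 \<le> \<alpha> i \<and> \<alpha> i < t})"
      have X: "finite X" unfolding X_def
        by (intro finite.insertI finite_imageI finite_subset[OF _ fin[of "t / 2"]]) (use t in auto)
      have Xt: "Max X < t" using X t by (subst Max_less_iff) (auto simp: X_def)
      have X2: "t / 2 \<le> Max X" using X by (intro Max_ge) (auto simp: X_def)
      have "s \<le> Max X" if s: "s \<in> Q n" for s
      proof (rule ccontr)
        assume *: "\<not> s \<le> Max X"
        then have "s > 0" using X2 t by linarith
        have "{i \<in> I. s \<le> \<alpha> i} \<subseteq> {i \<in> I. t \<le> \<alpha> i}"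
        proof safe
          fix i assume i: "i \<in> I" "s \<le> \<alpha> i"
          show "t \<le> \<alpha> i"
          proof (rule ccontr)
            assume "\<not> t \<le> \<alpha> i"
            then have "\<alpha> i \<in> X" using i * X2 by (auto simp: X_def)
            then show False using X i * Max_ge[of X "\<alpha> i"] by linarith
          qed
        qed
        then have "N s \<le> N t" unfolding N_def by (intro card_mono fin t)
        then show False using n s \<open>s > 0\<close> by (auto simp: Q_def)
      qed
      then have "b n \<le> Max X" unfolding b_def by (intro cSup_least) (auto simp: Q_def)
      then show False using Xt tb by linarith
    qed
  qed
  have "decr_rearrangement I \<alpha> b"
    unfolding decr_rearrangement_def
  proof (intro conjI allI impI)
    show "decseq b" unfolding decseq_def b_def
      by (intro allI impI cSup_subset_mono bdd) (auto simp: Q_def)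
    show "b n \<ge> 0" for n unfolding b_def by (intro cSup_upper bdd) (auto simp: Q_def)
    fix t :: real assume t: "t > 0"
    obtain u where u: "u > t" "\<forall>i\<in>I. t < \<alpha> i \<longrightarrow> u \<le> \<alpha> i" using fin_above[OF t] by blast
    have eq: "{i \<in> I. t < \<alpha> i} = {i \<in> I. s \<le> \<alpha> i}" if "t < s" "s \<le> u" for s
      using that u by force
    have gt: "t < b n \<longleftrightarrow> n < N u" for n
    proof
      assume *: "t < b n"
      define s where "s = min (b n) u"
      have s: "t < s" "s \<le> u" "s \<le> b n" using * u by (auto simp: s_def)
      have "n < N s" using ge[of s n] s t by auto
      moreover have "N s = N u" unfolding N_def using eq[of s] eq[of u] s u by simp
      ultimately show "n < N u" by simp
    next
      assume "n < N u"
      then show "t < b n" using ge[of u n] u(1) t by simp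
    qed
    have "{n. b n = t} = {n. t \<le> b n} - {n. t < b n}" by auto
    also have "\<dots> = {N u..<N t}" unfolding ge[OF t] gt by auto
    finally have *: "{n. b n = t} = {N u..<N t}" .
    show "finite {n. b n = t}" unfolding * by simp
    have "{i \<in> I. \<alpha> i = t} = {i \<in> I. t \<le> \<alpha> i} - {i \<in> I. u \<le> \<alpha> i}"
      using u by force
    then have "card {i \<in> I. \<alpha> i = t} = N t - N u" unfolding N_def
      by (simp, subst card_Diff_subset) (use u t in \<open>auto intro!: fin\<close>)
    then show "card {n. b n = t} = card {i \<in> I. \<alpha> i = t}" unfolding * by simp
  qed
  then show ?thesis by blast
qed

lemma singular_values_diag:
  assumes fin: "\<And>\<epsilon>. \<epsilon> > 0 \<Longrightarrow> finite {i \<in> I. cmod (a i) \<ge> \<epsilon>}"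
  shows "decr_rearrangement I (\<lambda>i. cmod (a i)) (singular_values (ell2 I) (diag_oper I a))"
proof -
  obtain b where b: "decr_rearrangement I (\<lambda>i. cmod (a i)) b"
    using decr_rearrangement_exists[of I "\<lambda>i. cmod (a i)"] fin by auto
  have sv: "is_singular_values (ell2 I) (diag_oper I a) c \<longleftrightarrow> decr_rearrangement I (\<lambda>i. cmod (a i)) c" for c
    by (rule is_singular_values_diag) (rule fin)
  have "c = b" if "decr_rearrangement I (\<lambda>i. cmod (a i)) c" for c
    by (rule decr_rearrangement_unique[OF that b]) (rule fin)
  then have "is_singular_values (ell2 I) (diag_oper I a) = (\<lambda>c. c = b)"
    using sv b by metis
  then show ?thesis using b by (simp add: singular_values_def)
qed

text \<open>Level sets of equal finite size are matched height by height, and since the levels are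
  disjoint the bijections glue into one. Height 0 stays out because its level sets need not have the
  same size.\<close>

lemma decr_rearrangement_bij:
  assumes b: "decr_rearrangement I \<alpha> b" and fin: "\<And>\<epsilon>. \<epsilon> > 0 \<Longrightarrow> finite {i \<in> I. \<alpha> i \<ge> \<epsilon>}"
  obtains e where "bij_betw e {n. b n > 0} {i \<in> I. \<alpha> i > 0}" "\<And>n. b n > 0 \<Longrightarrow> \<alpha> (e n) = b n"
proof -
  have "\<exists>e. bij_betw e {n. b n = t} {i \<in> I. \<alpha> i = t}" if "t > 0" for t
    using b that by (intro finite_same_card_bij finite_subset[OF _ fin[OF that]])
      (auto simp: decr_rearrangement_def)
  then obtain g where g: "\<And>t. t > 0 \<Longrightarrow> bij_betw (g t) {n. b n = t} {i \<in> I. \<alpha> i = t}" by metis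
  define e where "e n = g (b n) n" for n
  have e: "e n \<in> I" "\<alpha> (e n) = b n" if "b n > 0" for n
    using bij_betwE[OF g[OF that]] by (auto simp: e_def)
  have "bij_betw e {n. b n > 0} {i \<in> I. \<alpha> i > 0}"
  proof (rule bij_betwI')
    fix m n assume mn: "m \<in> {n. b n > 0}" "n \<in> {n. b n > 0}"
    show "(e m = e n) = (m = n)"
    proof
      assume eq: "e m = e n"
      then have "b m = b n" using e mn by (metis mem_Collect_eq)
      then show "m = n" using eq mn bij_betw_imp_inj_on[OF g[of "b n"]]
        by (auto simp: e_def inj_on_def)
    qed simp
  next
    fix i assume i: "i \<in> {i \<in> I. \<alpha> i > 0}"
    then obtain n where "b n = \<alpha> i" "i = g (\<alpha> i) n"
      using bij_betw_imp_surj_on[OF g[of "\<alpha> i"]] by (auto simp: image_iff set_eq_iff)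
    then show "\<exists>n\<in>{n. b n > 0}. i = e n" using i by (intro bexI[of _ n]) (auto simp: e_def)
  qed (use e in auto)
  then show ?thesis using that e by blast
qed

text \<open>Exchange argument: the indices of Q from n on are no more numerous than the indices
  below n missing from Q, and \<open>b n\<close> separates the values at the former from those at
  the latter.\<close>

lemma sum_decseq_le:
  fixes b :: "nat \<Rightarrow> real"
  assumes b: "decseq b" "\<And>n. b n \<ge> 0" and Q: "finite Q" "card Q \<le> n"
  shows "(\<Sum>m\<in>Q. b m) \<le> (\<Sum>m<n. b m)"
proof -
  have "card (Q - {..<n}) + card (Q \<inter> {..<n}) = card Q"
    using Q by (metis Diff_Diff_Int Diff_subset add.commute card_Diff_subset_Int card_Un_disjoint
        Int_Diff_Un Diff_Int_distrib2 Un_Diff_Int finite_Diff finite_Int inf_commute Diff_disjoint Int_Diff)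
  moreover have "card ({..<n} - Q) + card (Q \<inter> {..<n}) = n"
    by (metis Int_Diff_Un Int_commute add.commute card_Un_disjoint card_lessThan finite_Diff
        finite_Int finite_lessThan Int_Diff_disjoint)
  ultimately have card: "card (Q - {..<n}) \<le> card ({..<n} - Q)" using Q by linarith
  have "(\<Sum>m\<in>Q - {..<n}. b m) \<le> of_nat (card (Q - {..<n})) * b n"
    using b by (intro sum_bounded_above) (auto simp: decseq_def)
  also have "\<dots> \<le> of_nat (card ({..<n} - Q)) * b n"
    using card b by (intro mult_right_mono) auto
  also have "\<dots> \<le> (\<Sum>m\<in>{..<n} - Q. b m)"
    using b by (intro sum_bounded_below) (auto simp: decseq_def)
  finally have "(\<Sum>m\<in>Q - {..<n}. b m) \<le> (\<Sum>m\<in>{..<n} - Q. b m)" .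
  moreover have "(\<Sum>m\<in>Q. b m) = (\<Sum>m\<in>Q \<inter> {..<n}. b m) + (\<Sum>m\<in>Q - {..<n}. b m)"
    using Q by (rule_tac sum.Int_Diff)
  moreover have "(\<Sum>m<n. b m) = (\<Sum>m\<in>{..<n} \<inter> Q. b m) + (\<Sum>m\<in>{..<n} - Q. b m)"
    by (rule sum.Int_Diff) simp
  ultimately show ?thesis by (simp add: Int_commute)
qed

text \<open>Together with \<open>decr_rearrangement_sum_le\<close> this makes the sum of the first n
  terms of b the maximum of the sums of \<alpha> over at most n indices. The asymptotics use b
  through this variational form alone.\<close>

lemma sum_le_decr_rearrangement:
  assumes b: "decr_rearrangement I \<alpha> b" and fin: "\<And>\<epsilon>. \<epsilon> > 0 \<Longrightarrow> finite {i \<in> I. \<alpha> i \<ge> \<epsilon>}"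
    and J: "J \<subseteq> I" "finite J" "card J \<le> n"
  shows "(\<Sum>i\<in>J. \<alpha> i) \<le> (\<Sum>m<n. b m)"
proof -
  obtain e where e: "bij_betw e {n. b n > 0} {i \<in> I. \<alpha> i > 0}" "\<And>n. b n > 0 \<Longrightarrow> \<alpha> (e n) = b n"
    using decr_rearrangement_bij[OF b fin] by blast
  define J' where "J' = {i \<in> J. \<alpha> i > 0}"
  define Q where "Q = {n. b n > 0 \<and> e n \<in> J'}"
  have bij: "bij_betw e Q J'"
  proof (rule bij_betw_subset[OF e(1)])
    show "e ` Q = J'"
    proof
      show "J' \<subseteq> e ` Q"
      proof
        fix i assume i: "i \<in> J'"
        then have "i \<in> e ` {n. b n > 0}" using e(1) J by (auto simp: J'_def bij_betw_def)
        then show "i \<in> e ` Q" using i by (auto simp: Q_def)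
      qed
    qed (auto simp: Q_def)
  qed (auto simp: Q_def)
  have Q: "finite Q" "card Q \<le> n"
  proof -
    have "finite J'" "card J' \<le> card J" using J by (auto simp: J'_def intro: card_mono)
    then show "finite Q" "card Q \<le> n"
      using bij_betw_finite[OF bij] bij_betw_same_card[OF bij] J by auto
  qed
  have "(\<Sum>i\<in>J. \<alpha> i) \<le> (\<Sum>i\<in>J'. \<alpha> i)"
    using sum.subset_diff[of J' J \<alpha>] sum_nonpos[of "J - J'" \<alpha>] J by (force simp: J'_def)
  also have "\<dots> = (\<Sum>m\<in>Q. \<alpha> (e m))" using sum.reindex_bij_betw[OF bij, of \<alpha>] by simp
  also have "\<dots> = (\<Sum>m\<in>Q. b m)" using e by (intro sum.cong) (auto simp: Q_def)
  also have "\<dots> \<le> (\<Sum>m<n. b m)"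
    using b by (intro sum_decseq_le Q) (auto simp: decr_rearrangement_def)
  finally show ?thesis .
qed

lemma decr_rearrangement_sum_le:
  assumes b: "decr_rearrangement I \<alpha> b" and fin: "\<And>\<epsilon>. \<epsilon> > 0 \<Longrightarrow> finite {i \<in> I. \<alpha> i \<ge> \<epsilon>}"
  obtains J where "J \<subseteq> I" "finite J" "card J \<le> n" "(\<Sum>m<n. b m) = (\<Sum>i\<in>J. \<alpha> i)"
proof -
  obtain e where e: "bij_betw e {n. b n > 0} {i \<in> I. \<alpha> i > 0}" "\<And>n. b n > 0 \<Longrightarrow> \<alpha> (e n) = b n"
    using decr_rearrangement_bij[OF b fin] by blast
  define Q where "Q = {m. m < n \<and> b m > 0}"
  have inj: "inj_on e Q" using e(1) by (auto simp: Q_def bij_betw_def inj_on_def)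
  have Q: "finite Q" "card Q \<le> n"
    using card_mono[of "{..<n}" Q] by (auto simp: Q_def)
  have "(\<Sum>m<n. b m) = (\<Sum>m\<in>Q. b m)"
    using b by (intro sum.mono_neutral_right) (auto simp: Q_def decr_rearrangement_def order.order_iff_strict)
  also have "\<dots> = (\<Sum>i\<in>e ` Q. \<alpha> i)"
    using e by (subst sum.reindex[OF inj]) (auto simp: Q_def)
  finally show ?thesis
    using that[of "e ` Q"] Q card_image[OF inj] e(1) by (auto simp: Q_def bij_betw_def)
qed

section \<open>The transfer operator of a normalized potential\<close>

definition agree :: "nat \<Rightarrow> (nat \<Rightarrow> 'k) \<Rightarrow> (nat \<Rightarrow> 'k) \<Rightarrow> bool" where
  "agree n s t \<longleftrightarrow> (\<forall>i<n. s i = t i)"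

lemma agree_refl: "agree n s s" by (simp add: agree_def)
lemma agree_sym: "agree n s t \<Longrightarrow> agree n t s" by (simp add: agree_def)
lemma agree_mono: "agree n s t \<Longrightarrow> m \<le> n \<Longrightarrow> agree m s t" by (simp add: agree_def)
lemma agree_trans: "agree n s t \<Longrightarrow> agree n t u \<Longrightarrow> agree n s u" by (simp add: agree_def)
lemma agree_suffix: "agree (i + n) s t \<Longrightarrow> agree n (suffix i s) (suffix i t)" by (simp add: agree_def)
lemma agree_conc: "agree r s t \<Longrightarrow> agree (length w + r) (w \<frown> s) (w \<frown> t)"
  by (auto simp: agree_def conc_def)
lemma agree_conc_word: "agree (length w) (w \<frown> s) (w \<frown> t)"
  by (auto simp: agree_def conc_def)

lemma suffix_conc_length: "suffix (length w) (w \<frown> s) = s"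
  by (auto simp: conc_def)

lemma subshift_suffix: "s \<in> subshift A \<Longrightarrow> suffix n s \<in> subshift A"
  by (simp add: subshift_def)

lemma subshift_Cons_iff: "[j] \<frown> s \<in> subshift A \<longleftrightarrow> A $ j $ s 0 = 1 \<and> s \<in> subshift A"
proof
  assume *: "[j] \<frown> s \<in> subshift A"
  then have "A $ ([j] \<frown> s) 0 $ ([j] \<frown> s) (Suc 0) = 1" by (simp only: subshift_def mem_Collect_eq)
  moreover have "suffix 1 ([j] \<frown> s) = s" using suffix_conc_length[of "[j]" s] by simp
  ultimately show "A $ j $ s 0 = 1 \<and> s \<in> subshift A"
    using subshift_suffix[OF *, of 1] by simp
next
  assume *: "A $ j $ s 0 = 1 \<and> s \<in> subshift A"
  show "[j] \<frown> s \<in> subshift A"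
    unfolding subshift_def
  proof safe
    fix n show "A $ ([j] \<frown> s) n $ ([j] \<frown> s) (Suc n) = 1"
      using * by (cases n) (auto simp: subshift_def)
  qed
qed

lemma subshift_build_iff: "j ## s \<in> subshift A \<longleftrightarrow> A $ j $ s 0 = 1 \<and> s \<in> subshift A"
  using subshift_Cons_iff[of j s A] by simp

lemma subshift_conc_suffix: "w \<frown> s \<in> subshift A \<Longrightarrow> s \<in> subshift A"
  using subshift_suffix[of "w \<frown> s" A "length w"] by (simp only: suffix_conc_length)

lemma prefix_conc_suffix: "prefix n s \<frown> suffix n s = s"
  by (auto simp: conc_def subsequence_def fun_eq_iff)

text \<open>All symbolic input in one place: h stands for \<phi> \<circ> p, \<open>var\<close> is
  its Hoelder continuity in terms of common letters, and \<open>norm\<close> sums over the letters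
  that may precede s. \<open>two_points\<close> excludes the shift on one letter, where the
  normalization would give h = 0 and the mean of h would vanish.\<close>

locale normalized_subshift =
  fixes A :: "nat^'k::finite^'k" and h :: "(nat \<Rightarrow> 'k) \<Rightarrow> real" and K \<theta> :: real
  assumes A01: "A $ i $ j \<in> {0, 1}"
    and aper: "aperiodic A"
    and \<theta>: "0 \<le> \<theta>" "\<theta> < 1" and K: "0 \<le> K"
    and var: "s \<in> subshift A \<Longrightarrow> t \<in> subshift A \<Longrightarrow> agree n s t \<Longrightarrow> \<bar>h s - h t\<bar> \<le> K * \<theta> ^ n"
    and norm: "s \<in> subshift A \<Longrightarrow> (\<Sum>j | A $ j $ s 0 = 1. exp (- h ([j] \<frown> s))) = 1"
    and two_points: "\<exists>s\<in>subshift A. \<exists>t\<in>subshift A. s \<noteq> t"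
begin

abbreviation "\<Sigma> \<equiv> subshift A"

definition pre :: "nat \<Rightarrow> (nat \<Rightarrow> 'k) \<Rightarrow> 'k list set" where
  "pre n s = {w. length w = n \<and> w \<frown> s \<in> \<Sigma>}"

definition S :: "nat \<Rightarrow> (nat \<Rightarrow> 'k) \<Rightarrow> real" where
  "S n s = (\<Sum>i<n. h (suffix i s))"

text \<open>The n-th power of the transfer operator with weight exp (- h), given by its closed
  formula; the sum runs over all words that may precede s, and \<open>Lop_add\<close> is the
  semigroup law.\<close>

definition Lop :: "nat \<Rightarrow> ((nat \<Rightarrow> 'k) \<Rightarrow> real) \<Rightarrow> (nat \<Rightarrow> 'k) \<Rightarrow> real" where
  "Lop n F s = (\<Sum>w\<in>pre n s. exp (- S n (w \<frown> s)) * F (w \<frown> s))"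

section \<open>Algebra of the transfer operator\<close>

lemma finite_pre: "finite (pre n s)"
  by (rule finite_subset[OF _ finite_lists_length_eq[of UNIV n]]) (auto simp: pre_def)

lemma pre_memD: "w \<in> pre n s \<Longrightarrow> length w = n" "w \<in> pre n s \<Longrightarrow> w \<frown> s \<in> \<Sigma>"
  by (auto simp: pre_def)

lemma pre_suffix: "w \<in> pre n s \<Longrightarrow> suffix n (w \<frown> s) = s"
  using suffix_conc_length pre_memD(1) by metis

lemma S_add: "S (n + m) s = S n s + S m (suffix n s)"
proof -
  have "(\<Sum>i<n + m. h (suffix i s)) = (\<Sum>i<n. h (suffix i s)) + (\<Sum>i<m. h (suffix (n + i) s))"
    by (induction m) auto
  then show ?thesis by (simp add: S_def)
qed

text \<open>A preceding word of length n + m splits as w v, with v adjacent to s; the cocycle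
  identity \<open>S_add\<close> splits its weight accordingly.\<close>

lemma Lop_add: "Lop (n + m) F s = Lop m (Lop n F) s"
proof -
  have bij: "bij_betw (\<lambda>(v, w). w @ v) (Sigma (pre m s) (\<lambda>v. pre n (v \<frown> s))) (pre (n + m) s)"
  proof (rule bij_betwI[where g = "\<lambda>u. (drop n u, take n u)"])
    show "(\<lambda>(v, w). w @ v) \<in> (SIGMA v:pre m s. pre n (v \<frown> s)) \<rightarrow> pre (n + m) s"
      by (auto simp: pre_def)
    show "(\<lambda>u. (drop n u, take n u)) \<in> pre (n + m) s \<rightarrow> (SIGMA v:pre m s. pre n (v \<frown> s))"
    proof
      fix u assume u: "u \<in> pre (n + m) s"
      have "take n u \<frown> drop n u \<frown> s = u \<frown> s" by simp
      moreover from this have "drop n u \<frown> s \<in> \<Sigma>"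
        using u by (metis pre_memD(2) subshift_conc_suffix)
      ultimately show "(drop n u, take n u) \<in> (SIGMA v:pre m s. pre n (v \<frown> s))"
        using u by (auto simp: pre_def)
    qed
  qed (auto simp: pre_def)
  have "Lop (n + m) F s = (\<Sum>x\<in>Sigma (pre m s) (\<lambda>v. pre n (v \<frown> s)).
      exp (- S (n + m) ((\<lambda>(v, w). w @ v) x \<frown> s)) * F ((\<lambda>(v, w). w @ v) x \<frown> s))"
    unfolding Lop_def by (rule sum.reindex_bij_betw[OF bij, symmetric])
  also have "\<dots> = (\<Sum>v\<in>pre m s. \<Sum>w\<in>pre n (v \<frown> s). exp (- S (n + m) (w \<frown> v \<frown> s)) * F (w \<frown> v \<frown> s))"
    by (subst sum.Sigma) (auto simp: finite_pre case_prod_unfold)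
  also have "\<dots> = (\<Sum>v\<in>pre m s. \<Sum>w\<in>pre n (v \<frown> s).
      exp (- S m (v \<frown> s)) * (exp (- S n (w \<frown> v \<frown> s)) * F (w \<frown> v \<frown> s)))"
  proof (intro sum.cong refl)
    fix v w assume "w \<in> pre n (v \<frown> s)"
    then have "S (n + m) (w \<frown> v \<frown> s) = S n (w \<frown> v \<frown> s) + S m (v \<frown> s)"
      by (simp only: S_add pre_suffix)
    then show "exp (- S (n + m) (w \<frown> v \<frown> s)) * F (w \<frown> v \<frown> s)
        = exp (- S m (v \<frown> s)) * (exp (- S n (w \<frown> v \<frown> s)) * F (w \<frown> v \<frown> s))"
      by (simp add: exp_diff exp_minus field_simps exp_add)
  qed
  also have "\<dots> = Lop m (Lop n F) s"
    unfolding Lop_def by (simp add: sum_distrib_left)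
  finally show ?thesis .
qed

lemma Lop_cong: "(\<And>u. u \<in> \<Sigma> \<Longrightarrow> F u = G u) \<Longrightarrow> Lop n F s = Lop n G s"
  unfolding Lop_def by (intro sum.cong) (auto dest: pre_memD)

lemma Lop_0: "s \<in> \<Sigma> \<Longrightarrow> Lop 0 F s = F s"
proof -
  assume "s \<in> \<Sigma>"
  then have "pre 0 s = {[]}" by (auto simp: pre_def)
  then show ?thesis by (simp add: Lop_def S_def)
qed

lemma Lop_1_one: "s \<in> \<Sigma> \<Longrightarrow> Lop 1 (\<lambda>_. 1) s = 1"
proof -
  assume s: "s \<in> \<Sigma>"
  have "pre 1 s = (\<lambda>j. [j]) ` {j. A $ j $ s 0 = 1}"
    using s by (auto simp: pre_def length_Suc_conv subshift_build_iff)
  then have "Lop 1 (\<lambda>_. 1) s = (\<Sum>j | A $ j $ s 0 = 1. exp (- S 1 ([j] \<frown> s)))"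
    unfolding Lop_def by (simp add: sum.reindex inj_on_def)
  then show ?thesis using norm[OF s] by (simp add: S_def)
qed

lemma Lop_one: "s \<in> \<Sigma> \<Longrightarrow> Lop n (\<lambda>_. 1) s = 1"
proof (induction n arbitrary: s)
  case (Suc n)
  have "Lop (1 + n) (\<lambda>_. 1) s = Lop n (Lop 1 (\<lambda>_. 1)) s" by (rule Lop_add)
  also have "\<dots> = Lop n (\<lambda>_. 1) s" by (rule Lop_cong) (rule Lop_1_one)
  finally show ?case using Suc by simp
qed (simp add: Lop_0)

lemma Lop_mono: "(\<And>u. u \<in> \<Sigma> \<Longrightarrow> F u \<le> G u) \<Longrightarrow> Lop n F s \<le> Lop n G s"
  unfolding Lop_def by (intro sum_mono mult_left_mono) (auto dest: pre_memD)

lemma Lop_sum: "Lop n (\<lambda>u. \<Sum>i\<in>I. F i u) s = (\<Sum>i\<in>I. Lop n (F i) s)"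
  unfolding Lop_def sum_distrib_left by (rule sum.swap)

lemma Lop_plus: "Lop n (\<lambda>u. F u + G u) s = Lop n F s + Lop n G s"
  unfolding Lop_def by (simp add: ring_distribs sum.distrib)

lemma Lop_cmult: "Lop n (\<lambda>u. c * F u) s = c * Lop n F s"
  unfolding Lop_def by (simp add: sum_distrib_left mult_ac)

lemma Lop_const: "s \<in> \<Sigma> \<Longrightarrow> Lop n (\<lambda>_. c) s = c"
  using Lop_cmult[of n c "\<lambda>_. 1"] Lop_one by simp

lemma Lop_abs_le:
  assumes "s \<in> \<Sigma>" "\<And>u. u \<in> \<Sigma> \<Longrightarrow> \<bar>F u\<bar> \<le> B" shows "\<bar>Lop n F s\<bar> \<le> B"
proof -
  have "Lop n F s \<le> Lop n (\<lambda>_. B) s" "Lop n (\<lambda>_. - B) s \<le> Lop n F s"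
    by (intro Lop_mono, use assms(2) in fastforce)+
  then show ?thesis using assms(1) by (simp add: Lop_const)
qed

text \<open>F composed with the n-th shift takes the constant value F s on the n-th preimages of s,
  so it leaves the sum, as a known factor leaves a conditional expectation.\<close>

lemma Lop_suffix_mult: "Lop n (\<lambda>u. F (suffix n u) * G u) s = F s * Lop n G s"
  unfolding Lop_def sum_distrib_left by (intro sum.cong) (auto simp del: suffix_def simp: pre_suffix)

lemma Lop_suffix: "s \<in> \<Sigma> \<Longrightarrow> Lop n (\<lambda>u. F (suffix n u)) s = F s"
  using Lop_suffix_mult[of n F "\<lambda>_. 1" s] by (simp add: Lop_one)

section \<open>Bounded distortion and equicontinuity\<close>

definition D :: real where "D = K / (1 - \<theta>)"

lemma D_nonneg: "0 \<le> D" using \<theta> K by (simp add: D_def)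

text \<open>After i shifts the two sequences still share n + r - i letters, so the differences are
  dominated by a geometric series whose sum is at most D * \<theta> ^ r, independently of n.\<close>

lemma S_distortion:
  assumes s: "s \<in> \<Sigma>" and t: "t \<in> \<Sigma>" and agr: "agree (n + r) s t"
  shows "\<bar>S n s - S n t\<bar> \<le> D * \<theta> ^ r"
proof -
  have "\<bar>S n s - S n t\<bar> \<le> (\<Sum>i<n. \<bar>h (suffix i s) - h (suffix i t)\<bar>)"
    unfolding S_def sum_subtractf[symmetric] by (rule sum_abs)
  also have "\<dots> \<le> (\<Sum>i<n. K * (\<theta> ^ r * \<theta> ^ (n - Suc i)))"
  proof (rule sum_mono)
    fix i assume i: "i \<in> {..<n}"
    have "agree (n + r - i) (suffix i s) (suffix i t)"
      using i agr by (intro agree_suffix) simp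
    then have "\<bar>h (suffix i s) - h (suffix i t)\<bar> \<le> K * \<theta> ^ (n + r - i)"
      by (intro var subshift_suffix s t)
    \<comment> \<open>The exponent drops by one from n + r - i, at the price of a factor \<theta>
      \<le> 1, so that reindexing gives the geometric sum starting at 0.\<close>
    also have "\<dots> \<le> K * \<theta> ^ (r + (n - Suc i))"
      using i \<theta> K by (intro mult_left_mono power_decreasing) auto
    finally show "\<bar>h (suffix i s) - h (suffix i t)\<bar> \<le> K * (\<theta> ^ r * \<theta> ^ (n - Suc i))"
      by (simp add: power_add)
  qed
  also have "\<dots> = K * \<theta> ^ r * (\<Sum>i<n. \<theta> ^ i)"
    by (simp add: sum_distrib_left[symmetric] sum.nat_diff_reindex[of "\<lambda>i. \<theta> ^ i"] mult.assoc)
  also have "\<dots> \<le> K * \<theta> ^ r * (1 / (1 - \<theta>))"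
  proof (intro mult_left_mono)
    show "(\<Sum>i<n. \<theta> ^ i) \<le> 1 / (1 - \<theta>)"
      using \<theta> sum_gp_strict[of \<theta> n] by (simp add: divide_right_mono)
  qed (use K \<theta> in auto)
  finally show ?thesis by (simp add: D_def)
qed

lemma exp_diff_le:
  assumes "\<bar>a - b\<bar> \<le> (\<delta>::real)"
  shows "\<bar>exp (- a) - exp (- b)\<bar> \<le> (exp \<delta> - 1) * exp (- b)"
proof -
  have "\<bar>exp (b - a) - 1\<bar> \<le> exp \<delta> - 1"
  proof (cases "a \<le> b")
    case False
    have "1 - exp (b - a) \<le> a - b" using exp_ge_add_one_self[of "b - a"] by linarith
    also have "\<dots> \<le> exp \<delta> - 1" using assms exp_ge_add_one_self[of \<delta>] by linarith
    finally show ?thesis using False by simp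
  qed (use assms in simp)
  moreover have "\<bar>exp (- a) - exp (- b)\<bar> = \<bar>exp (b - a) - 1\<bar> * exp (- b)"
  proof -
    have "exp (- a) - exp (- b) = (exp (b - a) - 1) * exp (- b)"
      by (simp add: algebra_simps flip: exp_add)
    then show ?thesis by (simp add: abs_mult)
  qed
  ultimately show ?thesis by (simp add: mult_right_mono)
qed

text \<open>A subshift of finite type has memory one: which words may precede s depends on the first
  letter of s alone. The sums defining \<open>Lop\<close> at two such points can therefore be
  compared term by term.\<close>

lemma pre_cong: "s \<in> \<Sigma> \<Longrightarrow> t \<in> \<Sigma> \<Longrightarrow> s 0 = t 0 \<Longrightarrow> pre n s = pre n t"
proof -
  have "w \<frown> s \<in> \<Sigma> \<longleftrightarrow> w \<frown> t \<in> \<Sigma>" if "s \<in> \<Sigma>" "t \<in> \<Sigma>" "s 0 = t 0" for w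
  proof (induction w)
    case (Cons j w)
    have "([j] @ w) \<frown> s = [j] \<frown> (w \<frown> s)" "([j] @ w) \<frown> t = [j] \<frown> (w \<frown> t)" by simp_all
    then have "(j # w) \<frown> s \<in> \<Sigma> \<longleftrightarrow> A $ j $ (w \<frown> s) 0 = 1 \<and> w \<frown> s \<in> \<Sigma>"
      "(j # w) \<frown> t \<in> \<Sigma> \<longleftrightarrow> A $ j $ (w \<frown> t) 0 = 1 \<and> w \<frown> t \<in> \<Sigma>"
      by (metis append_Cons append_Nil subshift_Cons_iff)+
    moreover have "(w \<frown> s) 0 = (w \<frown> t) 0" using that by (simp add: conc_def)
    ultimately show ?case using Cons by simp
  qed (use that in simp)
  then show "s \<in> \<Sigma> \<Longrightarrow> t \<in> \<Sigma> \<Longrightarrow> s 0 = t 0 \<Longrightarrow> pre n s = pre n t"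
    by (simp add: pre_def)
qed

text \<open>Equicontinuity of all iterates: distortion changes each weight by a relative error of at
  most \<open>exp (D * \<theta> ^ r) - 1\<close>, prepending a word only increases the agreement
  seen by F, and the normalized weights add up to 1. Nothing in the bound depends on n.\<close>

lemma Lop_variation:
  assumes s: "s \<in> \<Sigma>" and t: "t \<in> \<Sigma>" and agr: "agree r s t" and r: "r \<ge> 1" "r \<ge> N"
    and B: "\<And>u. u \<in> \<Sigma> \<Longrightarrow> \<bar>F u\<bar> \<le> B"
    and F: "\<And>u v. u \<in> \<Sigma> \<Longrightarrow> v \<in> \<Sigma> \<Longrightarrow> agree N u v \<Longrightarrow> \<bar>F u - F v\<bar> \<le> \<epsilon>"
  shows "\<bar>Lop n F s - Lop n F t\<bar> \<le> B * (exp (D * \<theta> ^ r) - 1) + \<epsilon>"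
proof -
  define c where "c = B * (exp (D * \<theta> ^ r) - 1) + \<epsilon>"
  have B0: "0 \<le> B" using B[OF s] by linarith
  have e1: "exp (D * \<theta> ^ r) - 1 \<ge> 0" using D_nonneg \<theta> by simp
  have pre: "pre n s = pre n t" using agr r by (intro pre_cong s t) (auto simp: agree_def)
  have "\<bar>Lop n F s - Lop n F t\<bar>
      \<le> (\<Sum>w\<in>pre n t. \<bar>exp (- S n (w \<frown> s)) * F (w \<frown> s) - exp (- S n (w \<frown> t)) * F (w \<frown> t)\<bar>)"
    unfolding Lop_def pre sum_subtractf[symmetric] by (rule sum_abs)
  also have "\<dots> \<le> (\<Sum>w\<in>pre n t. exp (- S n (w \<frown> t)) * c)"
  proof (rule sum_mono)
    fix w assume w: "w \<in> pre n t"
    have ws: "w \<frown> s \<in> \<Sigma>" and wt: "w \<frown> t \<in> \<Sigma>" using w pre by (auto dest: pre_memD)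
    have agr': "agree (n + r) (w \<frown> s) (w \<frown> t)"
      using agree_conc[OF agr, of w] w by (simp add: pre_memD)
    let ?a = "exp (- S n (w \<frown> s))" and ?b = "exp (- S n (w \<frown> t))"
    have 1: "\<bar>?a - ?b\<bar> \<le> (exp (D * \<theta> ^ r) - 1) * ?b"
      by (rule exp_diff_le) (rule S_distortion[OF ws wt agr'])
    have 2: "\<bar>F (w \<frown> s) - F (w \<frown> t)\<bar> \<le> \<epsilon>"
      using agree_mono[OF agr'] r by (intro F ws wt) simp
    have "?a * F (w \<frown> s) - ?b * F (w \<frown> t) = (?a - ?b) * F (w \<frown> s) + ?b * (F (w \<frown> s) - F (w \<frown> t))"
      by (simp add: algebra_simps)
    then have "\<bar>?a * F (w \<frown> s) - ?b * F (w \<frown> t)\<bar>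
        \<le> \<bar>(?a - ?b) * F (w \<frown> s)\<bar> + \<bar>?b * (F (w \<frown> s) - F (w \<frown> t))\<bar>"
      by (metis abs_triangle_ineq)
    also have "\<dots> \<le> ((exp (D * \<theta> ^ r) - 1) * ?b) * B + ?b * \<epsilon>"
      unfolding abs_mult using 1 2 B[OF ws] B0 e1
      by (intro add_mono mult_mono) auto
    finally show "\<bar>?a * F (w \<frown> s) - ?b * F (w \<frown> t)\<bar> \<le> ?b * c"
      by (simp add: c_def algebra_simps)
  qed
  also have "\<dots> = c * Lop n (\<lambda>_. 1) t"
    unfolding Lop_def by (simp add: sum_distrib_left mult.commute)
  finally show ?thesis using Lop_one[OF t] by (simp add: c_def)
qed

text \<open>Uniform continuity with the cylinder length as modulus. Continuous functions on
  \<Lambda>, read through p, have it by compactness (\<open>unif_continuous\<close>).\<close>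

definition unif :: "((nat \<Rightarrow> 'k) \<Rightarrow> 'b::metric_space) \<Rightarrow> bool" where
  "unif F \<longleftrightarrow> (\<forall>\<epsilon>>0. \<exists>N. \<forall>s\<in>\<Sigma>. \<forall>t\<in>\<Sigma>. agree N s t \<longrightarrow> dist (F s) (F t) \<le> \<epsilon>)"

text \<open>Up to an error of 1, F is determined by its values at one representative of each of the
  finitely many cylinders of length N; the sum of their absolute values serves as a common
  bound.\<close>

lemma unif_bounded:
  fixes F :: "(nat \<Rightarrow> 'k) \<Rightarrow> real"
  assumes "unif F" obtains B where "\<And>s. s \<in> \<Sigma> \<Longrightarrow> \<bar>F s\<bar> \<le> B"
proof -
  obtain N where N: "\<And>s t. s \<in> \<Sigma> \<Longrightarrow> t \<in> \<Sigma> \<Longrightarrow> agree N s t \<Longrightarrow> dist (F s) (F t) \<le> 1"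
    using assms unfolding unif_def by (meson zero_less_one)
  define W where "W = {w :: 'k list. set w \<subseteq> UNIV \<and> length w = N}"
  have W: "finite W" unfolding W_def by (rule finite_lists_length_eq) simp
  define rep where "rep w = (SOME s. s \<in> \<Sigma> \<and> prefix N s = w)" for w
  have "\<bar>F s\<bar> \<le> 1 + (\<Sum>w\<in>W. \<bar>F (rep w)\<bar>)" if s: "s \<in> \<Sigma>" for s
  proof -
    have "rep (prefix N s) \<in> \<Sigma> \<and> prefix N (rep (prefix N s)) = prefix N s"
      unfolding rep_def using someI[of "\<lambda>u. u \<in> \<Sigma> \<and> prefix N u = prefix N s" s] s by simp
    then have *: "rep (prefix N s) \<in> \<Sigma>" "agree N s (rep (prefix N s))"
      by (auto simp: agree_def subsequence_def list_eq_iff_nth_eq)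
    have "prefix N s \<in> W" by (simp add: W_def subsequence_def)
    then have "\<bar>F (rep (prefix N s))\<bar> \<le> (\<Sum>w\<in>W. \<bar>F (rep w)\<bar>)"
      by (intro member_le_sum W) auto
    then show ?thesis using N[OF s *] by (simp add: dist_real_def)
  qed
  then show ?thesis using that by blast
qed

lemma unif_h: "unif h"
  unfolding unif_def dist_real_def
proof safe
  fix \<epsilon> :: real assume "\<epsilon> > 0"
  have "(\<lambda>n. K * \<theta> ^ n) \<longlonglongrightarrow> K * 0"
    using \<theta> by (intro tendsto_mult_left LIMSEQ_power_zero) auto
  then have "\<forall>\<^sub>F n in sequentially. K * \<theta> ^ n < \<epsilon>"
    using \<open>\<epsilon> > 0\<close> by (intro order_tendstoD) auto
  then obtain N where "K * \<theta> ^ N < \<epsilon>" by (meson eventually_happens' sequentially_bot)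
  then show "\<exists>N. \<forall>s\<in>\<Sigma>. \<forall>t\<in>\<Sigma>. agree N s t \<longrightarrow> \<bar>h s - h t\<bar> \<le> \<epsilon>"
    by (intro exI[of _ N]) (use var in fastforce)
qed

lemma unif_const: "unif (\<lambda>_. c)"
  by (auto simp: unif_def intro: exI[of _ 0])

lemma unif_plus:
  fixes F G :: "(nat \<Rightarrow> 'k) \<Rightarrow> real"
  assumes "unif F" "unif G" shows "unif (\<lambda>s. F s + G s)"
  unfolding unif_def
proof safe
  fix \<epsilon> :: real assume "\<epsilon> > 0"
  then have "\<epsilon> / 2 > 0" by simp
  then obtain N M where "\<And>s t. s \<in> \<Sigma> \<Longrightarrow> t \<in> \<Sigma> \<Longrightarrow> agree N s t \<Longrightarrow> dist (F s) (F t) \<le> \<epsilon> / 2"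
      "\<And>s t. s \<in> \<Sigma> \<Longrightarrow> t \<in> \<Sigma> \<Longrightarrow> agree M s t \<Longrightarrow> dist (G s) (G t) \<le> \<epsilon> / 2"
    using assms unfolding unif_def by metis
  then have "dist (F s + G s) (F t + G t) \<le> \<epsilon>" if "s \<in> \<Sigma>" "t \<in> \<Sigma>" "agree (max N M) s t" for s t
    using that agree_mono[OF that(3), of N] agree_mono[OF that(3), of M]
      dist_triangle_add[of "F s" "G s" "F t" "G t"] by (smt (verit) field_sum_of_halves max.cobounded1 max.cobounded2)
  then show "\<exists>N. \<forall>s\<in>\<Sigma>. \<forall>t\<in>\<Sigma>. agree N s t \<longrightarrow> dist (F s + G s) (F t + G t) \<le> \<epsilon>" by blast
qed

lemma unif_cmult:
  fixes F :: "(nat \<Rightarrow> 'k) \<Rightarrow> real"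
  assumes "unif F" shows "unif (\<lambda>s. c * F s)"
  unfolding unif_def
proof safe
  fix \<epsilon> :: real assume "\<epsilon> > 0"
  then have "\<epsilon> / (\<bar>c\<bar> + 1) > 0" by simp
  then obtain N where N: "\<And>s t. s \<in> \<Sigma> \<Longrightarrow> t \<in> \<Sigma> \<Longrightarrow> agree N s t \<Longrightarrow> dist (F s) (F t) \<le> \<epsilon> / (\<bar>c\<bar> + 1)"
    using assms unfolding unif_def by metis
  have "dist (c * F s) (c * F t) \<le> \<epsilon>" if "s \<in> \<Sigma>" "t \<in> \<Sigma>" "agree N s t" for s t
  proof -
    have "dist (c * F s) (c * F t) = \<bar>c\<bar> * dist (F s) (F t)"
      by (simp add: dist_real_def abs_mult flip: right_diff_distrib)
    also have "\<dots> \<le> (\<bar>c\<bar> + 1) * (\<epsilon> / (\<bar>c\<bar> + 1))"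
      using N[OF that] \<open>\<epsilon> > 0\<close> by (intro mult_mono) auto
    also have "\<dots> = \<epsilon>" using abs_ge_zero[of c] by (simp add: add_nonneg_eq_0_iff)
    finally show ?thesis .
  qed
  then show "\<exists>N. \<forall>s\<in>\<Sigma>. \<forall>t\<in>\<Sigma>. agree N s t \<longrightarrow> dist (c * F s) (c * F t) \<le> \<epsilon>" by blast
qed

lemma unif_suffix:
  assumes "unif F" shows "unif (\<lambda>s. F (suffix n s))"
  unfolding unif_def
proof safe
  fix \<epsilon> :: real assume "\<epsilon> > 0"
  then obtain N where "\<And>s t. s \<in> \<Sigma> \<Longrightarrow> t \<in> \<Sigma> \<Longrightarrow> agree N s t \<Longrightarrow> dist (F s) (F t) \<le> \<epsilon>"
    using assms unfolding unif_def by metis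
  then show "\<exists>N. \<forall>s\<in>\<Sigma>. \<forall>t\<in>\<Sigma>. agree N s t \<longrightarrow> dist (F (suffix n s)) (F (suffix n t)) \<le> \<epsilon>"
    by (intro exI[of _ "n + N"]) (auto intro!: subshift_suffix agree_suffix)
qed

lemma unif_local: "(\<And>s t. s \<in> \<Sigma> \<Longrightarrow> t \<in> \<Sigma> \<Longrightarrow> agree N s t \<Longrightarrow> F s = F t) \<Longrightarrow> unif F"
  unfolding unif_def by (metis dist_self less_le)

section \<open>Aperiodicity and linear growth of Birkhoff sums\<close>

lemma matrix_mult_component: "(B ** C) $ i $ j = (\<Sum>k\<in>UNIV. B $ i $ k * C $ k $ j)"
  by (simp add: matrix_matrix_mult_def)

lemma path_word:
  assumes "(((**) A ^^ n) (mat 1)) $ i $ j > 0" "s \<in> \<Sigma>" "s 0 = j"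
  shows "\<exists>w\<in>pre n s. (w \<frown> s) 0 = i"
  using assms(1)
proof (induction n arbitrary: i)
  case 0
  then have "i = j" by (simp add: mat_def split: if_splits)
  then show ?case using assms by (intro bexI[of _ "[]"]) (auto simp: pre_def)
next
  case (Suc n)
  then have "(\<Sum>k\<in>UNIV. A $ i $ k * (((**) A ^^ n) (mat 1)) $ k $ j) > 0"
    by (simp add: matrix_mult_component)
  then obtain k where k: "A $ i $ k * (((**) A ^^ n) (mat 1)) $ k $ j > 0"
    by (metis (no_types, lifting) less_numeral_extra(3) not_gr_zero sum.neutral)
  then have "A $ i $ k = 1" "(((**) A ^^ n) (mat 1)) $ k $ j > 0"
    using A01[of i k] by auto
  then obtain w where w: "w \<in> pre n s" "(w \<frown> s) 0 = k" using Suc.IH by blast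
  have "([i] @ w) \<frown> s = [i] \<frown> (w \<frown> s)" by simp
  then have "(i # w) \<frown> s \<in> \<Sigma>"
    using w \<open>A $ i $ k = 1\<close> by (metis append_Cons append_Nil pre_memD(2) subshift_Cons_iff)
  then show ?case using w by (intro bexI[of _ "i # w"]) (auto simp: pre_def)
qed

text \<open>Some power of A has only positive entries, so from every point each letter is reached
  backwards in exactly N steps, with the same N for all.\<close>

lemma primitive:
  obtains N where "N \<ge> 1" "\<And>i s. s \<in> \<Sigma> \<Longrightarrow> \<exists>w\<in>pre N s. (w \<frown> s) 0 = i"
  using aper path_word unfolding aperiodic_def by metis

text \<open>exp (- h s) is one of the terms that add up to 1 at the shifted point.\<close>

lemma h_nonneg: "s \<in> \<Sigma> \<Longrightarrow> 0 \<le> h s"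
proof -
  assume s: "s \<in> \<Sigma>"
  have "[s 0] \<frown> suffix 1 s = s" using prefix_conc_suffix[of s 1] by (simp add: subsequence_def)
  moreover have "A $ s 0 $ suffix 1 s 0 = 1" using s by (simp add: subshift_def)
  ultimately have "exp (- h s) \<le> (\<Sum>j | A $ j $ suffix 1 s 0 = 1. exp (- h ([j] \<frown> suffix 1 s)))"
    using member_le_sum[of "s 0" "{j. A $ j $ suffix 1 s 0 = 1}" "\<lambda>j. exp (- h ([j] \<frown> suffix 1 s))"] by simp
  then show ?thesis using norm[OF subshift_suffix[OF s, of 1]] by simp
qed

lemma S_nonneg: "s \<in> \<Sigma> \<Longrightarrow> 0 \<le> S n s"
  unfolding S_def by (intro sum_nonneg h_nonneg subshift_suffix)

text \<open>h may vanish where the shifted point has a single preimage, so the decay of weights is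
  obtained over N steps: every point has N-th preimages beginning with two different letters, hence
  each of them has a competitor of weight at least \<kappa> sharing the total mass 1, and exp (- S
  N) \<le> 1 - \<kappa> everywhere. Adding up blocks of length N gives linear growth; C absorbs the
  incomplete block.\<close>

lemma S_linear_lower_bound:
  obtains c C where "c > 0" "\<And>n s. s \<in> \<Sigma> \<Longrightarrow> c * real n - C \<le> S n s"
proof -
  obtain N where N: "N \<ge> 1" "\<And>i s. s \<in> \<Sigma> \<Longrightarrow> \<exists>w\<in>pre N s. (w \<frown> s) 0 = i" using primitive by blast
  obtain s1 s2 where "s1 \<in> \<Sigma>" "s2 \<in> \<Sigma>" "s1 \<noteq> s2" using two_points by blast
  then obtain i1 i2 :: 'k where i12: "i1 \<noteq> i2" by (metis ext)
  obtain H where H: "\<And>s. s \<in> \<Sigma> \<Longrightarrow> \<bar>h s\<bar> \<le> H" using unif_bounded[OF unif_h] by blast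
  define \<kappa> where "\<kappa> = exp (- (real N * H))"
  have S_le: "S n s \<le> real n * H" if "s \<in> \<Sigma>" for n s
    unfolding S_def using H[OF subshift_suffix[OF that]]
    by (intro order.trans[OF sum_bounded_above[of _ _ H]]) (auto simp: abs_le_iff)
  have step: "exp (- S N u) \<le> 1 - \<kappa>" if u: "u \<in> \<Sigma>" for u
  proof -
    define s where "s = suffix N u"
    have s: "s \<in> \<Sigma>" unfolding s_def by (rule subshift_suffix[OF u])
    obtain w1 w2 where w: "w1 \<in> pre N s" "(w1 \<frown> s) 0 = i1" "w2 \<in> pre N s" "(w2 \<frown> s) 0 = i2"
      using N(2)[OF s] by metis
    define w where "w = prefix N u"
    have w_pre: "w \<in> pre N s" using u by (simp add: pre_def w_def s_def subsequence_def prefix_conc_suffix[unfolded subsequence_def])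
    have ws: "w \<frown> s = u" by (simp add: w_def s_def prefix_conc_suffix)
    obtain w' where w': "w' \<in> pre N s" "w' \<noteq> w" using w i12 by metis
    have "exp (- S N (w \<frown> s)) + exp (- S N (w' \<frown> s)) = (\<Sum>v\<in>{w, w'}. exp (- S N (v \<frown> s)))"
      using w' by simp
    also have "\<dots> \<le> (\<Sum>v\<in>pre N s. exp (- S N (v \<frown> s)))"
      using w' w_pre by (intro sum_mono2 finite_pre) auto
    also have "\<dots> = 1" using Lop_one[OF s, of N] by (simp add: Lop_def)
    finally have "exp (- S N u) \<le> 1 - exp (- S N (w' \<frown> s))" by (simp add: ws)
    moreover have "exp (- S N (w' \<frown> s)) \<ge> \<kappa>"
      unfolding \<kappa>_def using S_le[OF pre_memD(2)[OF w'(1)], of N] by simp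
    ultimately show ?thesis by linarith
  qed
  have \<kappa>: "0 < \<kappa>" "\<kappa> < 1"
  proof -
    show "0 < \<kappa>" by (simp add: \<kappa>_def)
    show "\<kappa> < 1" using step[OF \<open>s1 \<in> \<Sigma>\<close>] by (smt (verit) exp_gt_zero)
  qed
  define c1 where "c1 = - ln (1 - \<kappa>)"
  have c1: "c1 > 0" using \<kappa> by (simp add: c1_def)
  have c1_le: "c1 \<le> S N u" if "u \<in> \<Sigma>" for u
  proof -
    have "- S N u \<le> ln (1 - \<kappa>)" using step[OF that] \<kappa> by (subst ln_ge_iff) auto
    then show ?thesis by (simp add: c1_def)
  qed
  have mult: "c1 * real q \<le> S (q * N) s" if "s \<in> \<Sigma>" for q s
  proof (induction q)
    case (Suc q)
    have "S (q * N + N) s = S (q * N) s + S N (suffix (q * N) s)" by (rule S_add)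
    then show ?case using Suc c1_le[OF subshift_suffix[OF that, of "q * N"]] by (simp add: algebra_simps)
  qed (simp add: S_def)
  have "c1 / N * real n - c1 \<le> S n s" if s: "s \<in> \<Sigma>" for n s
  proof -
    have "real n / real N < real (n div N) + 1"
    proof -
      have "n < N * (n div N + 1)" using N(1) dividend_less_times_div[of N n] by simp
      then have "real n < real N * real (n div N + 1)" by (metis of_nat_less_iff of_nat_mult)
      then show ?thesis using N(1) by (simp add: field_simps)
    qed
    then have "c1 * (real n / N) \<le> c1 * (real (n div N) + 1)" using c1 by (intro mult_left_mono) auto
    also have "\<dots> \<le> S (n div N * N) s + c1" using mult[OF s, of "n div N"] by (simp add: algebra_simps)
    also have "S (n div N * N) s \<le> S n s"
      unfolding S_def using h_nonneg[OF subshift_suffix[OF s]] div_times_less_eq_dividend[of n N]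
      by (intro sum_mono2) (auto simp del: div_times_less_eq_dividend)
    finally show ?thesis by simp
  qed
  then show ?thesis using that[of "c1 / N" c1] c1 N(1) by simp
qed

end

section \<open>Convergence of the iterates, the limit functional and the law of large
  numbers\<close>

context normalized_subshift begin

text \<open>The supremum of the iterates decreases, the infimum increases, and a contraction forces
  their limits to agree: the value at any x is an average over preimages, one of which is close to a
  point where the infimum is nearly attained. By equicontinuity q and \<kappa> depend on \<epsilon>
  but not on n, so n can go to infinity first and \<epsilon> to 0 afterwards.\<close>

lemma Lop_uniform_limit:
  assumes F: "unif F"
  shows "\<exists>l. \<forall>\<epsilon>>0. \<exists>n0. \<forall>n\<ge>n0. \<forall>s\<in>\<Sigma>. \<bar>Lop n F s - l\<bar> \<le> (\<epsilon>::real)"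
proof -
  obtain B where B: "\<And>u. u \<in> \<Sigma> \<Longrightarrow> \<bar>F u\<bar> \<le> B" using unif_bounded[OF F] by blast
  obtain H where H: "\<And>u. u \<in> \<Sigma> \<Longrightarrow> \<bar>h u\<bar> \<le> H" using unif_bounded[OF unif_h] by blast
  obtain N0 where N0: "\<And>i s. s \<in> \<Sigma> \<Longrightarrow> \<exists>w\<in>pre N0 s. (w \<frown> s) 0 = i" using primitive by metis
  have ne: "\<Sigma> \<noteq> {}" using two_points by auto
  have abs_le: "\<bar>Lop n F s\<bar> \<le> B" if "s \<in> \<Sigma>" for n s using that B by (rule Lop_abs_le)
  have S_le: "S n s \<le> real n * H" if "s \<in> \<Sigma>" for n s
    unfolding S_def using H[OF subshift_suffix[OF that]]
    by (intro order.trans[OF sum_bounded_above[of _ _ H]]) (auto simp: abs_le_iff)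
  define M where "M n = (SUP s\<in>\<Sigma>. Lop n F s)" for n
  define m where "m n = (INF s\<in>\<Sigma>. Lop n F s)" for n
  have bdd: "bdd_above (Lop n F ` \<Sigma>)" "bdd_below (Lop n F ` \<Sigma>)" for n
    using abs_le by (auto intro!: bdd_aboveI2[where M = B] bdd_belowI2[where m = "- B"] simp: abs_le_iff)
      (metis abs_le_D2 abs_le neg_le_iff_le minus_minus minus_le_iff)
  have le_M: "Lop n F s \<le> M n" and m_le: "m n \<le> Lop n F s" if "s \<in> \<Sigma>" for n s
    unfolding M_def m_def using that by (auto intro: cSUP_upper cINF_lower bdd)
  have M_step: "M (Suc n) \<le> M n" for n
    unfolding M_def[of "Suc n"]
  proof (rule cSUP_least[OF ne])
    fix s assume s: "s \<in> \<Sigma>"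
    have "Lop (n + 1) F s = Lop 1 (Lop n F) s" by (rule Lop_add)
    also have "\<dots> \<le> Lop 1 (\<lambda>_. M n) s" by (intro Lop_mono le_M)
    finally show "Lop (Suc n) F s \<le> M n" using Lop_const[OF s] by simp
  qed
  have m_step: "m n \<le> m (Suc n)" for n
    unfolding m_def[of "Suc n"]
  proof (rule cINF_greatest[OF ne])
    fix s assume s: "s \<in> \<Sigma>"
    have "m n = Lop 1 (\<lambda>_. m n) s" using Lop_const[OF s] by simp
    also have "\<dots> \<le> Lop 1 (Lop n F) s" by (intro Lop_mono m_le)
    also have "\<dots> = Lop (n + 1) F s" by (rule Lop_add[symmetric])
    finally show "m n \<le> Lop (Suc n) F s" by simp
  qed
  have m_le_M: "m n \<le> M n" for n using le_M m_le ne by (meson equals0I order.trans)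
  have dec: "decseq M" and inc: "incseq m" using M_step m_step by (auto intro: decseq_SucI incseq_SucI)
  have "m 0 \<le> M n" "m n \<le> M 0" for n
    using m_le_M[of n] incseqD[OF inc, of 0 n] decseqD[OF dec, of 0 n] by linarith+
  then obtain L1 L2 where L1: "M \<longlonglongrightarrow> L1" "\<And>n. L1 \<le> M n" and L2: "m \<longlonglongrightarrow> L2" "\<And>n. m n \<le> L2"
    by (metis dec inc decseq_convergent incseq_convergent)
  have "L1 \<le> L2 + \<epsilon>" if \<epsilon>: "\<epsilon> > 0" for \<epsilon>
  proof -
    obtain N where N: "\<And>u v. u \<in> \<Sigma> \<Longrightarrow> v \<in> \<Sigma> \<Longrightarrow> agree N u v \<Longrightarrow> \<bar>F u - F v\<bar> \<le> \<epsilon> / 2"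
      using F \<epsilon> unfolding unif_def dist_real_def by (metis half_gt_zero)
    have "(\<lambda>r. B * (exp (D * \<theta> ^ r) - 1)) \<longlonglongrightarrow> B * (exp (D * 0) - 1)"
      using \<theta> by (intro tendsto_intros LIMSEQ_power_zero) auto
    then have "\<forall>\<^sub>F r in sequentially. B * (exp (D * \<theta> ^ r) - 1) < \<epsilon> / 2"
      using \<epsilon> by (intro order_tendstoD) auto
    then obtain r where r: "r \<ge> max 1 N" "B * (exp (D * \<theta> ^ r) - 1) < \<epsilon> / 2"
      unfolding eventually_sequentially by (meson max.cobounded1 max.cobounded2)
    \<comment> \<open>r letters to come close to x', and N0 more to connect them with x.\<close>
    define q where "q = N0 + r"
    define \<kappa> where "\<kappa> = exp (- (real q * H))"
    have \<kappa>: "\<kappa> > 0" by (simp add: \<kappa>_def)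
    \<comment> \<open>Every \<open>x\<close> has a \<open>q\<close>-th preimage near \<open>x'\<close>, and it carries weight at least \<open>\<kappa>\<close>.\<close>
    have step: "Lop (n + q) F x \<le> M n - \<kappa> * (M n - Lop n F x' - \<epsilon>)" if x: "x \<in> \<Sigma>" and x': "x' \<in> \<Sigma>" for n x x'
    proof -
      obtain c where c: "c \<in> pre N0 x" "(c \<frown> x) 0 = x' r" using N0[OF x] by metis
      define w where "w = prefix r x' @ c"
      have w_conc: "w \<frown> x = prefix r x' \<frown> (c \<frown> x)" by (simp add: w_def)
      have len: "length (prefix r x') = r" by (simp add: subsequence_def)
      have "prefix r x' \<in> pre r (suffix r x')" using x' len by (simp add: pre_def prefix_conc_suffix)
      also have "pre r (suffix r x') = pre r (c \<frown> x)"
        by (rule pre_cong) (use x' c in \<open>auto simp: subshift_suffix pre_def\<close>)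
      finally have wx: "w \<frown> x \<in> \<Sigma>" unfolding w_conc by (rule pre_memD)
      have w: "w \<in> pre q x" using wx len c by (simp add: pre_def w_def q_def)
      have "agree (length (prefix r x')) (prefix r x' \<frown> (c \<frown> x)) (prefix r x' \<frown> suffix r x')"
        by (rule agree_conc_word)
      then have agr: "agree r (w \<frown> x) x'" by (simp only: w_conc len prefix_conc_suffix)
      have "\<bar>Lop n F (w \<frown> x) - Lop n F x'\<bar> \<le> B * (exp (D * \<theta> ^ r) - 1) + \<epsilon> / 2"
        by (rule Lop_variation[OF wx x' agr _ _ B N]) (use r in auto)
      then have v: "Lop n F (w \<frown> x) \<le> Lop n F x' + \<epsilon>" using r(2) by linarith
      have "\<kappa> * (M n - Lop n F x' - \<epsilon>) \<le> \<kappa> * (M n - Lop n F (w \<frown> x))"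
        using v \<kappa> by (intro mult_left_mono) auto
      also have "\<dots> \<le> exp (- S q (w \<frown> x)) * (M n - Lop n F (w \<frown> x))"
        using S_le[OF wx, of q] le_M[OF wx, of n] by (intro mult_right_mono) (auto simp: \<kappa>_def)
      also have "\<dots> \<le> Lop q (\<lambda>u. M n - Lop n F u) x"
        unfolding Lop_def[of q] by (rule member_le_sum[OF w]) (use le_M in \<open>auto simp: finite_pre dest: pre_memD\<close>)
      also have "\<dots> = Lop q (\<lambda>_. M n) x + Lop q (\<lambda>u. (-1) * Lop n F u) x"
        by (subst Lop_plus[symmetric]) simp
      also have "\<dots> = M n - Lop (n + q) F x"
        unfolding Lop_cmult Lop_const[OF x] Lop_add by simp
      finally show ?thesis by simp
    qed
    have "M (n + q) \<le> M n - \<kappa> * (M n - m n - \<epsilon>)" for n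
      unfolding M_def[of "n + q"]
    proof (rule cSUP_least[OF ne])
      fix x assume x: "x \<in> \<Sigma>"
      have "(Lop (n + q) F x - M n) / \<kappa> + M n - \<epsilon> \<le> m n"
        unfolding m_def
      proof (rule cINF_greatest[OF ne])
        fix x' assume "x' \<in> \<Sigma>"
        from step[OF x this, of n] show "(Lop (n + q) F x - M n) / \<kappa> + M n - \<epsilon> \<le> Lop n F x'"
          using \<kappa> by (simp add: field_simps)
      qed
      then show "Lop (n + q) F x \<le> M n - \<kappa> * (M n - m n - \<epsilon>)"
        using \<kappa> by (simp add: field_simps)
    qed
    moreover have "(\<lambda>n. M (n + q)) \<longlonglongrightarrow> L1" by (rule LIMSEQ_ignore_initial_segment[OF L1(1)])
    moreover have "(\<lambda>n. M n - \<kappa> * (M n - m n - \<epsilon>)) \<longlonglongrightarrow> L1 - \<kappa> * (L1 - L2 - \<epsilon>)"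
      by (intro tendsto_intros L1 L2)
    ultimately have "L1 \<le> L1 - \<kappa> * (L1 - L2 - \<epsilon>)" by (intro LIMSEQ_le) auto
    then have "\<kappa> * (L1 - L2 - \<epsilon>) \<le> 0" by simp
    then show ?thesis using \<kappa> by (simp add: mult_le_0_iff)
  qed
  then have "L1 \<le> L2" by (rule field_le_epsilon)
  show ?thesis
  proof (intro exI[of _ L1] allI impI)
    fix \<epsilon> :: real assume \<epsilon>: "\<epsilon> > 0"
    have "\<forall>\<^sub>F n in sequentially. M n < L1 + \<epsilon>" using \<epsilon> by (intro order_tendstoD(2)[OF L1(1)]) auto
    moreover have "\<forall>\<^sub>F n in sequentially. m n > L2 - \<epsilon>" using \<epsilon> by (intro order_tendstoD(1)[OF L2(1)]) auto
    ultimately have "\<forall>\<^sub>F n in sequentially. \<forall>s\<in>\<Sigma>. \<bar>Lop n F s - L1\<bar> \<le> \<epsilon>"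
    proof eventually_elim
      case (elim n)
      show ?case
      proof
        fix s assume "s \<in> \<Sigma>"
        then show "\<bar>Lop n F s - L1\<bar> \<le> \<epsilon>"
          using le_M[of s n] m_le[of s n] elim \<open>L1 \<le> L2\<close> by (simp add: abs_le_iff)
      qed
    qed
    then show "\<exists>n0. \<forall>n\<ge>n0. \<forall>s\<in>\<Sigma>. \<bar>Lop n F s - L1\<bar> \<le> \<epsilon>" by (simp add: eventually_sequentially)
  qed
qed

text \<open>The integral against the invariant measure, as a functional on \<open>unif\<close>
  functions; the base point is arbitrary because the limit is the same everywhere. It becomes an
  actual measure in \<open>Lim_measure_exists\<close>.\<close>

definition Lim :: "((nat \<Rightarrow> 'k) \<Rightarrow> real) \<Rightarrow> real" where
  "Lim F = lim (\<lambda>n. Lop n F (SOME s. s \<in> \<Sigma>))"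

lemma Lop_Lim:
  assumes "unif F" "\<epsilon> > 0"
  shows "\<exists>n0. \<forall>n\<ge>n0. \<forall>s\<in>\<Sigma>. \<bar>Lop n F s - Lim F\<bar> \<le> \<epsilon>"
proof -
  obtain l where l: "\<And>\<epsilon>. \<epsilon> > 0 \<Longrightarrow> \<exists>n0. \<forall>n\<ge>n0. \<forall>s\<in>\<Sigma>. \<bar>Lop n F s - l\<bar> \<le> \<epsilon>"
    using Lop_uniform_limit[OF assms(1)] by blast
  define s0 where "s0 = (SOME s. s \<in> \<Sigma>)"
  have s0: "s0 \<in> \<Sigma>" unfolding s0_def using two_points by (metis someI)
  have "(\<lambda>n. Lop n F s0) \<longlonglongrightarrow> l"
  proof (rule LIMSEQ_I)
    fix r :: real assume "0 < r"
    then obtain n0 where "\<forall>n\<ge>n0. \<forall>s\<in>\<Sigma>. \<bar>Lop n F s - l\<bar> \<le> r / 2" using l[of "r / 2"] by auto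
    then show "\<exists>n0. \<forall>n\<ge>n0. norm (Lop n F s0 - l) < r"
      using s0 \<open>0 < r\<close> by (intro exI[of _ n0]) (fastforce)
  qed
  then have "Lim F = l" unfolding Lim_def s0_def[symmetric] by (rule limI)
  then show ?thesis using l assms(2) by simp
qed

lemma Lop_tendsto:
  assumes "unif F" "s \<in> \<Sigma>" shows "(\<lambda>n. Lop n F s) \<longlonglongrightarrow> Lim F"
proof (rule LIMSEQ_I)
  fix r :: real assume "0 < r"
  then obtain n0 where "\<forall>n\<ge>n0. \<forall>s\<in>\<Sigma>. \<bar>Lop n F s - Lim F\<bar> \<le> r / 2"
    using Lop_Lim[OF assms(1), of "r / 2"] by auto
  then show "\<exists>n0. \<forall>n\<ge>n0. norm (Lop n F s - Lim F) < r"
    using assms(2) \<open>0 < r\<close> by (intro exI[of _ n0]) fastforce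
qed

lemma Lim_unique:
  assumes "unif F" "s \<in> \<Sigma>" "(\<lambda>n. Lop n F s) \<longlonglongrightarrow> l" shows "Lim F = l"
  using Lop_tendsto[OF assms(1,2)] assms(3) by (rule LIMSEQ_unique)

lemma Lim_const: "Lim (\<lambda>_. c) = c"
proof -
  obtain s where s: "s \<in> \<Sigma>" using two_points by blast
  show ?thesis by (rule Lim_unique[OF unif_const s]) (simp add: Lop_const[OF s])
qed

lemma Lim_plus: "unif F \<Longrightarrow> unif G \<Longrightarrow> Lim (\<lambda>s. F s + G s) = Lim F + Lim G"
proof -
  assume F: "unif F" and G: "unif G"
  obtain s where s: "s \<in> \<Sigma>" using two_points by blast
  show ?thesis
    by (rule Lim_unique[OF unif_plus[OF F G] s])
      (simp add: Lop_plus tendsto_add Lop_tendsto[OF F s] Lop_tendsto[OF G s])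
qed

lemma Lim_cmult: "unif F \<Longrightarrow> Lim (\<lambda>s. c * F s) = c * Lim F"
proof -
  assume F: "unif F"
  obtain s where s: "s \<in> \<Sigma>" using two_points by blast
  show ?thesis
    by (rule Lim_unique[OF unif_cmult[OF F] s])
      (simp add: Lop_cmult tendsto_mult_left Lop_tendsto[OF F s])
qed

lemma unif_sum:
  fixes F :: "'i \<Rightarrow> (nat \<Rightarrow> 'k) \<Rightarrow> real"
  assumes "\<And>i. i \<in> I \<Longrightarrow> unif (F i)" shows "unif (\<lambda>s. \<Sum>i\<in>I. F i s)"
  using assms by (induction I rule: infinite_finite_induct) (auto intro: unif_const unif_plus)

lemma Lim_sum:
  assumes "\<And>i. i \<in> I \<Longrightarrow> unif (F i)" shows "Lim (\<lambda>s. \<Sum>i\<in>I. F i s) = (\<Sum>i\<in>I. Lim (F i))"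
  using assms by (induction I rule: infinite_finite_induct) (auto simp: Lim_const Lim_plus unif_sum)

text \<open>Later iterates are averages of the n-th one, so a uniform bound on a single iterate
  passes to the limit.\<close>

lemma Lim_le:
  assumes "unif F" "\<And>s. s \<in> \<Sigma> \<Longrightarrow> Lop n F s \<le> C" shows "Lim F \<le> C"
proof -
  obtain s where s: "s \<in> \<Sigma>" using two_points by blast
  have "Lop (k + n) F s \<le> C" for k
  proof -
    have "Lop (n + k) F s = Lop k (Lop n F) s" by (rule Lop_add)
    also have "\<dots> \<le> Lop k (\<lambda>_. C) s" by (intro Lop_mono assms)
    finally show ?thesis using Lop_const[OF s] by (simp add: add.commute)
  qed
  then show ?thesis
    by (intro LIMSEQ_le_const2[OF LIMSEQ_ignore_initial_segment[OF Lop_tendsto[OF assms(1) s], of n]]) auto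
qed

lemma Lim_mono:
  assumes "unif F" "unif G" "\<And>s. s \<in> \<Sigma> \<Longrightarrow> F s \<le> G s" shows "Lim F \<le> Lim G"
proof -
  obtain s where s: "s \<in> \<Sigma>" using two_points by blast
  show ?thesis
    by (rule LIMSEQ_le[OF Lop_tendsto[OF assms(1) s] Lop_tendsto[OF assms(2) s]])
      (use assms(3) Lop_mono in auto)
qed

lemma Lim_cong:
  assumes "\<And>s. s \<in> \<Sigma> \<Longrightarrow> F s = G s" shows "Lim F = Lim G"
proof -
  have "Lop n F s = Lop n G s" for n s by (rule Lop_cong) (rule assms)
  then show ?thesis by (simp add: Lim_def)
qed

text \<open>Of k + n applications of the transfer operator the first n undo the shift; this is where
  the invariance of the measure comes from.\<close>

lemma Lim_suffix:
  assumes F: "unif F" shows "Lim (\<lambda>s. F (suffix n s)) = Lim F"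
proof -
  obtain s where s: "s \<in> \<Sigma>" using two_points by blast
  have "Lop (k + n) (\<lambda>s. F (suffix n s)) s = Lop k F s" for k
  proof -
    have "Lop (n + k) (\<lambda>s. F (suffix n s)) s = Lop k (Lop n (\<lambda>s. F (suffix n s))) s" by (rule Lop_add)
    also have "\<dots> = Lop k F s" by (intro Lop_cong Lop_suffix)
    finally show ?thesis by (simp add: add.commute)
  qed
  then have "(\<lambda>k. Lop k F s) \<longlonglongrightarrow> Lim (\<lambda>s. F (suffix n s))"
    using LIMSEQ_ignore_initial_segment[OF Lop_tendsto[OF unif_suffix[OF F] s], of n n] by simp
  then show ?thesis using Lim_unique[OF F s] by simp
qed

lemma unif_S: "unif (S n)"
  unfolding S_def by (intro unif_sum unif_suffix unif_h)

lemma Lim_S: "Lim (S n) = n * Lim h"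
  unfolding S_def by (subst Lim_sum) (simp_all add: unif_suffix unif_h Lim_suffix del: suffix_def)

text \<open>By linear growth some \<open>S n\<close> is at least 1 everywhere, and its limit value
  is n times that of h by invariance.\<close>

lemma Lim_h_pos: "0 < Lim h"
proof -
  obtain c C where c: "c > 0" "\<And>n s. s \<in> \<Sigma> \<Longrightarrow> c * real n - C \<le> S n s"
    using S_linear_lower_bound by blast
  obtain n :: nat where "real n > (C + 1) / c" using reals_Archimedean2 by blast
  then have n: "c * real n - C \<ge> 1" using c(1) by (simp add: field_simps)
  have "1 \<le> S n s" if "s \<in> \<Sigma>" for s using n c(2)[OF that, of n] by linarith
  then have "Lim (\<lambda>_. 1) \<le> Lim (S n)"
    by (intro Lim_mono unif_const unif_S)
  then have "1 \<le> n * Lim h" by (simp add: Lim_const Lim_S)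
  then show ?thesis
    by (metis less_le_not_le linorder_not_less mult_nonneg_nonpos of_nat_0_le_iff zero_less_one order.trans)
qed

text \<open>The first i applications remove the common shift and leave the product of V with its
  shift by d = l - i; the next d pull out the shifted factor and leave V times
  \<open>Lop d V\<close>. Hence the decay of \<open>Lop d V\<close> bounds the correlation, and the
  remaining n - l applications only average.\<close>

lemma Lop_correlation:
  assumes s: "s \<in> \<Sigma>" and B: "\<And>u. u \<in> \<Sigma> \<Longrightarrow> \<bar>V u\<bar> \<le> B"
    and a: "\<And>u. u \<in> \<Sigma> \<Longrightarrow> \<bar>Lop (l - i) V u\<bar> \<le> a" and il: "i \<le> l" "l \<le> n"
  shows "\<bar>Lop n (\<lambda>u. V (suffix i u) * V (suffix l u)) s\<bar> \<le> B * a"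
proof -
  define d k where "d = l - i" and "k = n - l"
  have n: "n = i + (d + k)" and l: "l = i + d" using il by (auto simp: d_def k_def)
  have B0: "0 \<le> B" using B[OF s] by linarith
  have 1: "Lop i (\<lambda>u. V (suffix i u) * V (suffix l u)) t = V t * V (suffix d t)" if "t \<in> \<Sigma>" for t
    using Lop_suffix[OF that, of i "\<lambda>t. V t * V (suffix d t)"] by (simp add: l add.commute del: suffix_def)
  have 2: "Lop d (\<lambda>t. V t * V (suffix d t)) r = V r * Lop d V r" for r
    using Lop_suffix_mult[of d V V r] by (simp add: mult.commute del: suffix_def)
  have "Lop n (\<lambda>u. V (suffix i u) * V (suffix l u)) s
      = Lop (d + k) (Lop i (\<lambda>u. V (suffix i u) * V (suffix l u))) s" unfolding n by (rule Lop_add)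
  also have "\<dots> = Lop (d + k) (\<lambda>t. V t * V (suffix d t)) s" by (intro Lop_cong 1)
  also have "\<dots> = Lop k (\<lambda>r. V r * Lop d V r) s" unfolding Lop_add 2 ..
  finally show ?thesis
    using Lop_abs_le[OF s, of "\<lambda>r. V r * Lop d V r" "B * a" k] B a B0
    by (simp add: abs_mult mult_mono d_def)
qed

text \<open>By the second moment method: correlations decay because \<open>Lop d (h - Lim h)\<close> tends to \<open>0\<close>
  uniformly as \<open>d\<close> grows.\<close>

lemma Lop_weak_law:
  assumes \<delta>: "\<delta> > 0" and \<epsilon>: "\<epsilon> > 0"
  shows "\<exists>n0. \<forall>n\<ge>n0. \<forall>s\<in>\<Sigma>. Lop n (\<lambda>u. of_bool (\<bar>S n u - n * Lim h\<bar> > \<delta> * n)) s \<le> \<epsilon>"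
proof -
  define V where "V u = h u + (- Lim h)" for u
  have V: "unif V" unfolding V_def by (intro unif_plus unif_h unif_const)
  have Lim_V: "Lim V = 0" unfolding V_def by (subst Lim_plus) (auto simp: unif_h unif_const Lim_const)
  obtain B where B: "\<And>u. u \<in> \<Sigma> \<Longrightarrow> \<bar>V u\<bar> \<le> B" using unif_bounded[OF V] by blast
  obtain s0 where "s0 \<in> \<Sigma>" using two_points by blast
  then have B0: "0 \<le> B" using B[of s0] by linarith
  \<comment> \<open>With this choice the term B * \<epsilon>1 / \<delta>^2 of the final estimate is
    at most \<epsilon> / 2; B + 1 avoids a division by 0.\<close>
  define \<epsilon>1 where "\<epsilon>1 = \<epsilon> * \<delta>\<^sup>2 / (2 * (B + 1))"
  have \<epsilon>1: "\<epsilon>1 > 0" using \<epsilon> \<delta> B0 by (simp add: \<epsilon>1_def)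
  obtain k0 where k0: "\<And>n s. n \<ge> k0 \<Longrightarrow> s \<in> \<Sigma> \<Longrightarrow> \<bar>Lop n V s\<bar> \<le> \<epsilon>1"
    using Lop_Lim[OF V \<epsilon>1] unfolding Lim_V by auto
  have corr: "\<bar>Lop n (\<lambda>u. V (suffix i u) * V (suffix l u)) s\<bar> \<le> B * \<epsilon>1 + of_bool (l - i < k0) * B\<^sup>2"
    if "s \<in> \<Sigma>" "i \<le> l" "l < n" for n i l s
  proof (cases "l - i < k0")
    case True
    have "\<bar>Lop n (\<lambda>u. V (suffix i u) * V (suffix l u)) s\<bar> \<le> B * B"
      using that B by (intro Lop_correlation) (auto intro: Lop_abs_le)
    also have "\<dots> \<le> B * \<epsilon>1 + B\<^sup>2" using B0 \<epsilon>1 by (simp add: power2_eq_square)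
    finally show ?thesis using True by simp
  next
    case False
    then have "\<bar>Lop n (\<lambda>u. V (suffix i u) * V (suffix l u)) s\<bar> \<le> B * \<epsilon>1"
      using that B k0 by (intro Lop_correlation) auto
    then show ?thesis using False by simp
  qed
  have corr': "\<bar>Lop n (\<lambda>u. V (suffix i u) * V (suffix l u)) s\<bar>
      \<le> B * \<epsilon>1 + of_bool (l \<in> {i - k0..<i + k0 + 1}) * B\<^sup>2" if "s \<in> \<Sigma>" "i < n" "l < n" for n i l s
  proof (cases "i \<le> l")
    case True
    then have "of_bool (l - i < k0) * B\<^sup>2 \<le> of_bool (l \<in> {i - k0..<i + k0 + 1}) * B\<^sup>2"
      by (intro mult_right_mono) auto
    then show ?thesis using corr[OF that(1) True that(3)] by linarith
  next
    case False
    then have "l \<le> i" by simp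
    have eq: "(\<lambda>u. V (suffix i u) * V (suffix l u)) = (\<lambda>u. V (suffix l u) * V (suffix i u))"
      by (simp add: mult.commute)
    have "of_bool (i - l < k0) * B\<^sup>2 \<le> of_bool (l \<in> {i - k0..<i + k0 + 1}) * B\<^sup>2"
      using False by (intro mult_right_mono) auto
    then show ?thesis unfolding eq using corr[OF that(1) \<open>l \<le> i\<close> that(2)] by linarith
  qed
  \<comment> \<open>The square expands into n^2 correlations. Each gets the small bound B *
    \<epsilon>1, and pairs with i and l at distance at most k0, no more than 2 * k0 + 1 for each i,
    get the trivial bound B^2 on top of it.\<close>
  have second_moment: "Lop n (\<lambda>u. (S n u - n * Lim h)\<^sup>2) s \<le> n * (n * (B * \<epsilon>1) + (2 * k0 + 1) * B\<^sup>2)"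
    if s: "s \<in> \<Sigma>" for n s
  proof -
    have "S n u - n * Lim h = (\<Sum>i<n. V (suffix i u))" for u
      by (simp add: S_def V_def sum_subtractf)
    then have "Lop n (\<lambda>u. (S n u - n * Lim h)\<^sup>2) s
        = (\<Sum>i<n. \<Sum>l<n. Lop n (\<lambda>u. V (suffix i u) * V (suffix l u)) s)"
      by (simp add: power2_eq_square sum_product Lop_sum del: suffix_def)
    also have "\<dots> \<le> (\<Sum>i<n. \<Sum>l<n. B * \<epsilon>1 + of_bool (l \<in> {i - k0..<i + k0 + 1}) * B\<^sup>2)"
      using corr'[OF s] by (intro sum_mono) (auto simp: abs_le_iff)
    also have "\<dots> \<le> (\<Sum>i<n. n * (B * \<epsilon>1) + (2 * k0 + 1) * B\<^sup>2)"
    proof (rule sum_mono)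
      fix i
      have "(\<Sum>l<n. of_bool (l \<in> Q) * B\<^sup>2) = card ({..<n} \<inter> Q) * B\<^sup>2" for Q
        by (simp add: sum.If_cases of_bool_def if_distrib[of "\<lambda>x. x * _"] cong: if_cong)
      then have "(\<Sum>l<n. of_bool (l \<in> {i - k0..<i + k0 + 1}) * B\<^sup>2) = card ({..<n} \<inter> {i - k0..<i + k0 + 1}) * B\<^sup>2" .
      also have "\<dots> \<le> (2 * k0 + 1) * B\<^sup>2"
      proof (intro mult_right_mono)
        have "card ({..<n} \<inter> {i - k0..<i + k0 + 1}) \<le> card {i - k0..<i + k0 + 1}"
          by (intro card_mono) auto
        then show "real (card ({..<n} \<inter> {i - k0..<i + k0 + 1})) \<le> real (2 * k0 + 1)"
          by (subst of_nat_le_iff) auto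
      qed auto
      finally show "(\<Sum>l<n. B * \<epsilon>1 + of_bool (l \<in> {i - k0..<i + k0 + 1}) * B\<^sup>2)
          \<le> n * (B * \<epsilon>1) + (2 * k0 + 1) * B\<^sup>2"
        by (simp add: sum.distrib)
    qed
    finally show ?thesis by simp
  qed
  obtain n0 :: nat where n0: "real n0 > 2 * ((2 * k0 + 1) * B\<^sup>2) / (\<epsilon> * \<delta>\<^sup>2)" using reals_Archimedean2 by blast
  show ?thesis
  proof (intro exI[of _ "max 1 n0"] allI impI ballI)
    fix n s assume n: "max 1 n0 \<le> n" and s: "s \<in> \<Sigma>"
    define N where "N = real n"
    have N: "N \<ge> 1" "N \<ge> n0" using n by (auto simp: N_def)
    have e\<delta>: "\<epsilon> * \<delta>\<^sup>2 > 0" using \<epsilon> \<delta> by simp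
    \<comment> \<open>Chebyshev's inequality for the probability weights of
      \<open>Lop n\<close>.\<close>
    have "Lop n (\<lambda>u. of_bool (\<bar>S n u - n * Lim h\<bar> > \<delta> * n)) s
        \<le> Lop n (\<lambda>u. 1 / (\<delta> * N)\<^sup>2 * (S n u - n * Lim h)\<^sup>2) s"
    proof (rule Lop_mono)
      fix u
      have "(\<delta> * N)\<^sup>2 \<le> (S n u - n * Lim h)\<^sup>2" if "\<bar>S n u - n * Lim h\<bar> > \<delta> * n"
        using that \<delta> N unfolding N_def by (intro abs_le_square_iff[THEN iffD1]) simp
      moreover have "(\<delta> * N)\<^sup>2 > 0" using \<delta> N by simp
      ultimately show "of_bool (\<bar>S n u - n * Lim h\<bar> > \<delta> * n) \<le> 1 / (\<delta> * N)\<^sup>2 * (S n u - n * Lim h)\<^sup>2"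
        by (auto simp: field_simps)
    qed
    also have "\<dots> \<le> 1 / (\<delta> * N)\<^sup>2 * (N * (N * (B * \<epsilon>1) + (2 * k0 + 1) * B\<^sup>2))"
      unfolding Lop_cmult using second_moment[OF s, of n] by (intro mult_left_mono) (auto simp: N_def)
    also have "\<dots> = (B * \<epsilon>1 + ((2 * k0 + 1) * B\<^sup>2) / N) / \<delta>\<^sup>2"
      using N \<delta> by (simp add: field_simps power2_eq_square)
    also have "\<dots> \<le> (\<epsilon> * \<delta>\<^sup>2 / 2 + \<epsilon> * \<delta>\<^sup>2 / 2) / \<delta>\<^sup>2"
    proof (intro divide_right_mono add_mono)
      have "B * \<epsilon>1 \<le> (B + 1) * \<epsilon>1" using \<epsilon>1 by (simp add: algebra_simps)
      also have "\<dots> = \<epsilon> * \<delta>\<^sup>2 / 2" unfolding \<epsilon>1_def using B0 by (simp add: field_simps)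
      finally show "B * \<epsilon>1 \<le> \<epsilon> * \<delta>\<^sup>2 / 2" .
      have "2 * ((2 * k0 + 1) * B\<^sup>2) / (\<epsilon> * \<delta>\<^sup>2) \<le> N" using n0 N by linarith
      then have "2 * ((2 * k0 + 1) * B\<^sup>2) \<le> N * (\<epsilon> * \<delta>\<^sup>2)" using e\<delta> by (simp add: pos_divide_le_eq)
      then show "((2 * k0 + 1) * B\<^sup>2) / N \<le> \<epsilon> * \<delta>\<^sup>2 / 2" using N by (simp add: pos_divide_le_eq mult.commute)
    qed simp
    also have "\<dots> = \<epsilon>" using \<delta> by simp
    finally show "Lop n (\<lambda>u. of_bool (\<bar>S n u - n * Lim h\<bar> > \<delta> * n)) s \<le> \<epsilon>" .
  qed
qed

end

section \<open>Counting words\<close>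

lemma cesaro_mean:
  fixes X :: "nat \<Rightarrow> real"
  assumes X: "X \<longlonglongrightarrow> a"
  shows "(\<lambda>n. (\<Sum>k<n. X k) / n) \<longlonglongrightarrow> a"
proof (rule LIMSEQ_I)
  fix \<epsilon> :: real assume \<epsilon>: "0 < \<epsilon>"
  obtain N where N: "\<And>n. n \<ge> N \<Longrightarrow> \<bar>X n - a\<bar> < \<epsilon> / 2"
    using LIMSEQ_D[OF X, of "\<epsilon> / 2"] \<epsilon> by auto
  define C where "C = (\<Sum>k<N. \<bar>X k - a\<bar>)"
  obtain n0 :: nat where n0: "real n0 > 2 * C / \<epsilon>" using reals_Archimedean2 by blast
  have "\<bar>(\<Sum>k<n. X k) / n - a\<bar> < \<epsilon>" if n: "n \<ge> max 1 n0" for n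
  proof -
    have "(\<Sum>k<n. X k) / n - a = (\<Sum>k<n. X k - a) / n"
      using n by (simp add: sum_subtractf field_simps)
    also have "\<bar>\<dots>\<bar> \<le> (\<Sum>k<n. \<bar>X k - a\<bar>) / n"
      by (simp add: abs_divide divide_right_mono sum_abs)
    also have "(\<Sum>k<n. \<bar>X k - a\<bar>) \<le> (\<Sum>k<n. of_bool (k < N) * \<bar>X k - a\<bar> + \<epsilon> / 2)"
      by (rule sum_mono) (use N \<epsilon> in \<open>force simp: not_less\<close>)
    also have "\<dots> = (\<Sum>k<n. of_bool (k < N) * \<bar>X k - a\<bar>) + n * (\<epsilon> / 2)"
      by (simp add: sum.distrib)
    also have "(\<Sum>k<n. of_bool (k < N) * \<bar>X k - a\<bar>) = (\<Sum>k\<in>{..<n} \<inter> {..<N}. \<bar>X k - a\<bar>)"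
      by (rule sum.mono_neutral_cong_right) auto
    also have "\<dots> \<le> C" unfolding C_def by (rule sum_mono2) auto
    finally have "\<bar>(\<Sum>k<n. X k) / n - a\<bar> \<le> (C + n * (\<epsilon> / 2)) / n" by (simp add: divide_right_mono)
    also have "\<dots> = C / n + \<epsilon> / 2" using n by (simp add: add_divide_distrib)
    also have "C / n < \<epsilon> / 2"
    proof -
      have "2 * C / \<epsilon> < n" using n n0 by linarith
      then show ?thesis using n \<epsilon> by (simp add: field_simps)
    qed
    finally show ?thesis by simp
  qed
  then show "\<exists>n0. \<forall>n\<ge>n0. norm ((\<Sum>k<n. X k) / n - a) < \<epsilon>"
    by (intro exI[of _ "max 1 n0"]) simp
qed

text \<open>The number of terms is R / \<kappa> up to a bounded error, so the quotient is a Cesaro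
  mean times a ratio tending to 1 / \<kappa>; the offset C leaves room for cut-offs other than R /
  \<kappa> itself.\<close>

lemma cesaro_mean_real:
  fixes X :: "nat \<Rightarrow> real"
  assumes X: "X \<longlonglongrightarrow> a" and \<kappa>: "\<kappa> > 0"
  shows "((\<lambda>R. (\<Sum>k<nat \<lfloor>(R + C) / \<kappa>\<rfloor>. X k) / R) \<longlongrightarrow> a / \<kappa>) at_top"
proof -
  define N where "N R = nat \<lfloor>(R + C) / \<kappa>\<rfloor>" for R
  have N_bounds: "(R + C) / \<kappa> - 1 \<le> real (N R)" "real (N R) \<le> (R + C) / \<kappa>" if "R + C \<ge> 0" for R
  proof -
    have "(R + C) / \<kappa> \<ge> 0" using that \<kappa> by simp
    then have "real (N R) = of_int \<lfloor>(R + C) / \<kappa>\<rfloor>" by (simp add: N_def)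
    then show "(R + C) / \<kappa> - 1 \<le> real (N R)" "real (N R) \<le> (R + C) / \<kappa>" by linarith+
  qed
  have N_top: "filterlim N at_top at_top"
    unfolding filterlim_at_top
  proof
    fix Z :: nat
    show "\<forall>\<^sub>F R in at_top. Z \<le> N R"
      using eventually_ge_at_top[of "\<kappa> * Z - C"] eventually_ge_at_top[of "- C"]
    proof eventually_elim
      case (elim R)
      then have "real Z \<le> (R + C) / \<kappa>" using \<kappa> by (simp add: field_simps)
      then have "int Z \<le> \<lfloor>(R + C) / \<kappa>\<rfloor>" by (simp add: le_floor_iff)
      then show ?case by (simp add: N_def)
    qed
  qed
  have "((\<lambda>R. (\<Sum>k<N R. X k) / N R) \<longlongrightarrow> a) at_top"
    by (rule filterlim_compose[OF cesaro_mean[OF X] N_top])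
  moreover have "((\<lambda>R. N R / R) \<longlongrightarrow> 1 / \<kappa>) at_top"
  proof (rule real_tendsto_sandwich)
    have inv: "((\<lambda>R::real. 1 / R) \<longlongrightarrow> 0) at_top"
      using tendsto_inverse_0_at_top[OF filterlim_ident] by (simp add: inverse_eq_divide)
    have "((\<lambda>R. 1 / \<kappa> + (C / \<kappa> - 1) * (1 / R)) \<longlongrightarrow> 1 / \<kappa> + (C / \<kappa> - 1) * 0) at_top"
      by (intro tendsto_intros inv)
    then show "((\<lambda>R. 1 / \<kappa> + (C / \<kappa> - 1) * (1 / R)) \<longlongrightarrow> 1 / \<kappa>) at_top" by simp
    have "((\<lambda>R. 1 / \<kappa> + C / \<kappa> * (1 / R)) \<longlongrightarrow> 1 / \<kappa> + C / \<kappa> * 0) at_top"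
      by (intro tendsto_intros inv)
    then show "((\<lambda>R. 1 / \<kappa> + C / \<kappa> * (1 / R)) \<longlongrightarrow> 1 / \<kappa>) at_top" by simp
    show "\<forall>\<^sub>F R in at_top. 1 / \<kappa> + (C / \<kappa> - 1) * (1 / R) \<le> N R / R"
      using eventually_ge_at_top[of "- C"] eventually_gt_at_top[of 0]
    proof eventually_elim
      case (elim R)
      have "1 / \<kappa> + (C / \<kappa> - 1) * (1 / R) = ((R + C) / \<kappa> - 1) / R"
        using elim \<kappa> by (simp add: field_simps)
      also have "\<dots> \<le> N R / R" using elim N_bounds(1)[of R] by (intro divide_right_mono) auto
      finally show ?case .
    qed
    show "\<forall>\<^sub>F R in at_top. N R / R \<le> 1 / \<kappa> + C / \<kappa> * (1 / R)"
      using eventually_ge_at_top[of "- C"] eventually_gt_at_top[of 0]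
    proof eventually_elim
      case (elim R)
      have "N R / R \<le> ((R + C) / \<kappa>) / R" using elim N_bounds(2)[of R] by (intro divide_right_mono) auto
      also have "\<dots> = 1 / \<kappa> + C / \<kappa> * (1 / R)" using elim \<kappa> by (simp add: field_simps)
      finally show ?case .
    qed
  qed
  ultimately have "((\<lambda>R. (\<Sum>k<N R. X k) / N R * (N R / R)) \<longlongrightarrow> a * (1 / \<kappa>)) at_top"
    by (rule tendsto_mult)
  moreover have "\<forall>\<^sub>F R in at_top. (\<Sum>k<N R. X k) / N R * (N R / R) = (\<Sum>k<N R. X k) / R"
  proof -
    have "\<forall>\<^sub>F R in at_top. N R \<ge> 1" using N_top unfolding filterlim_at_top by blast
    then show ?thesis by eventually_elim simp
  qed
  ultimately have "((\<lambda>R. (\<Sum>k<N R. X k) / R) \<longlongrightarrow> a * (1 / \<kappa>)) at_top"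
    by (rule Lim_transform_eventually)
  then show ?thesis by (simp add: N_def)
qed

text \<open>\<open>T n R\<close> is the part of the mass \<open>a n\<close> of the words of length \<open>n\<close> that lies below level \<open>R\<close>:
  almost everything for \<open>n < R / m\<close>, almost nothing for \<open>n > R / m\<close>, by the law of large numbers.\<close>

lemma renewal_limit:
  fixes T :: "nat \<Rightarrow> real \<Rightarrow> real" and m c C L :: real
  assumes a: "a \<longlonglongrightarrow> L" and m: "m > 0" and c: "c > 0"
    and T_nonneg: "\<And>n R. 0 \<le> T n R" and T_le: "\<And>n R. T n R \<le> a n"
    and T_low: "\<And>\<delta>. \<delta> > 0 \<Longrightarrow> \<exists>e. e \<longlonglongrightarrow> 0 \<and> (\<forall>n R. (m + \<delta>) * n \<le> R \<longrightarrow> a n - e n \<le> T n R)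
                      \<and> (\<forall>n R. R < (m - \<delta>) * n \<longrightarrow> T n R \<le> e n)"
    and T_zero: "\<And>n R. R < c * n - C \<Longrightarrow> T n R = 0"
    and J: "\<And>R. finite (J R)" "\<And>n R. n \<notin> J R \<Longrightarrow> T n R = 0"
  shows "((\<lambda>R. (\<Sum>n\<in>J R. T n R) / R) \<longlongrightarrow> L / m) at_top"
proof -
  have L: "L \<ge> 0" by (rule LIMSEQ_le_const[OF a]) (use T_nonneg T_le order.trans in blast)
  define \<Phi> where "\<Phi> R = (\<Sum>n\<in>J R. T n R)" for R
  have \<Phi>_eq: "\<Phi> R = (\<Sum>n\<in>Q. T n R)" if "finite Q" "\<And>n. n \<notin> Q \<Longrightarrow> T n R = 0" for Q R
    unfolding \<Phi>_def by (rule sum.mono_neutral_cong) (use that J in auto)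
  have upper: "\<exists>u. (u \<longlongrightarrow> L / (m - \<delta>)) at_top \<and> (\<forall>\<^sub>F R in at_top. \<Phi> R / R \<le> u R)"
    if \<delta>: "0 < \<delta>" "\<delta> < m" for \<delta>
  proof -
    obtain e where e: "e \<longlonglongrightarrow> 0" "\<And>n R. R < (m - \<delta>) * n \<Longrightarrow> T n R \<le> e n"
      using T_low[OF \<delta>(1)] by blast
    have e': "(\<lambda>n. \<bar>e n\<bar>) \<longlonglongrightarrow> 0" using tendsto_rabs[OF e(1)] by simp
    \<comment> \<open>From \<open>N R\<close> on the law of large numbers makes T small, from
      \<open>M R\<close> on T vanishes. The errors e n are summed up to \<open>M R\<close> only,
      which grows linearly in R, so that their mean tends to 0. The offsets raise both quotients by
      1 before rounding down, which turns n \<ge> N R and n \<ge> M R into the strict inequalities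
      required.\<close>
    define N where "N R = nat \<lfloor>(R + (m - \<delta>)) / (m - \<delta>)\<rfloor>" for R
    define M where "M R = nat \<lfloor>(R + (C + c)) / c\<rfloor>" for R
    have "((\<lambda>R. (\<Sum>k<N R. a k) / R + (\<Sum>k<M R. \<bar>e k\<bar>) / R) \<longlongrightarrow> L / (m - \<delta>) + 0 / c) at_top"
      unfolding N_def M_def using \<delta> c by (intro tendsto_add cesaro_mean_real a e') auto
    moreover have "\<forall>\<^sub>F R in at_top. \<Phi> R / R \<le> (\<Sum>k<N R. a k) / R + (\<Sum>k<M R. \<bar>e k\<bar>) / R"
      using eventually_gt_at_top[of 0]
    proof eventually_elim
      case (elim R)
      have M: "T n R = 0" if "n \<notin> {..<M R}" for n
      proof (rule T_zero)
        have "\<lfloor>(R + (C + c)) / c\<rfloor> \<le> int n" using that by (simp add: M_def)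
        then have "(R + (C + c)) / c < real n + 1" by linarith
        then show "R < c * real n - C" using c by (simp add: field_simps)
      qed
      have N: "T n R \<le> \<bar>e n\<bar>" if "n \<notin> {..<N R}" for n
      proof -
        have "\<lfloor>(R + (m - \<delta>)) / (m - \<delta>)\<rfloor> \<le> int n" using that by (simp add: N_def)
        then have "(R + (m - \<delta>)) / (m - \<delta>) < real n + 1" by linarith
        then have "R < (m - \<delta>) * real n" using \<delta> by (simp add: pos_divide_less_eq algebra_simps)
        from e(2)[OF this] show ?thesis by linarith
      qed
      have a0: "0 \<le> a n" for n using T_nonneg T_le order.trans by blast
      have "\<Phi> R = (\<Sum>n\<in>{..<N R} \<union> {..<M R}. T n R)" by (rule \<Phi>_eq) (use M in auto)
      also have "\<dots> \<le> (\<Sum>n\<in>{..<N R} \<union> {..<M R}. of_bool (n < N R) * a n + of_bool (n < M R) * \<bar>e n\<bar>)"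
      proof (rule sum_mono)
        fix n assume "n \<in> {..<N R} \<union> {..<M R}"
        show "T n R \<le> of_bool (n < N R) * a n + of_bool (n < M R) * \<bar>e n\<bar>"
          using T_le[of n R] N[of n] M[of n] a0[of n] by (cases "n < N R"; cases "n < M R") auto
      qed
      also have "\<dots> = (\<Sum>n\<in>{..<N R} \<union> {..<M R}. of_bool (n < N R) * a n)
          + (\<Sum>n\<in>{..<N R} \<union> {..<M R}. of_bool (n < M R) * \<bar>e n\<bar>)" by (rule sum.distrib)
      also have "(\<Sum>n\<in>{..<N R} \<union> {..<M R}. of_bool (n < N R) * a n) = (\<Sum>n<N R. a n)"
        by (rule sum.mono_neutral_cong_right) auto
      also have "(\<Sum>n\<in>{..<N R} \<union> {..<M R}. of_bool (n < M R) * \<bar>e n\<bar>) = (\<Sum>n<M R. \<bar>e n\<bar>)"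
        by (rule sum.mono_neutral_cong_right) auto
      finally show ?case using elim by (simp add: field_simps)
    qed
    ultimately show ?thesis by auto
  qed
  have lower: "\<exists>u. (u \<longlongrightarrow> L / (m + \<delta>)) at_top \<and> (\<forall>\<^sub>F R in at_top. u R \<le> \<Phi> R / R)"
    if \<delta>: "0 < \<delta>" for \<delta>
  proof -
    obtain e where e: "e \<longlonglongrightarrow> 0" "\<And>n R. (m + \<delta>) * n \<le> R \<Longrightarrow> a n - e n \<le> T n R"
      using T_low[OF \<delta>] by blast
    define N where "N R = nat \<lfloor>(R + 0) / (m + \<delta>)\<rfloor>" for R
    have "(\<lambda>k. a k - e k) \<longlonglongrightarrow> L - 0" by (intro tendsto_intros a e)
    then have "((\<lambda>R. (\<Sum>k<N R. a k - e k) / R) \<longlongrightarrow> (L - 0) / (m + \<delta>)) at_top"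
      unfolding N_def using \<delta> m by (intro cesaro_mean_real) auto
    moreover have "\<forall>\<^sub>F R in at_top. (\<Sum>k<N R. a k - e k) / R \<le> \<Phi> R / R"
      using eventually_gt_at_top[of 0]
    proof eventually_elim
      case (elim R)
      have "(\<Sum>k<N R. a k - e k) \<le> (\<Sum>k<N R. T k R)"
      proof (rule sum_mono)
        fix k assume "k \<in> {..<N R}"
        then have "int k < \<lfloor>R / (m + \<delta>)\<rfloor>" by (simp add: N_def)
        then have "real k < R / (m + \<delta>)" by linarith
        then have "(m + \<delta>) * k \<le> R" using \<delta> m by (simp add: pos_less_divide_eq mult.commute)
        then show "a k - e k \<le> T k R" by (rule e(2))
      qed
      also have "\<dots> \<le> (\<Sum>k\<in>{..<N R} \<union> J R. T k R)"
        by (rule sum_mono2) (use T_nonneg J in auto)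
      also have "\<dots> = \<Phi> R" by (rule \<Phi>_eq[symmetric]) (use J in auto)
      finally show ?case using elim by (simp add: divide_right_mono)
    qed
    ultimately show ?thesis by auto
  qed
  have cont_minus: "((\<lambda>\<delta>. L / (m - \<delta>)) \<longlongrightarrow> L / (m - 0)) (at_right 0)"
    and cont_plus: "((\<lambda>\<delta>. L / (m + \<delta>)) \<longlongrightarrow> L / (m + 0)) (at_right 0)"
    using m by (intro tendsto_divide tendsto_const tendsto_diff tendsto_add tendsto_ident_at; simp)+
  show ?thesis unfolding \<Phi>_def[symmetric]
  proof (rule order_tendstoI)
    fix y assume y: "L / m < y"
    have "\<forall>\<^sub>F \<delta> in at_right 0. L / (m - \<delta>) < y" using cont_minus y by (intro order_tendstoD) auto
    moreover have "\<forall>\<^sub>F \<delta> in at_right 0. \<delta> \<in> {0<..<m}" using m by (rule eventually_at_right_real)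
    ultimately have "\<forall>\<^sub>F \<delta> in at_right 0. L / (m - \<delta>) < y \<and> \<delta> \<in> {0<..<m}" by eventually_elim auto
    then obtain \<delta> where \<delta>: "L / (m - \<delta>) < y" "0 < \<delta>" "\<delta> < m"
      by (auto dest!: eventually_happens' [OF trivial_limit_at_right_real])
    obtain u where u: "(u \<longlongrightarrow> L / (m - \<delta>)) at_top" "\<forall>\<^sub>F R in at_top. \<Phi> R / R \<le> u R"
      using upper[OF \<delta>(2,3)] by blast
    have "\<forall>\<^sub>F R in at_top. u R < y" using u(1) \<delta>(1) by (rule order_tendstoD)
    with u(2) show "\<forall>\<^sub>F R in at_top. \<Phi> R / R < y" by eventually_elim auto
  next
    fix y assume y: "y < L / m"
    have "\<forall>\<^sub>F \<delta> in at_right 0. y < L / (m + \<delta>)" using cont_plus y by (intro order_tendstoD) auto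
    moreover have "\<forall>\<^sub>F \<delta> in at_right 0. \<delta> \<in> {0<..<m}" using m by (rule eventually_at_right_real)
    ultimately have "\<forall>\<^sub>F \<delta> in at_right 0. y < L / (m + \<delta>) \<and> \<delta> \<in> {0<..<m}" by eventually_elim auto
    then obtain \<delta> where \<delta>: "y < L / (m + \<delta>)" "0 < \<delta>"
      by (auto dest!: eventually_happens' [OF trivial_limit_at_right_real])
    obtain u where u: "(u \<longlongrightarrow> L / (m + \<delta>)) at_top" "\<forall>\<^sub>F R in at_top. u R \<le> \<Phi> R / R"
      using lower[OF \<delta>(2)] by blast
    have "\<forall>\<^sub>F R in at_top. y < u R" using u(1) \<delta>(1) by (rule order_tendstoD)
    with u(2) show "\<forall>\<^sub>F R in at_top. y < \<Phi> R / R" by eventually_elim auto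
  qed
qed

text \<open>The n largest values of \<alpha> are compared with a cut-off by the weight w alone.
  Above: in an optimal J at most n indices have weight below 1 / n, and they add at most B'. Below:
  the cut-off at n powr - (1 - \<eta>) keeps at most n indices, since their weights add up to O(log
  n); the loss is a factor 1 - \<eta>, and \<eta> is arbitrary.\<close>

lemma log_mean_rearrangement:
  fixes \<alpha> w g :: "'i \<Rightarrow> real"
  assumes b: "decr_rearrangement I \<alpha> b" and \<alpha>: "\<And>i. i \<in> I \<Longrightarrow> \<alpha> i = w i * g i"
    and w: "\<And>i. i \<in> I \<Longrightarrow> 0 < w i" and g: "\<And>i. i \<in> I \<Longrightarrow> 0 \<le> g i \<and> g i \<le> B"
    and fin_w: "\<And>\<epsilon>. \<epsilon> > 0 \<Longrightarrow> finite {i \<in> I. w i \<ge> \<epsilon>}"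
    and lim: "((\<lambda>R. (\<Sum>i | i \<in> I \<and> w i \<ge> exp (- R). w i * g i) / R) \<longlongrightarrow> c) at_top"
    and lim1: "((\<lambda>R. (\<Sum>i | i \<in> I \<and> w i \<ge> exp (- R). w i) / R) \<longlongrightarrow> c1) at_top"
  shows "(\<lambda>n. 1 / ln (real n) * (\<Sum>m<n. b m)) \<longlonglongrightarrow> c"
proof -
  define \<Phi> where "\<Phi> R = (\<Sum>i | i \<in> I \<and> w i \<ge> exp (- R). w i * g i)" for R
  define \<Psi> where "\<Psi> R = (\<Sum>i | i \<in> I \<and> w i \<ge> exp (- R). w i)" for R
  define B' where "B' = max B 1"
  have B': "B' > 0" "\<And>i. i \<in> I \<Longrightarrow> g i \<le> B'" using g by (fastforce simp: B'_def)+
  have fin: "finite {i \<in> I. \<alpha> i \<ge> \<epsilon>}" if "\<epsilon> > 0" for \<epsilon>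
  proof (rule finite_subset[OF _ fin_w[of "\<epsilon> / B'"]])
    show "{i \<in> I. \<alpha> i \<ge> \<epsilon>} \<subseteq> {i \<in> I. \<epsilon> / B' \<le> w i}"
    proof safe
      fix i assume i: "i \<in> I" "\<epsilon> \<le> \<alpha> i"
      have "w i * g i \<le> w i * B'" using w[OF i(1)] B'(2)[OF i(1)] by (intro mult_left_mono) auto
      then show "\<epsilon> / B' \<le> w i" using i \<alpha> B'(1) by (simp add: field_simps)
    qed
  qed (use that B' in simp)
  have ln_top: "filterlim (\<lambda>n. ln (real n)) at_top sequentially"
    by (rule filterlim_compose[OF ln_at_top filterlim_real_sequentially])
  have upper: "(\<Sum>m<n. b m) \<le> \<Phi> (ln n) + B'" if n: "n \<ge> 1" for n
  proof -
    obtain J where J: "J \<subseteq> I" "finite J" "card J \<le> n" "(\<Sum>m<n. b m) = (\<Sum>i\<in>J. \<alpha> i)"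
      using decr_rearrangement_sum_le[OF b fin] by blast
    have e: "exp (- ln (real n)) = 1 / n" using n by (simp add: exp_minus inverse_eq_divide)
    have "(\<Sum>i\<in>J. \<alpha> i) = (\<Sum>i\<in>J. w i * g i)" using J \<alpha> by (intro sum.cong) auto
    also have "\<dots> = (\<Sum>i\<in>J \<inter> {i. w i \<ge> 1 / n}. w i * g i) + (\<Sum>i\<in>J - {i. w i \<ge> 1 / n}. w i * g i)"
      by (rule sum.Int_Diff[OF J(2)])
    also have "(\<Sum>i\<in>J \<inter> {i. w i \<ge> 1 / n}. w i * g i) \<le> \<Phi> (ln n)"
      unfolding \<Phi>_def e
    proof (rule sum_mono2)
      show "finite {i. i \<in> I \<and> 1 / real n \<le> w i}" using fin_w[of "1 / n"] n by simp
      show "0 \<le> w i * g i" if "i \<in> {i. i \<in> I \<and> 1 / real n \<le> w i} - J \<inter> {i. 1 / real n \<le> w i}" for i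
        using that w[of i] g[of i] by simp
    qed (use J in auto)
    also have "(\<Sum>i\<in>J - {i. w i \<ge> 1 / n}. w i * g i) \<le> of_nat (card (J - {i. w i \<ge> 1 / n})) * (1 / n * B')"
    proof (rule sum_bounded_above)
      fix i assume i: "i \<in> J - {i. w i \<ge> 1 / n}"
      then have "i \<in> I" using J by auto
      then show "w i * g i \<le> 1 / n * B'"
        using w[of i] g[of i] B'(2)[of i] i by (intro mult_mono) auto
    qed
    also have "\<dots> \<le> of_nat n * (1 / n * B')"
    proof (rule mult_right_mono)
      have "card (J - {i. w i \<ge> 1 / n}) \<le> card J" using J by (intro card_mono) auto
      then show "real (card (J - {i. w i \<ge> 1 / n})) \<le> real n" using J by linarith
    qed (use B' in simp)
    also have "\<dots> = B'" using n by simp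
    finally show ?thesis using J by simp
  qed
  have lower: "\<forall>\<^sub>F n in sequentially. \<Phi> ((1 - \<eta>) * ln n) \<le> (\<Sum>m<n. b m)" if \<eta>: "0 < \<eta>" "\<eta> < 1" for \<eta>
  proof -
    define R where "R n = (1 - \<eta>) * ln (real n)" for n :: nat
    have R_top: "filterlim R at_top sequentially"
      unfolding R_def using \<eta> by (intro filterlim_tendsto_pos_mult_at_top[OF tendsto_const _ ln_top]) auto
    have "(\<lambda>n. \<Psi> (R n) / R n) \<longlonglongrightarrow> c1"
      using filterlim_compose[OF lim1 R_top] by (simp add: \<Psi>_def)
    then have ev1: "\<forall>\<^sub>F n in sequentially. \<Psi> (R n) / R n < c1 + 1" by (rule order_tendstoD) simp
    \<comment> \<open>This sequence bounds the number of retained indices divided by n: the gain n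
      powr - \<eta> beats the logarithm coming from their total weight.\<close>
    have "(\<lambda>n. (c1 + 1) * (1 - \<eta>) * (ln (real n) / real n powr \<eta>)) \<longlonglongrightarrow> (c1 + 1) * (1 - \<eta>) * 0"
      by (intro tendsto_intros lim_ln_over_power \<eta>)
    then have ev2: "\<forall>\<^sub>F n in sequentially. (c1 + 1) * (1 - \<eta>) * (ln (real n) / real n powr \<eta>) < 1"
      by (rule order_tendstoD) simp
    have ev3: "\<forall>\<^sub>F n in sequentially. R n > 0"
      using R_top unfolding filterlim_at_top_dense by blast
    show ?thesis
      using ev1 ev2 ev3 eventually_ge_at_top[of 1]
    proof eventually_elim
      case (elim n)
      define J where "J = {i. i \<in> I \<and> w i \<ge> exp (- R n)}"
      have J: "finite J" using fin_w[of "exp (- R n)"] by (simp add: J_def)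
      have "exp (- R n) * card J \<le> (\<Sum>i\<in>J. w i)"
        using sum_bounded_below[of J "exp (- R n)" w] by (simp add: J_def mult.commute)
      also have "\<dots> = \<Psi> (R n)" by (simp add: \<Psi>_def J_def)
      also have "\<dots> \<le> (c1 + 1) * R n" using elim by (simp add: pos_divide_less_eq)
      finally have "card J \<le> exp (R n) * ((c1 + 1) * R n)"
        by (simp add: exp_minus field_simps)
      also have "exp (R n) = n / n powr \<eta>"
        using elim by (simp add: R_def powr_def algebra_simps exp_diff)
      also have "n / n powr \<eta> * ((c1 + 1) * R n) = n * ((c1 + 1) * (1 - \<eta>) * (ln (real n) / real n powr \<eta>))"
        by (simp add: R_def)
      also have "\<dots> \<le> real n * 1" using elim by (intro mult_left_mono) auto
      finally have "card J \<le> n" by simp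
      have "\<Phi> (R n) = (\<Sum>i\<in>J. \<alpha> i)" unfolding \<Phi>_def J_def by (intro sum.cong) (auto simp: \<alpha>)
      also have "\<dots> \<le> (\<Sum>m<n. b m)"
        by (rule sum_le_decr_rearrangement[OF b fin _ J \<open>card J \<le> n\<close>]) (auto simp: J_def)
      finally show ?case by (simp add: R_def)
    qed
  qed
  have lim_\<Phi>: "((\<lambda>R. \<Phi> R / R) \<longlongrightarrow> c) at_top" using lim by (simp add: \<Phi>_def)
  show ?thesis
  proof (rule order_tendstoI)
    fix y assume y: "c < y"
    have "(\<lambda>n. \<Phi> (ln (real n)) / ln n + B' * inverse (ln (real n))) \<longlonglongrightarrow> c + B' * 0"
      by (intro tendsto_intros filterlim_compose[OF lim_\<Phi> ln_top] tendsto_inverse_0_at_top[OF ln_top])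
    then have "\<forall>\<^sub>F n in sequentially. \<Phi> (ln (real n)) / ln n + B' * inverse (ln (real n)) < y"
      by (rule order_tendstoD) (use y in simp)
    then show "\<forall>\<^sub>F n in sequentially. 1 / ln (real n) * (\<Sum>m<n. b m) < y"
      using eventually_ge_at_top[of 2]
    proof eventually_elim
      case (elim n)
      have "(\<Sum>m<n. b m) / ln (real n) \<le> (\<Phi> (ln n) + B') / ln n"
        using upper[of n] elim by (intro divide_right_mono) auto
      moreover have "(\<Phi> (ln n) + B') / ln n = \<Phi> (ln n) / ln n + B' * inverse (ln (real n))"
        by (simp add: divide_inverse ring_distribs)
      ultimately have "(\<Sum>m<n. b m) / ln (real n) < y" using elim by linarith
      then show ?case by simp
    qed
  next
    fix y assume y: "y < c"
    have "((\<lambda>\<eta>. (1 - \<eta>) * c) \<longlongrightarrow> (1 - 0) * c) (at_right 0)" by (intro tendsto_intros)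
    then have "\<forall>\<^sub>F \<eta> in at_right 0. y < (1 - \<eta>) * c" by (rule order_tendstoD) (use y in simp)
    moreover have "\<forall>\<^sub>F \<eta> in at_right 0. \<eta> \<in> {0<..<1::real}" by (rule eventually_at_right_real) simp
    ultimately have "\<forall>\<^sub>F \<eta> in at_right 0. y < (1 - \<eta>) * c \<and> \<eta> \<in> {0<..<1}" by eventually_elim auto
    then obtain \<eta> where \<eta>: "y < (1 - \<eta>) * c" "0 < \<eta>" "\<eta> < 1"
      by (auto dest!: eventually_happens' [OF trivial_limit_at_right_real])
    have R_top: "filterlim (\<lambda>n. (1 - \<eta>) * ln (real n)) at_top sequentially"
      using \<eta> by (intro filterlim_tendsto_pos_mult_at_top[OF tendsto_const _ ln_top]) auto
    have "(\<lambda>n. (1 - \<eta>) * (\<Phi> ((1 - \<eta>) * ln (real n)) / ((1 - \<eta>) * ln (real n)))) \<longlonglongrightarrow> (1 - \<eta>) * c"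
      by (intro tendsto_intros filterlim_compose[OF lim_\<Phi> R_top])
    then have "\<forall>\<^sub>F n in sequentially. y < (1 - \<eta>) * (\<Phi> ((1 - \<eta>) * ln (real n)) / ((1 - \<eta>) * ln (real n)))"
      by (rule order_tendstoD) (use \<eta> in simp)
    then show "\<forall>\<^sub>F n in sequentially. y < 1 / ln (real n) * (\<Sum>m<n. b m)"
      using lower[OF \<eta>(2,3)] eventually_ge_at_top[of 2]
    proof eventually_elim
      case (elim n)
      have "y < \<Phi> ((1 - \<eta>) * ln (real n)) / ln (real n)" using elim \<eta> by simp
      also have "\<dots> \<le> (\<Sum>m<n. b m) / ln (real n)" using elim by (intro divide_right_mono) auto
      finally show ?case by simp
    qed
  qed
qed

section \<open>Words completed by prescribed tails\<close>

lemma finite_words: "finite (words A n :: 'k::finite list set)"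
  by (rule finite_subset[OF _ finite_lists_length_eq[of UNIV n]]) (auto simp: words_def)

lemma words_conc_iff:
  assumes w: "w \<noteq> []"
  shows "w \<frown> t \<in> subshift A \<longleftrightarrow> w \<in> words A (length w) \<and> [last w] \<frown> t \<in> subshift A"
proof
  assume wt: "w \<frown> t \<in> subshift A"
  have "A $ (w ! m) $ (w ! Suc m) = 1" if "Suc m < length w" for m
  proof -
    have "A $ (w \<frown> t) m $ (w \<frown> t) (Suc m) = 1" using wt by (simp only: subshift_def mem_Collect_eq)
    then show ?thesis using that by simp
  qed
  moreover have "butlast w \<frown> ([last w] \<frown> t) = w \<frown> t"
    by (simp only: conc_conc append_butlast_last_id[OF w])
  then have "[last w] \<frown> t \<in> subshift A" using wt by (metis subshift_conc_suffix)
  ultimately show "w \<in> words A (length w) \<and> [last w] \<frown> t \<in> subshift A"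
    by (simp add: words_def)
next
  assume *: "w \<in> words A (length w) \<and> [last w] \<frown> t \<in> subshift A"
  then have t: "A $ last w $ t 0 = 1" "t \<in> subshift A" using subshift_Cons_iff by blast+
  show "w \<frown> t \<in> subshift A"
    unfolding subshift_def
  proof safe
    fix n
    consider "Suc n < length w" | "Suc n = length w" | "length w \<le> n" by linarith
    then show "A $ (w \<frown> t) n $ (w \<frown> t) (Suc n) = 1"
    proof cases
      case 1
      then show ?thesis using * by (simp add: words_def)
    next
      case 2
      then have "w ! n = last w" using w by (simp add: last_conv_nth flip: 2)
      then show ?thesis using 2 t by (simp add: conc_def)
    next
      case 3
      then show ?thesis using t(2) by (simp add: conc_def subshift_def Suc_diff_le)
    qed
  qed
qed

locale based_subshift = normalized_subshift A h K \<theta>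
  for A :: "nat^'k::finite^'k" and h K \<theta> +
  fixes x :: "'k \<Rightarrow> nat \<Rightarrow> 'k"
  assumes x: "[j] \<frown> x j \<in> subshift A"
begin

definition ext :: "'k list \<Rightarrow> nat \<Rightarrow> 'k" where "ext w = w \<frown> x (last w)"

definition wt :: "'k list \<Rightarrow> real" where "wt w = exp (- S (length w) (ext w))"

definition Wsum :: "nat \<Rightarrow> ((nat \<Rightarrow> 'k) \<Rightarrow> real) \<Rightarrow> real" where
  "Wsum n F = (\<Sum>w\<in>words A n. wt w * F (ext w))"

text \<open>The double sum in c_\<phi>: among the preimages of x^j the indicator of p([j]) retains
  just j x^j (\<open>c_const_eq\<close>).\<close>

definition C1 :: real where "C1 = (\<Sum>j\<in>UNIV. exp (- h ([j] \<frown> x j)))"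

lemma x_in: "x j \<in> \<Sigma>"
  using x[of j] subshift_Cons_iff by blast

lemma words_iff: "n \<ge> 1 \<Longrightarrow> w \<in> words A n \<longleftrightarrow> length w = n \<and> ext w \<in> \<Sigma>"
proof -
  assume "n \<ge> 1"
  then have "w \<noteq> []" if "length w = n" using that by auto
  moreover have "length w = n" if "w \<in> words A n" using that by (simp add: words_def)
  ultimately show ?thesis using words_conc_iff[of w "x (last w)" A] x by (auto simp: ext_def)
qed

lemma wt_pos: "0 < wt w" by (simp add: wt_def)

text \<open>The last letter takes one step of the Birkhoff sum with it, so words of length
  \<open>Suc m\<close> meet \<open>Lop m\<close>; the word-dependent tail is traded for finitely
  many base points.\<close>

lemma Wsum_Suc: "Wsum (Suc m) F = (\<Sum>j\<in>UNIV. exp (- h ([j] \<frown> x j)) * Lop m F ([j] \<frown> x j))"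
proof -
  let ?f = "\<lambda>w. wt w * F (ext w)"
  have bij: "bij_betw (\<lambda>(j, v). v @ [j]) (Sigma UNIV (\<lambda>j. pre m ([j] \<frown> x j))) (words A (Suc m))"
  proof (rule bij_betwI[where g = "\<lambda>w. (last w, butlast w)"])
    show "(\<lambda>(j, v). v @ [j]) \<in> (SIGMA j:UNIV. pre m ([j] \<frown> x j)) \<rightarrow> words A (Suc m)"
      by (auto simp: words_iff pre_def ext_def)
    show "(\<lambda>w. (last w, butlast w)) \<in> words A (Suc m) \<rightarrow> (SIGMA j:UNIV. pre m ([j] \<frown> x j))"
    proof
      fix w assume w: "w \<in> words A (Suc m)"
      then have "w \<noteq> []" by (auto simp: words_def)
      then have "butlast w \<frown> ([last w] \<frown> x (last w)) = ext w"
        unfolding ext_def by (simp only: conc_conc append_butlast_last_id[OF \<open>w \<noteq> []\<close>])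
      then show "(last w, butlast w) \<in> (SIGMA j:UNIV. pre m ([j] \<frown> x j))"
        using w by (simp add: words_iff pre_def del: conc_conc build_cons)
    qed
  qed (auto simp: words_def intro!: append_butlast_last_id)
  have "Wsum (Suc m) F = (\<Sum>q\<in>(SIGMA j:UNIV. pre m ([j] \<frown> x j)). ?f ((\<lambda>(j, v). v @ [j]) q))"
    unfolding Wsum_def by (rule sum.reindex_bij_betw[OF bij, symmetric])
  also have "\<dots> = (\<Sum>j\<in>UNIV. \<Sum>v\<in>pre m ([j] \<frown> x j). ?f (v @ [j]))"
    by (subst sum.Sigma) (auto simp: finite_pre case_prod_unfold)
  also have "\<dots> = (\<Sum>j\<in>UNIV. \<Sum>v\<in>pre m ([j] \<frown> x j).
      exp (- h ([j] \<frown> x j)) * (exp (- S m (v \<frown> [j] \<frown> x j)) * F (v \<frown> [j] \<frown> x j)))"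
  proof (intro sum.cong refl)
    fix j v assume v: "v \<in> pre m ([j] \<frown> x j)"
    have e: "ext (v @ [j]) = v \<frown> [j] \<frown> x j" by (simp add: ext_def)
    have "S (m + 1) (v \<frown> [j] \<frown> x j) = S m (v \<frown> [j] \<frown> x j) + S 1 ([j] \<frown> x j)"
      by (simp only: S_add pre_suffix[OF v])
    moreover have "S 1 ([j] \<frown> x j) = h ([j] \<frown> x j)" by (simp add: S_def)
    moreover have "length (v @ [j]) = m + 1" using v by (simp add: pre_def)
    ultimately have "wt (v @ [j]) = exp (- h ([j] \<frown> x j)) * exp (- S m (v \<frown> [j] \<frown> x j))"
      unfolding wt_def e by (simp only: minus_add exp_add mult.commute minus_add_distrib)
    then show "?f (v @ [j]) = exp (- h ([j] \<frown> x j)) * (exp (- S m (v \<frown> [j] \<frown> x j)) * F (v \<frown> [j] \<frown> x j))"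
      by (simp only: e mult.assoc)
  qed
  also have "\<dots> = (\<Sum>j\<in>UNIV. exp (- h ([j] \<frown> x j)) * Lop m F ([j] \<frown> x j))"
    unfolding Lop_def by (simp only: sum_distrib_left)
  finally show ?thesis .
qed

lemma Wsum_tendsto:
  assumes "unif F" shows "(\<lambda>n. Wsum n F) \<longlonglongrightarrow> C1 * Lim F"
proof -
  have "(\<lambda>m. Wsum (Suc m) F) \<longlonglongrightarrow> (\<Sum>j\<in>UNIV. exp (- h ([j] \<frown> x j)) * Lim F)"
    unfolding Wsum_Suc by (intro tendsto_sum tendsto_mult_left Lop_tendsto assms x)
  then show ?thesis
    unfolding C1_def sum_distrib_right by (rule LIMSEQ_imp_Suc)
qed

text \<open>The words with last letter j are among those that may precede x j. Unlike
  \<open>Wsum_Suc\<close>, this keeps the length n, so that it combines with the law of large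
  numbers for \<open>S n\<close>.\<close>

lemma Wsum_le_Lop:
  assumes n: "n \<ge> 1" and F: "\<And>u. u \<in> \<Sigma> \<Longrightarrow> 0 \<le> F u"
  shows "Wsum n F \<le> (\<Sum>j\<in>UNIV. Lop n F (x j))"
proof -
  have "Wsum n F = (\<Sum>j\<in>UNIV. \<Sum>w | w \<in> words A n \<and> last w = j. wt w * F (ext w))"
    unfolding Wsum_def by (rule sum.group[symmetric]) (auto simp: finite_words)
  also have "\<dots> \<le> (\<Sum>j\<in>UNIV. Lop n F (x j))"
  proof (rule sum_mono)
    fix j
    have "(\<Sum>w | w \<in> words A n \<and> last w = j. wt w * F (ext w))
        = (\<Sum>w | w \<in> words A n \<and> last w = j. exp (- S n (w \<frown> x j)) * F (w \<frown> x j))"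
      using n by (intro sum.cong) (auto simp: wt_def ext_def words_iff)
    also have "\<dots> \<le> Lop n F (x j)"
      unfolding Lop_def
    proof (rule sum_mono2[OF finite_pre])
      show "{w \<in> words A n. last w = j} \<subseteq> pre n (x j)"
        using n by (auto simp: words_iff pre_def ext_def)
    qed (use F in \<open>auto dest: pre_memD\<close>)
    finally show "(\<Sum>w | w \<in> words A n \<and> last w = j. wt w * F (ext w)) \<le> Lop n F (x j)" .
  qed
  finally show ?thesis .
qed

lemma Wsum_one_le: "n \<ge> 1 \<Longrightarrow> Wsum n (\<lambda>_. 1) \<le> CARD('k)"
  using Wsum_le_Lop[of n "\<lambda>_. 1"] by (simp add: Lop_one[OF x_in])

text \<open>Linear growth of S turns a lower bound on the weight into an upper bound on the
  length.\<close>

lemma finite_wt_ge: "\<epsilon> > 0 \<Longrightarrow> finite {w \<in> all_words A. wt w \<ge> \<epsilon>}"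
proof -
  assume \<epsilon>: "\<epsilon> > 0"
  obtain c C where c: "c > 0" "\<And>n s. s \<in> \<Sigma> \<Longrightarrow> c * real n - C \<le> S n s"
    using S_linear_lower_bound by blast
  obtain N :: nat where N: "real N > (C - ln \<epsilon>) / c" using reals_Archimedean2 by blast
  have "{w \<in> all_words A. wt w \<ge> \<epsilon>} \<subseteq> (\<Union>n\<le>N. words A n)"
  proof safe
    fix w assume w: "w \<in> all_words A" "\<epsilon> \<le> wt w"
    then obtain n where n: "n \<ge> 1" "w \<in> words A n" by (auto simp: all_words_def)
    then have len: "length w = n" "ext w \<in> \<Sigma>" by (auto simp: words_iff)
    have "ln \<epsilon> \<le> ln (wt w)" using w(2) \<epsilon> by simp
    then have "ln \<epsilon> \<le> - S n (ext w)" by (simp add: wt_def len)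
    then have "c * real n \<le> C - ln \<epsilon>" using c(2)[OF len(2), of n] by simp
    then have "real n \<le> (C - ln \<epsilon>) / c" using c(1) by (simp add: field_simps)
    then have "n \<le> N" using N by linarith
    then show "w \<in> (\<Union>n\<le>N. words A n)" using n by auto
  qed
  then show ?thesis by (rule finite_subset) (auto simp: finite_words)
qed

text \<open>An instance of \<open>renewal_limit\<close>: the masses of the words of length n, those
  of the words with S at most R, and as error B times the mass of the words violating the law of
  large numbers. G allows for values of a function along other tails than x, which approach F as the
  length grows.\<close>

lemma all_words_mass:
  fixes F :: "(nat \<Rightarrow> 'k) \<Rightarrow> real" and G :: "'k list \<Rightarrow> real"
  assumes F: "unif F" and G: "\<And>w. w \<in> all_words A \<Longrightarrow> 0 \<le> G w \<and> G w \<le> B"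
    and GF: "\<And>\<epsilon>. \<epsilon> > 0 \<Longrightarrow> \<exists>n0. \<forall>n\<ge>n0. \<forall>w\<in>words A n. \<bar>G w - F (ext w)\<bar> \<le> \<epsilon>"
  shows "((\<lambda>R. (\<Sum>w | w \<in> all_words A \<and> wt w \<ge> exp (- R). wt w * G w) / R)
          \<longlongrightarrow> C1 * Lim F / Lim h) at_top"
proof -
  obtain c C where c: "c > 0" "\<And>n s. s \<in> \<Sigma> \<Longrightarrow> c * real n - C \<le> S n s"
    using S_linear_lower_bound by blast
  \<comment> \<open>\<open>all_words\<close> begins with length 1, hence the value 0 at n =
    0.\<close>
  define a where "a n = (if n = 0 then 0 else \<Sum>w\<in>words A n. wt w * G w)" for n
  define T where "T n R = (if n = 0 then 0 else \<Sum>w | w \<in> words A n \<and> S n (ext w) \<le> R. wt w * G w)" for n R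
  define J where "J R = {n. c * real n - C \<le> R}" for R
  define P where "P \<delta> n = Wsum n (\<lambda>u. of_bool (\<bar>S n u - n * Lim h\<bar> > \<delta> * n))" for \<delta> :: real and n
  have finJ: "finite (J R)" for R
  proof (rule finite_subset)
    show "J R \<subseteq> {..nat \<lceil>(R + C) / c\<rceil>}"
    proof
      fix n assume "n \<in> J R"
      then have "real n \<le> (R + C) / c" using c(1) by (simp add: J_def field_simps)
      then show "n \<in> {..nat \<lceil>(R + C) / c\<rceil>}" by (simp add: le_nat_iff) linarith
    qed
  qed simp
  have B0: "0 \<le> B"
  proof -
    have "[undefined] \<in> words A 1" by (simp add: words_def)
    then have "[undefined] \<in> all_words A" by (auto simp: all_words_def)
    from G[OF this] show ?thesis by linarith
  qed
  have G': "0 \<le> G w \<and> G w \<le> B" if "w \<in> words A n" "n \<noteq> 0" for w n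
    using that by (intro G) (force simp: all_words_def)
  have nonneg: "0 \<le> wt w * G w" if "w \<in> words A n" "n \<noteq> 0" for w n
    using G'[OF that] wt_pos[of w] by simp
  have a_lim: "a \<longlonglongrightarrow> C1 * Lim F"
  proof -
    have "(\<lambda>n. a n - Wsum n F) \<longlonglongrightarrow> 0"
    proof (rule LIMSEQ_I)
      fix \<epsilon> :: real assume "0 < \<epsilon>"
      define \<epsilon>' where "\<epsilon>' = \<epsilon> / (2 * CARD('k))"
      have "\<epsilon>' > 0" using \<open>0 < \<epsilon>\<close> by (simp add: \<epsilon>'_def)
      then obtain n0 where n0: "\<And>n w. n \<ge> n0 \<Longrightarrow> w \<in> words A n \<Longrightarrow> \<bar>G w - F (ext w)\<bar> \<le> \<epsilon>'"
        using GF by metis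
      have "norm (a n - Wsum n F - 0) < \<epsilon>" if n: "n \<ge> max 1 n0" for n
      proof -
        have "\<bar>a n - Wsum n F\<bar> = \<bar>\<Sum>w\<in>words A n. wt w * (G w - F (ext w))\<bar>"
          using n by (simp add: a_def Wsum_def sum_subtractf right_diff_distrib)
        also have "\<dots> \<le> (\<Sum>w\<in>words A n. \<bar>wt w * (G w - F (ext w))\<bar>)" by (rule sum_abs)
        also have "\<dots> \<le> (\<Sum>w\<in>words A n. wt w * \<epsilon>')"
        proof (rule sum_mono)
          fix w assume "w \<in> words A n"
          then show "\<bar>wt w * (G w - F (ext w))\<bar> \<le> wt w * \<epsilon>'"
            using n0[of n w] n wt_pos[of w] by (simp add: abs_mult)
        qed
        also have "\<dots> = \<epsilon>' * Wsum n (\<lambda>_. 1)" by (simp add: Wsum_def sum_distrib_left mult.commute)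
        also have "\<dots> \<le> \<epsilon>' * CARD('k)"
          using Wsum_one_le[of n] n \<open>\<epsilon>' > 0\<close> by (intro mult_left_mono) auto
        also have "\<dots> < \<epsilon>" using \<open>0 < \<epsilon>\<close> by (simp add: \<epsilon>'_def)
        finally show ?thesis by simp
      qed
      then show "\<exists>n0. \<forall>n\<ge>n0. norm (a n - Wsum n F - 0) < \<epsilon>" by blast
    qed
    from tendsto_add[OF this Wsum_tendsto[OF F]] show ?thesis by simp
  qed
  have P_lim: "P \<delta> \<longlonglongrightarrow> 0" if \<delta>: "\<delta> > 0" for \<delta>
  proof (rule LIMSEQ_I)
    fix \<epsilon> :: real assume "0 < \<epsilon>"
    define \<epsilon>' where "\<epsilon>' = \<epsilon> / (2 * CARD('k))"
    have "\<epsilon>' > 0" using \<open>0 < \<epsilon>\<close> by (simp add: \<epsilon>'_def)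
    then obtain n0 where n0: "\<And>n s. n \<ge> n0 \<Longrightarrow> s \<in> \<Sigma> \<Longrightarrow>
        Lop n (\<lambda>u. of_bool (\<bar>S n u - n * Lim h\<bar> > \<delta> * n)) s \<le> \<epsilon>'"
      using Lop_weak_law[OF \<delta>] by metis
    have "norm (P \<delta> n - 0) < \<epsilon>" if n: "n \<ge> max 1 n0" for n
    proof -
      have "0 \<le> P \<delta> n" unfolding P_def Wsum_def using wt_pos by (intro sum_nonneg) (simp add: less_imp_le)
      have "P \<delta> n \<le> (\<Sum>j\<in>UNIV. Lop n (\<lambda>u. of_bool (\<bar>S n u - n * Lim h\<bar> > \<delta> * n)) (x j))"
        unfolding P_def using n by (intro Wsum_le_Lop) auto
      also have "\<dots> \<le> (\<Sum>j\<in>(UNIV :: 'k set). \<epsilon>')" using n by (intro sum_mono n0 x_in) auto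
      also have "\<dots> < \<epsilon>" using \<open>0 < \<epsilon>\<close> by (simp add: \<epsilon>'_def)
      finally show ?thesis using \<open>0 \<le> P \<delta> n\<close> by simp
    qed
    then show "\<exists>n0. \<forall>n\<ge>n0. norm (P \<delta> n - 0) < \<epsilon>" by blast
  qed
  have bound: "(\<Sum>w | w \<in> words A n \<and> Q w. wt w * G w) \<le> B * P \<delta> n"
    if n: "n \<noteq> 0" and Q: "\<And>w. w \<in> words A n \<Longrightarrow> Q w \<Longrightarrow> \<bar>S n (ext w) - n * Lim h\<bar> > \<delta> * n" for n \<delta> Q
  proof -
    have "(\<Sum>w | w \<in> words A n \<and> Q w. wt w * G w)
        \<le> (\<Sum>w | w \<in> words A n \<and> Q w. B * (wt w * of_bool (\<bar>S n (ext w) - n * Lim h\<bar> > \<delta> * n)))"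
    proof (rule sum_mono)
      fix w assume w: "w \<in> {w. w \<in> words A n \<and> Q w}"
      then show "wt w * G w \<le> B * (wt w * of_bool (\<bar>S n (ext w) - n * Lim h\<bar> > \<delta> * n))"
        using G'[of w n] n Q[of w] wt_pos[of w] by simp
    qed
    also have "\<dots> \<le> (\<Sum>w\<in>words A n. B * (wt w * of_bool (\<bar>S n (ext w) - n * Lim h\<bar> > \<delta> * n)))"
      by (rule sum_mono2) (use B0 wt_pos in \<open>auto simp: finite_words less_imp_le\<close>)
    also have "\<dots> = B * P \<delta> n" by (simp add: P_def Wsum_def sum_distrib_left)
    finally show ?thesis .
  qed
  have main: "((\<lambda>R. (\<Sum>n\<in>J R. T n R) / R) \<longlongrightarrow> C1 * Lim F / Lim h) at_top"
  proof (rule renewal_limit[OF a_lim Lim_h_pos c(1)])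
    show "0 \<le> T n R" for n R using nonneg by (auto simp: T_def intro!: sum_nonneg)
    show "T n R \<le> a n" for n R
      using nonneg by (auto simp: T_def a_def finite_words intro!: sum_mono2)
    show zero: "T n R = 0" if "R < c * real n - C" for n R
    proof (cases "n = 0")
      case False
      then have "\<not> S n (ext w) \<le> R" if "w \<in> words A n" for w
        using c(2)[of "ext w" n] that \<open>R < c * real n - C\<close> by (simp add: words_iff)
      then show ?thesis by (auto simp: T_def intro!: sum.neutral)
    qed (simp add: T_def)
    show "T n R = 0" if "n \<notin> J R" for n R using that by (intro zero) (simp add: J_def)
    show "finite (J R)" for R by (rule finJ)
    fix \<delta> :: real assume \<delta>: "\<delta> > 0"
    show "\<exists>e. e \<longlonglongrightarrow> 0 \<and> (\<forall>n R. (Lim h + \<delta>) * real n \<le> R \<longrightarrow> a n - e n \<le> T n R)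
        \<and> (\<forall>n R. R < (Lim h - \<delta>) * real n \<longrightarrow> T n R \<le> e n)"
    proof (intro exI[of _ "\<lambda>n. B * P \<delta> n"] conjI allI impI)
      show "(\<lambda>n. B * P \<delta> n) \<longlonglongrightarrow> 0" using tendsto_mult_left[OF P_lim[OF \<delta>], of B] by simp
      have P0: "0 \<le> B * P \<delta> n" for n
        unfolding P_def Wsum_def using B0 wt_pos by (intro mult_nonneg_nonneg sum_nonneg) (auto simp: less_imp_le)
      fix n R
      {
        assume R: "(Lim h + \<delta>) * real n \<le> R"
        show "a n - B * P \<delta> n \<le> T n R"
        proof (cases "n = 0")
          case False
          have "a n - T n R = (\<Sum>w | w \<in> words A n \<and> \<not> S n (ext w) \<le> R. wt w * G w)"
          proof -
            have "{w \<in> words A n. \<not> S n (ext w) \<le> R} = words A n - {w \<in> words A n. S n (ext w) \<le> R}" by auto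
            then show ?thesis using False by (simp add: a_def T_def sum_diff finite_words)
          qed
          also have "\<dots> \<le> B * P \<delta> n"
            using R False by (intro bound) (auto simp: algebra_simps)
          finally show ?thesis by simp
        qed (use P0[of 0] in \<open>simp add: a_def T_def\<close>)
      next
        assume R: "R < (Lim h - \<delta>) * real n"
        show "T n R \<le> B * P \<delta> n"
        proof (cases "n = 0")
          case False
          then show ?thesis unfolding T_def
            using R by (simp, intro bound) (auto simp: algebra_simps)
        qed (use P0[of 0] in \<open>simp add: T_def\<close>)
      }
    qed
  qed
  have "(\<Sum>w | w \<in> all_words A \<and> wt w \<ge> exp (- R). wt w * G w) = (\<Sum>n\<in>J R. T n R)" for R
  proof -
    have eq: "{w. w \<in> all_words A \<and> wt w \<ge> exp (- R)}
        = (\<Union>n\<in>J R - {0}. {w. w \<in> words A n \<and> S n (ext w) \<le> R})"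
    proof (intro set_eqI iffI)
      fix w assume "w \<in> {w. w \<in> all_words A \<and> wt w \<ge> exp (- R)}"
      then have w: "w \<in> all_words A" "wt w \<ge> exp (- R)" by auto
      then obtain n where n: "n \<ge> 1" "w \<in> words A n" by (auto simp: all_words_def)
      then have len: "length w = n" "ext w \<in> \<Sigma>" by (auto simp: words_iff)
      have le: "S n (ext w) \<le> R" using w len by (simp add: wt_def)
      then have "n \<in> J R - {0}" using c(2)[OF len(2), of n] n by (simp add: J_def)
      then show "w \<in> (\<Union>n\<in>J R - {0}. {w. w \<in> words A n \<and> S n (ext w) \<le> R})" using n le by auto
    next
      fix w assume "w \<in> (\<Union>n\<in>J R - {0}. {w. w \<in> words A n \<and> S n (ext w) \<le> R})"
      then obtain n where w: "w \<in> words A n" "S n (ext w) \<le> R" and n: "n \<noteq> 0" by auto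
      have "w \<in> all_words A" using w n by (force simp: all_words_def)
      moreover have "wt w \<ge> exp (- R)" using w by (simp add: wt_def words_def)
      ultimately show "w \<in> {w. w \<in> all_words A \<and> wt w \<ge> exp (- R)}" by simp
    qed
    have "(\<Sum>w | w \<in> all_words A \<and> wt w \<ge> exp (- R). wt w * G w)
        = (\<Sum>n\<in>J R - {0}. \<Sum>w | w \<in> words A n \<and> S n (ext w) \<le> R. wt w * G w)"
      unfolding eq
    proof (rule sum.UNION_disjoint)
      have "length w = n" if "w \<in> words A n" for w n using that by (simp add: words_def)
      then show "\<forall>n\<in>J R - {0}. \<forall>k\<in>J R - {0}. n \<noteq> k \<longrightarrow>
          {w. w \<in> words A n \<and> S n (ext w) \<le> R} \<inter> {w. w \<in> words A k \<and> S k (ext w) \<le> R} = {}"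
        by blast
    qed (use finJ in \<open>auto simp: finite_words\<close>)
    also have "\<dots> = (\<Sum>n\<in>J R - {0}. T n R)" by (intro sum.cong) (auto simp: T_def)
    also have "\<dots> = (\<Sum>n\<in>J R. T n R)" by (rule sum.mono_neutral_left) (auto simp: finJ T_def)
    finally show ?thesis .
  qed
  then show ?thesis using main by simp
qed

text \<open>Each summand contributes the same limit, which doubles the constant. The limit with 1 in
  place of G is the counting estimate that \<open>log_mean_rearrangement\<close> asks for.\<close>

lemma log_mean_words:
  fixes F :: "(nat \<Rightarrow> 'k) \<Rightarrow> real" and G :: "'k list + 'k list \<Rightarrow> real"
  defines "I \<equiv> all_words A <+> all_words A"
  assumes F: "unif F" and G: "\<And>i. i \<in> I \<Longrightarrow> 0 \<le> G i \<and> G i \<le> B"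
    and G1: "\<And>\<epsilon>. \<epsilon> > 0 \<Longrightarrow> \<exists>n0. \<forall>n\<ge>n0. \<forall>w\<in>words A n. \<bar>G (Inl w) - F (ext w)\<bar> \<le> \<epsilon>"
    and G2: "\<And>\<epsilon>. \<epsilon> > 0 \<Longrightarrow> \<exists>n0. \<forall>n\<ge>n0. \<forall>w\<in>words A n. \<bar>G (Inr w) - F (ext w)\<bar> \<le> \<epsilon>"
    and b: "decr_rearrangement I \<alpha> b"
    and \<alpha>: "\<And>i. i \<in> I \<Longrightarrow> \<alpha> i = case_sum wt wt i * G i"
  shows "(\<lambda>n. 1 / ln (real n) * (\<Sum>m<n. b m)) \<longlonglongrightarrow> 2 * C1 * Lim F / Lim h"
proof (rule log_mean_rearrangement[OF b \<alpha> _ G])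
  have split: "{i. i \<in> I \<and> case_sum wt wt i \<ge> e}
      = {w. w \<in> all_words A \<and> wt w \<ge> e} <+> {w. w \<in> all_words A \<and> wt w \<ge> e}" for e
    by (auto simp: I_def)
  show "0 < case_sum wt wt i" for i by (cases i) (auto simp: wt_pos)
  show fin: "finite {i \<in> I. case_sum wt wt i \<ge> \<epsilon>}" if "\<epsilon> > 0" for \<epsilon>
    unfolding split using finite_wt_ge[OF that] by simp
  have sum_split: "(\<Sum>i | i \<in> I \<and> case_sum wt wt i \<ge> exp (- R). case_sum wt wt i * G' i)
      = (\<Sum>w | w \<in> all_words A \<and> wt w \<ge> exp (- R). wt w * G' (Inl w))
        + (\<Sum>w | w \<in> all_words A \<and> wt w \<ge> exp (- R). wt w * G' (Inr w))" for R G'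
    unfolding split using finite_wt_ge[of "exp (- R)"] by (subst sum.Plus) auto
  have "((\<lambda>R. (\<Sum>w | w \<in> all_words A \<and> wt w \<ge> exp (- R). wt w * G (Inl w)) / R
      + (\<Sum>w | w \<in> all_words A \<and> wt w \<ge> exp (- R). wt w * G (Inr w)) / R)
      \<longlongrightarrow> C1 * Lim F / Lim h + C1 * Lim F / Lim h) at_top"
    by (intro tendsto_add all_words_mass[OF F _ G1, where B = B] all_words_mass[OF F _ G2, where B = B] G)
      (auto simp: I_def)
  then show "((\<lambda>R. (\<Sum>i | i \<in> I \<and> case_sum wt wt i \<ge> exp (- R). case_sum wt wt i * G i) / R)
      \<longlongrightarrow> 2 * C1 * Lim F / Lim h) at_top"
    unfolding sum_split by (simp add: add_divide_distrib mult.assoc)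
  have "((\<lambda>R. (\<Sum>w | w \<in> all_words A \<and> wt w \<ge> exp (- R). wt w * 1) / R
      + (\<Sum>w | w \<in> all_words A \<and> wt w \<ge> exp (- R). wt w * 1) / R)
      \<longlongrightarrow> C1 * Lim (\<lambda>_. 1) / Lim h + C1 * Lim (\<lambda>_. 1) / Lim h) at_top"
    by (intro tendsto_add all_words_mass[OF unif_const, where B = 1]) auto
  then show "((\<lambda>R. (\<Sum>i | i \<in> I \<and> case_sum wt wt i \<ge> exp (- R). case_sum wt wt i) / R)
      \<longlongrightarrow> C1 * Lim (\<lambda>_. 1) / Lim h + C1 * Lim (\<lambda>_. 1) / Lim h) at_top"
    using sum_split[of "\<lambda>_. 1"] by (simp add: add_divide_distrib)
qed

end

section \<open>Entropy of finite partitions\<close>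

text \<open>The entropy of the partition generated by \<open>X\<close>, which is written through the measure of the
  cell of a point, so that it evidently depends on the partition only.\<close>

definition ent :: "'m measure \<Rightarrow> ('m \<Rightarrow> 'v) \<Rightarrow> real" where
  "ent m X = (\<integral>u. - ln (measure m {v \<in> space m. X v = X u}) \<partial>m)"

text \<open>Partitions are handled as fibres of labelling maps, so that joins become pairs of labels
  and preimages become compositions.\<close>

definition finite_label :: "'m measure \<Rightarrow> ('m \<Rightarrow> 'v) \<Rightarrow> bool" where
  "finite_label m X \<longleftrightarrow> finite (X ` space m) \<and> (\<forall>v. {u \<in> space m. X u = v} \<in> sets m)"

lemma finite_labelD:
  "finite_label m X \<Longrightarrow> finite (X ` space m)"
  "finite_label m X \<Longrightarrow> {u \<in> space m. X u = v} \<in> sets m"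
  by (auto simp: finite_label_def)

lemma finite_label_Pair:
  assumes "finite_label m X" "finite_label m Y" shows "finite_label m (\<lambda>u. (X u, Y u))"
  unfolding finite_label_def
proof safe
  show "finite ((\<lambda>u. (X u, Y u)) ` space m)"
    by (rule finite_subset[of _ "X ` space m \<times> Y ` space m"]) (use assms in \<open>auto simp: finite_label_def\<close>)
  fix a b
  have "{u \<in> space m. (X u, Y u) = (a, b)} = {u \<in> space m. X u = a} \<inter> {u \<in> space m. Y u = b}" by auto
  then show "{u \<in> space m. (X u, Y u) = (a, b)} \<in> sets m"
    using assms by (auto simp: finite_label_def)
qed

lemma finite_label_image:
  assumes X: "finite_label m X" shows "finite_label m (\<lambda>u. f (X u))"
  unfolding finite_label_def
proof safe
  show "finite ((\<lambda>u. f (X u)) ` space m)" using finite_labelD(1)[OF X] by (simp add: image_image[symmetric])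
  fix v
  have "{u \<in> space m. f (X u) = v} = (\<Union>x\<in>{x \<in> X ` space m. f x = v}. {u \<in> space m. X u = x})" by auto
  also have "\<dots> \<in> sets m" using X by (intro sets.finite_UN) (auto simp: finite_label_def)
  finally show "{u \<in> space m. f (X u) = v} \<in> sets m" .
qed

lemma finite_label_restrict:
  fixes X :: "nat \<Rightarrow> 'm \<Rightarrow> 'v"
  assumes X: "\<And>i. i < n \<Longrightarrow> finite_label m (X i)"
  shows "finite_label m (\<lambda>u. \<lambda>i\<in>{..<n}. X i u)"
  unfolding finite_label_def
proof safe
  show "finite ((\<lambda>u. \<lambda>i\<in>{..<n}. X i u) ` space m)"
  proof (rule finite_subset)
    show "(\<lambda>u. \<lambda>i\<in>{..<n}. X i u) ` space m \<subseteq> PiE {..<n} (\<lambda>i. X i ` space m)"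
      by (auto simp: restrict_def PiE_def extensional_def)
    show "finite (PiE {..<n} (\<lambda>i. X i ` space m))"
      by (rule finite_PiE) (use X in \<open>auto simp: finite_label_def\<close>)
  qed
  fix v
  show "{u \<in> space m. (\<lambda>i\<in>{..<n}. X i u) = v} \<in> sets m"
  proof (cases "v \<in> extensional {..<n}")
    case True
    have "(\<lambda>i\<in>{..<n}. X i u) = v \<longleftrightarrow> (\<forall>i<n. X i u = v i)" for u
    proof
      assume *: "\<forall>i<n. X i u = v i"
      show "(\<lambda>i\<in>{..<n}. X i u) = v"
        by (rule extensionalityI[OF restrict_extensional True]) (use * in simp)
    qed auto
    then have "{u \<in> space m. (\<lambda>i\<in>{..<n}. X i u) = v} = space m \<inter> (\<Inter>i<n. {u \<in> space m. X i u = v i})"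
      by auto
    also have "\<dots> \<in> sets m"
    proof (cases "n = 0")
      case False
      then show ?thesis using finite_labelD(2)[OF X] by (intro sets.Int sets.finite_INT) auto
    qed simp
    finally show ?thesis .
  next
    case False
    then have "(\<lambda>i\<in>{..<n}. X i u) \<noteq> v" for u using restrict_extensional by metis
    then have "{u \<in> space m. (\<lambda>i\<in>{..<n}. X i u) = v} = {}" by blast
    then show ?thesis by (simp only: sets.empty_sets)
  qed
qed

section \<open>Entropy inequalities\<close>

context prob_space
begin

lemma finite_label_expansion:
  assumes X: "finite_label M X" and u: "u \<in> space M"
  shows "f (X u) = (\<Sum>v\<in>X ` space M. (f v :: real) * indicator {u \<in> space M. X u = v} u)"
proof -
  have "(\<Sum>v\<in>X ` space M. f v * indicator {u \<in> space M. X u = v} u) = (\<Sum>v\<in>X ` space M. if v = X u then f v else 0)"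
    using u by (intro sum.cong) (auto simp: indicator_def)
  then show ?thesis using u finite_labelD(1)[OF X] by simp
qed

lemma integrable_finite_label:
  assumes X: "finite_label M X" shows "integrable M (\<lambda>u. f (X u) :: real)"
proof -
  have "integrable M (\<lambda>u. \<Sum>v\<in>X ` space M. f v * indicator {u \<in> space M. X u = v} u)"
    using finite_labelD(2)[OF X] by (intro Bochner_Integration.integrable_sum integrable_mult_right) (auto simp: less_top[symmetric])
  then show ?thesis
    by (rule Bochner_Integration.integrable_cong[THEN iffD1, rotated -1])
      (use finite_label_expansion[OF X] in simp_all)
qed

lemma integral_finite_label:
  assumes X: "finite_label M X"
  shows "(\<integral>u. f (X u) \<partial>M) = (\<Sum>v\<in>X ` space M. measure M {u \<in> space M. X u = v} * (f v :: real))"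
proof -
  have "(\<integral>u. f (X u) \<partial>M) = (\<integral>u. (\<Sum>v\<in>X ` space M. f v * indicator {u \<in> space M. X u = v} u) \<partial>M)"
    by (rule Bochner_Integration.integral_cong) (use finite_label_expansion[OF X] in simp_all)
  also have "\<dots> = (\<Sum>v\<in>X ` space M. (\<integral>u. f v * indicator {u \<in> space M. X u = v} u \<partial>M))"
    using finite_labelD(2)[OF X]
    by (intro Bochner_Integration.integral_sum integrable_mult_right) (auto simp: less_top[symmetric])
  also have "\<dots> = (\<Sum>v\<in>X ` space M. measure M {u \<in> space M. X u = v} * f v)"
    using finite_labelD(2)[OF X] by (intro sum.cong) (simp_all add: mult.commute sets.Int_space_eq2)
  finally show ?thesis .
qed

lemma sum_finite_label:
  assumes X: "finite_label M X"
  shows "(\<Sum>v\<in>X ` space M. measure M {u \<in> space M. X u = v}) = 1"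
  using integral_finite_label[OF X, of "\<lambda>_. 1"] by (simp add: prob_space)

lemma ent_sum:
  assumes X: "finite_label M X"
  shows "ent M X = (\<Sum>v\<in>X ` space M. measure M {u \<in> space M. X u = v} * - ln (measure M {u \<in> space M. X u = v}))"
  unfolding ent_def
  by (rule integral_finite_label[OF X, of "\<lambda>v. - ln (measure M {w \<in> space M. X w = v})"])

text \<open>On a null cell \<open>ln\<close> takes its default value at 0, which says nothing about
  size; comparisons of entropies are therefore made almost everywhere, off these cells.\<close>

lemma AE_cell_pos:
  assumes X: "finite_label M X"
  shows "AE u in M. 0 < measure M {v \<in> space M. X v = X u}"
proof -
  have "AE u in M. \<forall>v\<in>X ` space M. measure M {w \<in> space M. X w = v} = 0 \<longrightarrow> X u \<noteq> v"
  proof (rule AE_finite_allI[OF finite_labelD(1)[OF X]])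
    fix v
    show "AE u in M. measure M {w \<in> space M. X w = v} = 0 \<longrightarrow> X u \<noteq> v"
    proof (cases "measure M {w \<in> space M. X w = v} = 0")
      case True
      then have "{w \<in> space M. X w = v} \<in> null_sets M"
        using finite_labelD(2)[OF X] by (simp add: null_sets_def emeasure_eq_measure)
      then show ?thesis by (rule AE_I') auto
    qed simp
  qed
  then show ?thesis
  proof (rule AE_mp, intro AE_I2 impI)
    fix u assume "u \<in> space M" "\<forall>v\<in>X ` space M. measure M {w \<in> space M. X w = v} = 0 \<longrightarrow> X u \<noteq> v"
    then show "0 < measure M {v \<in> space M. X v = X u}"
      using measure_nonneg[of M "{v \<in> space M. X v = X u}"] by (auto simp: order.order_iff_strict)
  qed
qed

lemma ent_nonneg: "0 \<le> ent M X"
  unfolding ent_def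
proof (rule Bochner_Integration.integral_nonneg)
  fix u
  have "0 \<le> p \<Longrightarrow> p \<le> 1 \<Longrightarrow> 0 \<le> - ln p" for p :: real by (cases "p = 0") auto
  then show "0 \<le> - ln (measure M {v \<in> space M. X v = X u})" by simp
qed

text \<open>Gibbs' inequality, from ln t \<le> t - 1, for weights that need not add up to 1: the
  excess of their total mass over 1 is an additive error, harmless once it is bounded and divided by
  n.\<close>

lemma ent_le_cross:
  assumes X: "finite_label M X" and q: "\<And>v. v \<in> X ` space M \<Longrightarrow> 0 \<le> q v"
    and pos: "\<And>v. v \<in> X ` space M \<Longrightarrow> 0 < measure M {u \<in> space M. X u = v} \<Longrightarrow> 0 < q v"
  shows "ent M X \<le> (\<integral>u. - ln (q (X u)) \<partial>M) + (\<Sum>v\<in>X ` space M. q v) - 1"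
proof -
  let ?P = "\<lambda>v. measure M {u \<in> space M. X u = v}"
  have "ent M X \<le> (\<Sum>v\<in>X ` space M. ?P v * - ln (q v) + q v - ?P v)"
    unfolding ent_sum[OF X]
  proof (rule sum_mono)
    fix v assume v: "v \<in> X ` space M"
    show "?P v * - ln (?P v) \<le> ?P v * - ln (q v) + q v - ?P v"
    proof (cases "?P v = 0")
      case False
      then have P: "?P v > 0" by (simp add: zero_less_measure_iff)
      then have "ln (q v) - ln (?P v) = ln (q v / ?P v)" using pos[OF v] by (simp add: ln_div)
      also have "\<dots> \<le> q v / ?P v - 1" using P pos[OF v] by (intro ln_le_minus_one) simp
      finally have "?P v * (ln (q v) - ln (?P v)) \<le> ?P v * (q v / ?P v - 1)"
        using P by (intro mult_left_mono) auto
      then show ?thesis using P by (simp add: algebra_simps)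
    qed (use q[OF v] in simp)
  qed
  also have "\<dots> = (\<integral>u. - ln (q (X u)) \<partial>M) + (\<Sum>v\<in>X ` space M. q v) - 1"
    using integral_finite_label[OF X, of "\<lambda>v. - ln (q v)"] sum_finite_label[OF X]
    by (simp add: sum.distrib sum_subtractf sum_negf)
  finally show ?thesis .
qed

text \<open>Cells of a coarser partition are larger, and with the entropy written as an integral the
  comparison is pointwise.\<close>

lemma ent_mono:
  assumes Z: "finite_label M Z" shows "ent M (\<lambda>u. f (Z u)) \<le> ent M Z"
  unfolding ent_def
proof (rule integral_mono_AE)
  show "integrable M (\<lambda>u. - ln (measure M {v \<in> space M. f (Z v) = f (Z u)}))"
    by (rule integrable_finite_label[OF Z, of "\<lambda>z. - ln (measure M {v \<in> space M. f (Z v) = f z})"])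
  show "integrable M (\<lambda>u. - ln (measure M {v \<in> space M. Z v = Z u}))"
    by (rule integrable_finite_label[OF Z, of "\<lambda>z. - ln (measure M {v \<in> space M. Z v = z})"])
  show "AE u in M. - ln (measure M {v \<in> space M. f (Z v) = f (Z u)}) \<le> - ln (measure M {v \<in> space M. Z v = Z u})"
    using AE_cell_pos[OF Z]
  proof eventually_elim
    case (elim u)
    have "measure M {v \<in> space M. Z v = Z u} \<le> measure M {v \<in> space M. f (Z v) = f (Z u)}"
      using finite_labelD(2)[OF finite_label_image[OF Z]] by (intro finite_measure_mono) auto
    then show ?case using elim by simp
  qed
qed

text \<open>Gibbs' inequality against the product of the two marginals, whose mass on the occurring
  pairs is at most 1.\<close>

lemma ent_Pair_le:
  assumes X: "finite_label M X" and Y: "finite_label M Y"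
  shows "ent M (\<lambda>u. (X u, Y u)) \<le> ent M X + ent M Y"
proof -
  define PX where "PX a = measure M {u \<in> space M. X u = a}" for a
  define PY where "PY b = measure M {u \<in> space M. Y u = b}" for b
  define q where "q = (\<lambda>(a, b). PX a * PY b)"
  note Z = finite_label_Pair[OF X Y]
  have le: "measure M {u \<in> space M. (X u, Y u) = (a, b)} \<le> PX a" "measure M {u \<in> space M. (X u, Y u) = (a, b)} \<le> PY b" for a b
    unfolding PX_def PY_def using finite_labelD(2)[OF X] finite_labelD(2)[OF Y]
    by (auto intro!: finite_measure_mono)
  have "ent M (\<lambda>u. (X u, Y u))
      \<le> (\<integral>u. - ln (q (X u, Y u)) \<partial>M) + (\<Sum>v\<in>(\<lambda>u. (X u, Y u)) ` space M. q v) - 1"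
  proof (rule ent_le_cross[OF Z])
    show "0 \<le> q v" for v by (cases v) (simp add: q_def PX_def PY_def)
    show "0 < q v" if "0 < measure M {u \<in> space M. (X u, Y u) = v}" for v
      using that le[of "fst v" "snd v"] by (cases v) (auto simp: q_def)
  qed
  also have "(\<Sum>v\<in>(\<lambda>u. (X u, Y u)) ` space M. q v) \<le> (\<Sum>v\<in>X ` space M \<times> Y ` space M. q v)"
    by (rule sum_mono2) (use X Y in \<open>auto simp: finite_label_def q_def PX_def PY_def\<close>)
  also have "\<dots> = (\<Sum>a\<in>X ` space M. PX a) * (\<Sum>b\<in>Y ` space M. PY b)"
    by (simp add: q_def sum_product sum.cartesian_product)
  also have "\<dots> = 1" using sum_finite_label[OF X] sum_finite_label[OF Y] by (simp add: PX_def PY_def)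
  also have "(\<integral>u. - ln (q (X u, Y u)) \<partial>M) = (\<integral>u. - ln (PX (X u)) + - ln (PY (Y u)) \<partial>M)"
  proof (rule integral_cong_AE)
    show "(\<lambda>u. - ln (q (X u, Y u))) \<in> borel_measurable M"
      using integrable_finite_label[OF Z, of "\<lambda>z. - ln (q z)"] by (rule borel_measurable_integrable)
    show "(\<lambda>u. - ln (PX (X u)) + - ln (PY (Y u))) \<in> borel_measurable M"
      using integrable_finite_label[OF X, of "\<lambda>z. - ln (PX z)"] integrable_finite_label[OF Y, of "\<lambda>z. - ln (PY z)"]
      by (intro borel_measurable_add borel_measurable_integrable) auto
    show "AE u in M. - ln (q (X u, Y u)) = - ln (PX (X u)) + - ln (PY (Y u))"
      using AE_cell_pos[OF X] AE_cell_pos[OF Y]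
      by eventually_elim (simp add: q_def PX_def PY_def ln_mult)
  qed
  also have "\<dots> = ent M X + ent M Y"
    unfolding ent_def PX_def PY_def
    using integrable_finite_label[OF X, of "\<lambda>z. - ln (measure M {u \<in> space M. X u = z})"]
      integrable_finite_label[OF Y, of "\<lambda>z. - ln (measure M {u \<in> space M. Y u = z})"]
    by (rule Bochner_Integration.integral_add)
  finally show ?thesis by simp
qed

end

text \<open>\<open>ks_entropy\<close> is defined with \<open>lim\<close>, which carries information
  only along convergent sequences; subadditivity provides the convergence, towards the
  infimum.\<close>

lemma fekete:
  fixes f :: "nat \<Rightarrow> real"
  assumes sub: "\<And>n k. f (n + k) \<le> f n + f k" and nonneg: "\<And>n. 0 \<le> f n"
  shows "convergent (\<lambda>n. f n / n)"
proof -
  define L where "L = (INF k\<in>{1..}. f k / k)"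
  have bdd: "bdd_below ((\<lambda>k. f k / k) ` {1..})" using nonneg by (intro bdd_belowI2[where m = 0]) simp
  have "(\<lambda>n. f n / n) \<longlonglongrightarrow> L"
  proof (rule LIMSEQ_I)
    fix \<epsilon> :: real assume \<epsilon>: "0 < \<epsilon>"
    have "\<exists>k\<in>{1..}. f k / k < L + \<epsilon> / 2"
      using cINF_less_iff[OF _ bdd, of "L + \<epsilon> / 2"] \<epsilon> by (auto simp: L_def)
    then obtain k where k: "k \<ge> 1" "f k / k < L + \<epsilon> / 2" by auto
    define C where "C = (\<Sum>r<k. f r)"
    have mult: "f (q * k + r) \<le> q * f k + f r" for q r
    proof (induction q)
      case (Suc q)
      have "f (Suc q * k + r) = f (k + (q * k + r))" by (simp add: algebra_simps)
      also have "\<dots> \<le> f k + (q * f k + f r)" using sub[of k "q * k + r"] Suc by linarith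
      finally show ?case by (simp add: algebra_simps)
    qed simp
    obtain n0 :: nat where n0: "real n0 > 2 * C / \<epsilon>" using reals_Archimedean2 by blast
    have "norm (f n / n - L) < \<epsilon>" if n: "n \<ge> max 1 n0" for n
    proof -
      have "L \<le> f n / n" unfolding L_def using n by (intro cINF_lower bdd) auto
      moreover have "f n / n < L + \<epsilon>"
      proof -
        have "f n \<le> (n div k) * f k + f (n mod k)" using mult[of "n div k" "n mod k"] by simp
        also have "f (n mod k) \<le> C"
          unfolding C_def using k nonneg by (intro member_le_sum) auto
        also have "real (n div k) * f k \<le> (real n / real k) * f k"
          using nonneg by (intro mult_right_mono of_nat_div_le_of_nat) auto
        finally have "f n \<le> real n * (f k / k) + C" by simp
        then have "f n / n \<le> (real n * (f k / k) + C) / n" by (intro divide_right_mono) auto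
        also have "\<dots> = f k / k + C / n" using n by (simp add: field_simps)
        also have "C / n < \<epsilon> / 2"
        proof -
          have "2 * C / \<epsilon> < n" using n n0 by linarith
          then show ?thesis using n \<epsilon> by (simp add: field_simps)
        qed
        finally show ?thesis using k(2) by linarith
      qed
      ultimately show ?thesis by simp
    qed
    then show "\<exists>n0. \<forall>n\<ge>n0. norm (f n / n - L) < \<epsilon>" by blast
  qed
  then show ?thesis by (rule convergentI)
qed

section \<open>Itineraries and the entropy of an invariant measure\<close>

definition block :: "'m set set \<Rightarrow> 'm \<Rightarrow> 'm set" where
  "block P u = (THE B. B \<in> P \<and> u \<in> B)"

lemma block_eqI: "partition_on S P \<Longrightarrow> B \<in> P \<Longrightarrow> u \<in> B \<Longrightarrow> block P u = B"
  unfolding block_def by (rule the_equality) (auto simp: partition_on_def disjoint_def)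

lemma block_in:
  assumes "partition_on S P" "u \<in> S" shows "block P u \<in> P" "u \<in> block P u"
proof -
  obtain B where "B \<in> P" "u \<in> B" using assms by (auto simp: partition_on_def)
  then show "block P u \<in> P" "u \<in> block P u" using block_eqI[OF assms(1)] by auto
qed

definition itinerary :: "('m \<Rightarrow> 'm) \<Rightarrow> 'm set set \<Rightarrow> nat \<Rightarrow> 'm \<Rightarrow> nat \<Rightarrow> 'm set" where
  "itinerary T P n u = (\<lambda>i\<in>{..<n}. block P ((T ^^ i) u))"

locale invariant_prob = prob_space m for m :: "'m measure" +
  fixes T :: "'m \<Rightarrow> 'm"
  assumes T_meas: "T \<in> m \<rightarrow>\<^sub>M m" and T_inv: "distr m m T = m"
begin

lemma T_pow_meas: "T ^^ n \<in> m \<rightarrow>\<^sub>M m"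
proof (induction n)
  case (Suc n)
  then have "T \<circ> T ^^ n \<in> m \<rightarrow>\<^sub>M m" using T_meas by (rule measurable_comp)
  then show ?case by (simp only: funpow.simps)
qed (simp add: id_def)

lemma T_pow_space: "u \<in> space m \<Longrightarrow> (T ^^ n) u \<in> space m"
  using T_pow_meas by (rule measurable_space)

lemma T_pow_inv: "distr m m (T ^^ n) = m"
proof (induction n)
  case 0
  show ?case by (simp add: id_def distr_id)
next
  case (Suc n)
  have "distr m m (T \<circ> T ^^ n) = distr (distr m m (T ^^ n)) m T"
    by (rule distr_distr[symmetric, OF T_meas T_pow_meas])
  then show ?case by (simp only: funpow.simps Suc T_inv)
qed

lemma measure_T_pow: "B \<in> sets m \<Longrightarrow> measure m {u \<in> space m. (T ^^ n) u \<in> B} = measure m B"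
  using measure_distr[OF T_pow_meas[of n], of B] T_pow_inv[of n]
  by (simp add: vimage_def Int_def conj_commute)

lemma integral_T_pow:
  assumes "f \<in> borel_measurable m" shows "(\<integral>u. f ((T ^^ n) u) \<partial>m) = (\<integral>u. (f u :: real) \<partial>m)"
  using integral_distr[OF T_pow_meas[of n] assms] T_pow_inv[of n] by simp

lemma measure_label_T_pow:
  assumes "finite_label m Y"
  shows "measure m {u \<in> space m. Y ((T ^^ n) u) = y} = measure m {u \<in> space m. Y u = y}"
proof -
  have "{u \<in> space m. Y ((T ^^ n) u) = y} = {u \<in> space m. (T ^^ n) u \<in> {v \<in> space m. Y v = y}}"
    using T_pow_space by auto
  then show ?thesis using measure_T_pow[OF finite_labelD(2)[OF assms, of y]] by simp
qed

lemma finite_label_T_pow: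
  assumes "finite_label m Y" shows "finite_label m (\<lambda>u. Y ((T ^^ n) u))"
  unfolding finite_label_def
proof safe
  show "finite ((\<lambda>u. Y ((T ^^ n) u)) ` space m)"
    by (rule finite_subset[OF _ finite_labelD(1)[OF assms]]) (use T_pow_space in auto)
  fix v
  have "{u \<in> space m. Y ((T ^^ n) u) = v} = (T ^^ n) -` {w \<in> space m. Y w = v} \<inter> space m"
    using T_pow_space by auto
  then show "{u \<in> space m. Y ((T ^^ n) u) = v} \<in> sets m"
    using measurable_sets[OF T_pow_meas finite_labelD(2)[OF assms]] by simp
qed

lemma ent_T_pow:
  assumes Y: "finite_label m Y" shows "ent m (\<lambda>u. Y ((T ^^ n) u)) = ent m Y"
  unfolding ent_def measure_label_T_pow[OF Y]
  using integrable_finite_label[OF Y, of "\<lambda>y. - ln (measure m {u \<in> space m. Y u = y})"]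
  by (intro integral_T_pow borel_measurable_integrable)

context
  fixes P assumes fin: "finite P" and P_sets: "P \<subseteq> sets m" and part: "partition_on (space m) P"
begin

lemma finite_label_block: "finite_label m (block P)"
  unfolding finite_label_def
proof safe
  show "finite (block P ` space m)"
    by (rule finite_subset[OF _ fin]) (use block_in[OF part] in auto)
  fix B
  show "{u \<in> space m. block P u = B} \<in> sets m"
  proof (cases "B \<in> P")
    case True
    then have "{u \<in> space m. block P u = B} = B"
      using block_in[OF part] block_eqI[OF part True] P_sets sets.sets_into_space by blast
    then show ?thesis using True P_sets by auto
  next
    case False
    then have "{u \<in> space m. block P u = B} = {}" using block_in[OF part] by auto
    then show ?thesis by (simp only: sets.empty_sets)
  qed
qed

lemma finite_label_itinerary: "finite_label m (itinerary T P n)"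
proof -
  have "itinerary T P n = (\<lambda>u. \<lambda>i\<in>{..<n}. block P ((T ^^ i) u))" by (auto simp: itinerary_def)
  then show ?thesis using finite_label_restrict[OF finite_label_T_pow[OF finite_label_block]] by simp
qed

lemma itinerary_eq_iff:
  "itinerary T P n u = itinerary T P n v \<longleftrightarrow> (\<forall>i<n. block P ((T ^^ i) u) = block P ((T ^^ i) v))"
  by (auto simp: itinerary_def fun_eq_iff restrict_def)

text \<open>The nonempty sets of the join are the fibres of the itinerary, and the empty set
  contributes 0.\<close>

lemma partition_entropy_join: "partition_entropy m (join_partition m T P n) = ent m (itinerary T P n)"
proof -
  define X where "X = itinerary T P n"
  have X: "finite_label m X" unfolding X_def by (rule finite_label_itinerary)
  define cell where "cell v = {u \<in> space m. X u = v}" for v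
  have cell_eq: "cell (X u) = {w \<in> space m. \<forall>i<n. (T ^^ i) w \<in> block P ((T ^^ i) u)}" if u: "u \<in> space m" for u
    unfolding cell_def X_def itinerary_eq_iff
  proof (intro Collect_cong conj_cong refl)
    fix w assume w: "w \<in> space m"
    show "(\<forall>i<n. block P ((T ^^ i) w) = block P ((T ^^ i) u)) \<longleftrightarrow> (\<forall>i<n. (T ^^ i) w \<in> block P ((T ^^ i) u))"
      using block_in[OF part T_pow_space[OF w]] block_in[OF part T_pow_space[OF u]] block_eqI[OF part] by metis
  qed
  have join: "join_partition m T P n - {{}} = cell ` (X ` space m)"
  proof (intro set_eqI iffI)
    fix B assume "B \<in> join_partition m T P n - {{}}"
    then obtain a where a: "\<And>i. i < n \<Longrightarrow> a i \<in> P" "B = {x \<in> space m. \<forall>i<n. (T ^^ i) x \<in> a i}" "B \<noteq> {}"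
      by (auto simp: join_partition_def)
    then obtain u where u: "u \<in> B" by blast
    then have "\<And>i. i < n \<Longrightarrow> a i = block P ((T ^^ i) u)" using a block_eqI[OF part] by (metis (mono_tags, lifting) mem_Collect_eq)
    then have "B = cell (X u)" using u a(2) cell_eq[of u] by auto
    then show "B \<in> cell ` (X ` space m)" using u a(2) by auto
  next
    fix B assume "B \<in> cell ` (X ` space m)"
    then obtain u where u: "u \<in> space m" "B = cell (X u)" by auto
    then have "u \<in> B" by (simp add: cell_def)
    moreover have "B \<in> join_partition m T P n"
      unfolding join_partition_def u(2) cell_eq[OF u(1)]
      by (intro CollectI exI[of _ "\<lambda>i. block P ((T ^^ i) u)"])
        (simp add: block_in(1)[OF part T_pow_space[OF u(1)]])
    ultimately show "B \<in> join_partition m T P n - {{}}" by auto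
  qed
  have "finite (cell ` (X ` space m))" using finite_labelD(1)[OF X] by simp
  then have fin_join: "finite (join_partition m T P n)" using join by (metis finite_Diff2 finite.emptyI finite_insert)
  have inj: "inj_on cell (X ` space m)"
    by (rule inj_onI) (auto simp: cell_def)
  have "(\<Sum>B\<in>join_partition m T P n. measure m B * ln (measure m B))
      = (\<Sum>B\<in>join_partition m T P n - {{}}. measure m B * ln (measure m B))"
    by (rule sum.mono_neutral_right[OF fin_join]) auto
  also have "\<dots> = (\<Sum>v\<in>X ` space m. measure m (cell v) * ln (measure m (cell v)))"
    unfolding join by (simp add: sum.reindex[OF inj])
  finally show ?thesis
    unfolding partition_entropy_def X_def[symmetric] ent_sum[OF X] cell_def by (simp add: sum_negf)
qed

text \<open>n + k steps are n steps followed by k steps from the n-th image; the second itinerary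
  has the entropy of an itinerary from time 0 by invariance, which gives the subadditivity.\<close>

lemma itinerary_entropy_convergent: "convergent (\<lambda>n. ent m (itinerary T P n) / n)"
proof (rule fekete)
  show "0 \<le> ent m (itinerary T P n)" for n by (rule ent_nonneg)
  fix n k
  define Z where "Z u = (itinerary T P n u, itinerary T P k ((T ^^ n) u))" for u
  have Z: "finite_label m Z" unfolding Z_def
    by (intro finite_label_Pair finite_label_itinerary finite_label_T_pow)
  have cells: "Z u = Z v \<longleftrightarrow> itinerary T P (n + k) u = itinerary T P (n + k) v" for u v
  proof -
    have "(\<forall>i<n + k. Q i) \<longleftrightarrow> (\<forall>i<n. Q i) \<and> (\<forall>i<k. Q (i + n))" for Q :: "nat \<Rightarrow> bool"
    proof (intro iffI allI impI)
      fix i assume Q: "(\<forall>i<n. Q i) \<and> (\<forall>i<k. Q (i + n))" and i: "i < n + k"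
      show "Q i"
      proof (cases "i < n")
        case False
        then have "Q (i - n + n)" using Q i by (intro Q[THEN conjunct2, rule_format]) auto
        then show ?thesis using False by simp
      qed (use Q in simp)
    qed simp
    then show ?thesis by (simp add: Z_def itinerary_eq_iff funpow_add)
  qed
  have "ent m (itinerary T P (n + k)) = ent m Z" unfolding ent_def cells ..
  also have "\<dots> \<le> ent m (itinerary T P n) + ent m (\<lambda>u. itinerary T P k ((T ^^ n) u))"
    unfolding Z_def by (intro ent_Pair_le finite_label_itinerary finite_label_T_pow)
  also have "ent m (\<lambda>u. itinerary T P k ((T ^^ n) u)) = ent m (itinerary T P k)"
    by (rule ent_T_pow[OF finite_label_itinerary])
  finally show "ent m (itinerary T P (n + k)) \<le> ent m (itinerary T P n) + ent m (itinerary T P k)" .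
qed

lemma partition_entropy_tendsto:
  "(\<lambda>n. ent m (itinerary T P n) / n) \<longlonglongrightarrow> lim (\<lambda>n. partition_entropy m (join_partition m T P n) / real n)"
  unfolding partition_entropy_join using itinerary_entropy_convergent by (simp add: convergent_LIMSEQ_iff)

end

end

section \<open>Coding by a subshift\<close>

lemma topspace_subshift_top: "topspace (subshift_top A) = subshift A"
  by (simp add: subshift_top_def)

lemma openin_subshift_cylinder: "openin (subshift_top A) {t \<in> subshift A. agree n s t}"
proof -
  define U where "U i = (if i < n then {s i} else UNIV)" for i
  have "openin (product_topology (\<lambda>_. discrete_topology UNIV) UNIV) (PiE UNIV U)"
  proof (subst openin_PiE_gen, rule disjI2, intro conjI)
    show "finite {i \<in> UNIV. U i \<noteq> topspace (discrete_topology UNIV)}"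
      by (rule finite_subset[of _ "{..<n}"]) (auto simp: U_def)
  qed auto
  moreover have "{t \<in> subshift A. agree n s t} = PiE UNIV U \<inter> subshift A"
  proof -
    have "agree n s t \<longleftrightarrow> (\<forall>i. t i \<in> U i)" for t by (auto simp: agree_def U_def)
    then show ?thesis by (auto simp: PiE_UNIV_domain)
  qed
  ultimately show ?thesis unfolding subshift_top_def openin_subtopology by blast
qed

lemma subshift_open_contains_cylinder:
  assumes W: "openin (subshift_top A) W" and s: "s \<in> W"
  shows "\<exists>n. {t \<in> subshift A. agree n s t} \<subseteq> W"
proof -
  obtain W' where W': "openin (product_topology (\<lambda>_. discrete_topology UNIV) UNIV) W'" "W = W' \<inter> subshift A"
    using W unfolding subshift_top_def openin_subtopology by blast
  then obtain U where U: "finite {i \<in> UNIV. U i \<noteq> UNIV}" "s \<in> PiE UNIV U" "PiE UNIV U \<subseteq> W'"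
    using s unfolding openin_product_topology_alt by fastforce
  from finite_nat_bounded[OF U(1)] obtain n where n: "{i \<in> UNIV. U i \<noteq> UNIV} \<subseteq> {..<n}" ..
  have "t \<in> PiE UNIV U" if "agree n s t" for t
  proof -
    have "t i \<in> U i" for i
    proof (cases "i < n")
      case True
      then have "s i = t i" using that by (simp add: agree_def)
      moreover have "s i \<in> U i" by (rule PiE_mem[OF U(2)]) simp
      ultimately show ?thesis by simp
    next
      case False
      then have "U i = UNIV" using n by auto
      then show ?thesis by simp
    qed
    then show ?thesis by (simp add: PiE_UNIV_domain Pi_def)
  qed
  then have "{t \<in> subshift A. agree n s t} \<subseteq> W" using U(3) W'(2) by blast
  then show ?thesis by blast
qed

locale coding =
  fixes A :: "nat^'k::finite^'k" and p :: "(nat \<Rightarrow> 'k) \<Rightarrow> 'm::t2_space" and \<Lambda> :: "'m set"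
  assumes hom: "homeomorphic_map (subshift_top A) (top_of_set \<Lambda>) p"
    and compact: "compact \<Lambda>"
begin

definition q :: "'m \<Rightarrow> nat \<Rightarrow> 'k" where "q = inv_into (subshift A) p"

lemma p_image: "p ` subshift A = \<Lambda>"
  using homeomorphic_imp_surjective_map[OF hom] by (simp add: topspace_subshift_top)

lemma p_inj: "inj_on p (subshift A)"
  using homeomorphic_imp_injective_map[OF hom] by (simp add: topspace_subshift_top)

lemma p_in: "s \<in> subshift A \<Longrightarrow> p s \<in> \<Lambda>" using p_image by auto

lemma q_p: "s \<in> subshift A \<Longrightarrow> q (p s) = s"
  unfolding q_def by (rule inv_into_f_f[OF p_inj])

lemma q_in: "u \<in> \<Lambda> \<Longrightarrow> q u \<in> subshift A"
  unfolding q_def using p_image by (metis inv_into_into)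

lemma p_q: "u \<in> \<Lambda> \<Longrightarrow> p (q u) = u"
  unfolding q_def using p_image by (metis f_inv_into_f)

definition cyl :: "nat \<Rightarrow> (nat \<Rightarrow> 'k) \<Rightarrow> 'm set" where
  "cyl n s = p ` {t \<in> subshift A. agree n s t}"

lemma in_cyl_iff: "u \<in> cyl n s \<longleftrightarrow> u \<in> \<Lambda> \<and> agree n s (q u)"
  unfolding cyl_def using q_p q_in p_q p_in by (auto simp: image_iff) metis

lemma openin_cyl: "openin (top_of_set \<Lambda>) (cyl n s)"
  unfolding cyl_def
  using homeomorphic_imp_open_map[OF hom] openin_subshift_cylinder by (auto simp: open_map_def)

lemma open_contains_cyl:
  assumes V: "openin (top_of_set \<Lambda>) V" and u: "u \<in> V"
  shows "\<exists>n. cyl n (q u) \<subseteq> V"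
proof -
  have u\<Lambda>: "u \<in> \<Lambda>" using V u openin_subset by fastforce
  have 1: "openin (subshift_top A) {s \<in> topspace (subshift_top A). p s \<in> V}"
    using homeomorphic_imp_continuous_map[OF hom] V by (rule openin_continuous_map_preimage)
  have 2: "q u \<in> {s \<in> topspace (subshift_top A). p s \<in> V}"
    using u\<Lambda> u by (simp add: topspace_subshift_top q_in p_q)
  obtain n where "{t \<in> subshift A. agree n (q u) t} \<subseteq> {s \<in> topspace (subshift_top A). p s \<in> V}"
    using subshift_open_contains_cylinder[OF 1 2] by blast
  then have "cyl n (q u) \<subseteq> V" unfolding cyl_def by auto
  then show ?thesis by blast
qed

text \<open>The Lebesgue number lemma with cylinder length in place of a distance: finitely many
  good cylinders cover \<Lambda>, and the sum of their lengths bounds each of them. Q is left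
  general, as it serves both uniform continuity and the local nonnegativity of the Riemannian
  distance.\<close>

lemma cylinder_lebesgue_number:
  assumes "\<And>u. u \<in> \<Lambda> \<Longrightarrow> \<exists>V. openin (top_of_set \<Lambda>) V \<and> u \<in> V \<and> Q V"
  shows "\<exists>N. \<forall>s\<in>subshift A. \<exists>V. Q V \<and> (\<forall>t\<in>subshift A. agree N s t \<longrightarrow> p t \<in> V)"
proof -
  have "\<exists>n V. Q V \<and> cyl n (q u) \<subseteq> V" if "u \<in> \<Lambda>" for u
    using assms[OF that] open_contains_cyl by meson
  then obtain n V where nV: "\<And>u. u \<in> \<Lambda> \<Longrightarrow> Q (V u) \<and> cyl (n u) (q u) \<subseteq> V u" by metis
  define C where "C = (\<lambda>u. cyl (n u) (q u)) ` \<Lambda>"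
  have "\<Lambda> \<subseteq> \<Union>C" unfolding C_def by (auto simp: in_cyl_iff agree_refl)
  moreover have "\<forall>c\<in>C. openin (top_of_set \<Lambda>) c" unfolding C_def using openin_cyl by simp
  ultimately obtain E where E: "E \<subseteq> C" "finite E" "\<Lambda> \<subseteq> \<Union>E"
    using compact[unfolded compact_eq_openin_cover, rule_format, of C] by auto
  from finite_subset_image[OF E(2) E(1)[unfolded C_def]]
  obtain F where F: "F \<subseteq> \<Lambda>" "finite F" "E = (\<lambda>u. cyl (n u) (q u)) ` F" by auto
  show ?thesis
  proof (intro exI[of _ "sum n F"] ballI)
    fix s assume s: "s \<in> subshift A"
    then obtain u where u: "u \<in> F" "p s \<in> cyl (n u) (q u)" using E(3) F(3) p_in by blast
    have n: "n u \<le> sum n F" using F(2) u(1) by (intro member_le_sum) auto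
    have "p t \<in> V u" if "t \<in> subshift A" "agree (sum n F) s t" for t
    proof -
      have "agree (n u) (q u) s" using u(2) s by (simp add: in_cyl_iff q_p)
      then have "agree (n u) (q u) t" using agree_mono[OF that(2) n] agree_trans by blast
      then have "p t \<in> cyl (n u) (q u)" using that by (simp add: in_cyl_iff q_p p_in)
      then show ?thesis using nV u F(1) by auto
    qed
    then show "\<exists>V. Q V \<and> (\<forall>t\<in>subshift A. agree (sum n F) s t \<longrightarrow> p t \<in> V)"
      using nV u(1) F(1) by blast
  qed
qed

lemma continuous_uniformly:
  fixes f :: "'m \<Rightarrow> 'b::metric_space"
  assumes f: "continuous_on \<Lambda> f" and \<epsilon>: "\<epsilon> > 0"
  shows "\<exists>N. \<forall>s\<in>subshift A. \<forall>t\<in>subshift A. agree N s t \<longrightarrow> dist (f (p s)) (f (p t)) \<le> \<epsilon>"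
proof -
  have "\<exists>N. \<forall>s\<in>subshift A. \<exists>V. (\<forall>a\<in>V. \<forall>b\<in>V. dist (f a) (f b) \<le> \<epsilon>)
      \<and> (\<forall>t\<in>subshift A. agree N s t \<longrightarrow> p t \<in> V)"
  proof (rule cylinder_lebesgue_number)
    fix u assume u: "u \<in> \<Lambda>"
    have "openin (top_of_set \<Lambda>) (\<Lambda> \<inter> f -` ball (f u) (\<epsilon> / 2))"
      by (rule continuous_openin_preimage_gen[OF f]) simp
    moreover have "dist (f a) (f b) \<le> \<epsilon>" if "a \<in> \<Lambda> \<inter> f -` ball (f u) (\<epsilon> / 2)" "b \<in> \<Lambda> \<inter> f -` ball (f u) (\<epsilon> / 2)" for a b
      using that dist_triangle_half_r[of "f u" "f a" \<epsilon> "f b"] by simp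
    ultimately show "\<exists>V. openin (top_of_set \<Lambda>) V \<and> u \<in> V \<and> (\<forall>a\<in>V. \<forall>b\<in>V. dist (f a) (f b) \<le> \<epsilon>)"
      using u \<epsilon> by (intro exI[of _ "\<Lambda> \<inter> f -` ball (f u) (\<epsilon> / 2)"]) auto
  qed
  then obtain N where N: "\<And>s. s \<in> subshift A \<Longrightarrow> \<exists>V. (\<forall>a\<in>V. \<forall>b\<in>V. dist (f a) (f b) \<le> \<epsilon>)
      \<and> (\<forall>t\<in>subshift A. agree N s t \<longrightarrow> p t \<in> V)" by blast
  then show ?thesis using agree_refl by (intro exI[of _ N]) blast
qed

lemma uniformly_continuous:
  fixes f :: "'m \<Rightarrow> 'b::metric_space"
  assumes "\<And>\<epsilon>. \<epsilon> > 0 \<Longrightarrow> \<exists>N. \<forall>s\<in>subshift A. \<forall>t\<in>subshift A. agree N s t \<longrightarrow> dist (f (p s)) (f (p t)) \<le> \<epsilon>"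
  shows "continuous_on \<Lambda> f"
  unfolding continuous_on_def
proof (intro ballI tendstoI)
  fix u and \<epsilon> :: real assume u: "u \<in> \<Lambda>" and "0 < \<epsilon>"
  then obtain N where N: "\<And>s t. s \<in> subshift A \<Longrightarrow> t \<in> subshift A \<Longrightarrow> agree N s t \<Longrightarrow> dist (f (p s)) (f (p t)) \<le> \<epsilon> / 2"
    using assms[of "\<epsilon> / 2"] by auto
  obtain W where W: "open W" "cyl N (q u) = \<Lambda> \<inter> W" using openin_cyl[of N "q u"] unfolding openin_open by blast
  have "u \<in> W" using u W in_cyl_iff[of u N "q u"] agree_refl by blast
  have "dist (f v) (f u) < \<epsilon>" if "v \<in> W" "v \<in> \<Lambda>" for v
  proof -
    have "agree N (q u) (q v)" using that W in_cyl_iff by blast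
    then have "dist (f u) (f v) \<le> \<epsilon> / 2" using N[of "q u" "q v"] u that(2) by (simp add: q_in p_q)
    then show ?thesis using \<open>0 < \<epsilon>\<close> by (simp add: dist_commute)
  qed
  then show "\<forall>\<^sub>F v in at u within \<Lambda>. dist (f v) (f u) < \<epsilon>"
    unfolding eventually_at_topological using W(1) \<open>u \<in> W\<close> by blast
qed

section \<open>Sets decided by finitely many letters, and the measures they determine\<close>

definition clopens :: "'m set set" where
  "clopens = {C. C \<subseteq> \<Lambda> \<and> (\<exists>N. \<forall>s\<in>subshift A. \<forall>t\<in>subshift A. agree N s t \<longrightarrow> (p s \<in> C \<longleftrightarrow> p t \<in> C))}"

lemma clopensI:
  "C \<subseteq> \<Lambda> \<Longrightarrow> (\<And>s t. s \<in> subshift A \<Longrightarrow> t \<in> subshift A \<Longrightarrow> agree N s t \<Longrightarrow> p s \<in> C \<Longrightarrow> p t \<in> C) \<Longrightarrow> C \<in> clopens"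
  unfolding clopens_def using agree_sym by blast

lemma cyl_clopen: "cyl n s \<in> clopens"
  by (rule clopensI[where N = n]) (auto simp: in_cyl_iff q_p p_in intro: agree_trans)

lemma openin_clopen:
  assumes "C \<in> clopens" shows "openin (top_of_set \<Lambda>) C"
proof -
  obtain N where N: "C \<subseteq> \<Lambda>" "\<And>s t. s \<in> subshift A \<Longrightarrow> t \<in> subshift A \<Longrightarrow> agree N s t \<Longrightarrow> p s \<in> C \<longleftrightarrow> p t \<in> C"
    using assms unfolding clopens_def by blast
  have eq: "C = (\<Union>u\<in>C. cyl N (q u))"
  proof safe
    fix u assume "u \<in> C"
    then show "u \<in> (\<Union>u\<in>C. cyl N (q u))" using N(1) agree_refl by (auto simp: in_cyl_iff)
  next
    fix u v assume "u \<in> C" "v \<in> cyl N (q u)"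
    then show "v \<in> C" using N(1) N(2)[of "q u" "q v"] by (auto simp: in_cyl_iff q_in p_q)
  qed
  have "openin (top_of_set \<Lambda>) (\<Union>u\<in>C. cyl N (q u))"
    by (rule openin_Union) (auto simp: openin_cyl)
  then show ?thesis by (simp only: eq[symmetric])
qed

lemma clopen_Diff: "C \<in> clopens \<Longrightarrow> \<Lambda> - C \<in> clopens"
proof -
  assume "C \<in> clopens"
  then obtain N where N: "\<And>s t. s \<in> subshift A \<Longrightarrow> t \<in> subshift A \<Longrightarrow> agree N s t \<Longrightarrow> p s \<in> C \<longleftrightarrow> p t \<in> C"
    unfolding clopens_def by blast
  show ?thesis by (rule clopensI[where N = N]) (use N p_in in auto)
qed

lemma clopen_Un: "C \<in> clopens \<Longrightarrow> C' \<in> clopens \<Longrightarrow> C \<union> C' \<in> clopens"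
proof -
  assume "C \<in> clopens" "C' \<in> clopens"
  then obtain N N' where N: "C \<subseteq> \<Lambda>" "\<And>s t. s \<in> subshift A \<Longrightarrow> t \<in> subshift A \<Longrightarrow> agree N s t \<Longrightarrow> p s \<in> C \<longleftrightarrow> p t \<in> C"
    and N': "C' \<subseteq> \<Lambda>" "\<And>s t. s \<in> subshift A \<Longrightarrow> t \<in> subshift A \<Longrightarrow> agree N' s t \<Longrightarrow> p s \<in> C' \<longleftrightarrow> p t \<in> C'"
    unfolding clopens_def by blast
  show ?thesis
  proof (rule clopensI[where N = "max N N'"])
    show "C \<union> C' \<subseteq> \<Lambda>" using N N' by blast
    fix s t assume st: "s \<in> subshift A" "t \<in> subshift A" "agree (max N N') s t" "p s \<in> C \<union> C'"
    then have "agree N s t" "agree N' s t" by (auto intro: agree_mono)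
    then show "p t \<in> C \<union> C'" using N(2) N'(2) st by blast
  qed
qed

lemma clopens_subset: "clopens \<subseteq> Pow \<Lambda>"
  by (auto simp: clopens_def)

lemma algebra_clopens: "algebra \<Lambda> clopens"
  unfolding algebra_iff_Un
proof (intro conjI ballI)
  show "{} \<in> clopens" by (simp add: clopens_def)
qed (auto simp: clopen_Un clopen_Diff dest: clopens_subset[THEN subsetD])

lemma Int_stable_clopens: "Int_stable clopens"
  using algebra.Int_stable[OF algebra_clopens] .

text \<open>Every relatively open set is a union of cylinders; indexing the union by words rather
  than by points shows that it is countable.\<close>

lemma sets_clopens: "sets (restrict_space borel \<Lambda>) = sigma_sets \<Lambda> clopens"
proof
  have "\<Lambda> \<in> sets borel" using compact_imp_closed[OF compact] by (rule borel_closed)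
  have "C \<in> sets (restrict_space borel \<Lambda>)" if C: "C \<in> clopens" for C
  proof -
    obtain V where "open V" "C = \<Lambda> \<inter> V" using openin_clopen[OF C] unfolding openin_open by blast
    then show ?thesis unfolding sets_restrict_space using borel_open by blast
  qed
  then show "sigma_sets \<Lambda> clopens \<subseteq> sets (restrict_space borel \<Lambda>)"
    using sets.sigma_sets_subset[of clopens "restrict_space borel \<Lambda>"] by (auto simp: space_restrict_space)
  have "sets (restrict_space borel \<Lambda>) = (\<inter>) \<Lambda> ` sigma_sets UNIV {S. open S}"
    unfolding sets_restrict_space borel_def by simp
  also have "\<dots> = sigma_sets \<Lambda> ((\<inter>) \<Lambda> ` {S. open S})"
    using \<open>\<Lambda> \<in> sets borel\<close> unfolding borel_def by (intro sigma_sets_Int) auto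
  also have "\<dots> \<subseteq> sigma_sets \<Lambda> clopens"
  proof (rule sigma_sets_mono)
    show "(\<inter>) \<Lambda> ` {S. open S} \<subseteq> sigma_sets \<Lambda> clopens"
    proof
      fix V assume "V \<in> (\<inter>) \<Lambda> ` {S. open S}"
      then have V: "openin (top_of_set \<Lambda>) V" by (auto simp: openin_open)
      define W where "W = {w :: 'k list. \<exists>u\<in>V. \<exists>n. w = prefix n (q u) \<and> cyl n (q u) \<subseteq> V}"
      define Z where "Z w = p ` {t \<in> subshift A. prefix (length w) t = w}" for w
      have Z: "Z (prefix n s) = cyl n s" for n s
      proof -
        have "prefix n t = prefix n s \<longleftrightarrow> agree n s t" for t
          by (auto simp: agree_def subsequence_def list_eq_iff_nth_eq)
        then show ?thesis by (simp add: Z_def cyl_def subsequence_def)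
      qed
      have "V = (\<Union>w\<in>W. Z w)"
      proof
        show "V \<subseteq> (\<Union>w\<in>W. Z w)"
        proof
          fix u assume u: "u \<in> V"
          then obtain n where n: "cyl n (q u) \<subseteq> V" using open_contains_cyl[OF V] by blast
          have "u \<in> cyl n (q u)" using u V openin_subset[OF V] by (auto simp: in_cyl_iff agree_refl)
          then show "u \<in> (\<Union>w\<in>W. Z w)" using u n Z unfolding W_def by blast
        qed
        show "(\<Union>w\<in>W. Z w) \<subseteq> V" using Z unfolding W_def by auto
      qed
      moreover have "(\<Union>w\<in>W. Z w) \<in> sigma_sets \<Lambda> clopens"
      proof (rule sigma_sets_UNION)
        show "countable (Z ` W)" by (intro countable_image) simp
        show "B \<in> sigma_sets \<Lambda> clopens" if "B \<in> Z ` W" for B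
          using that Z cyl_clopen unfolding W_def by (auto intro!: sigma_sets.Basic)
      qed
      ultimately show "V \<in> sigma_sets \<Lambda> clopens" by simp
    qed
  qed
  finally show "sets (restrict_space borel \<Lambda>) \<subseteq> sigma_sets \<Lambda> clopens" .
qed

lemma space_eq: "sets m = sets (restrict_space borel \<Lambda>) \<Longrightarrow> space m = \<Lambda>"
  by (drule sets_eq_imp_space_eq) (simp add: space_restrict_space)

lemma clopen_in_sets: "C \<in> clopens \<Longrightarrow> C \<in> sets (restrict_space borel \<Lambda>)"
  unfolding sets_clopens by (rule sigma_sets.Basic)

text \<open>Caratheodory's extension needs continuity at the empty set. It is automatic here: by
  compactness, a decreasing sequence of clopen sets with empty intersection is empty from some index
  on.\<close>

lemma clopen_measure_exists:
  fixes l :: "'m set \<Rightarrow> real"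
  assumes pos: "\<And>C. C \<in> clopens \<Longrightarrow> 0 \<le> l C" and empty: "l {} = 0"
    and add: "\<And>C C'. C \<in> clopens \<Longrightarrow> C' \<in> clopens \<Longrightarrow> C \<inter> C' = {} \<Longrightarrow> l (C \<union> C') = l C + l C'"
  shows "\<exists>\<nu>. sets \<nu> = sets (restrict_space borel \<Lambda>) \<and> (\<forall>C\<in>clopens. emeasure \<nu> C = ennreal (l C))"
proof -
  interpret algebra \<Lambda> clopens by (rule algebra_clopens)
  have "\<exists>\<mu>. (\<forall>C\<in>clopens. \<mu> C = ennreal (l C)) \<and> measure_space \<Lambda> (sigma_sets \<Lambda> clopens) \<mu>"
  proof (rule caratheodory_empty_continuous)
    show "positive clopens (\<lambda>C. ennreal (l C))" by (simp add: positive_def empty)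
    show "additive clopens (\<lambda>C. ennreal (l C))"
      unfolding additive_def using add pos by (auto simp: ennreal_plus)
    fix C :: "nat \<Rightarrow> 'm set" assume C: "range C \<subseteq> clopens" "decseq C" "(\<Inter>i. C i) = {}"
    define O' where "O' = (\<lambda>i. \<Lambda> - C i) ` UNIV"
    have "\<forall>c\<in>O'. openin (top_of_set \<Lambda>) c" using C(1) clopen_Diff openin_clopen unfolding O'_def by blast
    moreover have "\<Lambda> \<subseteq> \<Union>O'" using C(3) unfolding O'_def by auto
    ultimately obtain E where E: "E \<subseteq> O'" "finite E" "\<Lambda> \<subseteq> \<Union>E"
      using compact[unfolded compact_eq_openin_cover, rule_format, of O'] by auto
    from finite_subset_image[OF E(2) E(1)[unfolded O'_def]]
    obtain F where F: "finite F" "E = (\<lambda>i. \<Lambda> - C i) ` F" by auto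
    have "C i = {}" if i: "i \<ge> sum id F" for i
    proof -
      have "C i \<subseteq> C j" if "j \<in> F" for j
      proof -
        have "j \<le> sum id F" using F(1) that by (metis id_apply member_le_sum zero_le)
        then show ?thesis using C(2) i unfolding decseq_def by (meson order.trans)
      qed
      moreover have "C i \<subseteq> \<Lambda>" using C(1) clopens_subset by blast
      ultimately show ?thesis using E(3) F(2) by blast
    qed
    then have "\<forall>\<^sub>F i in sequentially. ennreal (l (C i)) = 0"
      unfolding eventually_sequentially using empty by (intro exI[of _ "sum id F"]) simp
    then show "(\<lambda>i. ennreal (l (C i))) \<longlonglongrightarrow> 0" by (simp add: tendsto_eventually)
  qed simp
  then obtain \<mu> where \<mu>: "\<And>C. C \<in> clopens \<Longrightarrow> \<mu> C = ennreal (l C)" "measure_space \<Lambda> (sigma_sets \<Lambda> clopens) \<mu>"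
    by blast
  define \<nu> where "\<nu> = measure_of \<Lambda> (sigma_sets \<Lambda> clopens) \<mu>"
  have "sets \<nu> = sigma_sets \<Lambda> clopens"
    unfolding \<nu>_def using sigma_algebra.sets_measure_of_eq[OF sigma_algebra_sigma_sets[OF clopens_subset]] .
  moreover have "emeasure \<nu> C = ennreal (l C)" if "C \<in> clopens" for C
    unfolding \<nu>_def using \<mu> that
    by (subst emeasure_measure_of_sigma) (auto simp: measure_space_def sigma_sets.Basic)
  ultimately show ?thesis using sets_clopens by auto
qed

text \<open>The sets approximable in measure contain the algebra and are closed under complements
  and countable disjoint unions; for a union, a tail of small measure is cut off and the remaining n
  + 1 sets are approximated one by one.\<close>

lemma clopen_approximation:
  assumes m: "prob_space m" "sets m = sets (restrict_space borel \<Lambda>)" and B: "B \<in> sets m" and \<epsilon>: "\<epsilon> > 0"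
  shows "\<exists>C\<in>clopens. measure m ((B - C) \<union> (C - B)) < \<epsilon>"
proof -
  interpret prob_space m by fact
  have space: "space m = \<Lambda>" by (rule space_eq[OF m(2)])
  have sets: "sets m = sigma_sets \<Lambda> clopens" using m(2) sets_clopens by simp
  have cl: "C \<in> sets m" if "C \<in> clopens" for C using that sets by auto
  have "\<forall>\<epsilon>>0. \<exists>C\<in>clopens. measure m ((B - C) \<union> (C - B)) < \<epsilon>"
  proof (rule sigma_sets_induct_disjoint[OF Int_stable_clopens clopens_subset])
    show "B \<in> sigma_sets \<Lambda> clopens" using B sets by simp
    show "\<forall>\<epsilon>>0. \<exists>C\<in>clopens. measure m ((C' - C) \<union> (C - C')) < \<epsilon>" if "C' \<in> clopens" for C'
      using that by (intro allI impI bexI[of _ C']) auto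
    show "\<forall>\<epsilon>>0. \<exists>C\<in>clopens. measure m (({} - C) \<union> (C - {})) < \<epsilon>"
      by (intro allI impI bexI[of _ "{}"]) (auto simp: clopens_def)
    show "\<forall>\<epsilon>>0. \<exists>C\<in>clopens. measure m ((\<Lambda> - X - C) \<union> (C - (\<Lambda> - X))) < \<epsilon>"
      if X: "X \<in> sigma_sets \<Lambda> clopens" "\<forall>\<epsilon>>0. \<exists>C\<in>clopens. measure m ((X - C) \<union> (C - X)) < \<epsilon>" for X
    proof (intro allI impI)
      fix \<epsilon> :: real assume "\<epsilon> > 0"
      then obtain C where C: "C \<in> clopens" "measure m ((X - C) \<union> (C - X)) < \<epsilon>" using X by blast
      have "X \<subseteq> \<Lambda>" using X sets space sets.sets_into_space by blast
      then have "(\<Lambda> - X - (\<Lambda> - C)) \<union> ((\<Lambda> - C) - (\<Lambda> - X)) = (X - C) \<union> (C - X)"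
        using C clopens_subset by blast
      then show "\<exists>C\<in>clopens. measure m ((\<Lambda> - X - C) \<union> (C - (\<Lambda> - X))) < \<epsilon>"
        using C clopen_Diff by (intro bexI[of _ "\<Lambda> - C"]) auto
    qed
    show "\<forall>\<epsilon>>0. \<exists>C\<in>clopens. measure m (((\<Union>i. X i) - C) \<union> (C - (\<Union>i. X i))) < \<epsilon>"
      if disj: "disjoint_family X" and X: "range X \<subseteq> sigma_sets \<Lambda> clopens"
        and IH: "\<And>i::nat. \<forall>\<epsilon>>0. \<exists>C\<in>clopens. measure m ((X i - C) \<union> (C - X i)) < \<epsilon>" for X
    proof (intro allI impI)
      fix \<epsilon> :: real assume \<epsilon>: "\<epsilon> > 0"
      have Xs: "X i \<in> sets m" for i using X sets by auto
      have "(\<lambda>n. measure m (\<Union>i\<le>n. X i)) \<longlonglongrightarrow> measure m (\<Union>n. \<Union>i\<le>n. X i)"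
        using Xs by (intro finite_Lim_measure_incseq) (auto simp: incseq_def intro: order_trans)
      moreover have "(\<Union>n. \<Union>i\<le>n. X i) = (\<Union>i. X i)" by auto
      ultimately have "(\<lambda>n. measure m (\<Union>i\<le>n. X i)) \<longlonglongrightarrow> measure m (\<Union>i. X i)" by simp
      then have "\<forall>\<^sub>F n in sequentially. measure m (\<Union>i. X i) - \<epsilon> / 2 < measure m (\<Union>i\<le>n. X i)"
        using \<epsilon> by (intro order_tendstoD) auto
      then obtain n where n: "measure m (\<Union>i. X i) - \<epsilon> / 2 < measure m (\<Union>i\<le>n. X i)"
        by (meson eventually_happens' sequentially_bot)
      define \<epsilon>' where "\<epsilon>' = \<epsilon> / (2 * (n + 1))"
      have "\<epsilon>' > 0" using \<epsilon> by (simp add: \<epsilon>'_def)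
      then have "\<forall>i. \<exists>C. C \<in> clopens \<and> measure m ((X i - C) \<union> (C - X i)) < \<epsilon>'"
        using IH by blast
      from choice[OF this] obtain C where
        C: "\<And>i. C i \<in> clopens" "\<And>i. measure m ((X i - C i) \<union> (C i - X i)) < \<epsilon>'"
        by blast
      define C' where "C' = (\<Union>i\<le>n. C i)"
      have C': "C' \<in> clopens"
      proof -
        interpret algebra \<Lambda> clopens by (rule algebra_clopens)
        show ?thesis unfolding C'_def using C(1) by (intro finite_UN) auto
      qed
      let ?T = "(\<Union>i. X i) - (\<Union>i\<le>n. X i)"
      have "measure m ?T = measure m (\<Union>i. X i) - measure m (\<Union>i\<le>n. X i)"
        using Xs by (intro finite_measure_Diff) auto
      then have T: "measure m ?T < \<epsilon> / 2" using n by linarith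
      have "measure m (((\<Union>i. X i) - C') \<union> (C' - (\<Union>i. X i)))
          \<le> measure m (?T \<union> (\<Union>i\<le>n. (X i - C i) \<union> (C i - X i)))"
        using Xs cl[OF C(1)] by (intro finite_measure_mono) (auto simp: C'_def)
      also have "\<dots> \<le> measure m ?T + measure m (\<Union>i\<le>n. (X i - C i) \<union> (C i - X i))"
        using Xs cl[OF C(1)] by (intro measure_Un_le) auto
      also have "measure m (\<Union>i\<le>n. (X i - C i) \<union> (C i - X i)) \<le> (\<Sum>i\<le>n. measure m ((X i - C i) \<union> (C i - X i)))"
        using Xs cl[OF C(1)] by (intro measure_UNION_le) auto
      also have "\<dots> \<le> (\<Sum>i\<le>n. \<epsilon>')" using C(2) by (intro sum_mono less_imp_le)
      also have "\<dots> = \<epsilon> / 2" by (simp add: \<epsilon>'_def field_simps)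
      finally have "measure m (((\<Union>i. X i) - C') \<union> (C' - (\<Union>i. X i))) < \<epsilon>" using T by linarith
      then show "\<exists>C\<in>clopens. measure m (((\<Union>i. X i) - C) \<union> (C - (\<Union>i. X i))) < \<epsilon>" using C' by blast
    qed
  qed
  then show ?thesis using \<epsilon> by blast
qed

end

section \<open>The Gibbs measure\<close>

text \<open>Meant for a cell of mass b of which a block takes the mass a. With t = a / b, - t ln t
  is small near t = 0 and near t = 1: it is at most 2 sqrt t and at most 2 sqrt (1 - t), and 2 sqrt
  x \<le> \<delta> + x / \<delta>. Trading the roots for these linear terms yields a bound that can
  be summed over cells.\<close>

lemma entropy_term_bound:
  fixes a b \<delta> :: real
  assumes a: "0 \<le> a" "a \<le> b" and \<delta>: "\<delta> > 0"
  shows "a * - ln (a / b) \<le> \<delta> * b + min a (b - a) / \<delta>"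
proof (cases "a = 0")
  case False
  then have ab: "0 < a" "0 < b" using a by auto
  define t where "t = a / b"
  have t: "0 < t" "t \<le> 1" using ab a by (auto simp: t_def)
  have amgm: "2 * sqrt x \<le> \<delta> + x / \<delta>" if "0 \<le> x" for x
  proof -
    have "0 \<le> (\<delta> - sqrt x)\<^sup>2" by simp
    also have "\<dots> = \<delta>\<^sup>2 - 2 * \<delta> * sqrt x + x" using that by (simp add: power2_diff)
    finally have "2 * sqrt x * \<delta> \<le> (\<delta> + x / \<delta>) * \<delta>"
      using \<delta> by (simp add: algebra_simps power2_eq_square)
    then show ?thesis using \<delta> by simp
  qed
  have 1: "t * - ln t \<le> \<delta> + (1 - t) / \<delta>"
  proof -
    have "ln (1 / t) \<le> 1 / t - 1" using t by (intro ln_le_minus_one) simp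
    then have "- ln t \<le> 1 / t - 1" using t by (simp add: ln_div)
    then have "t * - ln t \<le> t * (1 / t - 1)" using t by (intro mult_left_mono) auto
    also have "\<dots> = 1 - t" using t by (simp add: algebra_simps)
    also have "\<dots> = sqrt (1 - t) * sqrt (1 - t)" using t by simp
    also have "\<dots> \<le> 2 * sqrt (1 - t)"
    proof (intro mult_right_mono)
      have "sqrt (1 - t) \<le> 1" using t by simp
      then show "sqrt (1 - t) \<le> 2" by linarith
    qed (use t in simp)
    also have "\<dots> \<le> \<delta> + (1 - t) / \<delta>" using t by (intro amgm) simp
    finally show ?thesis .
  qed
  have 2: "t * - ln t \<le> \<delta> + t / \<delta>"
  proof -
    have s: "sqrt t > 0" using t by simp
    have "ln (1 / sqrt t) \<le> 1 / sqrt t - 1" using t by (intro ln_le_minus_one) simp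
    moreover have "ln t = 2 * ln (sqrt t)" using t by (simp add: ln_sqrt)
    ultimately have "- ln t \<le> 2 * (1 / sqrt t - 1)" using t by (simp add: ln_div)
    then have "t * - ln t \<le> t * (2 * (1 / sqrt t - 1))" using t by (intro mult_left_mono) auto
    also have "\<dots> = 2 * sqrt t - 2 * t" using t s by (simp add: field_simps real_div_sqrt)
    also have "\<dots> \<le> 2 * sqrt t" using t by simp
    also have "\<dots> \<le> \<delta> + t / \<delta>" using t by (intro amgm) simp
    finally show ?thesis .
  qed
  have "a * - ln (a / b) = b * (t * - ln t)" using ab by (simp add: t_def)
  also have "\<dots> \<le> b * (\<delta> + min t (1 - t) / \<delta>)"
    using 1 2 ab by (intro mult_left_mono) (auto simp: min_def)
  also have "b * (\<delta> + min t (1 - t) / \<delta>) = \<delta> * b + min a (b - a) / \<delta>"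
  proof -
    have "b * min t (1 - t) = min a (b - a)"
      using ab by (simp add: t_def min_mult_distrib_left right_diff_distrib)
    then show ?thesis by (simp add: distrib_left mult.commute)
  qed
  finally show ?thesis .
qed (use assms in simp)

lemma prefix_eq_iff: "prefix n s = prefix n t \<longleftrightarrow> agree n s t"
  by (auto simp: agree_def subsequence_def list_eq_iff_nth_eq)

lemma length_prefix: "length (prefix n s) = n"
  by (simp add: subsequence_def)

lemma prefix_in_words: "s \<in> subshift A \<Longrightarrow> prefix n s \<in> words A n"
  by (auto simp: words_def subsequence_def subshift_def)

lemma take_drop_prefix: "i \<le> n \<Longrightarrow> take N (drop i (prefix (n + N) s)) = prefix N (suffix i s)"
  by (rule nth_equalityI) (auto simp: subsequence_def)

locale coded_system = based_subshift A h K \<theta> x + coding A p \<Lambda>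
  for A :: "nat^'k::finite^'k" and h K \<theta> x and p :: "(nat \<Rightarrow> 'k) \<Rightarrow> 'm::t2_space" and \<Lambda> +
  fixes T :: "'m \<Rightarrow> 'm" and \<phi> :: "'m \<Rightarrow> real"
  assumes h_eq: "s \<in> subshift A \<Longrightarrow> h s = \<phi> (p s)"
    and conj: "s \<in> subshift A \<Longrightarrow> T (p s) = p (suffix 1 s)"
begin

section \<open>Transport to \<Lambda>: continuous functions and the measure given by the limit
  functional\<close>

lemma T_pow_p: "s \<in> \<Sigma> \<Longrightarrow> (T ^^ n) (p s) = p (suffix n s)"
proof (induction n)
  case (Suc n)
  have "(T ^^ Suc n) (p s) = T (p (suffix n s))"
    using Suc.IH[OF Suc.prems] by (simp only: funpow.simps o_apply)
  also have "\<dots> = p (suffix 1 (suffix n s))" by (rule conj[OF subshift_suffix[OF Suc.prems]])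
  finally show ?case by (simp only: suffix_suffix Suc_eq_plus1)
qed simp

lemma T_pow_in: "u \<in> \<Lambda> \<Longrightarrow> (T ^^ n) u \<in> \<Lambda>"
  using T_pow_p[OF q_in, of u n] p_q[of u] p_in[OF subshift_suffix[OF q_in, of u n]] by simp

lemma q_T_pow: "u \<in> \<Lambda> \<Longrightarrow> q ((T ^^ n) u) = suffix n (q u)"
  using T_pow_p[OF q_in, of u n] p_q[of u] q_p[OF subshift_suffix[OF q_in, of u n]] by simp

lemma S_birkhoff: "u \<in> \<Lambda> \<Longrightarrow> S n (q u) = (\<Sum>i<n. \<phi> ((T ^^ i) u))"
proof -
  assume u: "u \<in> \<Lambda>"
  have "h (suffix i (q u)) = \<phi> ((T ^^ i) u)" for i
    using h_eq[OF subshift_suffix[OF q_in[OF u], of i]] T_pow_p[OF q_in[OF u], of i] p_q[OF u] by simp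
  then show ?thesis by (simp add: S_def)
qed

lemma unif_continuous:
  fixes f :: "'m \<Rightarrow> 'b::metric_space"
  shows "continuous_on \<Lambda> f \<Longrightarrow> unif (\<lambda>s. f (p s))"
  unfolding unif_def using continuous_uniformly by blast

lemma continuous_\<phi>: "continuous_on \<Lambda> \<phi>"
proof (rule uniformly_continuous)
  fix \<epsilon> :: real assume "\<epsilon> > 0"
  then obtain N where "\<And>s t. s \<in> \<Sigma> \<Longrightarrow> t \<in> \<Sigma> \<Longrightarrow> agree N s t \<Longrightarrow> dist (h s) (h t) \<le> \<epsilon>"
    using unif_h unfolding unif_def by metis
  then show "\<exists>N. \<forall>s\<in>\<Sigma>. \<forall>t\<in>\<Sigma>. agree N s t \<longrightarrow> dist (\<phi> (p s)) (\<phi> (p t)) \<le> \<epsilon>"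
    using h_eq by (intro exI[of _ N]) auto
qed

lemma Lim_\<phi>: "Lim (\<lambda>s. \<phi> (p s)) = Lim h"
  by (rule Lim_cong) (simp add: h_eq)

lemma unif_clopen: "C \<in> clopens \<Longrightarrow> unif (\<lambda>s. indicator C (p s) :: real)"
proof -
  assume "C \<in> clopens"
  then obtain N where N: "\<And>s t. s \<in> \<Sigma> \<Longrightarrow> t \<in> \<Sigma> \<Longrightarrow> agree N s t \<Longrightarrow> p s \<in> C \<longleftrightarrow> p t \<in> C"
    unfolding clopens_def by blast
  show ?thesis by (rule unif_local[where N = N]) (use N in \<open>auto simp: indicator_def\<close>)
qed

text \<open>\<open>Lim\<close> is nonnegative, additive and normalized on indicators of clopen sets,
  so the extension from clopen sets applies; it takes the place of the Riesz representation
  theorem.\<close>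

lemma Lim_measure_exists:
  "\<exists>\<nu>. sets \<nu> = sets (restrict_space borel \<Lambda>) \<and> prob_space \<nu>
     \<and> (\<forall>C\<in>clopens. measure \<nu> C = Lim (\<lambda>s. indicator C (p s)))"
proof -
  define l where "l C = Lim (\<lambda>s. indicator C (p s))" for C
  have l_nonneg: "0 \<le> l C" if "C \<in> clopens" for C
  proof -
    have "Lim (\<lambda>_. 0) \<le> l C" unfolding l_def by (intro Lim_mono unif_const unif_clopen that) simp
    then show ?thesis by (simp add: Lim_const)
  qed
  have "\<exists>\<nu>. sets \<nu> = sets (restrict_space borel \<Lambda>) \<and> (\<forall>C\<in>clopens. emeasure \<nu> C = ennreal (l C))"
  proof (rule clopen_measure_exists[OF l_nonneg])
    show "l {} = 0" by (simp add: l_def Lim_const)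
    fix C C' assume C: "C \<in> clopens" "C' \<in> clopens" "C \<inter> C' = {}"
    have "l (C \<union> C') = Lim (\<lambda>s. indicator C (p s) + indicator C' (p s))"
      unfolding l_def by (rule Lim_cong) (use C(3) in \<open>auto simp: indicator_def\<close>)
    also have "\<dots> = l C + l C'" unfolding l_def by (intro Lim_plus unif_clopen C)
    finally show "l (C \<union> C') = l C + l C'" .
  qed
  then obtain \<nu> where \<nu>: "sets \<nu> = sets (restrict_space borel \<Lambda>)" "\<And>C. C \<in> clopens \<Longrightarrow> emeasure \<nu> C = ennreal (l C)"
    by blast
  have space: "space \<nu> = \<Lambda>" by (rule space_eq[OF \<nu>(1)])
  have "l \<Lambda> = Lim (\<lambda>_. 1)" unfolding l_def by (rule Lim_cong) (simp add: p_in)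
  moreover have "\<Lambda> \<in> clopens" by (rule clopensI[where N = 0]) (auto simp: p_in)
  ultimately have "emeasure \<nu> (space \<nu>) = 1" using \<nu>(2)[of \<Lambda>] space by (simp add: Lim_const)
  then have "prob_space \<nu>" by (rule prob_spaceI)
  moreover have "measure \<nu> C = l C" if "C \<in> clopens" for C
    using \<nu>(2)[OF that] l_nonneg[OF that] by (simp add: measure_def)
  ultimately show ?thesis using \<nu>(1) by (auto simp: l_def)
qed

lemma clopen_vimage:
  assumes "C \<in> clopens" shows "T -` C \<inter> \<Lambda> \<in> clopens"
proof -
  obtain N where N: "\<And>s t. s \<in> \<Sigma> \<Longrightarrow> t \<in> \<Sigma> \<Longrightarrow> agree N s t \<Longrightarrow> p s \<in> C \<longleftrightarrow> p t \<in> C"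
    using assms unfolding clopens_def by blast
  show ?thesis
  proof (rule clopensI[where N = "1 + N"])
    fix s t assume st: "s \<in> \<Sigma>" "t \<in> \<Sigma>" "agree (1 + N) s t" "p s \<in> T -` C \<inter> \<Lambda>"
    have "p (suffix 1 s) \<in> C \<longleftrightarrow> p (suffix 1 t) \<in> C"
      using st by (intro N subshift_suffix agree_suffix)
    then show "p t \<in> T -` C \<inter> \<Lambda>" using st conj[OF st(1)] conj[OF st(2)] p_in by simp
  qed simp
qed

lemma T_measurable:
  assumes m: "sets m = sets (restrict_space borel \<Lambda>)" shows "T \<in> m \<rightarrow>\<^sub>M m"
proof -
  have space: "space m = \<Lambda>" by (rule space_eq[OF m])
  show ?thesis
  proof (rule measurable_sigma_sets)
    show "sets m = sigma_sets \<Lambda> clopens" using m sets_clopens by simp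
    show "clopens \<subseteq> Pow \<Lambda>" by (rule clopens_subset)
    show "T \<in> space m \<rightarrow> \<Lambda>" using T_pow_in[of _ 1] by (simp add: space)
    fix C assume "C \<in> clopens"
    then have "T -` C \<inter> \<Lambda> \<in> clopens" by (rule clopen_vimage)
    then show "T -` C \<inter> space m \<in> sets m" using clopen_in_sets m space by simp
  qed
qed

lemma continuous_measurable:
  fixes f :: "'m \<Rightarrow> 'b::topological_space"
  assumes "sets m = sets (restrict_space borel \<Lambda>)" "continuous_on \<Lambda> f" shows "f \<in> borel_measurable m"
  using borel_measurable_continuous_on_restrict[OF assms(2)] measurable_cong_sets[OF assms(1) refl] by blast

lemma continuous_integrable:
  fixes f :: "'m \<Rightarrow> real"
  assumes m: "prob_space m" "sets m = sets (restrict_space borel \<Lambda>)" and f: "continuous_on \<Lambda> f"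
  shows "integrable m f"
proof -
  interpret prob_space m by fact
  have space: "space m = \<Lambda>" by (rule space_eq[OF m(2)])
  obtain B where B: "\<And>s. s \<in> \<Sigma> \<Longrightarrow> \<bar>f (p s)\<bar> \<le> B" using unif_bounded[OF unif_continuous[OF f]] by blast
  have "norm (f u) \<le> B" if "u \<in> space m" for u
    using B[OF q_in[of u]] p_q[of u] that by (simp add: space)
  then show ?thesis
    by (intro integrable_const_bound[of _ B] AE_I2 continuous_measurable[OF m(2) f])
qed

lemma finite_label_prefix:
  assumes m: "sets m = sets (restrict_space borel \<Lambda>)"
  shows "finite_label m (\<lambda>u. prefix N (q u))"
  unfolding finite_label_def
proof safe
  have space: "space m = \<Lambda>" by (rule space_eq[OF m])
  show "finite ((\<lambda>u. prefix N (q u)) ` space m)"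
    by (rule finite_subset[OF _ finite_lists_length_eq[of UNIV N]]) (auto simp: length_prefix)
  fix w
  show "{u \<in> space m. prefix N (q u) = w} \<in> sets m"
  proof (cases "\<exists>v\<in>\<Lambda>. prefix N (q v) = w")
    case True
    then obtain v where v: "v \<in> \<Lambda>" "prefix N (q v) = w" by blast
    then have "{u \<in> space m. prefix N (q u) = w} = cyl N (q v)"
      by (auto simp: space in_cyl_iff prefix_eq_iff intro: agree_sym)
    then show ?thesis using clopen_in_sets[OF cyl_clopen] m by simp
  next
    case False
    then have "{u \<in> space m. prefix N (q u) = w} = {}" by (auto simp: space)
    then show ?thesis by (simp only: sets.empty_sets)
  qed
qed

text \<open>Both sides agree on step functions constant on the cylinders of length N, by finite
  additivity, and f is within \<epsilon> / 2 of such a function by uniform continuity.\<close>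

lemma integral_Lim:
  fixes f :: "'m \<Rightarrow> real"
  assumes \<nu>: "prob_space \<nu>" "sets \<nu> = sets (restrict_space borel \<Lambda>)"
    "\<And>C. C \<in> clopens \<Longrightarrow> measure \<nu> C = Lim (\<lambda>s. indicator C (p s))"
    and f: "continuous_on \<Lambda> f"
  shows "(\<integral>u. f u \<partial>\<nu>) = Lim (\<lambda>s. f (p s))"
proof -
  interpret prob_space \<nu> by fact
  have space: "space \<nu> = \<Lambda>" by (rule space_eq[OF \<nu>(2)])
  have "\<bar>(\<integral>u. f u \<partial>\<nu>) - Lim (\<lambda>s. f (p s))\<bar> \<le> \<epsilon>" if \<epsilon>: "\<epsilon> > 0" for \<epsilon>
  proof -
    obtain N where N: "\<And>s t. s \<in> \<Sigma> \<Longrightarrow> t \<in> \<Sigma> \<Longrightarrow> agree N s t \<Longrightarrow> dist (f (p s)) (f (p t)) \<le> \<epsilon> / 2"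
      using continuous_uniformly[OF f, of "\<epsilon> / 2"] \<epsilon> by auto
    define X where "X u = prefix N (q u)" for u
    have X: "finite_label \<nu> X" unfolding X_def by (rule finite_label_prefix[OF \<nu>(2)])
    define rep where "rep w = (SOME u. u \<in> \<Lambda> \<and> X u = w)" for w
    have rep: "rep (X u) \<in> \<Lambda>" "X (rep (X u)) = X u" if "u \<in> \<Lambda>" for u
      using someI[of "\<lambda>v. v \<in> \<Lambda> \<and> X v = X u" u] that by (auto simp: rep_def)
    define g where "g w = f (rep w)" for w
    have close: "\<bar>f u - g (X u)\<bar> \<le> \<epsilon> / 2" if u: "u \<in> \<Lambda>" for u
    proof -
      have "agree N (q u) (q (rep (X u)))"
        using rep(2)[OF u] by (simp add: X_def prefix_eq_iff agree_sym)
      from N[OF q_in[OF u] q_in[OF rep(1)[OF u]] this] show ?thesis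
        using p_q[OF u] p_q[OF rep(1)[OF u]] by (simp add: g_def dist_real_def)
    qed
    have up: "f u \<le> g (X u) + \<epsilon> / 2" and lo: "g (X u) - \<epsilon> / 2 \<le> f u" if "u \<in> \<Lambda>" for u
      using close[OF that] by linarith+
    have cell: "{u \<in> space \<nu>. X u = X v} \<in> clopens" if "v \<in> \<Lambda>" for v
    proof -
      have "{u \<in> space \<nu>. X u = X v} = cyl N (q v)"
        by (auto simp: space in_cyl_iff prefix_eq_iff X_def intro: agree_sym)
      then show ?thesis using cyl_clopen by simp
    qed
    have unif_gX: "unif (\<lambda>s. g (X (p s)))"
      by (rule unif_local[where N = N]) (simp add: X_def q_p prefix_eq_iff[symmetric])
    have gX: "(\<integral>u. g (X u) \<partial>\<nu>) = Lim (\<lambda>s. g (X (p s)))"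
    proof -
      have "Lim (\<lambda>s. g (X (p s))) = Lim (\<lambda>s. \<Sum>w\<in>X ` space \<nu>. g w * indicator {u \<in> space \<nu>. X u = w} (p s))"
        by (rule Lim_cong) (rule finite_label_expansion[OF X], simp add: space p_in)
      also have "\<dots> = (\<Sum>w\<in>X ` space \<nu>. Lim (\<lambda>s. g w * indicator {u \<in> space \<nu>. X u = w} (p s)))"
        by (rule Lim_sum) (auto intro!: unif_cmult unif_clopen cell simp: space[symmetric])
      also have "\<dots> = (\<Sum>w\<in>X ` space \<nu>. g w * measure \<nu> {u \<in> space \<nu>. X u = w})"
      proof (rule sum.cong[OF refl])
        fix w assume "w \<in> X ` space \<nu>"
        then have "{u \<in> space \<nu>. X u = w} \<in> clopens" using cell by (auto simp: space)
        then show "Lim (\<lambda>s. g w * indicator {u \<in> space \<nu>. X u = w} (p s)) = g w * measure \<nu> {u \<in> space \<nu>. X u = w}"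
          using \<nu>(3) Lim_cmult[OF unif_clopen] by simp
      qed
      also have "\<dots> = (\<integral>u. g (X u) \<partial>\<nu>)"
        using integral_finite_label[OF X, of g] by (simp add: mult.commute)
      finally show ?thesis by simp
    qed
    have int_f: "integrable \<nu> f" by (rule continuous_integrable[OF \<nu>(1,2) f])
    have int_g: "integrable \<nu> (\<lambda>u. g (X u))" by (rule integrable_finite_label[OF X])
    have "(\<integral>u. f u \<partial>\<nu>) \<le> (\<integral>u. g (X u) + \<epsilon> / 2 \<partial>\<nu>)"
      by (rule integral_mono) (use int_f int_g up in \<open>simp_all add: space\<close>)
    moreover have "(\<integral>u. g (X u) - \<epsilon> / 2 \<partial>\<nu>) \<le> (\<integral>u. f u \<partial>\<nu>)"
      by (rule integral_mono) (use int_f int_g lo in \<open>simp_all add: space\<close>)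
    ultimately have 1: "\<bar>(\<integral>u. f u \<partial>\<nu>) - (\<integral>u. g (X u) \<partial>\<nu>)\<bar> \<le> \<epsilon> / 2"
      using int_g by (intro abs_leI) (simp_all add: prob_space)
    have "Lim (\<lambda>s. f (p s)) \<le> Lim (\<lambda>s. g (X (p s)) + \<epsilon> / 2)"
      by (intro Lim_mono unif_continuous[OF f] unif_plus unif_gX unif_const up p_in)
    moreover have "Lim (\<lambda>s. g (X (p s)) + (- (\<epsilon> / 2))) \<le> Lim (\<lambda>s. f (p s))"
      using lo[OF p_in] by (intro Lim_mono unif_continuous[OF f] unif_plus unif_gX unif_const) simp
    ultimately have 2: "\<bar>Lim (\<lambda>s. g (X (p s))) - Lim (\<lambda>s. f (p s))\<bar> \<le> \<epsilon> / 2"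
      unfolding Lim_plus[OF unif_gX unif_const] Lim_const by (intro abs_leI) simp_all
    show ?thesis using 1 2 gX by linarith
  qed
  then have "\<bar>(\<integral>u. f u \<partial>\<nu>) - Lim (\<lambda>s. f (p s))\<bar> \<le> 0" 
    by (rule field_le_epsilon) simp
  then show ?thesis by simp
qed

text \<open>On clopen sets invariance is \<open>Lim_suffix\<close>; they are stable under
  intersection and generate the Borel sets.\<close>

lemma Lim_measure_invariant:
  assumes \<nu>: "prob_space \<nu>" "sets \<nu> = sets (restrict_space borel \<Lambda>)"
    "\<And>C. C \<in> clopens \<Longrightarrow> measure \<nu> C = Lim (\<lambda>s. indicator C (p s))"
  shows "\<nu> \<in> invariant_measures \<Lambda> T"
proof -
  interpret prob_space \<nu> by fact
  have space: "space \<nu> = \<Lambda>" by (rule space_eq[OF \<nu>(2)])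
  note T = T_measurable[OF \<nu>(2)]
  have "distr \<nu> \<nu> T = \<nu>"
  proof (rule measure_eqI_generator_eq[OF Int_stable_clopens clopens_subset])
    show "sets (distr \<nu> \<nu> T) = sigma_sets \<Lambda> clopens" "sets \<nu> = sigma_sets \<Lambda> clopens"
      using \<nu>(2) sets_clopens by simp_all
    show "range (\<lambda>_::nat. \<Lambda>) \<subseteq> clopens" using clopensI[of \<Lambda> 0] by (auto simp: p_in)
    show "emeasure (distr \<nu> \<nu> T) \<Lambda> \<noteq> \<infinity>" for i :: nat
      using finite_measure.emeasure_finite[OF prob_space.finite_measure[OF prob_space_distr[OF T]]]
      by (simp add: less_top)
    fix C assume C: "C \<in> clopens"
    have Cs: "C \<in> sets \<nu>" using clopen_in_sets[OF C] \<nu>(2) by simp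
    have TC: "T -` C \<inter> \<Lambda> \<in> clopens" by (rule clopen_vimage[OF C])
    have "measure \<nu> (T -` C \<inter> \<Lambda>) = Lim (\<lambda>s. indicator C (p (suffix 1 s)))"
      unfolding \<nu>(3)[OF TC] by (rule Lim_cong) (simp add: indicator_def conj p_in)
    also have "\<dots> = measure \<nu> C"
      using Lim_suffix[OF unif_clopen[OF C], of 1] \<nu>(3)[OF C] by simp
    finally show "emeasure (distr \<nu> \<nu> T) C = emeasure \<nu> C"
      using emeasure_distr[OF T Cs] by (simp add: emeasure_eq_measure space)
  qed auto
  then show ?thesis unfolding invariant_measures_def using \<nu> T by simp
qed

end

section \<open>Lower and upper bounds for the entropy\<close>

context coded_system
begin

text \<open>At any point t, the n-th iterate of the indicator has at most one nonzero term, that of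
  the word \<open>prefix n s\<close>, and distortion compares its weight with exp (- S n s). This is
  the upper half of the Gibbs property.\<close>

lemma cyl_Lim_measure_le:
  assumes \<nu>: "\<And>C. C \<in> clopens \<Longrightarrow> measure \<nu> C = Lim (\<lambda>s. indicator C (p s))" and s: "s \<in> \<Sigma>"
  shows "measure \<nu> (cyl n s) \<le> exp (D - S n s)"
  unfolding \<nu>[OF cyl_clopen]
proof (rule Lim_le[OF unif_clopen[OF cyl_clopen]])
  fix t assume t: "t \<in> \<Sigma>"
  let ?w = "prefix n s"
  have zero: "indicator (cyl n s) (p (w \<frown> t)) = (0::real)" if w: "w \<in> pre n t" "w \<noteq> ?w" for w
  proof -
    have "\<not> agree n s (w \<frown> t)"
    proof
      assume "agree n s (w \<frown> t)"
      then have "?w ! i = w ! i" if "i < n" for i using that w by (simp add: agree_def subsequence_def pre_memD)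
      then have "?w = w" using w by (intro nth_equalityI) (auto simp: length_prefix pre_memD)
      then show False using w by simp
    qed
    then show ?thesis using pre_memD(2)[OF w(1)] by (simp add: in_cyl_iff q_p p_in)
  qed
  have "Lop n (\<lambda>s'. indicator (cyl n s) (p s')) t
      = (\<Sum>w\<in>pre n t \<inter> {?w}. exp (- S n (w \<frown> t)) * indicator (cyl n s) (p (w \<frown> t)))"
    unfolding Lop_def by (rule sum.mono_neutral_right) (use zero in \<open>auto simp: finite_pre\<close>)
  also have "\<dots> \<le> exp (D - S n s)"
  proof (cases "?w \<in> pre n t")
    case True
    have "agree n (?w \<frown> t) (?w \<frown> suffix n s)"
      using agree_conc_word[of ?w t "suffix n s"] by (simp only: length_prefix)
    then have "\<bar>S n (?w \<frown> t) - S n s\<bar> \<le> D * \<theta> ^ 0"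
      using pre_memD(2)[OF True] s by (intro S_distortion) (simp_all only: prefix_conc_suffix add_0_right)
    then have "exp (- S n (?w \<frown> t)) \<le> exp (D - S n s)" by simp
    then have "exp (- S n (?w \<frown> t)) * indicator (cyl n s) (p (?w \<frown> t)) \<le> exp (D - S n s) * 1"
      by (intro mult_mono) (auto simp: indicator_def)
    moreover have "pre n t \<inter> {?w} = {?w}" using True by auto
    moreover have "(\<Sum>w\<in>{?w}. G w) = G ?w" for G :: "'k list \<Rightarrow> real" by simp
    ultimately show ?thesis by (simp only: mult_1_right)
  qed simp
  finally show "Lop n (\<lambda>s'. indicator (cyl n s) (p s')) t \<le> exp (D - S n s)" .
qed

lemma invariant_measureD:
  assumes "m \<in> invariant_measures \<Lambda> T"
  shows "prob_space m" "sets m = sets (restrict_space borel \<Lambda>)" "space m = \<Lambda>" "invariant_prob m T"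
proof -
  show m: "prob_space m" "sets m = sets (restrict_space borel \<Lambda>)" using assms by (auto simp: invariant_measures_def)
  show "space m = \<Lambda>" by (rule space_eq[OF m(2)])
  show "invariant_prob m T"
    using assms by (intro invariant_prob.intro invariant_prob_axioms.intro) (auto simp: invariant_measures_def)
qed

lemma integral_S:
  assumes m: "m \<in> invariant_measures \<Lambda> T"
  shows "integrable m (\<lambda>u. S n (q u))" "(\<integral>u. S n (q u) \<partial>m) = n * (\<integral>u. \<phi> u \<partial>m)"
proof -
  note mD = invariant_measureD[OF m]
  interpret invariant_prob m T by (rule mD)
  have int: "integrable m \<phi>" by (rule continuous_integrable[OF mD(1,2) continuous_\<phi>])
  have int': "integrable m (\<lambda>u. \<phi> ((T ^^ i) u))" for i
    by (rule integrable_distr[OF T_pow_meas]) (simp add: T_pow_inv int)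
  have "integrable m (\<lambda>u. S n (q u)) \<longleftrightarrow> integrable m (\<lambda>u. \<Sum>i<n. \<phi> ((T ^^ i) u))"
    by (rule Bochner_Integration.integrable_cong) (auto simp: mD(3) S_birkhoff)
  then show "integrable m (\<lambda>u. S n (q u))" using int' by simp
  have "(\<integral>u. S n (q u) \<partial>m) = (\<integral>u. (\<Sum>i<n. \<phi> ((T ^^ i) u)) \<partial>m)"
    by (rule Bochner_Integration.integral_cong) (auto simp: mD(3) S_birkhoff)
  also have "\<dots> = (\<Sum>i<n. \<integral>u. \<phi> ((T ^^ i) u) \<partial>m)" using int' by simp
  also have "\<dots> = n * (\<integral>u. \<phi> u \<partial>m)"
    using integral_T_pow[OF borel_measurable_integrable[OF int]] by simp
  finally show "(\<integral>u. S n (q u) \<partial>m) = n * (\<integral>u. \<phi> u \<partial>m)" .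
qed

text \<open>For the partition by the first letter the cells of the n-th join are the cylinders of
  length n. Integrating the logarithm of the cylinder bound gives entropy at least n times the mean
  of \<phi>, minus D, which disappears after division by n.\<close>

lemma ks_entropy_Lim_measure_ge:
  assumes \<nu>: "\<nu> \<in> invariant_measures \<Lambda> T"
    "\<And>C. C \<in> clopens \<Longrightarrow> measure \<nu> C = Lim (\<lambda>s. indicator C (p s))"
  shows "ereal (\<integral>u. \<phi> u \<partial>\<nu>) \<le> ks_entropy T \<nu>"
proof -
  note \<nu>D = invariant_measureD[OF \<nu>(1)]
  interpret invariant_prob \<nu> T by (rule \<nu>D)
  define c where "c j = {u \<in> \<Lambda>. q u 0 = j}" for j
  \<comment> \<open>Empty classes are dropped because \<open>partition_on\<close> excludes the empty
    set.\<close>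
  define P where "P = c ` {j. c j \<noteq> {}}"
  have c_sets: "c j \<in> sets \<nu>" for j
  proof -
    have "c j \<in> clopens" by (rule clopensI[where N = 1]) (auto simp: c_def q_p p_in agree_def)
    then show ?thesis using clopen_in_sets \<nu>D(2) by simp
  qed
  have P: "finite P" "P \<subseteq> sets \<nu>" "partition_on (space \<nu>) P"
    using c_sets by (auto simp: P_def partition_on_def disjoint_def \<nu>D(3)) (auto simp: c_def)
  have block: "block P u = c (q u 0)" if u: "u \<in> \<Lambda>" for u
    by (rule block_eqI[OF P(3)]) (use u in \<open>auto simp: P_def c_def\<close>)
  have c_inj: "c (q u 0) = c (q v 0) \<longleftrightarrow> q u 0 = q v 0" if "u \<in> \<Lambda>" for u v
    using that by (auto simp: c_def)
  have cell: "{v \<in> space \<nu>. itinerary T P n v = itinerary T P n u} = cyl n (q u)" if u: "u \<in> \<Lambda>" for u n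
  proof -
    have "itinerary T P n v = itinerary T P n u \<longleftrightarrow> agree n (q u) (q v)" if v: "v \<in> \<Lambda>" for v
    proof -
      have "block P ((T ^^ i) v) = block P ((T ^^ i) u) \<longleftrightarrow> q v i = q u i" for i
        using c_inj[OF T_pow_in[OF v, of i], of "(T ^^ i) u"] by (simp add: block T_pow_in u v q_T_pow)
      then show ?thesis unfolding itinerary_eq_iff[OF P] by (auto simp: agree_def)
    qed
    then show ?thesis by (auto simp: \<nu>D(3) in_cyl_iff)
  qed
  note lab = finite_label_itinerary[OF P]
  have "n * (\<integral>u. \<phi> u \<partial>\<nu>) - D \<le> ent \<nu> (itinerary T P n)" for n
  proof -
    have "(\<integral>u. S n (q u) - D \<partial>\<nu>) \<le> ent \<nu> (itinerary T P n)"
      unfolding ent_def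
    proof (rule integral_mono_AE)
      show "integrable \<nu> (\<lambda>u. S n (q u) - D)" using integral_S(1)[OF \<nu>(1)] by simp
      show "integrable \<nu> (\<lambda>u. - ln (measure \<nu> {v \<in> space \<nu>. itinerary T P n v = itinerary T P n u}))"
        by (rule integrable_finite_label[OF lab, of "\<lambda>z. - ln (measure \<nu> {v \<in> space \<nu>. itinerary T P n v = z})"])
      show "AE u in \<nu>. S n (q u) - D \<le> - ln (measure \<nu> {v \<in> space \<nu>. itinerary T P n v = itinerary T P n u})"
        using AE_cell_pos[OF lab, of n] AE_space
      proof eventually_elim
        case (elim u)
        then have u: "u \<in> \<Lambda>" by (simp add: \<nu>D(3))
        have "ln (measure \<nu> (cyl n (q u))) \<le> ln (exp (D - S n (q u)))"
          using elim(1) cyl_Lim_measure_le[OF \<nu>(2) q_in[OF u], of n] unfolding cell[OF u]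
          by (subst ln_le_cancel_iff) auto
        then show ?case unfolding cell[OF u] by simp
      qed
    qed
    then show ?thesis using integral_S[OF \<nu>(1), of n] by (simp add: prob_space)
  qed
  then have le: "(\<integral>u. \<phi> u \<partial>\<nu>) - D * inverse (real n) \<le> ent \<nu> (itinerary T P n) / n" if "n \<ge> 1" for n
  proof -
    have "(n * (\<integral>u. \<phi> u \<partial>\<nu>) - D) / n \<le> ent \<nu> (itinerary T P n) / n"
      using \<open>\<And>n. n * (\<integral>u. \<phi> u \<partial>\<nu>) - D \<le> ent \<nu> (itinerary T P n)\<close>
      by (rule divide_right_mono) simp
    moreover have "(n * (\<integral>u. \<phi> u \<partial>\<nu>) - D) / n = (\<integral>u. \<phi> u \<partial>\<nu>) - D * inverse (real n)"
      using that by (simp add: field_simps)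
    ultimately show ?thesis by simp
  qed
  have "(\<lambda>n. (\<integral>u. \<phi> u \<partial>\<nu>) - D * inverse (real n)) \<longlonglongrightarrow> (\<integral>u. \<phi> u \<partial>\<nu>) - D * 0"
    by (intro tendsto_intros LIMSEQ_inverse_real_of_nat[THEN LIMSEQ_imp_Suc])
  then have "(\<integral>u. \<phi> u \<partial>\<nu>) - D * 0 \<le> lim (\<lambda>n. partition_entropy \<nu> (join_partition \<nu> T P n) / real n)"
    by (rule LIMSEQ_le[OF _ partition_entropy_tendsto[OF P]]) (use le in blast)
  then have "ereal (\<integral>u. \<phi> u \<partial>\<nu>) \<le> ereal (lim (\<lambda>n. partition_entropy \<nu> (join_partition \<nu> T P n) / real n))"
    by simp
  also have "\<dots> \<le> ks_entropy T \<nu>"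
    unfolding ks_entropy_def by (rule SUP_upper) (use P in auto)
  finally show ?thesis .
qed

lemma clopen_level_mono:
  assumes "C \<in> clopens"
  obtains N where "\<And>M s t. M \<ge> N \<Longrightarrow> s \<in> \<Sigma> \<Longrightarrow> t \<in> \<Sigma> \<Longrightarrow> agree M s t \<Longrightarrow> p s \<in> C \<longleftrightarrow> p t \<in> C"
proof -
  obtain N where "\<And>s t. s \<in> \<Sigma> \<Longrightarrow> t \<in> \<Sigma> \<Longrightarrow> agree N s t \<Longrightarrow> p s \<in> C \<longleftrightarrow> p t \<in> C"
    using assms unfolding clopens_def by blast
  then show ?thesis by (intro that[of N]) (auto intro: agree_mono)
qed

context
  fixes m P
  assumes m: "m \<in> invariant_measures \<Lambda> T"
    and fin: "finite P" and P_sets: "P \<subseteq> sets m" and part: "partition_on (space m) P"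
begin

interpretation invariant_prob m T by (rule invariant_measureD(4)[OF m])

definition lab :: "nat \<Rightarrow> 'm \<Rightarrow> 'm set \<times> 'k list" where
  "lab N u = (block P u, prefix N (q u))"

text \<open>The conditional probability of the block \<open>fst y\<close> given the first N letters
  \<open>snd y\<close>; it is 0 on null cylinders by the convention for division.\<close>

definition cprob :: "nat \<Rightarrow> 'm set \<times> 'k list \<Rightarrow> real" where
  "cprob N y = measure m {u \<in> space m. lab N u = y} / measure m {u \<in> space m. prefix N (q u) = snd y}"

text \<open>The conditional entropy of P given the first N letters.\<close>

definition cent :: "nat \<Rightarrow> real" where "cent N = (\<integral>u. - ln (cprob N (lab N u)) \<partial>m)"

lemma space_m: "space m = \<Lambda>" by (rule invariant_measureD(3)[OF m])

lemma sets_m: "sets m = sets (restrict_space borel \<Lambda>)" by (rule invariant_measureD(2)[OF m])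

lemma finite_label_lab: "finite_label m (lab N)"
  unfolding lab_def[abs_def]
  by (intro finite_label_Pair finite_label_block[OF fin P_sets part] finite_label_prefix[OF sets_m])

lemma lab_le: "measure m {u \<in> space m. lab N u = y} \<le> measure m {u \<in> space m. prefix N (q u) = snd y}"
  using finite_labelD(2)[OF finite_label_prefix[OF sets_m]]
  by (intro finite_measure_mono) (auto simp: lab_def)

lemma cprob_nonneg: "0 \<le> cprob N y"
  by (simp add: cprob_def)

lemma sum_lab:
  "(\<Sum>B\<in>P. measure m {u \<in> space m. lab N u = (B, c)}) = measure m {u \<in> space m. prefix N (q u) = c}"
proof -
  have "(\<Sum>B\<in>P. measure m {u \<in> space m. lab N u = (B, c)}) = measure m (\<Union>B\<in>P. {u \<in> space m. lab N u = (B, c)})"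
    using finite_labelD(2)[OF finite_label_lab]
    by (intro finite_measure_finite_Union[symmetric] fin) (auto simp: disjoint_family_on_def)
  also have "(\<Union>B\<in>P. {u \<in> space m. lab N u = (B, c)}) = {u \<in> space m. prefix N (q u) = c}"
    using block_in(1)[OF part] by (auto simp: lab_def)
  finally show ?thesis .
qed

lemma sum_cprob_le: "(\<Sum>B\<in>P. cprob N (B, c)) \<le> 1"
  unfolding cprob_def by (simp add: sum_divide_distrib[symmetric] sum_lab)

text \<open>Gibbs' inequality for the joint law of the itinerary and the first \<open>n + N\<close> letters, compared
  with the weights \<open>wt w * \<Prod>\<^sub>i cprob (a\<^sub>i | w\<^sub>i \<dots> w\<^sub>i\<^sub>+\<^sub>N\<^sub>-\<^sub>1)\<close>, whose total mass is bounded.\<close>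

lemma itinerary_entropy_le:
  assumes N: "N \<ge> 1"
  shows "ent m (itinerary T P n) \<le> (n + N) * (\<integral>u. \<phi> u \<partial>m) + D + n * cent N + CARD('k)"
proof -
  define Z where "Z u = (itinerary T P n u, prefix (n + N) (q u))" for u
  define Q where "Q = (\<lambda>(a, w). wt w * (\<Prod>i<n. cprob N (a i, take N (drop i w))))"
  have Z: "finite_label m Z" unfolding Z_def
    by (intro finite_label_Pair finite_label_itinerary[OF fin P_sets part] finite_label_prefix[OF sets_m])
  have Q_Z: "Q (Z u) = wt (prefix (n + N) (q u)) * (\<Prod>i<n. cprob N (lab N ((T ^^ i) u)))" if u: "u \<in> \<Lambda>" for u
  proof -
    have "cprob N (itinerary T P n u i, take N (drop i (prefix (n + N) (q u)))) = cprob N (lab N ((T ^^ i) u))"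
      if "i < n" for i
      using that u by (simp add: itinerary_def take_drop_prefix lab_def q_T_pow del: suffix_def)
    then show ?thesis by (simp add: Q_def Z_def)
  qed
  have Q_nonneg: "0 \<le> Q v" for v
    by (cases v) (auto simp: Q_def intro!: mult_nonneg_nonneg prod_nonneg cprob_nonneg less_imp_le[OF wt_pos])
  \<comment> \<open>Gibbs' inequality needs positive weights on cells of positive mass. The cell of
    Z u lies in the i-th preimage of a cell of \<open>lab N\<close>, which by invariance has the
    same measure as that cell.\<close>
  have cprob_pos: "0 < cprob N (lab N ((T ^^ i) u))"
    if pos: "0 < measure m {v \<in> space m. Z v = Z u}" and u: "u \<in> \<Lambda>" and i: "i < n" for u i
  proof -
    have "measure m {v \<in> space m. Z v = Z u} \<le> measure m {v \<in> space m. lab N ((T ^^ i) v) = lab N ((T ^^ i) u)}"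
    proof (rule finite_measure_mono)
      show "{v \<in> space m. Z v = Z u} \<subseteq> {v \<in> space m. lab N ((T ^^ i) v) = lab N ((T ^^ i) u)}"
      proof safe
        fix v assume v: "v \<in> space m" "Z v = Z u"
        have "block P ((T ^^ i) v) = block P ((T ^^ i) u)"
          using v(2) i by (simp add: Z_def itinerary_eq_iff[OF fin P_sets part])
        moreover have "prefix N (q ((T ^^ i) v)) = prefix N (q ((T ^^ i) u))"
        proof -
          have "take N (drop i (prefix (n + N) (q v))) = take N (drop i (prefix (n + N) (q u)))"
            using v(2) by (simp add: Z_def)
          then show ?thesis using i u v(1) by (simp only: take_drop_prefix less_imp_le q_T_pow space_m)
        qed
        ultimately show "lab N ((T ^^ i) v) = lab N ((T ^^ i) u)" by (simp add: lab_def)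
      qed
      show "{v \<in> space m. lab N ((T ^^ i) v) = lab N ((T ^^ i) u)} \<in> sets m"
        by (rule finite_labelD(2)[OF finite_label_T_pow[OF finite_label_lab]])
    qed
    also have "\<dots> = measure m {v \<in> space m. lab N v = lab N ((T ^^ i) u)}"
      by (rule measure_label_T_pow[OF finite_label_lab])
    finally have "0 < measure m {v \<in> space m. lab N v = lab N ((T ^^ i) u)}" using pos by linarith
    then show ?thesis using lab_le[of N "lab N ((T ^^ i) u)"] by (simp add: cprob_def)
  qed
  have "ent m (itinerary T P n) \<le> ent m Z"
    using ent_mono[OF Z, of fst] by (simp add: Z_def)
  also have "\<dots> \<le> (\<integral>u. - ln (Q (Z u)) \<partial>m) + (\<Sum>v\<in>Z ` space m. Q v) - 1"
  proof (rule ent_le_cross[OF Z Q_nonneg])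
    fix v assume v: "v \<in> Z ` space m" "0 < measure m {u \<in> space m. Z u = v}"
    then obtain u where u: "u \<in> \<Lambda>" "v = Z u" by (auto simp: space_m)
    have "0 < (\<Prod>i<n. cprob N (lab N ((T ^^ i) u)))"
      by (rule prod_pos) (use cprob_pos[of u] u v(2) in simp)
    then show "0 < Q v" using wt_pos u by (simp add: Q_Z)
  qed
  also have "(\<Sum>v\<in>Z ` space m. Q v) \<le> CARD('k)"
  proof -
    let ?A = "PiE {..<n} (\<lambda>_. P)" and ?W = "words A (n + N)"
    have "Z ` space m \<subseteq> ?A \<times> ?W"
    proof (rule image_subsetI)
      fix u assume u: "u \<in> space m"
      then show "Z u \<in> ?A \<times> ?W"
        using block_in(1)[OF part T_pow_space[OF u]] prefix_in_words[OF q_in[of u], of "n + N"]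
        by (auto simp: Z_def itinerary_def space_m)
    qed
    then have "(\<Sum>v\<in>Z ` space m. Q v) \<le> (\<Sum>v\<in>?A \<times> ?W. Q v)"
      by (intro sum_mono2 Q_nonneg) (auto simp: finite_words fin intro!: finite_PiE)
    also have "\<dots> = (\<Sum>w\<in>?W. \<Sum>a\<in>?A. Q (a, w))"
      by (subst sum.cartesian_product'[symmetric] | subst sum.swap)+ simp
    \<comment> \<open>For a fixed word the sum over itineraries factors over the times i, and each
      factor is a sum of conditional probabilities, at most 1. What remains is the total weight of
      the words of length n + N.\<close>
    also have "\<dots> = (\<Sum>w\<in>?W. wt w * (\<Prod>i<n. \<Sum>B\<in>P. cprob N (B, take N (drop i w))))"
      unfolding Q_def by (simp add: prod_sum_PiE fin sum_distrib_left)
    also have "\<dots> \<le> (\<Sum>w\<in>?W. wt w * 1)"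
      using wt_pos sum_cprob_le cprob_nonneg
      by (intro sum_mono mult_left_mono prod_le_1 conjI sum_nonneg) (auto simp: less_imp_le)
    also have "\<dots> \<le> CARD('k)" using Wsum_one_le[of "n + N"] N by (simp add: Wsum_def)
    finally show ?thesis .
  qed
  also have "(\<integral>u. - ln (Q (Z u)) \<partial>m)
      \<le> (\<integral>u. (S (n + N) (q u) + D) + (\<Sum>i<n. - ln (cprob N (lab N ((T ^^ i) u)))) \<partial>m)"
  proof (rule integral_mono_AE)
    have int_lab: "integrable m (\<lambda>u. - ln (cprob N (lab N ((T ^^ i) u))))" for i
      by (rule integrable_finite_label[OF finite_label_T_pow[OF finite_label_lab], of "\<lambda>y. - ln (cprob N y)"])
    show "integrable m (\<lambda>u. - ln (Q (Z u)))" by (rule integrable_finite_label[OF Z, of "\<lambda>z. - ln (Q z)"])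
    show "integrable m (\<lambda>u. (S (n + N) (q u) + D) + (\<Sum>i<n. - ln (cprob N (lab N ((T ^^ i) u)))))"
      using integral_S(1)[OF m] int_lab
      by (intro Bochner_Integration.integrable_add Bochner_Integration.integrable_sum) simp_all
    show "AE u in m. - ln (Q (Z u)) \<le> (S (n + N) (q u) + D) + (\<Sum>i<n. - ln (cprob N (lab N ((T ^^ i) u))))"
      using AE_cell_pos[OF Z] AE_space
    proof eventually_elim
      case (elim u)
      then have u: "u \<in> \<Lambda>" by (simp add: space_m)
      let ?w = "prefix (n + N) (q u)"
      have pos: "0 < cprob N (lab N ((T ^^ i) u))" if "i < n" for i using cprob_pos[OF elim(1) u that] .
      have w: "?w \<in> words A (n + N)" by (rule prefix_in_words[OF q_in[OF u]])
      then have ext: "ext ?w \<in> \<Sigma>" using words_iff[of "n + N" ?w] N by simp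
      \<comment> \<open>\<open>wt\<close> evaluates the word with the tail prescribed by x, not with
        the continuation of u itself; distortion bounds the discrepancy by D.\<close>
      have "agree (length ?w) (?w \<frown> x (last ?w)) (?w \<frown> suffix (n + N) (q u))"
        by (rule agree_conc_word)
      then have "agree (n + N) (ext ?w) (q u)"
        unfolding prefix_conc_suffix length_prefix ext_def .
      then have "\<bar>S (n + N) (ext ?w) - S (n + N) (q u)\<bar> \<le> D * \<theta> ^ 0"
        by (intro S_distortion ext q_in u) simp
      then have "- ln (wt ?w) \<le> S (n + N) (q u) + D" by (simp add: wt_def length_prefix)
      moreover have "ln (Q (Z u)) = ln (wt ?w) + (\<Sum>i<n. ln (cprob N (lab N ((T ^^ i) u))))"
      proof -
        have "0 < (\<Prod>i<n. cprob N (lab N ((T ^^ i) u)))" using pos by (intro prod_pos) auto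
        then have "ln (Q (Z u)) = ln (wt ?w) + ln (\<Prod>i<n. cprob N (lab N ((T ^^ i) u)))"
          unfolding Q_Z[OF u] by (rule ln_mult_pos[OF wt_pos])
        also have "ln (\<Prod>i<n. cprob N (lab N ((T ^^ i) u))) = (\<Sum>i<n. ln (cprob N (lab N ((T ^^ i) u))))"
        proof (rule ln_prod)
          fix i assume "i \<in> {..<n}"
          then show "cprob N (lab N ((T ^^ i) u)) \<noteq> 0" using pos[of i] by simp
        qed simp
        finally show ?thesis .
      qed
      ultimately show ?case by (simp add: sum_negf)
    qed
  qed
  also have "(\<integral>u. (S (n + N) (q u) + D) + (\<Sum>i<n. - ln (cprob N (lab N ((T ^^ i) u)))) \<partial>m)
      = (n + N) * (\<integral>u. \<phi> u \<partial>m) + D + n * cent N"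
  proof -
    have int_lab: "integrable m (\<lambda>u. - ln (cprob N (lab N ((T ^^ i) u))))" for i
      by (rule integrable_finite_label[OF finite_label_T_pow[OF finite_label_lab], of "\<lambda>y. - ln (cprob N y)"])
    have "(\<integral>u. - ln (cprob N (lab N ((T ^^ i) u))) \<partial>m) = cent N" for i
      unfolding cent_def
      using integrable_finite_label[OF finite_label_lab, of "\<lambda>y. - ln (cprob N y)"]
      by (intro integral_T_pow borel_measurable_integrable)
    then have "(\<integral>u. (\<Sum>i<n. - ln (cprob N (lab N ((T ^^ i) u)))) \<partial>m) = n * cent N"
      by (subst Bochner_Integration.integral_sum[OF int_lab]) simp
    moreover have "(\<integral>u. (S (n + N) (q u) + D) \<partial>m) = (n + N) * (\<integral>u. \<phi> u \<partial>m) + D"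
      using integral_S[OF m, of "n + N"] by (simp add: prob_space)
    ultimately show ?thesis
      using integral_S(1)[OF m] int_lab
      by (subst Bochner_Integration.integral_add) (auto intro!: Bochner_Integration.integrable_add Bochner_Integration.integrable_sum)
  qed
  finally show ?thesis by simp
qed

text \<open>The cylinders generate: the conditional entropy of \<open>P\<close> given the first \<open>N\<close> letters is small,
  since the blocks of \<open>P\<close> are approximated by unions of cylinders.\<close>

lemma cent_small:
  assumes \<epsilon>: "\<epsilon> > 0"
  shows "\<exists>N\<ge>1. cent N \<le> \<epsilon>"
proof -
  \<comment> \<open>Each block of P will cost 2 * \<delta>: \<delta> from the first term of
    \<open>entropy_term_bound\<close>, and \<delta>^2 / \<delta> from the second, which is why the
    blocks are approximated up to \<delta>^2.\<close>
  define \<delta> where "\<delta> = \<epsilon> / (2 * (card P + 1))"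
  have \<delta>: "\<delta> > 0" using \<epsilon> by (simp add: \<delta>_def)
  have "\<exists>C\<in>clopens. measure m ((B - C) \<union> (C - B)) < \<delta>\<^sup>2" if "B \<in> P" for B
    using \<delta> P_sets that invariant_measureD[OF m] by (intro clopen_approximation) auto
  then obtain C where C: "\<And>B. B \<in> P \<Longrightarrow> C B \<in> clopens"
      "\<And>B. B \<in> P \<Longrightarrow> measure m ((B - C B) \<union> (C B - B)) < \<delta>\<^sup>2" by metis
  have "\<forall>B\<in>P. \<exists>N. \<forall>M s t. M \<ge> N \<longrightarrow> s \<in> \<Sigma> \<longrightarrow> t \<in> \<Sigma> \<longrightarrow> agree M s t \<longrightarrow> (p s \<in> C B \<longleftrightarrow> p t \<in> C B)"
  proof
    fix B assume "B \<in> P"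
    from clopen_level_mono[OF C(1)[OF this]]
    show "\<exists>N. \<forall>M s t. M \<ge> N \<longrightarrow> s \<in> \<Sigma> \<longrightarrow> t \<in> \<Sigma> \<longrightarrow> agree M s t \<longrightarrow> (p s \<in> C B \<longleftrightarrow> p t \<in> C B)"
      by metis
  qed
  from bchoice[OF this] obtain L where L: "\<And>B M s t. B \<in> P \<Longrightarrow> M \<ge> L B \<Longrightarrow> s \<in> \<Sigma> \<Longrightarrow> t \<in> \<Sigma> \<Longrightarrow>
      agree M s t \<Longrightarrow> p s \<in> C B \<longleftrightarrow> p t \<in> C B" by blast
  define N where "N = 1 + sum L P"
  have N: "N \<ge> 1" "\<And>B. B \<in> P \<Longrightarrow> L B \<le> N"
    using fin by (auto simp: N_def intro: trans_le_add2 member_le_sum le_SucI)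
  define W where "W = (\<lambda>u. prefix N (q u)) ` space m"
  define PY where "PY y = measure m {u \<in> space m. lab N u = y}" for y
  define PN where "PN c = measure m {u \<in> space m. prefix N (q u) = c}" for c
  have pre_lab: "finite_label m (\<lambda>u. prefix N (q u))" by (rule finite_label_prefix[OF sets_m])
  have W: "finite W" unfolding W_def by (rule finite_labelD(1)[OF pre_lab])
  have sum_PN: "(\<Sum>c\<in>W. PN c) = 1" unfolding W_def PN_def by (rule sum_finite_label[OF pre_lab])
  have le: "PY (B, c) \<le> PN c" for B c using lab_le[of N "(B, c)"] by (simp add: PY_def PN_def)
  have B_eq: "{u \<in> space m. lab N u = (B, c)} = {u \<in> space m. prefix N (q u) = c} \<inter> B" if "B \<in> P" for B c
    using block_in(2)[OF part] block_eqI[OF part that] by (auto simp: lab_def)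
  have min_le: "(\<Sum>c\<in>W. min (PY (B, c)) (PN c - PY (B, c))) \<le> \<delta>\<^sup>2" if B: "B \<in> P" for B
  proof -
    let ?E = "(B - C B) \<union> (C B - B)"
    let ?cell = "\<lambda>c. {u \<in> space m. prefix N (q u) = c}"
    have Bs: "B \<in> sets m" using P_sets B by auto
    have Cs: "C B \<in> sets m" using clopen_in_sets[OF C(1)[OF B]] sets_m by simp
    have cs: "?cell c \<in> sets m" for c by (rule finite_labelD(2)[OF pre_lab])
    \<comment> \<open>A cylinder of length N lies inside \<open>C B\<close> or is disjoint from it,
      so one of the two pieces into which B cuts the cylinder is part of the symmetric
      difference.\<close>
    have "min (PY (B, c)) (PN c - PY (B, c)) \<le> measure m (?cell c \<inter> ?E)" if "c \<in> W" for c
    proof -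
      obtain u where u: "u \<in> \<Lambda>" "c = prefix N (q u)" using \<open>c \<in> W\<close> by (auto simp: W_def space_m)
      have same: "v \<in> C B \<longleftrightarrow> u \<in> C B" if "v \<in> ?cell c" for v
      proof -
        have v: "v \<in> \<Lambda>" "agree N (q v) (q u)" using that u(2) by (auto simp: space_m prefix_eq_iff)
        show ?thesis using L[OF B N(2)[OF B] q_in[OF v(1)] q_in[OF u(1)] v(2)] p_q u(1) v(1) by simp
      qed
      have PY: "PY (B, c) = measure m (?cell c \<inter> B)" by (simp add: PY_def B_eq[OF B])
      show ?thesis
      proof (cases "u \<in> C B")
        case True
        have "PN c - PY (B, c) = measure m (?cell c - ?cell c \<inter> B)"
          unfolding PY PN_def using cs Bs by (intro finite_measure_Diff[symmetric]) auto
        also have "\<dots> \<le> measure m (?cell c \<inter> ?E)"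
          using cs Bs Cs same True by (intro finite_measure_mono) auto
        finally show ?thesis by simp
      next
        case False
        have "PY (B, c) \<le> measure m (?cell c \<inter> ?E)"
          unfolding PY using cs Bs Cs same False by (intro finite_measure_mono) auto
        then show ?thesis by simp
      qed
    qed
    then have "(\<Sum>c\<in>W. min (PY (B, c)) (PN c - PY (B, c))) \<le> (\<Sum>c\<in>W. measure m (?cell c \<inter> ?E))"
      by (rule sum_mono)
    also have "\<dots> = measure m (\<Union>c\<in>W. ?cell c \<inter> ?E)"
      using cs Bs Cs W by (intro finite_measure_finite_Union[symmetric]) (auto simp: disjoint_family_on_def)
    also have "\<dots> \<le> measure m ?E"
      using Bs Cs by (intro finite_measure_mono) auto
    also have "\<dots> \<le> \<delta>\<^sup>2" using C(2)[OF B] by simp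
    finally show ?thesis .
  qed
  have "cent N = (\<Sum>y\<in>lab N ` space m. PY y * - ln (cprob N y))"
    unfolding cent_def PY_def by (rule integral_finite_label[OF finite_label_lab])
  also have "\<dots> = (\<Sum>y\<in>lab N ` space m. PY y * - ln (PY y / PN (snd y)))"
    by (simp add: cprob_def PY_def PN_def)
  also have "\<dots> \<le> (\<Sum>y\<in>lab N ` space m. \<delta> * PN (snd y) + min (PY y) (PN (snd y) - PY y) / \<delta>)"
    using le \<delta> by (intro sum_mono entropy_term_bound) (auto simp: PY_def, metis PY_def prod.collapse)
  also have "\<dots> \<le> (\<Sum>y\<in>P \<times> W. \<delta> * PN (snd y) + min (PY y) (PN (snd y) - PY y) / \<delta>)"
  proof (rule sum_mono2)
    show "finite (P \<times> W)" using fin W by simp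
    show "lab N ` space m \<subseteq> P \<times> W" using block_in(1)[OF part] by (auto simp: lab_def W_def)
    show "0 \<le> \<delta> * PN (snd y) + min (PY y) (PN (snd y) - PY y) / \<delta>" for y
      using le[of "fst y" "snd y"] \<delta> by (auto simp: PN_def PY_def intro!: add_nonneg_nonneg divide_nonneg_nonneg)
  qed
  also have "\<dots> = (\<Sum>B\<in>P. \<delta> * (\<Sum>c\<in>W. PN c) + (\<Sum>c\<in>W. min (PY (B, c)) (PN c - PY (B, c))) / \<delta>)"
    by (simp add: sum.cartesian_product' sum.distrib sum_distrib_left sum_divide_distrib)
  also have "\<dots> \<le> (\<Sum>B\<in>P. \<delta> * 1 + \<delta>\<^sup>2 / \<delta>)"
    unfolding sum_PN using min_le \<delta> by (intro sum_mono add_mono divide_right_mono) auto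
  also have "\<dots> = 2 * card P * \<delta>" using \<delta> by (simp add: power2_eq_square)
  also have "\<dots> \<le> \<epsilon>" unfolding \<delta>_def using \<epsilon> by (simp add: field_simps)
  finally show ?thesis using N(1) by blast
qed

text \<open>Division by n removes everything but the mean of \<phi> and \<open>cent N\<close>, and
  the latter is as small as desired.\<close>

lemma partition_entropy_lim_le:
  "lim (\<lambda>n. partition_entropy m (join_partition m T P n) / real n) \<le> (\<integral>u. \<phi> u \<partial>m)"
proof (rule field_le_epsilon)
  fix \<epsilon> :: real assume "0 < \<epsilon>"
  then obtain N where N: "N \<ge> 1" "cent N \<le> \<epsilon>" using cent_small by blast
  define I where "I = (\<integral>u. \<phi> u \<partial>m)"
  have "ent m (itinerary T P n) / n \<le> (I + cent N) + (N * I + D + CARD('k)) * inverse (real n)" if "n \<ge> 1" for n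
  proof -
    have "ent m (itinerary T P n) / n \<le> ((n + N) * I + D + n * cent N + CARD('k)) / n"
      using itinerary_entropy_le[OF N(1), of n] by (intro divide_right_mono) (auto simp: I_def)
    also have "\<dots> = (I + cent N) + (N * I + D + CARD('k)) * inverse (real n)"
      using that by (simp add: field_simps)
    finally show ?thesis .
  qed
  moreover have "(\<lambda>n. (I + cent N) + (N * I + D + CARD('k)) * inverse (real n))
      \<longlonglongrightarrow> (I + cent N) + (N * I + D + CARD('k)) * 0"
    by (intro tendsto_intros LIMSEQ_inverse_real_of_nat[THEN LIMSEQ_imp_Suc])
  ultimately have "lim (\<lambda>n. partition_entropy m (join_partition m T P n) / real n)
      \<le> (I + cent N) + (N * I + D + CARD('k)) * 0"
    using LIMSEQ_le[OF partition_entropy_tendsto[OF fin P_sets part]] by blast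
  then show "lim (\<lambda>n. partition_entropy m (join_partition m T P n) / real n) \<le> (\<integral>u. \<phi> u \<partial>m) + \<epsilon>"
    using N(2) by (simp add: I_def)
qed

end

lemma ks_entropy_le:
  assumes m: "m \<in> invariant_measures \<Lambda> T"
  shows "ks_entropy T m \<le> ereal (\<integral>u. \<phi> u \<partial>m)"
  unfolding ks_entropy_def
  by (rule SUP_least) (auto intro: partition_entropy_lim_le[OF m])

text \<open>The pressure of -\<phi> is 0: no invariant measure exceeds this value, and the measure
  built from \<open>Lim\<close> attains it. Since \<open>is_gibbs_measure\<close> makes \<mu> the
  only maximiser, the two coincide.\<close>

lemma gibbs_measure_Lim:
  fixes f :: "'m \<Rightarrow> real"
  assumes \<mu>: "is_gibbs_measure \<Lambda> T (\<lambda>u. - \<phi> u) \<mu>" and f: "continuous_on \<Lambda> f"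
  shows "prob_space \<mu>" "sets \<mu> = sets (restrict_space borel \<Lambda>)" "(\<integral>u. f u \<partial>\<mu>) = Lim (\<lambda>s. f (p s))"
proof -
  obtain \<nu> where \<nu>: "sets \<nu> = sets (restrict_space borel \<Lambda>)" "prob_space \<nu>"
      "\<And>C. C \<in> clopens \<Longrightarrow> measure \<nu> C = Lim (\<lambda>s. indicator C (p s))"
    using Lim_measure_exists by blast
  let ?F = "pressure_functional T (\<lambda>u. - \<phi> u)"
  have inv: "\<nu> \<in> invariant_measures \<Lambda> T" by (rule Lim_measure_invariant[OF \<nu>(2,1,3)])
  have upper: "?F m \<le> 0" if m: "m \<in> invariant_measures \<Lambda> T" for m
  proof -
    have "?F m \<le> ereal (\<integral>u. \<phi> u \<partial>m) + ereal (\<integral>u. - \<phi> u \<partial>m)"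
      unfolding pressure_functional_def by (intro add_right_mono ks_entropy_le m)
    then show ?thesis by (simp add: zero_ereal_def)
  qed
  have "ereal (\<integral>u. \<phi> u \<partial>\<nu>) + ereal (\<integral>u. - \<phi> u \<partial>\<nu>) \<le> ?F \<nu>"
    unfolding pressure_functional_def by (intro add_right_mono ks_entropy_Lim_measure_ge inv \<nu>(3))
  then have "0 \<le> ?F \<nu>" by (simp add: zero_ereal_def)
  then have "?F \<nu> = 0" using upper[OF inv] by simp
  moreover have "(SUP m \<in> invariant_measures \<Lambda> T. ?F m) = 0"
    by (rule antisym) (use upper \<open>?F \<nu> = 0\<close> inv in \<open>auto intro: SUP_least SUP_upper2\<close>)
  ultimately have "\<nu> = \<mu>" using \<mu> inv unfolding is_gibbs_measure_def by auto
  then show "prob_space \<mu>" "sets \<mu> = sets (restrict_space borel \<Lambda>)" "(\<integral>u. f u \<partial>\<mu>) = Lim (\<lambda>s. f (p s))"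
    using \<nu> integral_Lim[OF \<nu>(2,1,3) f] by auto
qed

end

section \<open>Riemannian distance of nearby points\<close>

lemma riemannian_metric_nonneg:
  assumes "riemannian_manifold M \<A> g" "c \<in> \<A>" "x \<in> fst c"
  shows "0 \<le> g c x v v"
proof (cases "v = 0")
  case True
  have "bilinear (g c x)" using assms by (auto simp: riemannian_manifold_def)
  then show ?thesis using True by (simp add: bilinear_lzero)
next
  case False
  then show ?thesis using assms by (auto simp: riemannian_manifold_def less_imp_le)
qed

lemma piecewise_C1_curve_in:
  assumes "piecewise_C1_curve M \<A> \<gamma>" "s \<in> {0..1}"
  shows "\<gamma> s \<in> M"
proof -
  obtain n t where t: "t 0 = (0::real)" "t n = 1" "\<And>i. i < n \<Longrightarrow> C1_curve_on M \<A> {t i..t (Suc i)} \<gamma>"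
    using assms(1) unfolding piecewise_C1_curve_def by blast
  have cover: "\<exists>i<n. s \<in> {t i..t (Suc i)}" if "s \<le> t n" "n \<noteq> 0" for n
    using that
  proof (induction n)
    case (Suc n)
    show ?case
    proof (cases "n = 0 \<or> t n \<le> s")
      case True
      then show ?thesis using Suc.prems assms(2) t(1) by (intro exI[of _ n]) auto
    next
      case False
      then show ?thesis using Suc.IH by (auto simp: less_Suc_eq)
    qed
  qed simp
  have "n \<noteq> 0" using t(1,2) by (metis zero_neq_one)
  then obtain i where "i < n" "s \<in> {t i..t (Suc i)}" using cover[of n] t(2) assms(2) by auto
  then show ?thesis using t(3)[of i] unfolding C1_curve_on_def by blast
qed

lemma speed_nonneg:
  assumes "riemannian_manifold M \<A> g" "\<gamma> t \<in> M"
  shows "0 \<le> speed \<A> g \<gamma> t"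
proof -
  have "\<exists>c. c \<in> \<A> \<and> \<gamma> t \<in> fst c"
    using assms by (auto simp: riemannian_manifold_def smooth_atlas_def)
  then have "(SOME c. c \<in> \<A> \<and> \<gamma> t \<in> fst c) \<in> \<A> \<and> \<gamma> t \<in> fst (SOME c. c \<in> \<A> \<and> \<gamma> t \<in> fst c)"
    by (rule someI_ex)
  then show ?thesis unfolding speed_def Let_def
    using riemannian_metric_nonneg[OF assms(1)] by simp
qed

text \<open>If the speed is not integrable, its integral has the default value 0, which is
  nonnegative too.\<close>

lemma curve_length_nonneg:
  assumes "riemannian_manifold M \<A> g" "piecewise_C1_curve M \<A> \<gamma>"
  shows "0 \<le> curve_length \<A> g \<gamma>"
proof (cases "speed \<A> g \<gamma> integrable_on {0..1}")
  case True
  then show ?thesis unfolding curve_length_def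
    by (intro integral_nonneg) (use assms piecewise_C1_curve_in speed_nonneg in blast)+
qed (simp add: curve_length_def not_integrable_integral)

text \<open>In another chart the curve is the affine segment followed by the transition map, which
  is continuously differentiable on the overlap; the chain rule gives the velocity as the derivative
  of that map applied to b - a.\<close>

lemma chart_segment_C1:
  assumes R: "riemannian_manifold M \<A> g" and c: "c \<in> \<A>"
    and seg: "\<And>t. t \<in> {0..1} \<Longrightarrow> (1 - t) *\<^sub>R a + t *\<^sub>R b \<in> snd c ` fst c"
  shows "C1_curve_on M \<A> {0..1} (\<lambda>t. inv_into (fst c) (snd c) ((1 - t) *\<^sub>R a + t *\<^sub>R b))"
proof -
  define inv where "inv = inv_into (fst c) (snd c)"
  define l where "l t = (1 - t) *\<^sub>R a + t *\<^sub>R b" for t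
  define \<gamma> where "\<gamma> t = inv (l t)" for t
  have atlas: "smooth_atlas M \<A>" using R by (simp add: riemannian_manifold_def)
  have chart: "openin (top_of_set M) (fst d)" "open (snd d ` fst d)"
      "homeomorphism (fst d) (snd d ` fst d) (snd d) (inv_into (fst d) (snd d))" if "d \<in> \<A>" for d
    using atlas that by (auto simp: smooth_atlas_def)
  have hom: "homeomorphism (fst c) (snd c ` fst c) (snd c) inv" using chart(3)[OF c] by (simp add: inv_def)
  have l_in: "l t \<in> snd c ` fst c" if "t \<in> {0..1}" for t using seg[OF that] by (simp add: l_def)
  have \<gamma>_in: "\<gamma> t \<in> fst c" and snd_\<gamma>: "snd c (\<gamma> t) = l t" if "t \<in> {0..1}" for t
    using hom l_in[OF that] by (auto simp: \<gamma>_def homeomorphism_def)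
  have cont_l: "continuous_on J l" for J unfolding l_def by (intro continuous_intros)
  have "C1_curve_on M \<A> {0..1} \<gamma>"
    unfolding C1_curve_on_def
  proof (intro conjI ballI)
    show "continuous_on {0..1} \<gamma>"
      unfolding \<gamma>_def
      by (rule continuous_on_compose2[OF _ cont_l]) (use hom l_in in \<open>auto simp: homeomorphism_def\<close>)
    have "fst c \<subseteq> M" using chart(1)[OF c] openin_subset by fastforce
    then show "\<gamma> ` {0..1} \<subseteq> M" using \<gamma>_in by auto
    fix d assume d: "d \<in> \<A>"
    define \<psi> where "\<psi> = local_rep c d id"
    define V where "V = snd c ` (fst c \<inter> fst d)"
    have "openin (top_of_set (fst c)) (fst c \<inter> fst d)"
    proof -
      obtain S where "open S" "fst d = M \<inter> S" using chart(1)[OF d] by (auto simp: openin_open)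
      then have "fst c \<inter> fst d = fst c \<inter> S" using \<open>fst c \<subseteq> M\<close> by auto
      then show ?thesis using \<open>open S\<close> by (metis openin_open)
    qed
    then have "openin (top_of_set (snd c ` fst c)) V"
      unfolding V_def by (rule homeomorphism_imp_open_map[OF hom])
    then have V: "open V" using chart(2)[OF c] by (rule openin_open_trans)
    have "C_k_on (Suc 0) V \<psi>" using atlas c d unfolding smooth_atlas_def V_def \<psi>_def by blast
    then have diff: "\<psi> differentiable_on V"
      and cont: "\<And>v. continuous_on V (\<lambda>x. frechet_derivative \<psi> (at x) v)" by simp_all
    have l_V: "l t \<in> V" if "t \<in> {0..1} \<inter> \<gamma> -` fst d" for t
      using \<gamma>_in[of t] snd_\<gamma>[of t] that unfolding V_def by (metis IntD1 IntD2 IntI image_eqI vimageD)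
    have eq: "snd d \<circ> \<gamma> = \<psi> \<circ> l" by (simp add: \<psi>_def local_rep_def \<gamma>_def inv_def fun_eq_iff)
    show "\<exists>v. continuous_on ({0..1} \<inter> \<gamma> -` fst d) v \<and>
        (\<forall>t\<in>{0..1} \<inter> \<gamma> -` fst d. (snd d \<circ> \<gamma> has_vector_derivative v t) (at t within {0..1}))"
    proof (intro exI[of _ "\<lambda>t. frechet_derivative \<psi> (at (l t)) (b - a)"] conjI ballI)
      show "continuous_on ({0..1} \<inter> \<gamma> -` fst d) (\<lambda>t. frechet_derivative \<psi> (at (l t)) (b - a))"
        by (rule continuous_on_compose2[OF cont cont_l]) (use l_V in auto)
      fix t assume t: "t \<in> {0..1} \<inter> \<gamma> -` fst d"
      have "\<psi> differentiable (at (l t))"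
        using diff l_V[OF t] V by (simp add: differentiable_on_eq_differentiable_at)
      then have "(\<psi> has_derivative frechet_derivative \<psi> (at (l t))) (at (l t))"
        by (simp add: frechet_derivative_works)
      moreover have "(l has_vector_derivative (b - a)) (at t within {0..1})"
        unfolding l_def by (auto intro!: derivative_eq_intros)
      ultimately show "(snd d \<circ> \<gamma> has_vector_derivative frechet_derivative \<psi> (at (l t)) (b - a)) (at t within {0..1})"
        unfolding eq by (intro vector_derivative_diff_chain_within) (auto intro: has_derivative_at_withinI)
    qed
  qed
  then show ?thesis unfolding \<gamma>_def[abs_def] l_def inv_def .
qed

text \<open>For points that no curve connects, the distance is the infimum of the empty set, about which
  nothing is known; nearby points are joined by a segment in a chart.\<close>

lemma riemannian_dist_locally_nonneg:
  assumes R: "riemannian_manifold M \<A> g" and u: "u \<in> M"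
  obtains V where "openin (top_of_set M) V" "u \<in> V"
    "\<And>a b. a \<in> V \<Longrightarrow> b \<in> V \<Longrightarrow> 0 \<le> riemannian_dist M \<A> g a b"
proof -
  obtain c where c: "c \<in> \<A>" "u \<in> fst c"
    using R u by (auto simp: riemannian_manifold_def smooth_atlas_def)
  have chart: "openin (top_of_set M) (fst c)" "open (snd c ` fst c)"
      "homeomorphism (fst c) (snd c ` fst c) (snd c) (inv_into (fst c) (snd c))"
    using R c(1) by (auto simp: riemannian_manifold_def smooth_atlas_def)
  obtain r where r: "r > 0" "ball (snd c u) r \<subseteq> snd c ` fst c"
    using chart(2) c(2) by (metis image_eqI open_contains_ball)
  define V where "V = fst c \<inter> snd c -` ball (snd c u) r"
  have "openin (top_of_set (fst c)) V"
    unfolding V_def using chart(3) by (intro continuous_openin_preimage_gen) (auto simp: homeomorphism_def)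
  then have V: "openin (top_of_set M) V" using chart(1) by (rule openin_trans)
  have nn: "0 \<le> riemannian_dist M \<A> g a b" if ab: "a \<in> V" "b \<in> V" for a b
  proof -
    define \<gamma> where "\<gamma> t = inv_into (fst c) (snd c) ((1 - t) *\<^sub>R snd c a + t *\<^sub>R snd c b)" for t
    have "C1_curve_on M \<A> {0..1} \<gamma>"
      unfolding \<gamma>_def
    proof (rule chart_segment_C1[OF R c(1)])
      fix t :: real assume t: "t \<in> {0..1}"
      have "(1 - t) *\<^sub>R snd c a + t *\<^sub>R snd c b \<in> ball (snd c u) r"
        using ab t by (intro convexD[OF convex_ball]) (auto simp: V_def)
      then show "(1 - t) *\<^sub>R snd c a + t *\<^sub>R snd c b \<in> snd c ` fst c" using r by auto
    qed
    then have "piecewise_C1_curve M \<A> \<gamma>"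
      unfolding piecewise_C1_curve_def by (intro exI[of _ 1] exI[of _ real]) simp
    moreover have "\<gamma> 0 = a" "\<gamma> 1 = b" using ab chart(3) by (auto simp: \<gamma>_def V_def homeomorphism_def)
    ultimately show ?thesis
      unfolding riemannian_dist_def
      by (intro cInf_greatest) (use curve_length_nonneg[OF R] in auto)
  qed
  show ?thesis by (rule that[OF V _ nn]) (use c(2) r(1) in \<open>simp_all add: V_def\<close>)
qed

section \<open>The operators of the spectral triple\<close>

lemma seq_dist_bounds:
  assumes "agree n s t" shows "0 \<le> seq_dist s t" "seq_dist s t \<le> (1 / 2) ^ n"
proof -
  define f where "f k = (1 / 2 :: real) ^ Suc k * (1 - of_bool (s k = t k))" for k
  have geo: "(\<lambda>k. (1 / 2 :: real) ^ Suc k) sums 1" by (rule power_half_series)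
  have f: "0 \<le> f k" "f k \<le> (1 / 2) ^ Suc k" for k by (auto simp: f_def)
  have sum_f: "summable f"
    by (rule summable_comparison_test'[OF sums_summable[OF geo], of 0]) (use f in auto)
  show "0 \<le> seq_dist s t" unfolding seq_dist_def f_def[symmetric] by (rule suminf_nonneg[OF sum_f f(1)])
  have "seq_dist s t = (\<Sum>k. f (k + n)) + (\<Sum>k<n. f k)"
    unfolding seq_dist_def f_def[symmetric] by (rule suminf_split_initial_segment[OF sum_f])
  also have "(\<Sum>k<n. f k) = 0" using assms by (intro sum.neutral) (auto simp: f_def agree_def)
  also have "(\<Sum>k. f (k + n)) \<le> (\<Sum>k. (1 / 2) ^ n * (1 / 2) ^ Suc k)"
  proof (rule suminf_le)
    show "f (k + n) \<le> (1 / 2) ^ n * (1 / 2) ^ Suc k" for k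
      using f(2)[of "k + n"] by (simp add: power_add mult.commute mult.left_commute)
    show "summable (\<lambda>k. f (k + n))" using sum_f by (simp add: summable_iff_shift)
    show "summable (\<lambda>k. (1 / 2 :: real) ^ n * (1 / 2) ^ Suc k)" by (rule summable_mult[OF sums_summable[OF geo]])
  qed
  also have "(\<Sum>k. (1 / 2 :: real) ^ n * (1 / 2) ^ Suc k) = (1 / 2) ^ n"
    using sums_unique[OF sums_mult[OF geo, of "(1 / 2) ^ n"]] by simp
  finally show "seq_dist s t \<le> (1 / 2) ^ n" by simp
qed

lemma seq_shift_eq_suffix: "seq_shift s = suffix 1 s"
  by (auto simp: seq_shift_def)

lemma Cons_suffix: "[t 0] \<frown> suffix 1 t = t"
  using prefix_conc_suffix[of t 1] by (simp add: subsequence_def)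

text \<open>Composing the two Hoelder bounds with the estimate \<open>(1 / 2) ^ n\<close> for
  \<open>seq_dist\<close> gives the rate \<theta>. Monotonicity of \<open>powr\<close> requires a
  nonnegative argument, which the Riemannian distance is known to be between nearby points; so the
  estimate first holds for n \<ge> N. It makes \<phi> continuous, hence bounded, and the bound
  covers shorter agreements.\<close>

lemma (in coding) holder_coded:
  assumes R: "riemannian_manifold M \<A> g" and \<Lambda>M: "\<Lambda> \<subseteq> M"
    and p: "holder_on (subshift A) seq_dist (riemannian_dist M \<A> g) p"
    and \<phi>: "holder_on \<Lambda> (riemannian_dist M \<A> g) dist (\<phi> :: 'm \<Rightarrow> real)"
  obtains K \<theta> where "0 \<le> K" "0 \<le> \<theta>" "\<theta> < 1"
    "\<And>n s t. s \<in> subshift A \<Longrightarrow> t \<in> subshift A \<Longrightarrow> agree n s t \<Longrightarrow> \<bar>\<phi> (p s) - \<phi> (p t)\<bar> \<le> K * \<theta> ^ n"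
proof -
  let ?d = "riemannian_dist M \<A> g"
  obtain C1 \<alpha>1 where \<alpha>1: "0 < \<alpha>1" and C1: "\<And>s t. s \<in> subshift A \<Longrightarrow> t \<in> subshift A \<Longrightarrow>
      ?d (p s) (p t) \<le> C1 * seq_dist s t powr \<alpha>1"
    using p unfolding holder_on_def by blast
  obtain C2 \<alpha>2 where \<alpha>2: "0 < \<alpha>2" and C2: "\<And>u v. u \<in> \<Lambda> \<Longrightarrow> v \<in> \<Lambda> \<Longrightarrow> dist (\<phi> u) (\<phi> v) \<le> C2 * ?d u v powr \<alpha>2"
    using \<phi> unfolding holder_on_def by blast
  have "\<exists>N. \<forall>s\<in>subshift A. \<exists>V. (\<forall>a\<in>V. \<forall>b\<in>V. 0 \<le> ?d a b) \<and> (\<forall>t\<in>subshift A. agree N s t \<longrightarrow> p t \<in> V)"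
  proof (rule cylinder_lebesgue_number)
    fix u assume u: "u \<in> \<Lambda>"
    then have "u \<in> M" using \<Lambda>M by blast
    then obtain V where V: "openin (top_of_set M) V" "u \<in> V" "\<And>a b. a \<in> V \<Longrightarrow> b \<in> V \<Longrightarrow> 0 \<le> ?d a b"
      using riemannian_dist_locally_nonneg[OF R] by metis
    obtain W where W: "open W" "V = M \<inter> W" using V(1) unfolding openin_open by blast
    have "\<Lambda> \<inter> V = \<Lambda> \<inter> W" using W \<Lambda>M by blast
    then have "openin (top_of_set \<Lambda>) (\<Lambda> \<inter> V)" using W(1) by (auto simp: openin_open)
    then show "\<exists>V. openin (top_of_set \<Lambda>) V \<and> u \<in> V \<and> (\<forall>a\<in>V. \<forall>b\<in>V. 0 \<le> ?d a b)"
      using u V by (intro exI[of _ "\<Lambda> \<inter> V"]) auto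
  qed
  then obtain N where N: "\<And>s. s \<in> subshift A \<Longrightarrow> \<exists>V. (\<forall>a\<in>V. \<forall>b\<in>V. 0 \<le> ?d a b)
      \<and> (\<forall>t\<in>subshift A. agree N s t \<longrightarrow> p t \<in> V)" by blast
  have d_nonneg: "0 \<le> ?d (p s) (p t)" if "s \<in> subshift A" "t \<in> subshift A" "agree N s t" for s t
    using N[OF that(1)] that agree_refl by blast
  define \<theta> where "\<theta> = (1 / 2 :: real) powr (\<alpha>1 * \<alpha>2)"
  define C where "C = \<bar>C2\<bar> * \<bar>C1\<bar> powr \<alpha>2"
  have \<theta>: "0 < \<theta>" "\<theta> < 1"
    using \<alpha>1 \<alpha>2 powr_less_mono'[of "1 / 2" 0 "\<alpha>1 * \<alpha>2"] by (auto simp: \<theta>_def)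
  have far: "\<bar>\<phi> (p s) - \<phi> (p t)\<bar> \<le> C * \<theta> ^ n"
    if st: "s \<in> subshift A" "t \<in> subshift A" "agree n s t" and n: "n \<ge> N" for s t n
  proof -
    let ?r = "?d (p s) (p t)"
    have r0: "0 \<le> ?r" by (rule d_nonneg[OF st(1,2) agree_mono[OF st(3) n]])
    have "?r \<le> C1 * seq_dist s t powr \<alpha>1" by (rule C1[OF st(1,2)])
    also have "\<dots> \<le> \<bar>C1\<bar> * ((1 / 2) ^ n) powr \<alpha>1"
      using seq_dist_bounds[OF st(3)] \<alpha>1 by (intro mult_mono powr_mono2) auto
    finally have "?r powr \<alpha>2 \<le> (\<bar>C1\<bar> * ((1 / 2) ^ n) powr \<alpha>1) powr \<alpha>2"
      using r0 \<alpha>2 by (intro powr_mono2) auto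
    also have "\<dots> = \<bar>C1\<bar> powr \<alpha>2 * \<theta> ^ n"
    proof -
      have "(1 / 2 :: real) ^ n = (1 / 2) powr real n" by (simp add: powr_realpow)
      then have "(((1 / 2 :: real) ^ n) powr \<alpha>1) powr \<alpha>2 = (1 / 2) powr (real n * \<alpha>1 * \<alpha>2)"
        by (simp only: powr_powr)
      also have "\<dots> = \<theta> powr real n"
        unfolding \<theta>_def powr_powr by (simp only: mult.commute mult.assoc mult.left_commute)
      also have "\<dots> = \<theta> ^ n" using \<theta>(1) by (rule powr_realpow)
      finally have "(((1 / 2 :: real) ^ n) powr \<alpha>1) powr \<alpha>2 = \<theta> ^ n" .
      then show ?thesis using powr_mult[of "\<bar>C1\<bar>" "((1 / 2) ^ n) powr \<alpha>1" \<alpha>2] by simp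
    qed
    finally have "\<bar>C2\<bar> * ?r powr \<alpha>2 \<le> C * \<theta> ^ n"
      by (simp add: C_def mult.assoc mult_left_mono)
    moreover have "\<bar>\<phi> (p s) - \<phi> (p t)\<bar> \<le> C2 * ?r powr \<alpha>2"
      using C2[OF p_in[OF st(1)] p_in[OF st(2)]] by (simp add: dist_real_def)
    moreover have "C2 * ?r powr \<alpha>2 \<le> \<bar>C2\<bar> * ?r powr \<alpha>2" by (intro mult_right_mono) auto
    ultimately show ?thesis by linarith
  qed
  have C0: "0 \<le> C" by (simp add: C_def)
  have "continuous_on \<Lambda> \<phi>"
  proof (rule uniformly_continuous)
    fix \<epsilon> :: real assume "\<epsilon> > 0"
    have "(\<lambda>n. C * \<theta> ^ n) \<longlonglongrightarrow> C * 0" using \<theta> by (intro tendsto_mult_left LIMSEQ_power_zero) auto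
    then have "\<forall>\<^sub>F n in sequentially. C * \<theta> ^ n < \<epsilon>" using \<open>\<epsilon> > 0\<close> by (intro order_tendstoD) auto
    then have "\<forall>\<^sub>F n in sequentially. C * \<theta> ^ n < \<epsilon> \<and> n \<ge> N"
      using eventually_ge_at_top[of N] by eventually_elim auto
    then obtain n where "C * \<theta> ^ n < \<epsilon>" "n \<ge> N" by (auto dest: eventually_happens' [OF sequentially_bot])
    then show "\<exists>N. \<forall>s\<in>subshift A. \<forall>t\<in>subshift A. agree N s t \<longrightarrow> dist (\<phi> (p s)) (\<phi> (p t)) \<le> \<epsilon>"
      using far by (intro exI[of _ n]) (fastforce simp: dist_real_def)
  qed
  then have "bounded (\<phi> ` \<Lambda>)" using compact by (intro compact_imp_bounded compact_continuous_image)
  then obtain B where B: "\<And>u. u \<in> \<Lambda> \<Longrightarrow> \<bar>\<phi> u\<bar> \<le> B" by (auto simp: bounded_iff)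
  \<comment> \<open>The second summand covers n < N, where \<theta> ^ n \<ge> \<theta> ^ N.\<close>
  define K where "K = C + 2 * \<bar>B\<bar> / \<theta> ^ N"
  have "\<bar>\<phi> (p s) - \<phi> (p t)\<bar> \<le> K * \<theta> ^ n"
    if st: "s \<in> subshift A" "t \<in> subshift A" "agree n s t" for s t n
  proof (cases "n \<ge> N")
    case True
    have "C * \<theta> ^ n \<le> K * \<theta> ^ n" using \<theta> by (intro mult_right_mono) (auto simp: K_def)
    then show ?thesis using far[OF st True] by linarith
  next
    case False
    have "\<bar>\<phi> (p s) - \<phi> (p t)\<bar> \<le> 2 * \<bar>B\<bar>" using B[OF p_in[OF st(1)]] B[OF p_in[OF st(2)]] by linarith
    also have "\<dots> = 2 * \<bar>B\<bar> / \<theta> ^ N * \<theta> ^ N" using \<theta> by simp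
    also have "\<dots> \<le> 2 * \<bar>B\<bar> / \<theta> ^ N * \<theta> ^ n"
      using \<theta> False by (intro mult_left_mono power_decreasing) auto
    also have "\<dots> \<le> K * \<theta> ^ n" using \<theta> C0 by (intro mult_right_mono) (auto simp: K_def)
    finally show ?thesis .
  qed
  then show ?thesis using that[of K \<theta>] C0 \<theta> by (simp add: K_def)
qed

text \<open>Transports sums over T u = p s to sums over preceding letters, both for the
  normalization and for the constant c_\<phi>.\<close>

lemma (in coding) bij_betw_preimages:
  assumes s: "s \<in> subshift A" and T: "\<And>s. s \<in> subshift A \<Longrightarrow> T (p s) = p (suffix 1 s)"
  shows "bij_betw (\<lambda>j. p ([j] \<frown> s)) {j. A $ j $ s 0 = 1} {u \<in> \<Lambda>. T u = p s}"
proof (rule bij_betwI')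
  fix i j assume ij: "i \<in> {j. A $ j $ s 0 = 1}" "j \<in> {j. A $ j $ s 0 = 1}"
  then have "[i] \<frown> s \<in> subshift A" "[j] \<frown> s \<in> subshift A" using s by (simp_all add: subshift_build_iff)
  then have "p ([i] \<frown> s) = p ([j] \<frown> s) \<longleftrightarrow> [i] \<frown> s = [j] \<frown> s" using p_inj by (auto dest: inj_onD)
  then show "p ([i] \<frown> s) = p ([j] \<frown> s) \<longleftrightarrow> i = j" by simp
next
  fix j assume "j \<in> {j. A $ j $ s 0 = 1}"
  then have js: "[j] \<frown> s \<in> subshift A" using s by (simp add: subshift_build_iff)
  have "suffix 1 ([j] \<frown> s) = s" using suffix_conc_length[of "[j]" s] by simp
  then show "p ([j] \<frown> s) \<in> {u \<in> \<Lambda>. T u = p s}" using T[OF js] p_in[OF js] by simp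
next
  fix u assume u: "u \<in> {u \<in> \<Lambda>. T u = p s}"
  define t where "t = q u"
  have t: "t \<in> subshift A" "p t = u" using u by (auto simp: t_def q_in p_q)
  then have "p (suffix 1 t) = p s" using T[OF t(1)] u by simp
  then have ts: "suffix 1 t = s" using p_inj subshift_suffix[OF t(1)] s by (auto dest: inj_onD)
  then have "[t 0] \<frown> s = t" using Cons_suffix[of t] by simp
  moreover have "A $ t 0 $ s 0 = 1" using t(1) ts by (auto simp: subshift_def)
  ultimately show "\<exists>j\<in>{j. A $ j $ s 0 = 1}. u = p ([j] \<frown> s)" using t(2) by (intro bexI[of _ "t 0"]) auto
qed

section \<open>Coefficients, singular values and traces\<close>

locale spectral_system = coded_system A h K \<theta> x p \<Lambda> T \<phi>
  for A :: "nat^'k::finite^'k" and h K \<theta> x and p :: "(nat \<Rightarrow> 'k) \<Rightarrow> 'm::t2_space" and \<Lambda> T \<phi> +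
  fixes y z :: "'k \<Rightarrow> nat \<Rightarrow> 'k" and \<mu> :: "'m measure"
  assumes y: "[j] \<frown> y j \<in> subshift A" and z: "[j] \<frown> z j \<in> subshift A"
    and \<mu>: "is_gibbs_measure \<Lambda> T (\<lambda>u. - \<phi> u) \<mu>"
begin

abbreviation "I \<equiv> all_words A <+> all_words A"

definition F :: "('m \<Rightarrow> complex) \<Rightarrow> 'k list + 'k list \<Rightarrow> complex" where
  "F f = case_sum (\<lambda>w. f (p (w \<frown> y (last w)))) (\<lambda>w. f (p (w \<frown> z (last w))))"

text \<open>The eigenvalues of the absolute value of the Dirac operator. The formula is positive on
  all lists, admissible or not, so that division by E is harmless everywhere.\<close>

definition E :: "'k list + 'k list \<Rightarrow> real" where
  "E = (let e = (\<lambda>w. exp (birkhoff_sum T \<phi> (length w) (p (w \<frown> x (last w))))) in case_sum e e)"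

definition op :: "('m \<Rightarrow> complex) \<Rightarrow> ('k list + 'k list) oper" where
  "op f = pi_absD_inv A p T x y z \<phi> f"

lemma E_pos: "0 < E i"
  by (cases i) (auto simp: E_def Let_def)

lemma all_words_conc:
  assumes "w \<in> all_words A" "\<And>j. [j] \<frown> v j \<in> \<Sigma>" shows "w \<frown> v (last w) \<in> \<Sigma>"
proof -
  obtain n where n: "n \<ge> 1" "w \<in> words A n" using assms(1) by (auto simp: all_words_def)
  then have "w \<noteq> []" "length w = n" by (auto simp: words_def)
  then show ?thesis using words_conc_iff[of w "v (last w)" A] n assms(2) by simp
qed

lemma inverse_E: "i \<in> I \<Longrightarrow> 1 / E i = case_sum wt wt i"
proof -
  have "1 / exp (birkhoff_sum T \<phi> (length w) (p (w \<frown> x (last w)))) = wt w" if "w \<in> all_words A" for w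
  proof -
    have ew: "ext w \<in> \<Sigma>" unfolding ext_def by (rule all_words_conc[OF that x])
    have "birkhoff_sum T \<phi> (length w) (p (ext w)) = S (length w) (ext w)"
      using S_birkhoff[OF p_in[OF ew]] by (simp add: birkhoff_sum_def q_p[OF ew])
    then show ?thesis by (simp add: wt_def ext_def exp_minus divide_inverse)
  qed
  then show "i \<in> I \<Longrightarrow> 1 / E i = case_sum wt wt i" by (auto simp: E_def Let_def)
qed

lemma F_bounded:
  assumes f: "continuous_on \<Lambda> f" obtains B where "B > 0" "\<And>i. i \<in> I \<Longrightarrow> cmod (F f i) \<le> B"
proof -
  have "bounded (f ` \<Lambda>)" using compact f by (intro compact_imp_bounded compact_continuous_image)
  then obtain B where "\<And>u. u \<in> \<Lambda> \<Longrightarrow> cmod (f u) \<le> B" by (auto simp: bounded_iff)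
  then have "cmod (F f i) \<le> max B 1" if "i \<in> I" for i
    using that all_words_conc[of _ y] all_words_conc[of _ z] y z p_in by (force simp: F_def le_max_iff_disj)
  then show ?thesis using that[of "max B 1"] by simp
qed

text \<open>The swap of the summands leaves E invariant, so |D| is multiplication by E. Composing
  the converse relation with \<pi>(f) clearly gives part of the quotient operator; for equality the
  intermediate vector \<xi> / E must be square summable, and it is because S \<ge> 0 means 1 / E
  \<le> 1 on admissible words.\<close>

lemma op_eq: "op f = diag_oper I (\<lambda>i. F f i / of_real (E i))"
proof -
  define sw where "sw = case_sum Inr (Inl :: 'k list \<Rightarrow> 'k list + 'k list)"
  have "D_oper A p T x \<phi> = weighted_perm I (\<lambda>i. of_real (E i)) sw"
    unfolding D_oper_def weighted_perm_def hilb_def E_def sw_def Let_def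
    by (intro arg_cong[where f = "max_oper (ell2 I)"] ext) (auto split: sum.split)
  moreover have "abs_oper (ell2 I) (weighted_perm I (\<lambda>i. complex_of_real (E i)) sw)
      = diag_oper I (\<lambda>i. of_real (cmod (complex_of_real (E (sw i)))))"
    by (rule abs_weighted_perm) (auto simp: sw_def split: sum.split)
  moreover have "cmod (complex_of_real (E (sw i))) = E i" for i
    using E_pos[of i] by (cases i) (auto simp: sw_def E_def Let_def)
  ultimately have abs: "abs_oper (hilb A) (D_oper A p T x \<phi>) = diag_oper I (\<lambda>i. of_real (E i))"
    by (simp add: hilb_def)
  have pi: "pi_oper A p y z f = diag_oper I (F f)"
    unfolding pi_oper_def weighted_perm_def hilb_def F_def
    by (intro arg_cong[where f = "max_oper (ell2 I)"] ext) (auto split: sum.split)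
  have E0: "complex_of_real (E i) \<noteq> 0" for i using E_pos[of i] by simp
  show ?thesis unfolding op_def pi_absD_inv_def abs pi
  proof (intro set_eqI iffI; clarify)
    fix \<xi> \<eta> \<zeta> assume "(\<zeta>, \<xi>) \<in> diag_oper I (\<lambda>i. of_real (E i))" "(\<zeta>, \<eta>) \<in> diag_oper I (F f)"
    then show "(\<xi>, \<eta>) \<in> diag_oper I (\<lambda>i. F f i / of_real (E i))"
      using E0 by (auto simp: weighted_perm_iff fun_eq_iff)
  next
    fix \<xi> \<eta> assume *: "(\<xi>, \<eta>) \<in> diag_oper I (\<lambda>i. F f i / of_real (E i))"
    define \<zeta> where "\<zeta> = (\<lambda>i. of_real (1 / E i) * \<xi> i)"
    have "\<zeta> \<in> ell2 I"
      unfolding \<zeta>_def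
    proof (rule ell2_bounded_mult)
      fix i assume i: "i \<in> I"
      have "wt w \<le> 1" if "w \<in> all_words A" for w
        using S_nonneg[OF all_words_conc[OF that x]] by (simp add: wt_def ext_def)
      then have "case_sum wt wt i \<le> 1" using i by auto
      then have "1 / E i \<le> 1" using inverse_E[OF i] by simp
      moreover have "0 \<le> 1 / E i" using E_pos[of i] by (intro divide_nonneg_pos) simp_all
      moreover note norm_of_real[of "1 / E i", where 'a = complex]
      ultimately show "cmod (of_real (1 / E i)) \<le> 1" by linarith
    qed (use * in \<open>simp add: weighted_perm_iff\<close>)
    then have "(\<zeta>, \<xi>) \<in> diag_oper I (\<lambda>i. of_real (E i))" "(\<zeta>, \<eta>) \<in> diag_oper I (F f)"
      using * E0 by (auto simp: weighted_perm_iff fun_eq_iff \<zeta>_def)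
    then show "(\<xi>, \<eta>) \<in> (diag_oper I (\<lambda>i. of_real (E i)))\<inverse> O diag_oper I (F f)" by blast
  qed
qed

lemma cmod_coeff: "i \<in> I \<Longrightarrow> cmod (F f i / of_real (E i)) = case_sum wt wt i * cmod (F f i)"
  using inverse_E[of i] E_pos[of i] by (simp add: norm_divide field_simps)

lemma coeff_vanishing:
  assumes f: "continuous_on \<Lambda> f" and \<epsilon>: "\<epsilon> > 0"
  shows "finite {i \<in> I. cmod (F f i / of_real (E i)) \<ge> \<epsilon>}"
proof -
  obtain B where B: "B > 0" "\<And>i. i \<in> I \<Longrightarrow> cmod (F f i) \<le> B" using F_bounded[OF f] by blast
  have "{i \<in> I. cmod (F f i / of_real (E i)) \<ge> \<epsilon>}
      \<subseteq> {w \<in> all_words A. wt w \<ge> \<epsilon> / B} <+> {w \<in> all_words A. wt w \<ge> \<epsilon> / B}"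
  proof
    fix i assume *: "i \<in> {i \<in> I. cmod (F f i / of_real (E i)) \<ge> \<epsilon>}"
    then have "i \<in> I" by blast
    with * have i: "i \<in> I" "\<epsilon> \<le> case_sum wt wt i * cmod (F f i)" using cmod_coeff[of i f] by simp_all
    have "0 \<le> case_sum wt wt i" by (cases i) (auto simp: less_imp_le[OF wt_pos])
    then have "\<epsilon> \<le> case_sum wt wt i * B"
      using i(2) mult_left_mono[OF B(2)[OF i(1)]] by (meson order.trans)
    then have "\<epsilon> / B \<le> case_sum wt wt i" using B(1) by (simp add: pos_divide_le_eq)
    then show "i \<in> {w \<in> all_words A. wt w \<ge> \<epsilon> / B} <+> {w \<in> all_words A. wt w \<ge> \<epsilon> / B}"
      using i(1) by auto
  qed
  then show ?thesis using finite_wt_ge[of "\<epsilon> / B"] \<epsilon> B(1) by (meson finite_Plus finite_subset divide_pos_pos)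
qed

lemma c_const_eq: "c_const A p \<Lambda> T x \<phi> \<mu> = 2 * C1 / Lim h"
proof -
  have "(\<Sum>u | u \<in> \<Lambda> \<and> T u = p (x j). exp (- \<phi> u) * indicator (p ` cylinder1 A j) u) = exp (- h ([j] \<frown> x j))" for j
  proof -
    have mem: "p ([i] \<frown> x j) \<in> p ` cylinder1 A j \<longleftrightarrow> i = j" if "A $ i $ x j 0 = 1" for i
    proof -
      have "[i] \<frown> x j \<in> \<Sigma>" using that x_in[of j] by (simp add: subshift_build_iff)
      then have "p ([i] \<frown> x j) \<in> p ` cylinder1 A j \<longleftrightarrow> [i] \<frown> x j \<in> cylinder1 A j"
        using p_inj unfolding cylinder1_def by (subst inj_on_image_mem_iff[OF p_inj]) auto
      then show ?thesis using \<open>[i] \<frown> x j \<in> \<Sigma>\<close> by (simp add: cylinder1_def)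
    qed
    have "(\<Sum>u | u \<in> \<Lambda> \<and> T u = p (x j). exp (- \<phi> u) * indicator (p ` cylinder1 A j) u)
        = (\<Sum>i | A $ i $ x j 0 = 1. exp (- \<phi> (p ([i] \<frown> x j))) * indicator (p ` cylinder1 A j) (p ([i] \<frown> x j)))"
      by (rule sum.reindex_bij_betw[OF bij_betw_preimages[OF x_in conj], symmetric])
    also have "\<dots> = (\<Sum>i | A $ i $ x j 0 = 1. if i = j then exp (- \<phi> (p ([j] \<frown> x j))) else 0)"
      by (rule sum.cong) (use mem in \<open>auto simp: indicator_def\<close>)
    also have "\<dots> = exp (- \<phi> (p ([j] \<frown> x j)))"
      using x[of j] by (simp add: subshift_build_iff)
    also have "\<dots> = exp (- h ([j] \<frown> x j))" using h_eq[OF x[of j]] by simp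
    finally show ?thesis .
  qed
  moreover have "(\<integral>u. \<phi> u \<partial>\<mu>) = Lim h"
    using gibbs_measure_Lim(3)[OF \<mu> continuous_\<phi>] Lim_\<phi> by simp
  ultimately show ?thesis by (simp add: c_const_def C1_def)
qed

text \<open>Replacing the tails y and z by x costs at most the oscillation of |f| on cylinders of
  length n, which tends to 0; with this, the moduli of the coefficients meet the assumptions of
  \<open>log_mean_words\<close>.\<close>

lemma log_mean_op:
  assumes f: "continuous_on \<Lambda> f"
  shows "log_mean (hilb A) (op f) \<longlonglongrightarrow> c_const A p \<Lambda> T x \<phi> \<mu> * (\<integral>u. cmod (f u) \<partial>\<mu>)"
proof -
  have cont: "continuous_on \<Lambda> (\<lambda>u. cmod (f u))" using f by (rule continuous_on_norm)
  obtain B where B: "\<And>i. i \<in> I \<Longrightarrow> cmod (F f i) \<le> B" using F_bounded[OF f] by blast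
  have approx: "\<exists>n0. \<forall>n\<ge>n0. \<forall>w\<in>words A n. \<bar>cmod (f (p (w \<frown> v (last w)))) - cmod (f (p (ext w)))\<bar> \<le> \<epsilon>"
    if v: "\<And>j. [j] \<frown> v j \<in> \<Sigma>" and \<epsilon>: "\<epsilon> > 0" for v \<epsilon>
  proof -
    obtain N where N: "\<And>s t. s \<in> \<Sigma> \<Longrightarrow> t \<in> \<Sigma> \<Longrightarrow> agree N s t \<Longrightarrow> dist (cmod (f (p s))) (cmod (f (p t))) \<le> \<epsilon>"
      using continuous_uniformly[OF cont \<epsilon>] by blast
    show ?thesis
    proof (intro exI[of _ "max 1 N"] allI impI ballI)
      fix n w assume n: "max 1 N \<le> n" and w: "w \<in> words A n"
      have W: "w \<in> all_words A" using n w by (auto simp: all_words_def)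
      have "length w = n" using w by (simp add: words_def)
      then have "agree N (w \<frown> v (last w)) (ext w)"
        using agree_mono[OF agree_conc_word[of w]] n unfolding ext_def by simp
      then show "\<bar>cmod (f (p (w \<frown> v (last w)))) - cmod (f (p (ext w)))\<bar> \<le> \<epsilon>"
        using N[OF all_words_conc[OF W v] all_words_conc[OF W x]] by (simp add: ext_def dist_real_def)
    qed
  qed
  have "(\<lambda>n. 1 / ln (real n) * (\<Sum>m<n. singular_values (ell2 I) (op f) m))
      \<longlonglongrightarrow> 2 * C1 * Lim (\<lambda>s. cmod (f (p s))) / Lim h"
  proof (rule log_mean_words[where G = "\<lambda>i. cmod (F f i)" and \<alpha> = "\<lambda>i. cmod (F f i / of_real (E i))" and B = B])
    show "unif (\<lambda>s. cmod (f (p s)))" by (rule unif_continuous[OF cont])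
    show "0 \<le> cmod (F f i) \<and> cmod (F f i) \<le> B" if "i \<in> I" for i using B[OF that] by simp
    show "\<exists>n0. \<forall>n\<ge>n0. \<forall>w\<in>words A n. \<bar>cmod (F f (Inl w)) - cmod (f (p (ext w)))\<bar> \<le> \<epsilon>" if "\<epsilon> > 0" for \<epsilon>
      using approx[OF y that] by (simp add: F_def)
    show "\<exists>n0. \<forall>n\<ge>n0. \<forall>w\<in>words A n. \<bar>cmod (F f (Inr w)) - cmod (f (p (ext w)))\<bar> \<le> \<epsilon>" if "\<epsilon> > 0" for \<epsilon>
      using approx[OF z that] by (simp add: F_def)
    show "decr_rearrangement I (\<lambda>i. cmod (F f i / of_real (E i))) (singular_values (ell2 I) (op f))"
      unfolding op_eq by (rule singular_values_diag) (rule coeff_vanishing[OF f])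
    show "cmod (F f i / of_real (E i)) = case_sum wt wt i * cmod (F f i)" if "i \<in> I" for i
      by (rule cmod_coeff[OF that])
  qed
  then show ?thesis
    using gibbs_measure_Lim(3)[OF \<mu> cont] by (simp add: log_mean_def[abs_def] hilb_def c_const_eq)
qed

lemma op_L1_inf:
  assumes f: "continuous_on \<Lambda> f" shows "op f \<in> L1_inf (hilb A)"
proof -
  have "compact_oper (hilb A) (op f)"
    unfolding op_eq hilb_def by (rule compact_diag_oper) (rule coeff_vanishing[OF f])
  moreover have lim: "(\<lambda>n. ereal (log_mean (hilb A) (op f) n))
      \<longlonglongrightarrow> ereal (c_const A p \<Lambda> T x \<phi> \<mu> * (\<integral>u. cmod (f u) \<partial>\<mu>))"
    using log_mean_op[OF f] by simp
  have "limsup (\<lambda>n. ereal (log_mean (hilb A) (op f) n)) < \<infinity>"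
    unfolding lim_imp_Limsup[OF sequentially_bot lim] by simp
  ultimately show ?thesis by (simp add: L1_inf_def)
qed

text \<open>A linear combination of graphs lives on the intersection of the domains, so equality
  requires both operators to be defined on the whole space, which \<open>compact_oper\<close>
  includes.\<close>

lemma op_lincomb:
  assumes f: "continuous_on \<Lambda> f" and g: "continuous_on \<Lambda> g"
  shows "op (\<lambda>u. a * f u + b * g u) = lincomb_oper a (op f) b (op g)"
proof -
  have eq: "F (\<lambda>u. a * f u + b * g u) i = a * F f i + b * F g i" for i
    by (cases i) (auto simp: F_def)
  have dom: "\<exists>\<eta>. (\<xi>, \<eta>) \<in> op f'" if "continuous_on \<Lambda> f'" "\<xi> \<in> ell2 I" for f' \<xi>
  proof -
    have "compact_oper (ell2 I) (op f')" using op_L1_inf[OF that(1)] by (simp add: L1_inf_def hilb_def)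
    then have "Domain (op f') = ell2 I" by (simp add: compact_oper_def)
    then show ?thesis using that(2) by blast
  qed
  show ?thesis
  proof (intro set_eqI iffI; clarify)
    fix \<xi> \<eta> assume *: "(\<xi>, \<eta>) \<in> op (\<lambda>u. a * f u + b * g u)"
    then have "\<xi> \<in> ell2 I" by (simp add: op_eq weighted_perm_iff)
    then obtain \<eta>1 \<eta>2 where 1: "(\<xi>, \<eta>1) \<in> op f" and 2: "(\<xi>, \<eta>2) \<in> op g" using dom f g by blast
    have "\<eta> = cscale a \<eta>1 + cscale b \<eta>2"
      using * 1 2 by (simp add: op_eq weighted_perm_iff fun_eq_iff eq cscale_def divide_inverse ring_distribs mult_ac)
    then show "(\<xi>, \<eta>) \<in> lincomb_oper a (op f) b (op g)" using 1 2 unfolding lincomb_oper_def by blast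
  next
    fix \<xi> \<eta> assume "(\<xi>, \<eta>) \<in> lincomb_oper a (op f) b (op g)"
    then obtain \<eta>1 \<eta>2 where 1: "(\<xi>, \<eta>1) \<in> op f" and 2: "(\<xi>, \<eta>2) \<in> op g"
      and \<eta>: "\<eta> = cscale a \<eta>1 + cscale b \<eta>2" unfolding lincomb_oper_def by blast
    have "\<xi> \<in> ell2 I" "\<eta>1 \<in> ell2 I" "\<eta>2 \<in> ell2 I"
      using 1 2 unfolding op_eq weighted_perm_iff by blast+
    then have "\<eta> \<in> ell2 I" unfolding \<eta> by (intro ell2_add ell2_cscale)
    moreover have "\<eta> = (\<lambda>i. F (\<lambda>u. a * f u + b * g u) i / of_real (E i) * \<xi> i)"
      using 1 2 unfolding \<eta> by (simp add: op_eq weighted_perm_iff fun_eq_iff eq cscale_def divide_inverse ring_distribs mult_ac)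
    ultimately show "(\<xi>, \<eta>) \<in> op (\<lambda>u. a * f u + b * g u)"
      using \<open>\<xi> \<in> ell2 I\<close> by (simp add: op_eq weighted_perm_iff)
  qed
qed

text \<open>The coefficients are nonnegative, so the operator is positive and its trace is the
  generalized limit of the logarithmic means; these converge, and \<omega> returns their
  limit.\<close>

lemma dixmier_trace_nonneg:
  fixes g :: "'m \<Rightarrow> real"
  assumes \<tau>: "is_dixmier_trace (hilb A) \<omega> \<tau>" and g: "continuous_on \<Lambda> g" "\<And>u. 0 \<le> g u"
  shows "\<tau> (op (\<lambda>u. of_real (g u))) = of_real (c_const A p \<Lambda> T x \<phi> \<mu> * (\<integral>u. g u \<partial>\<mu>))"
proof -
  let ?f = "\<lambda>u. complex_of_real (g u)"
  have f: "continuous_on \<Lambda> ?f" using g(1) by (rule continuous_on_of_real)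
  have "F ?f i / of_real (E i) = of_real (case_sum (\<lambda>w. g (p (w \<frown> y (last w)))) (\<lambda>w. g (p (w \<frown> z (last w)))) i / E i)" for i
    by (cases i) (auto simp: F_def)
  moreover have "0 \<le> case_sum (\<lambda>w. g (p (w \<frown> y (last w)))) (\<lambda>w. g (p (w \<frown> z (last w)))) i / E i" for i
    using E_pos[of i] g(2) by (cases i) auto
  ultimately have "positive_oper (op ?f)" unfolding op_eq by (simp only: positive_diag_oper)
  then have "\<tau> (op ?f) = \<omega> (\<lambda>n. complex_of_real (log_mean (hilb A) (op ?f) n))"
    using \<tau> op_L1_inf[OF f] unfolding is_dixmier_trace_def by blast
  moreover have "(\<lambda>n. complex_of_real (log_mean (hilb A) (op ?f) n))
      \<longlonglongrightarrow> complex_of_real (c_const A p \<Lambda> T x \<phi> \<mu> * (\<integral>u. cmod (?f u) \<partial>\<mu>))"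
    by (rule tendsto_of_real[OF log_mean_op[OF f]])
  then have "\<omega> (\<lambda>n. complex_of_real (log_mean (hilb A) (op ?f) n))
      = complex_of_real (c_const A p \<Lambda> T x \<phi> \<mu> * (\<integral>u. cmod (?f u) \<partial>\<mu>))"
    using \<tau> unfolding is_dixmier_trace_def generalized_limit_def by blast
  ultimately show ?thesis using g(2) by simp
qed

text \<open>Positive and negative parts of the real and imaginary parts of f are continuous and
  nonnegative; \<tau> and the integral are both linear in these four functions.\<close>

lemma dixmier_trace_op:
  assumes \<tau>: "is_dixmier_trace (hilb A) \<omega> \<tau>" and f: "continuous_on \<Lambda> f"
  shows "\<tau> (op f) = of_real (c_const A p \<Lambda> T x \<phi> \<mu>) * (\<integral>u. f u \<partial>\<mu>)"
proof -
  define g1 g2 g3 g4 where "g1 u = max (Re (f u)) 0" and "g2 u = max (- Re (f u)) 0"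
    and "g3 u = max (Im (f u)) 0" and "g4 u = max (- Im (f u)) 0" for u
  have g: "continuous_on \<Lambda> g1" "continuous_on \<Lambda> g2" "continuous_on \<Lambda> g3" "continuous_on \<Lambda> g4"
    unfolding g1_def g2_def g3_def g4_def using f by (auto intro!: continuous_intros)
  have nonneg: "0 \<le> g1 u" "0 \<le> g2 u" "0 \<le> g3 u" "0 \<le> g4 u" for u
    by (auto simp: g1_def g2_def g3_def g4_def)
  have cg: "continuous_on \<Lambda> (\<lambda>u. complex_of_real (g1 u))" "continuous_on \<Lambda> (\<lambda>u. complex_of_real (g2 u))"
    "continuous_on \<Lambda> (\<lambda>u. complex_of_real (g3 u))" "continuous_on \<Lambda> (\<lambda>u. complex_of_real (g4 u))"
    using g by (simp_all only: continuous_on_of_real)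
  define r where "r u = 1 * complex_of_real (g1 u) + (-1) * complex_of_real (g2 u)" for u
  define s where "s u = 1 * complex_of_real (g3 u) + (-1) * complex_of_real (g4 u)" for u
  have rs: "continuous_on \<Lambda> r" "continuous_on \<Lambda> s" unfolding r_def s_def by (intro continuous_intros cg)+
  have f_eq: "f = (\<lambda>u. 1 * r u + \<i> * s u)"
    by (auto simp: fun_eq_iff complex_eq_iff r_def s_def g1_def g2_def g3_def g4_def max_def)
  have lin: "\<tau> (op (\<lambda>u. a * f1 u + b * f2 u)) = a * \<tau> (op f1) + b * \<tau> (op f2)"
    if "continuous_on \<Lambda> f1" "continuous_on \<Lambda> f2" for a b f1 f2
    using \<tau> op_L1_inf[OF that(1)] op_L1_inf[OF that(2)] unfolding op_lincomb[OF that] is_dixmier_trace_def by blast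
  let ?c = "c_const A p \<Lambda> T x \<phi> \<mu>"
  have "\<tau> (op r) = of_real ?c * (of_real (\<integral>u. g1 u \<partial>\<mu>) - of_real (\<integral>u. g2 u \<partial>\<mu>))"
    unfolding r_def[abs_def] lin[OF cg(1,2)]
    by (simp add: dixmier_trace_nonneg[OF \<tau>] g nonneg right_diff_distrib)
  moreover have "\<tau> (op s) = of_real ?c * (of_real (\<integral>u. g3 u \<partial>\<mu>) - of_real (\<integral>u. g4 u \<partial>\<mu>))"
    unfolding s_def[abs_def] lin[OF cg(3,4)]
    by (simp add: dixmier_trace_nonneg[OF \<tau>] g nonneg right_diff_distrib)
  moreover have "\<tau> (op f) = 1 * \<tau> (op r) + \<i> * \<tau> (op s)"
    by (subst f_eq) (rule lin[OF rs])
  moreover have "(\<integral>u. f u \<partial>\<mu>) = (of_real (\<integral>u. g1 u \<partial>\<mu>) - of_real (\<integral>u. g2 u \<partial>\<mu>))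
      + \<i> * (of_real (\<integral>u. g3 u \<partial>\<mu>) - of_real (\<integral>u. g4 u \<partial>\<mu>))"
  proof -
    have int: "integrable \<mu> g1" "integrable \<mu> g2" "integrable \<mu> g3" "integrable \<mu> g4"
      using g gibbs_measure_Lim(1,2)[OF \<mu> continuous_\<phi>] by (auto intro: continuous_integrable)
    then have "integrable \<mu> r" "integrable \<mu> s" unfolding r_def[abs_def] s_def[abs_def] by simp_all
    then have "(\<integral>u. f u \<partial>\<mu>) = (\<integral>u. r u \<partial>\<mu>) + \<i> * (\<integral>u. s u \<partial>\<mu>)"
      by (subst f_eq) simp
    then show ?thesis using int by (simp add: r_def[abs_def] s_def[abs_def])
  qed
  ultimately show ?thesis by (simp only: mult_1_left distrib_left mult.left_commute)
qed

end

theorem theorem2p1: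
  fixes A :: "nat^'k::finite^'k"
    and M U \<Lambda> :: "'m::t2_space set"
    and \<A> :: "('m, 'e::euclidean_space) chart set"
    and g :: "('m, 'e) metric_tensor"
    and T :: "'m \<Rightarrow> 'm"
    and p :: "(nat \<Rightarrow> 'k) \<Rightarrow> 'm"
    and x y z :: "'k \<Rightarrow> nat \<Rightarrow> 'k"
    and \<phi> :: "'m \<Rightarrow> real"
    and f :: "'m \<Rightarrow> complex"
    and \<mu> :: "'m measure"
  assumes "\<And>i j. A $ i $ j \<in> {0, 1}" and "aperiodic A"
    and "riemannian_manifold M \<A> g" and "compact M" and "connected M"
    and "\<Lambda> \<subseteq> U" and "compact \<Lambda>" and "openin (top_of_set M) U"
    and "T ` U \<subseteq> M" and "C1_map_on \<A> U T"
    and "\<exists>\<kappa>>1. expands_by \<kappa> \<A> g U T"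
    and "\<Lambda> = (\<Inter>n. (T ^^ n) -` U)"
    and "topologically_mixing_on \<Lambda> T"
    and "homeomorphic_map (subshift_top A) (top_of_set \<Lambda>) p"
    and "holder_on (subshift A) seq_dist (riemannian_dist M \<A> g) p"
    and "\<And>s. s \<in> subshift A \<Longrightarrow> p (seq_shift s) = T (p s)"
    and "\<And>j. x j \<in> subshift A" and "\<And>j. y j \<in> subshift A" and "\<And>j. z j \<in> subshift A"
    and "\<And>j. y j \<noteq> z j"
    and "\<And>j. [j] \<frown> x j \<in> subshift A" and "\<And>j. [j] \<frown> y j \<in> subshift A"
    and "\<And>j. [j] \<frown> z j \<in> subshift A"
    and "holder_on \<Lambda> (riemannian_dist M \<A> g) dist \<phi>"
    and "normalized_on \<Lambda> T (\<lambda>u. - \<phi> u)"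
    and "is_gibbs_measure \<Lambda> T (\<lambda>u. - \<phi> u) \<mu>"
    and "continuous_on \<Lambda> f"
  shows "pi_absD_inv A p T x y z \<phi> f \<in> L1_inf (hilb A)
       \<and> measurable_oper (hilb A) (pi_absD_inv A p T x y z \<phi> f)
       \<and> (\<forall>\<omega> \<tau>. is_dixmier_trace (hilb A) \<omega> \<tau> \<longrightarrow>
            \<tau> (pi_absD_inv A p T x y z \<phi> f) =
              complex_of_real (c_const A p \<Lambda> T x \<phi> \<mu>) * (\<integral>u. f u \<partial>\<mu>))"
proof -
  interpret coding A p \<Lambda> by unfold_locales (fact assms)+
  have "U \<subseteq> M" using assms(8) openin_subset by fastforce
  then have "\<Lambda> \<subseteq> M" using assms(6) by blast
  then obtain K \<theta> where K: "0 \<le> K" "0 \<le> \<theta>" "\<theta> < 1"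
    "\<And>n s t. s \<in> subshift A \<Longrightarrow> t \<in> subshift A \<Longrightarrow> agree n s t \<Longrightarrow> \<bar>\<phi> (p s) - \<phi> (p t)\<bar> \<le> K * \<theta> ^ n"
    using holder_coded[OF assms(3) _ assms(15,24)] by blast
  have conj: "T (p s) = p (suffix 1 s)" if "s \<in> subshift A" for s
    using assms(16)[OF that] by (simp add: seq_shift_eq_suffix)
  have norm: "(\<Sum>j | A $ j $ s 0 = 1. exp (- \<phi> (p ([j] \<frown> s)))) = 1" if s: "s \<in> subshift A" for s
    using sum.reindex_bij_betw[OF bij_betw_preimages[OF s conj], of "\<lambda>u. exp (- \<phi> u)"]
      assms(25) p_in[OF s] by (simp add: normalized_on_def)
  interpret spectral_system A "\<lambda>s. \<phi> (p s)" K \<theta> x p \<Lambda> T \<phi> y z \<mu>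
  proof unfold_locales
    \<comment> \<open>The distinct tails y^j and z^j are two different points of the
      subshift.\<close>
    show "\<exists>s\<in>subshift A. \<exists>t\<in>subshift A. s \<noteq> t" using assms(18,19,20) by blast
  qed (fact assms | fact K | fact conj | fact norm | rule refl)+
  show ?thesis
    using op_L1_inf[OF assms(27)] log_mean_op[OF assms(27)] dixmier_trace_op[OF _ assms(27)]
    unfolding op_def measurable_oper_def by (auto simp: convergent_def)
qed

end
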